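(* Let $\Gamma\curvearrowright^{\alpha}(X,\mu)$ be an essentially free ergodic compact p.m.p. action of a countable non-amenable group $\Gamma$. Let $\Lambda\curvearrowright^{\beta}(Y,\nu)=(Z,\rho)^{\Lambda}$ be a Bernoulli action of a countable group $\Lambda$. Then there does not exist a p.m.p. action $\Gamma\curvearrowright^{\sigma}(Y,\nu)$ such that both of the following hold: $\alpha$ is weakly contained in $\sigma$; and $\sigma(\Gamma)(y)\subset\beta(\Lambda)(y)$ for almost every $y\in Y$.
   Context: Probability spaces are standard; "p.m.p." means probability measure preserving. A p.m.p. action is essentially free if almost every point has trivial stabilizer. An ergodic p.m.p. action of $\Gamma$ is compact if it is isomorphic (via a measure preserving, a.e. equivariant map that is one-to-one on a conull set) to a translation action $\Gamma\curvearrowright(K/L,m_{K/L})$, where $K$ is a compact group, $L<K$ a closed subgroup, $m_{K/L}$ the unique $K$-invariant Borel probability measure on $K/L$, and $\Gamma$ acts via a homomorphism $\Gamma\to K$ with dense image. The Bernoulli action of $\Lambda$ with base a probability space $(Z,\rho)$ is the shift action of $\Lambda$ on the product space $(Z,\rho)^\Lambda$. $\sigma(\Gamma)(y)$ and $\beta(\Lambda)(y)$ denote the orbits of $y$ under $\sigma$ and $\beta$. Weak containment: for p.m.p. actions $\Gamma\curvearrowright^{\alpha}(X,\mu)$, $\Gamma\curvearrowright^{\sigma}(Y,\nu)$, $\alpha$ is weakly contained in $\sigma$ if for every finite $S\subset\Gamma$, every finite measurable partition $\{A_i\}_{i=1}^n$ of $X$ and every $\varepsilon>0$ there is a measurable partition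 $\{B_i\}_{i=1}^n$ of $Y$ with $|\mu(\gamma A_i\cap A_j)-\nu(\gamma B_i\cap B_j)|<\varepsilon$ for all $\gamma\in S$ and all $i,j\in\{1,\dots,n\}$. *)

theory Defs
  imports
    "HOL-Probability.Probability"
    "HOL-Algebra.Group_Action"
    "HOL-Algebra.Left_Coset"
begin

section \<open>Standard probability spaces\<close>

definition borel_sets_of :: "'a topology \<Rightarrow> 'a set set" where
  "borel_sets_of T = sigma_sets (topspace T) {U. openin T U}"

definition standard_prob_space :: "'a measure \<Rightarrow> bool" where
  "standard_prob_space M \<longleftrightarrow> prob_space M \<and>
     (\<exists>T. completely_metrizable_space T \<and> second_countable T \<and>
          topspace T = space M \<and> sets M = borel_sets_of T)"


section \<open>Probability measure preserving actions\<close>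

text \<open>
  An action is a homomorphism into the group of permutations of the underlying space, as in
  \<^locale>\<open>group_action\<close>; in particular the maps \<open>\<alpha> g\<close> are normalised to be \<open>undefined\<close> outside
  \<open>space M\<close>.
\<close>

definition pmp_action :: "'g monoid \<Rightarrow> 'a measure \<Rightarrow> ('g \<Rightarrow> 'a \<Rightarrow> 'a) \<Rightarrow> bool" where
  "pmp_action G M \<alpha> \<longleftrightarrow> prob_space M \<and> group_action G (space M) \<alpha> \<and>
     (\<forall>g\<in>carrier G. \<alpha> g \<in> measurable M M \<and> distr M M (\<alpha> g) = M)"

definition essentially_free :: "'g monoid \<Rightarrow> 'a measure \<Rightarrow> ('g \<Rightarrow> 'a \<Rightarrow> 'a) \<Rightarrow> bool" where
  "essentially_free G M \<alpha> \<longleftrightarrow> (AE x in M. stabilizer G \<alpha> x = {\<one>\<^bsub>G\<^esub>})"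

definition ergodic :: "'g monoid \<Rightarrow> 'a measure \<Rightarrow> ('g \<Rightarrow> 'a \<Rightarrow> 'a) \<Rightarrow> bool" where
  "ergodic G M \<alpha> \<longleftrightarrow>
     (\<forall>A\<in>sets M. (\<forall>g\<in>carrier G. \<alpha> g ` A = A) \<longrightarrow> measure M A = 0 \<or> measure M A = 1)"


section \<open>Compact actions\<close>

definition compact_group :: "'k monoid \<Rightarrow> 'k topology \<Rightarrow> bool" where
  "compact_group K T \<longleftrightarrow> group K \<and> topspace T = carrier K \<and>
     continuous_map (prod_topology T T) T (\<lambda>(x, y). x \<otimes>\<^bsub>K\<^esub> y) \<and>
     continuous_map T T (\<lambda>x. inv\<^bsub>K\<^esub> x) \<and>
     compact_space T \<and> Hausdorff_space T"

text \<open>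
  \<open>m\<close> is the invariant Borel probability measure on the space \<open>K/L\<close> of left cosets. The topology
  \<open>Q\<close> is determined by \<^const>\<open>quotient_map\<close>, hence is the quotient topology, and its underlying
  set is \<open>lcosets\<^bsub>K\<^esub> L\<close>. Like all probability spaces here \<open>(K/L, m)\<close> is taken to be
  standard, which makes \<open>Q\<close> metrizable, although \<open>K\<close> itself need not be. That at most one such \<open>m\<close> exists is a theorem and not part of the
  definition.
\<close>

definition coset_space_measure ::
    "'k monoid \<Rightarrow> 'k topology \<Rightarrow> 'k set \<Rightarrow> 'k set measure \<Rightarrow> bool" where
  "coset_space_measure K T L m \<longleftrightarrow>
     (\<exists>Q. quotient_map T Q (\<lambda>k. k <#\<^bsub>K\<^esub> L) \<and> space m = topspace Q \<and> sets m = borel_sets_of Q) \<and>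
     standard_prob_space m \<and>
     (\<forall>k\<in>carrier K. distr m m (\<lambda>C. k <#\<^bsub>K\<^esub> C) = m)"

text \<open>
  The type argument is the type over which the existentially quantified compact group ranges; as a
  hypothesis of a theorem that is polymorphic in \<open>'k\<close> this imposes no restriction. The
  homomorphism \<open>\<tau>\<close> is the one through which \<open>G\<close> acts on \<open>K/L\<close>.
\<close>

definition compact_action ::
    "'k itself \<Rightarrow> 'g monoid \<Rightarrow> 'a measure \<Rightarrow> ('g \<Rightarrow> 'a \<Rightarrow> 'a) \<Rightarrow> bool" where
  "compact_action _ G M \<alpha> \<longleftrightarrow> pmp_action G M \<alpha> \<and> ergodic G M \<alpha> \<and>
     (\<exists>(K :: 'k monoid) T L m \<tau> \<pi>.
        compact_group K T \<and> subgroup L K \<and> closedin T L \<and> coset_space_measure K T L m \<and>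
        \<tau> \<in> hom G K \<and> T closure_of (\<tau> ` carrier G) = carrier K \<and>
        \<pi> \<in> measurable M m \<and> distr M m \<pi> = m \<and>
        (\<forall>g\<in>carrier G. AE x in M. \<pi> (\<alpha> g x) = \<tau> g <#\<^bsub>K\<^esub> \<pi> x) \<and>
        (\<exists>X0\<in>sets M. measure M X0 = 1 \<and> inj_on \<pi> X0))"


section \<open>Non-amenability, Bernoulli actions and weak containment\<close>

text \<open>The library has no notion of amenability; this is the existence of an invariant mean.\<close>

definition amenable :: "'g monoid \<Rightarrow> bool" where
  "amenable G \<longleftrightarrow> (\<exists>p :: 'g set \<Rightarrow> real.
     (\<forall>A. A \<subseteq> carrier G \<longrightarrow> 0 \<le> p A) \<and> p (carrier G) = 1 \<and>
     (\<forall>A B. A \<subseteq> carrier G \<longrightarrow> B \<subseteq> carrier G \<longrightarrow> A \<inter> B = {} \<longrightarrow> p (A \<union> B) = p A + p B) \<and>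
     (\<forall>g\<in>carrier G. \<forall>A. A \<subseteq> carrier G \<longrightarrow> p (g <#\<^bsub>G\<^esub> A) = p A))"

definition bernoulli_space :: "'l monoid \<Rightarrow> 'z measure \<Rightarrow> ('l \<Rightarrow> 'z) measure" where
  "bernoulli_space H Z = PiM (carrier H) (\<lambda>_. Z)"

definition bernoulli_action :: "'l monoid \<Rightarrow> 'z measure \<Rightarrow> 'l \<Rightarrow> ('l \<Rightarrow> 'z) \<Rightarrow> ('l \<Rightarrow> 'z)" where
  "bernoulli_action H Z g =
     (\<lambda>y\<in>space (bernoulli_space H Z). \<lambda>h\<in>carrier H. y (inv\<^bsub>H\<^esub> g \<otimes>\<^bsub>H\<^esub> h))"

lemma pmp_action_bernoulli:
  assumes "group H" and "prob_space Z"
  shows "pmp_action H (bernoulli_space H Z) (bernoulli_action H Z)"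
proof -
  interpret H: group H by fact
  interpret Z: prob_space Z by fact
  interpret P: prob_space "PiM (carrier H) (\<lambda>_. Z)"
    by (rule prob_space_PiM) (rule assms)
  let ?E = "space (bernoulli_space H Z)"
  let ?b = "bernoulli_action H Z"
  have E: "?E = (carrier H \<rightarrow>\<^sub>E space Z)"
    by (simp add: bernoulli_space_def space_PiM)
  have cl: "?b g y \<in> ?E" if "g \<in> carrier H" "y \<in> ?E" for g y
    using that by (auto simp: bernoulli_action_def E)
  have mult: "?b (g \<otimes>\<^bsub>H\<^esub> g') y = ?b g (?b g' y)"
    if "g \<in> carrier H" "g' \<in> carrier H" "y \<in> ?E" for g g' y
    using that cl[OF that(2,3)]
    by (auto simp: bernoulli_action_def H.inv_mult_group H.m_assoc fun_eq_iff)
  have one: "?b \<one>\<^bsub>H\<^esub> y = y" if "y \<in> ?E" for y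
    using that by (auto simp: bernoulli_action_def E fun_eq_iff PiE_def extensional_def)
  have bij: "?b g \<in> Bij ?E" if g: "g \<in> carrier H" for g
  proof -
    have "bij_betw (?b g) ?E ?E"
    proof (rule bij_betw_byWitness[where f' = "?b (inv\<^bsub>H\<^esub> g)"])
      show "\<forall>y\<in>?E. ?b (inv\<^bsub>H\<^esub> g) (?b g y) = y"
        using g mult[of "inv\<^bsub>H\<^esub> g" g] one by simp
      show "\<forall>y\<in>?E. ?b g (?b (inv\<^bsub>H\<^esub> g) y) = y"
        using g mult[of g "inv\<^bsub>H\<^esub> g"] one by simp
    qed (use cl g in auto)
    then show ?thesis
      by (simp add: Bij_def bernoulli_action_def)
  qed
  have act: "group_action H ?E ?b"
  proof (unfold group_action_def group_hom_def group_hom_axioms_def, intro conjI homI)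
    fix g g' assume g: "g \<in> carrier H" "g' \<in> carrier H"
    have "?b (g \<otimes>\<^bsub>H\<^esub> g') = compose ?E (?b g) (?b g')"
    proof
      fix y show "?b (g \<otimes>\<^bsub>H\<^esub> g') y = compose ?E (?b g) (?b g') y"
        using mult[OF g, of y] by (cases "y \<in> ?E") (auto simp: compose_def bernoulli_action_def)
    qed
    with g bij show "?b (g \<otimes>\<^bsub>H\<^esub> g') = ?b g \<otimes>\<^bsub>BijGroup ?E\<^esub> ?b g'"
      by (simp add: BijGroup_def)
  qed (use bij in \<open>auto simp: BijGroup_def H.group_axioms intro: group_BijGroup[unfolded BijGroup_def]\<close>)
  have pres: "?b g \<in> measurable (bernoulli_space H Z) (bernoulli_space H Z)
      \<and> distr (bernoulli_space H Z) (bernoulli_space H Z) (?b g) = bernoulli_space H Z"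
    if g: "g \<in> carrier H" for g
  proof -
    let ?f = "\<lambda>y. \<lambda>h\<in>carrier H. y (inv\<^bsub>H\<^esub> g \<otimes>\<^bsub>H\<^esub> h)"
    let ?P = "PiM (carrier H) (\<lambda>_. Z)"
    have m: "?f \<in> measurable ?P ?P"
      using g by (intro measurable_restrict measurable_component_singleton) auto
    have eq: "?b g y = ?f y" if "y \<in> space ?P" for y
      using that by (simp add: bernoulli_action_def bernoulli_space_def)
    have "distr ?P ?P ?f = ?P"
      using g distr_PiM_reindex[of "carrier H" "\<lambda>_. Z" "\<lambda>h. inv\<^bsub>H\<^esub> g \<otimes>\<^bsub>H\<^esub> h" "carrier H"] assms(2)
      by (auto simp: inj_on_def)
    moreover have "distr ?P ?P (?b g) = distr ?P ?P ?f"
      by (rule distr_cong) (auto simp: eq)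
    moreover have "?b g \<in> measurable ?P ?P"
      using m eq by (simp cong: measurable_cong)
    ultimately show ?thesis
      by (simp add: bernoulli_space_def)
  qed
  show ?thesis
    using act pres P.prob_space_axioms by (simp add: pmp_action_def bernoulli_space_def)
qed

text \<open>Partitions are indexed by \<open>{1..n}\<close> and may have empty members.\<close>

definition measurable_partition :: "'a measure \<Rightarrow> nat \<Rightarrow> (nat \<Rightarrow> 'a set) \<Rightarrow> bool" where
  "measurable_partition M n A \<longleftrightarrow> (\<forall>i\<in>{1..n}. A i \<in> sets M) \<and>
     disjoint_family_on A {1..n} \<and> (\<Union>i\<in>{1..n}. A i) = space M"

definition weakly_contained ::
    "'g monoid \<Rightarrow> 'a measure \<Rightarrow> ('g \<Rightarrow> 'a \<Rightarrow> 'a) \<Rightarrow> 'b measure \<Rightarrow> ('g \<Rightarrow> 'b \<Rightarrow> 'b) \<Rightarrow> bool" where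
  "weakly_contained G M \<alpha> N \<sigma> \<longleftrightarrow>
     (\<forall>S n A. \<forall>\<epsilon>>0. finite S \<longrightarrow> S \<subseteq> carrier G \<longrightarrow> measurable_partition M n A \<longrightarrow>
        (\<exists>B. measurable_partition N n B \<and>
          (\<forall>g\<in>S. \<forall>i\<in>{1..n}. \<forall>j\<in>{1..n}.
             \<bar>measure M (\<alpha> g ` A i \<inter> A j) - measure N (\<sigma> g ` B i \<inter> B j)\<bar> < \<epsilon>)))"

end

theory Submission
  imports Defs
begin

text \<open>
  Suppose \<open>\<sigma>\<close> exists, so that \<open>\<sigma> g y = \<beta> (w g y) y\<close> for a measurable cocycle \<open>w\<close>. Compactness of \<open>\<alpha>\<close>
  gives a partition \<open>A i\<close> of \<open>X\<close> and unit vectors \<open>k i \<ge> 0\<close> of \<open>L\<^sup>2(X)\<close> with \<open>k j \<circ> \<alpha> g\<close> close to \<open>k i\<close>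
  whenever \<open>\<alpha> g (A i)\<close> meets \<open>A j\<close>, and almost orthogonal on average: bumps on \<open>K/L\<close> at the points of
  \<open>A i\<close>. Weak containment copies the partition to \<open>Y\<close>, and after approximation by cylinders the function
  \<open>f (x, y) = k i x\<close> for \<open>y \<in> B i\<close> depends on finitely many coordinates of \<open>y\<close>, is almost invariant under
  \<open>\<alpha> \<times> \<sigma>\<close> on a prescribed finite set and has a small mean over \<open>y\<close>.

  On the other hand, non-amenability gives a spectral gap: a function of \<open>(t, u)\<close> that is almost invariant
  under \<open>(s g t, \<beta> (w g (q t)) u)\<close>, for \<open>q\<close> equivariant into \<open>Y\<close>, hardly depends on \<open>u\<close>. Otherwise its weights
  in the decomposition of \<open>L\<^sup>2(Y)\<close> over the finite subsets of \<open>\<Lambda>\<close>, transported to \<open>\<Gamma>\<close> along the orbits,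
  would be an almost invariant mean. Apply this to \<open>f\<close> at a slightly resampled point: \<open>f\<close> is
  stable under noise, so its weight lies on sets of bounded size, and of many disjoint finite
  shells some has little influence on \<open>f\<close>. Apply it again, resampling outside that shell: \<open>f\<close> is almost
  a function of the coordinates in a finite set \<open>F\<close> that depends only on \<open>w\<close>. For \<open>g\<close> so far out
  that \<open>w g y\<close> mostly moves \<open>F\<close> off itself, invariance under \<open>g\<close> makes \<open>f\<close> almost independent of \<open>y\<close>,
  which contradicts the small mean.
\<close>

subsection \<open>Moebius inversion over subsets\<close>

text \<open>The obstacle is that \<open>w g y\<close> is read off from the very point that is to be
  resampled, whereas the spectral gap holds for a skew product whose cocycle is evaluated at a base
  point independent of u. Hence \<open>w\<close> is replaced by an approximation \<open>W\<close>
  with values in a finite set \<open>Q\<close> that reads only a finite set \<open>F0\<close> of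
  coordinates, and both resamplings keep \<open>F0\<close>, up to small probability or entirely. The
  order of the choices matters. Non-amenability gives \<open>S\<close> and \<kappa>; these give the
  tolerances, \<open>Q\<close>, \<open>F0\<close>, the noise rate and the number of shells, hence a
  finite set containing all shells. The far element \<open>g0\<close>, a finite set \<open>A\<close>
  of its likely cocycle values and the bound \<eta> come next, and only then f, almost invariant
  under \<open>S\<close> and \<open>g0\<close>. The finite set \<open>L\<close> of coordinates read
  by f is not bounded in advance, which is why a shell of small influence has to be found among sets
  fixed beforehand. Freeness of \<sigma>, inherited through weak containment, makes positions in
  orbits well defined and lets \<open>w g y\<close> take each value for at most one g.\<close>

definition mob :: "('i set \<Rightarrow> real) \<Rightarrow> 'i set \<Rightarrow> real" where
  "mob \<phi> A = (\<Sum>B\<in>Pow A. (-1) ^ card (A - B) * \<phi> B)"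

lemma sum_Pow_insert:
  assumes "finite A" "h \<notin> A"
  shows "(\<Sum>B\<in>Pow (insert h A). g B) = (\<Sum>B\<in>Pow A. g B + g (insert h B) :: 'b::comm_monoid_add)"
proof -
  have "(\<Sum>B\<in>Pow (insert h A). g B) = (\<Sum>B\<in>Pow A. g B) + (\<Sum>B\<in>insert h ` Pow A. g B)"
    unfolding Pow_insert using assms by (intro sum.union_disjoint) auto
  also have "(\<Sum>B\<in>insert h ` Pow A. g B) = (\<Sum>B\<in>Pow A. g (insert h B))"
    using assms by (intro sum.reindex_cong[where l="insert h"]) (auto simp: inj_on_def)
  finally show ?thesis by (simp add: sum.distrib)
qed

lemma mob_empty [simp]: "mob \<phi> {} = \<phi> {}"
  by (simp add: mob_def)

text \<open>One step of the transform is a difference in the new coordinate. The alternating sum is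
  an iterated difference, and the inductions on the set peel off one coordinate at a time through
  this identity.\<close>

lemma mob_insert:
  assumes "finite A" "h \<notin> A"
  shows "mob \<phi> (insert h A) = mob (\<lambda>B. \<phi> (insert h B) - \<phi> B) A"
proof -
  have "mob \<phi> (insert h A) = (\<Sum>B\<in>Pow A. (-1) ^ card (insert h A - B) * \<phi> B
      + (-1) ^ card (insert h A - insert h B) * \<phi> (insert h B))"
    unfolding mob_def by (rule sum_Pow_insert[OF assms])
  also have "\<dots> = mob (\<lambda>B. \<phi> (insert h B) - \<phi> B) A"
    unfolding mob_def
  proof (rule sum.cong[OF refl])
    fix B assume "B \<in> Pow A"
    then have B: "B \<subseteq> A" by auto
    with assms have "insert h A - B = insert h (A - B)" "insert h A - insert h B = A - B"
      and "finite (A - B)" "h \<notin> A - B"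
      by auto
    then show "(-1) ^ card (insert h A - B) * \<phi> B + (-1) ^ card (insert h A - insert h B) * \<phi> (insert h B)
        = (-1) ^ card (A - B) * (\<phi> (insert h B) - \<phi> B)"
      by (simp add: algebra_simps)
  qed
  finally show ?thesis .
qed

lemma mob_add: "mob (\<lambda>B. \<phi> B + \<psi> B) A = mob \<phi> A + mob \<psi> A"
  by (simp add: mob_def algebra_simps sum.distrib)

lemma mob_diff: "mob (\<lambda>B. \<phi> B - \<psi> B) A = mob \<phi> A - mob \<psi> A"
  by (simp add: mob_def algebra_simps sum_subtractf)

lemma mob_scale: "mob (\<lambda>B. c * \<phi> B) A = c * mob \<phi> A"
  by (simp add: mob_def sum_distrib_left algebra_simps)

lemma mob_cong: "(\<And>B. B \<subseteq> A \<Longrightarrow> \<phi> B = \<psi> B) \<Longrightarrow> mob \<phi> A = mob \<psi> A"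
  unfolding mob_def by (intro sum.cong) auto

text \<open>Moebius inversion on the Boolean lattice: the terms of A and of A with h added combine
  to the transform of a shifted function, to which the induction hypothesis applies.\<close>

lemma sum_mob: "finite D \<Longrightarrow> (\<Sum>A\<in>Pow D. mob \<phi> A) = \<phi> D"
proof (induction D arbitrary: \<phi> rule: finite_induct)
  case (insert h D)
  have "(\<Sum>A\<in>Pow (insert h D). mob \<phi> A) = (\<Sum>A\<in>Pow D. mob \<phi> A + mob \<phi> (insert h A))"
    using insert by (intro sum_Pow_insert) auto
  also have "\<dots> = (\<Sum>A\<in>Pow D. mob (\<lambda>B. \<phi> (insert h B)) A)"
  proof (rule sum.cong[OF refl])
    fix A assume "A \<in> Pow D"
    with insert have "finite A" "h \<notin> A" by (auto intro: finite_subset)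
    then show "mob \<phi> A + mob \<phi> (insert h A) = mob (\<lambda>B. \<phi> (insert h B)) A"
      by (simp add: mob_insert mob_diff)
  qed
  also have "\<dots> = \<phi> (insert h D)"
    by (rule insert.IH)
  finally show ?case .
qed simp

lemma mob_image:
  assumes "inj_on g A"
  shows "mob \<phi> (g ` A) = mob (\<lambda>B. \<phi> (g ` B)) A"
proof -
  have "mob \<phi> (g ` A) = (\<Sum>B\<in>Pow A. (-1) ^ card (g ` A - g ` B) * \<phi> (g ` B))"
    unfolding mob_def
  proof (rule sum.reindex_cong)
    show "inj_on ((`) g) (Pow A)"
      using assms by (simp add: inj_on_image_Pow)
    show "Pow (g ` A) = (`) g ` Pow A"
      by (simp add: image_Pow_surj)
  qed simp
  also have "\<dots> = mob (\<lambda>B. \<phi> (g ` B)) A"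
    unfolding mob_def
  proof (rule sum.cong[OF refl])
    fix B assume "B \<in> Pow A"
    then have "g ` A - g ` B = g ` (A - B)"
      using assms by (auto simp: inj_on_def)
    moreover have "card (g ` (A - B)) = card (A - B)"
      using assms by (intro card_image) (auto intro: inj_on_subset)
    ultimately show "(-1) ^ card (g ` A - g ` B) * \<phi> (g ` B) = (-1) ^ card (A - B) * \<phi> (g ` B)"
      by simp
  qed
  finally show ?thesis .
qed


subsection \<open>Bounded measurable functions on probability spaces\<close>

text \<open>The bound is required at every point of the type, not only on the space. The class is
  then closed under products, sections and composition with measurable maps, and most integrability
  conditions below reduce to \<open>integrable_bmeas\<close>.\<close>

definition bmeas :: "'a measure \<Rightarrow> ('a \<Rightarrow> real) set" where
  "bmeas M = {G \<in> borel_measurable M. \<exists>c. \<forall>x. \<bar>G x\<bar> \<le> c}"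

lemma bmeas_measurable [measurable_dest]: "G \<in> bmeas M \<Longrightarrow> G \<in> borel_measurable M"
  by (simp add: bmeas_def)

lemma bmeasI: "G \<in> borel_measurable M \<Longrightarrow> (\<And>x. \<bar>G x\<bar> \<le> c) \<Longrightarrow> G \<in> bmeas M"
  by (auto simp: bmeas_def)

lemma bmeasE:
  assumes "G \<in> bmeas M"
  obtains c where "c \<ge> 0" "\<And>x. \<bar>G x\<bar> \<le> c"
proof -
  obtain c where c: "\<forall>x. \<bar>G x\<bar> \<le> c"
    using assms by (auto simp: bmeas_def)
  then have "0 \<le> \<bar>G undefined\<bar>" "\<bar>G undefined\<bar> \<le> c" by auto
  with c show thesis by (intro that[of c]) auto
qed

lemma bmeas_const: "(\<lambda>_. c) \<in> bmeas M"
  by (rule bmeasI[where c="\<bar>c\<bar>"]) auto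

lemma bmeas_add:
  assumes [measurable]: "F \<in> bmeas M" "G \<in> bmeas M"
  shows "(\<lambda>x. F x + G x) \<in> bmeas M"
proof -
  obtain c d where *: "\<And>x. \<bar>F x\<bar> \<le> c" "\<And>x. \<bar>G x\<bar> \<le> d"
    using assms by (metis bmeasE)
  show "(\<lambda>x. F x + G x) \<in> bmeas M"
  proof (rule bmeasI[where c="c + d"])
    show "\<bar>F x + G x\<bar> \<le> c + d" for x
      using *(1)[of x] *(2)[of x] by linarith
  qed measurable
qed

lemma bmeas_mult:
  assumes [measurable]: "F \<in> bmeas M" "G \<in> bmeas M"
  shows "(\<lambda>x. F x * G x) \<in> bmeas M"
proof -
  obtain c d where *: "\<And>x. \<bar>F x\<bar> \<le> c" "\<And>x. \<bar>G x\<bar> \<le> d" "0 \<le> c"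
    using assms by (metis bmeasE)
  show "(\<lambda>x. F x * G x) \<in> bmeas M"
    by (rule bmeasI[where c="c * d"]) (auto simp: abs_mult intro!: mult_mono *)
qed

lemma bmeas_scale: "F \<in> bmeas M \<Longrightarrow> (\<lambda>x. c * F x) \<in> bmeas M"
  by (intro bmeas_mult bmeas_const)

lemma bmeas_diff: "F \<in> bmeas M \<Longrightarrow> G \<in> bmeas M \<Longrightarrow> (\<lambda>x. F x - G x) \<in> bmeas M"
  using bmeas_add[of F M "\<lambda>x. -1 * G x"] bmeas_scale[of G M "-1"] by simp

lemma bmeas_power2: "F \<in> bmeas M \<Longrightarrow> (\<lambda>x. (F x)\<^sup>2) \<in> bmeas M"
  by (simp add: power2_eq_square bmeas_mult)

lemma bmeas_sum: "(\<And>i. i \<in> A \<Longrightarrow> F i \<in> bmeas M) \<Longrightarrow> (\<lambda>x. \<Sum>i\<in>A. F i x) \<in> bmeas M"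
  by (induction A rule: infinite_finite_induct) (auto intro: bmeas_add bmeas_const)

lemma bmeas_compose: "F \<in> bmeas N \<Longrightarrow> T \<in> measurable M N \<Longrightarrow> (\<lambda>x. F (T x)) \<in> bmeas M"
  unfolding bmeas_def by auto

lemma bmeas_indicator: "A \<in> sets M \<Longrightarrow> (indicator A :: 'a \<Rightarrow> real) \<in> bmeas M"
  by (rule bmeasI[where c=1]) (auto simp: indicator_def)

lemma bmeas_section: "F \<in> bmeas (M \<Otimes>\<^sub>M N) \<Longrightarrow> x \<in> space M \<Longrightarrow> (\<lambda>y. F (x, y)) \<in> bmeas N"
  by (rule bmeas_compose) auto

lemmas bmeas_intros = bmeas_add bmeas_diff bmeas_mult bmeas_scale bmeas_const bmeas_power2

context prob_space
begin

lemma integrable_bmeas: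
  assumes [measurable]: "F \<in> bmeas M"
  shows "integrable M F"
proof -
  obtain c where "\<And>x. \<bar>F x\<bar> \<le> c"
    using bmeasE[OF assms] by blast
  then show ?thesis
    by (intro integrable_const_bound[where B=c]) auto
qed

text \<open>Measurability of F is not assumed: a non-integrable F has integral 0, which satisfies
  the bound as well.\<close>

lemma abs_integral_le:
  fixes F :: "'a \<Rightarrow> real"
  assumes "0 \<le> c" "\<And>x. x \<in> space M \<Longrightarrow> \<bar>F x\<bar> \<le> c"
  shows "\<bar>integral\<^sup>L M F\<bar> \<le> c"
proof (cases "integrable M F")
  case True
  have "\<bar>integral\<^sup>L M F\<bar> \<le> (\<integral>x. \<bar>F x\<bar> \<partial>M)"
    using integral_norm_bound[of M F] by simp
  also have "\<dots> \<le> (\<integral>x. c \<partial>M)"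
    using True assms by (intro integral_mono) auto
  finally show ?thesis by (simp add: prob_space)
qed (use assms in \<open>simp add: not_integrable_integral_eq\<close>)

lemma bmeas_integral:
  assumes "F \<in> bmeas (N \<Otimes>\<^sub>M M)"
  shows "(\<lambda>x. \<integral>y. F (x, y) \<partial>M) \<in> bmeas N"
proof -
  obtain c where c: "c \<ge> 0" "\<And>x. \<bar>F x\<bar> \<le> c"
    using bmeasE[OF assms] by blast
  note [measurable] = assms
  show ?thesis
  proof (rule bmeasI[where c=c])
    show "(\<lambda>x. \<integral>y. F (x, y) \<partial>M) \<in> borel_measurable N"
      using borel_measurable_lebesgue_integral[of "\<lambda>x y. F (x, y)" N] by simp
  qed (auto intro!: abs_integral_le c)
qed

lemma power2_integral_le:
  assumes "F \<in> bmeas M"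
  shows "(\<integral>x. F x \<partial>M)\<^sup>2 \<le> (\<integral>x. (F x)\<^sup>2 \<partial>M)"
proof -
  define a where "a = (\<integral>x. F x \<partial>M)"
  have "0 \<le> (\<integral>x. (F x - a)\<^sup>2 \<partial>M)" by simp
  also have "\<dots> = (\<integral>x. (F x)\<^sup>2 - 2 * a * F x + a\<^sup>2 \<partial>M)"
    by (simp add: power2_diff algebra_simps)
  also have "\<dots> = (\<integral>x. (F x)\<^sup>2 \<partial>M) - 2 * a * a + a\<^sup>2"
    unfolding a_def using assms
    by (subst Bochner_Integration.integral_add Bochner_Integration.integral_diff;
        (intro integrable_bmeas bmeas_intros assms)?; simp add: prob_space)+
  finally show ?thesis by (simp add: a_def power2_eq_square)
qed

end

lemma int_swap:
  assumes "prob_space M" "prob_space N" "F \<in> bmeas (M \<Otimes>\<^sub>M N)"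
  shows "(\<integral>x. \<integral>y. F (x, y) \<partial>N \<partial>M) = (\<integral>y. \<integral>x. F (x, y) \<partial>M \<partial>N)"
proof -
  interpret M: prob_space M by fact
  interpret N: prob_space N by fact
  interpret MN: pair_prob_space M N ..
  have "integrable (M \<Otimes>\<^sub>M N) F"
    by (rule MN.integrable_bmeas) fact
  then show ?thesis
    using MN.Fubini_integral[of "\<lambda>x y. F (x, y)"] by (simp add: case_prod_beta')
qed

lemma int_pair:
  assumes "prob_space M" "prob_space N" "F \<in> bmeas (M \<Otimes>\<^sub>M N)"
  shows "(\<integral>z. F z \<partial>(M \<Otimes>\<^sub>M N)) = (\<integral>x. \<integral>y. F (x, y) \<partial>N \<partial>M)"
proof -
  interpret M: prob_space M by fact
  interpret N: prob_space N by fact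
  interpret MN: pair_prob_space M N ..
  have "integrable (M \<Otimes>\<^sub>M N) F"
    by (rule MN.integrable_bmeas) fact
  then show ?thesis
    using MN.integral_fst'[of F] by simp
qed

lemma integral_mp:
  assumes "T \<in> measurable M N" "distr M N T = N" "F \<in> borel_measurable N"
  shows "(\<integral>x. F (T x) \<partial>M) = (\<integral>x. F x \<partial>N :: real)"
  using integral_distr[OF assms(1,3)] assms(2) by simp


subsection \<open>Resampling coordinates in a product space\<close>

definition mix :: "'i set \<Rightarrow> 'i set \<Rightarrow> ('i \<Rightarrow> 'z) \<Rightarrow> ('i \<Rightarrow> 'z) \<Rightarrow> 'i \<Rightarrow> 'z" where
  "mix I B y u = (\<lambda>h\<in>I. if h \<in> B then y h else u h)"

lemma mix_measurable [measurable]: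
  assumes "f \<in> measurable M (PiM I (\<lambda>_. Z))" "g \<in> measurable M (PiM I (\<lambda>_. Z))"
  shows "(\<lambda>x. mix I B (f x) (g x)) \<in> measurable M (PiM I (\<lambda>_. Z))"
  unfolding mix_def
proof (rule measurable_restrict)
  fix i assume "i \<in> I"
  then show "(\<lambda>x. if i \<in> B then f x i else g x i) \<in> measurable M Z"
    using measurable_compose[OF assms(1) measurable_component_singleton[of i I "\<lambda>_. Z"]]
      measurable_compose[OF assms(2) measurable_component_singleton[of i I "\<lambda>_. Z"]] by simp
qed

lemma mix_in_space:
  "y \<in> space (PiM I (\<lambda>_. Z)) \<Longrightarrow> u \<in> space (PiM I (\<lambda>_. Z)) \<Longrightarrow> mix I B y u \<in> space (PiM I (\<lambda>_. Z))"
  by (auto simp: mix_def space_PiM)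

lemma mix_full: "y \<in> space (PiM I (\<lambda>_. Z)) \<Longrightarrow> I \<subseteq> B \<Longrightarrow> mix I B y u = y"
  by (auto simp: mix_def space_PiM PiE_def extensional_def fun_eq_iff)

lemma mix_cong: "(\<And>h. h \<in> I \<Longrightarrow> h \<in> B \<Longrightarrow> y h = y' h) \<Longrightarrow> (\<And>h. h \<in> I \<Longrightarrow> h \<notin> B \<Longrightarrow> u h = u' h)
   \<Longrightarrow> mix I B y u = mix I B y' u'"
  by (auto simp: mix_def fun_eq_iff)

text \<open>Composition law behind \<open>avg_avg\<close>: what survives both rounds lies in the
  intersection, and the two fresh parts merge into one resampled point.\<close>

lemma mix_mix: "mix I C (mix I B y u) v = mix I (B \<inter> C) y (mix I C u v)"
  by (auto simp: mix_def fun_eq_iff)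

lemma mix_mix_swap: "y \<in> space (PiM I (\<lambda>_. Z)) \<Longrightarrow> mix I B (mix I B y u) (mix I B u y) = y"
  by (auto simp: mix_def space_PiM PiE_def extensional_def fun_eq_iff)

locale prod_prob =
  fixes I :: "'i set" and Z :: "'z measure"
  assumes prob_Z: "prob_space Z" and I_ne: "I \<noteq> {}"
begin

abbreviation P :: "('i \<Rightarrow> 'z) measure" where "P \<equiv> PiM I (\<lambda>_. Z)"

sublocale P: prob_space P
  by (rule prob_space_PiM) (rule prob_Z)

sublocale PP: pair_prob_space P P ..

text \<open>A pair of independent points is one point of a product over twice as many indices. In
  this form, exchanging the two copies of some coordinates becomes a permutation of indices, to
  which \<open>distr_PiM_reindex\<close> applies.\<close>

lemma distr_halves:
  "distr (PiM (I \<times> (UNIV::bool set)) (\<lambda>_. Z)) (P \<Otimes>\<^sub>M P) (\<lambda>\<omega>. (\<lambda>i\<in>I. \<omega> (i, True), \<lambda>i\<in>I. \<omega> (i, False))) = P \<Otimes>\<^sub>M P"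
proof -
  let ?J = "I \<times> (UNIV::bool set)"
  let ?O = "PiM ?J (\<lambda>_. Z)"
  interpret O: prob_space ?O by (rule prob_space_PiM) (rule prob_Z)
  have "?J \<noteq> {}" using I_ne by auto
  have ind: "O.indep_vars (\<lambda>_. Z) (\<lambda>j \<omega>. \<omega> j) ?J"
  proof (subst O.indep_vars_iff_distr_eq_PiM')
    have "distr ?O ?O (\<lambda>x. restrict x ?J) = distr ?O ?O (\<lambda>x. x)"
      by (rule distr_cong) (auto simp: space_PiM)
    moreover have "PiM ?J (\<lambda>i. distr ?O Z (\<lambda>\<omega>. \<omega> i)) = ?O"
      by (rule PiM_cong) (auto intro!: distr_PiM_component prob_Z)
    ultimately show "distr ?O ?O (\<lambda>x. restrict x ?J) = PiM ?J (\<lambda>i. distr ?O Z (\<lambda>\<omega>. \<omega> i))"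
      by simp
  qed (use I_ne in auto)
  let ?A = "I \<times> {True}" and ?B = "I \<times> {False}"
  have "O.indep_var (PiM ?A (\<lambda>_. Z)) (\<lambda>\<omega>. restrict \<omega> ?A) (PiM ?B (\<lambda>_. Z)) (\<lambda>\<omega>. restrict \<omega> ?B)"
    using O.indep_var_restrict[OF ind, of ?A ?B] by auto
  then have "O.indep_var P ((\<lambda>\<omega>. \<lambda>i\<in>I. \<omega> (i, True)) \<circ> (\<lambda>\<omega>. restrict \<omega> ?A)) P ((\<lambda>\<omega>. \<lambda>i\<in>I. \<omega> (i, False)) \<circ> (\<lambda>\<omega>. restrict \<omega> ?B))"
    by (rule O.indep_var_compose) (auto intro!: measurable_restrict measurable_component_singleton)
  moreover have "(\<lambda>\<omega>. \<lambda>i\<in>I. \<omega> (i, b)) \<circ> (\<lambda>\<omega>. restrict \<omega> (I \<times> {b})) = (\<lambda>\<omega> :: 'i \<times> bool \<Rightarrow> 'z. \<lambda>i\<in>I. \<omega> (i, b))" for b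
    by (auto simp: fun_eq_iff)
  ultimately have "O.indep_var P (\<lambda>\<omega>. \<lambda>i\<in>I. \<omega> (i, True)) P (\<lambda>\<omega>. \<lambda>i\<in>I. \<omega> (i, False))"
    by (simp only:)
  then have "distr ?O P (\<lambda>\<omega>. \<lambda>i\<in>I. \<omega> (i, True)) \<Otimes>\<^sub>M distr ?O P (\<lambda>\<omega>. \<lambda>i\<in>I. \<omega> (i, False))
      = distr ?O (P \<Otimes>\<^sub>M P) (\<lambda>\<omega>. (\<lambda>i\<in>I. \<omega> (i, True), \<lambda>i\<in>I. \<omega> (i, False)))"
    by (simp add: O.indep_var_distribution_eq)
  moreover have "distr ?O P (\<lambda>\<omega>. \<lambda>i\<in>I. \<omega> (i, b)) = P" for b
    using distr_PiM_reindex[of ?J "\<lambda>_. Z" "\<lambda>i. (i, b)" I] prob_Z by (auto simp: inj_on_def)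
  ultimately show ?thesis by simp
qed

lemma distr_mix_swap:
  "distr (P \<Otimes>\<^sub>M P) (P \<Otimes>\<^sub>M P) (\<lambda>(y, u). (mix I B y u, mix I B u y)) = P \<Otimes>\<^sub>M P"
proof -
  let ?J = "I \<times> (UNIV::bool set)"
  let ?O = "PiM ?J (\<lambda>_. Z)"
  let ?e = "\<lambda>\<omega>. (\<lambda>i\<in>I. \<omega> (i, True), \<lambda>i\<in>I. \<omega> (i, False))"
  \<comment> \<open>The permutation swaps the two copies of exactly the indices outside B.\<close>
  let ?r = "\<lambda>(i, b). (i, if i \<in> B then b else \<not> b)"
  let ?R = "\<lambda>\<omega>. \<lambda>n\<in>?J. \<omega> (?r n)"
  let ?s = "\<lambda>(y, u). (mix I B y u, mix I B u y)"
  have e: "?e \<in> measurable ?O (P \<Otimes>\<^sub>M P)"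
    by (intro measurable_Pair measurable_restrict measurable_component_singleton[where M="\<lambda>_. Z" and I="?J"]) auto
  have R: "?R \<in> measurable ?O ?O"
    by (intro measurable_restrict measurable_component_singleton[where M="\<lambda>_. Z" and I="?J"]) auto
  have s: "?s \<in> measurable (P \<Otimes>\<^sub>M P) (P \<Otimes>\<^sub>M P)"
    unfolding case_prod_beta by measurable
  have RO: "distr ?O ?O ?R = ?O"
  proof (rule distr_PiM_reindex)
    show "inj_on ?r ?J" by (auto simp: inj_on_def split: if_splits)
  qed (auto intro: prob_Z)
  have "P \<Otimes>\<^sub>M P = distr (distr ?O ?O ?R) (P \<Otimes>\<^sub>M P) ?e"
    by (simp add: RO distr_halves)
  also have "\<dots> = distr ?O (P \<Otimes>\<^sub>M P) (?e \<circ> ?R)"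
    by (rule distr_distr) (rule e R)+
  also have "?e \<circ> ?R = ?s \<circ> ?e"
    by (auto simp: fun_eq_iff mix_def)
  also have "distr ?O (P \<Otimes>\<^sub>M P) (?s \<circ> ?e) = distr (distr ?O (P \<Otimes>\<^sub>M P) ?e) (P \<Otimes>\<^sub>M P) ?s"
    by (rule distr_distr[symmetric]) (rule e s)+
  also have "\<dots> = distr (P \<Otimes>\<^sub>M P) (P \<Otimes>\<^sub>M P) ?s"
    by (simp add: distr_halves)
  finally show ?thesis ..
qed

lemma int_mix_swap:
  assumes "F \<in> bmeas (P \<Otimes>\<^sub>M P)"
  shows "(\<integral>y. \<integral>u. F (mix I B y u, mix I B u y) \<partial>P \<partial>P) = (\<integral>y. \<integral>u. F (y, u) \<partial>P \<partial>P)"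
proof -
  note [measurable] = assms
  let ?s = "\<lambda>(y, u). (mix I B y u, mix I B u y)"
  have s: "?s \<in> measurable (P \<Otimes>\<^sub>M P) (P \<Otimes>\<^sub>M P)"
    unfolding case_prod_beta by measurable
  have "(\<integral>z. F (?s z) \<partial>(P \<Otimes>\<^sub>M P)) = (\<integral>z. F z \<partial>(P \<Otimes>\<^sub>M P))"
    by (rule integral_mp[OF s distr_mix_swap]) measurable
  moreover have "(\<lambda>z. F (?s z)) \<in> bmeas (P \<Otimes>\<^sub>M P)"
    by (rule bmeas_compose[OF assms s])
  ultimately show ?thesis
    by (simp add: int_pair P.prob_space_axioms assms)
qed

lemma int_mix:
  assumes "G \<in> bmeas P"
  shows "(\<integral>y. \<integral>u. G (mix I B y u) \<partial>P \<partial>P) = (\<integral>y. G y \<partial>P)"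
  using int_mix_swap[of "\<lambda>z. G (fst z)" B] assms
  by (simp add: bmeas_compose P.prob_space)

text \<open>The conditional expectation given the coordinates in \<open>B\<close>.\<close>

definition avg :: "'i set \<Rightarrow> (('i \<Rightarrow> 'z) \<Rightarrow> real) \<Rightarrow> ('i \<Rightarrow> 'z) \<Rightarrow> real" where
  "avg B G y = (\<integral>u. G (mix I B y u) \<partial>P)"

lemma bmeas_mix: "G \<in> bmeas P \<Longrightarrow> (\<lambda>z. G (mix I B (fst z) (snd z))) \<in> bmeas (P \<Otimes>\<^sub>M P)"
  by (erule bmeas_compose) measurable

lemma bmeas_mix1: "G \<in> bmeas P \<Longrightarrow> y \<in> space P \<Longrightarrow> (\<lambda>u. G (mix I B y u)) \<in> bmeas P"
  by (erule bmeas_compose) measurable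

lemma bmeas_avg: "G \<in> bmeas P \<Longrightarrow> avg B G \<in> bmeas P"
  unfolding avg_def using P.bmeas_integral[OF bmeas_mix] by simp

text \<open>Conditional expectations on a product space commute. After \<open>mix_mix\<close> the
  two integrals resample one and the same point twice, and \<open>int_mix\<close> collapses
  them.\<close>

lemma avg_avg:
  assumes "G \<in> bmeas P" "y \<in> space P"
  shows "avg B (avg C G) y = avg (B \<inter> C) G y"
proof -
  have "avg B (avg C G) y = (\<integral>u. \<integral>v. G (mix I (B \<inter> C) y (mix I C u v)) \<partial>P \<partial>P)"
    by (simp add: avg_def mix_mix)
  also have "\<dots> = (\<integral>u. G (mix I (B \<inter> C) y u) \<partial>P)"
    using int_mix[of "\<lambda>u. G (mix I (B \<inter> C) y u)" C] assms by (simp add: bmeas_mix1)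
  finally show ?thesis by (simp add: avg_def)
qed

lemma avg_full: "y \<in> space P \<Longrightarrow> I \<subseteq> B \<Longrightarrow> avg B G y = G y"
  by (simp add: avg_def mix_full P.prob_space)

lemma avg_scale: "avg B (\<lambda>y. c * G y) y = c * avg B G y"
  unfolding avg_def by simp

lemma avg_local: "(\<And>h. h \<in> I \<Longrightarrow> h \<in> B \<Longrightarrow> y h = y' h) \<Longrightarrow> avg B G y = avg B G y'"
  unfolding avg_def by (auto intro!: Bochner_Integration.integral_cong arg_cong[of _ _ G] mix_cong)

text \<open>The inner product of G with the projection of H. Through symmetry and
  \<open>avg_avg\<close>, the operators \<open>avg B\<close> can be treated as commuting orthogonal
  projections while working with functions instead of classes.\<close>

definition bil :: "'i set \<Rightarrow> (('i \<Rightarrow> 'z) \<Rightarrow> real) \<Rightarrow> (('i \<Rightarrow> 'z) \<Rightarrow> real) \<Rightarrow> real" where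
  "bil B G H = (\<integral>y. G y * avg B H y \<partial>P)"

lemma bil_alt:
  assumes "G \<in> bmeas P" "H \<in> bmeas P"
  shows "bil B G H = (\<integral>y. \<integral>u. G y * H (mix I B y u) \<partial>P \<partial>P)"
  unfolding bil_def avg_def by simp

text \<open>The exchange of the coordinates outside B between y and u preserves the product measure
  and is its own inverse, so it moves the resampling from one factor to the other.\<close>

lemma bil_sym:
  assumes "G \<in> bmeas P" "H \<in> bmeas P"
  shows "bil B G H = bil B H G"
proof -
  have "bil B G H = (\<integral>y. \<integral>u. G y * H (mix I B y u) \<partial>P \<partial>P)"
    using assms by (rule bil_alt)
  also have "\<dots> = (\<integral>y. \<integral>u. G (mix I B y u) * H (mix I B (mix I B y u) (mix I B u y)) \<partial>P \<partial>P)"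
    using int_mix_swap[of "\<lambda>z. G (fst z) * H (mix I B (fst z) (snd z))" B] assms
    by (simp add: bmeas_mult bmeas_mix bmeas_compose[OF _ measurable_fst])
  also have "\<dots> = (\<integral>y. \<integral>u. H y * G (mix I B y u) \<partial>P \<partial>P)"
    by (intro Bochner_Integration.integral_cong refl) (simp add: mix_mix_swap)
  also have "\<dots> = bil B H G"
    using assms by (simp add: bil_alt)
  finally show ?thesis .
qed

lemma bil_add_left:
  "G \<in> bmeas P \<Longrightarrow> G' \<in> bmeas P \<Longrightarrow> H \<in> bmeas P \<Longrightarrow> bil B (\<lambda>y. G y + G' y) H = bil B G H + bil B G' H"
  unfolding bil_def distrib_right
  by (intro Bochner_Integration.integral_add P.integrable_bmeas bmeas_mult bmeas_avg)

lemma bil_diff_left: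
  "G \<in> bmeas P \<Longrightarrow> G' \<in> bmeas P \<Longrightarrow> H \<in> bmeas P \<Longrightarrow> bil B (\<lambda>y. G y - G' y) H = bil B G H - bil B G' H"
  unfolding bil_def left_diff_distrib
  by (intro Bochner_Integration.integral_diff P.integrable_bmeas bmeas_mult bmeas_avg)

lemma bil_scale_left: "bil B (\<lambda>y. c * G y) H = c * bil B G H"
  unfolding bil_def by (simp add: mult.assoc)

lemma bil_add_right:
  "G \<in> bmeas P \<Longrightarrow> G' \<in> bmeas P \<Longrightarrow> H \<in> bmeas P \<Longrightarrow> bil B H (\<lambda>y. G y + G' y) = bil B H G + bil B H G'"
  by (simp add: bil_sym[of H] bmeas_add bil_add_left)

lemma bil_diff_right:
  "G \<in> bmeas P \<Longrightarrow> G' \<in> bmeas P \<Longrightarrow> H \<in> bmeas P \<Longrightarrow> bil B H (\<lambda>y. G y - G' y) = bil B H G - bil B H G'"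
  by (simp add: bil_sym[of H] bmeas_diff bil_diff_left)

lemma bil_scale_right: "bil B H (\<lambda>y. c * G y) = c * bil B H G"
  unfolding bil_def by (simp add: avg_scale algebra_simps)

lemma bil_avg_right:
  assumes "G \<in> bmeas P" "H \<in> bmeas P"
  shows "bil B G (avg C H) = bil (B \<inter> C) G H"
  unfolding bil_def using assms by (intro Bochner_Integration.integral_cong refl) (simp add: avg_avg)

lemma bil_avg_left:
  assumes "G \<in> bmeas P" "H \<in> bmeas P"
  shows "bil B (avg C G) H = bil (B \<inter> C) G H"
  using assms by (simp add: bil_sym[of _ H] bmeas_avg bil_avg_right)

lemma bil_full: "I \<subseteq> B \<Longrightarrow> bil B G H = (\<integral>y. G y * H y \<partial>P)"
  unfolding bil_def by (intro Bochner_Integration.integral_cong refl) (simp add: avg_full)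

definition energy :: "'i set \<Rightarrow> (('i \<Rightarrow> 'z) \<Rightarrow> real) \<Rightarrow> real" where
  "energy B G = bil B G G"

lemma energy_eq:
  assumes "G \<in> bmeas P"
  shows "energy B G = (\<integral>y. (avg B G y)\<^sup>2 \<partial>P)"
proof -
  have "energy B G = bil (B \<inter> B) G G"
    by (simp add: energy_def)
  also have "\<dots> = bil B (avg B G) G"
    using assms by (simp add: bil_avg_left)
  also have "\<dots> = (\<integral>y. (avg B G y)\<^sup>2 \<partial>P)"
    by (simp add: bil_def power2_eq_square)
  finally show ?thesis .
qed

lemma energy_nonneg: "G \<in> bmeas P \<Longrightarrow> 0 \<le> energy B G"
  by (simp add: energy_eq)

lemma energy_full: "I \<subseteq> B \<Longrightarrow> energy B G = (\<integral>y. (G y)\<^sup>2 \<partial>P)"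
  by (simp add: energy_def bil_full power2_eq_square)

lemma energy_le: 
  assumes "G \<in> bmeas P"
  shows "energy B G \<le> (\<integral>y. (G y)\<^sup>2 \<partial>P)"
proof -
  have "0 \<le> (\<integral>y. (G y - avg B G y)\<^sup>2 \<partial>P)" by simp
  also have "\<dots> = (\<integral>y. (G y)\<^sup>2 - 2 * (G y * avg B G y) + (avg B G y)\<^sup>2 \<partial>P)"
    by (simp add: power2_diff algebra_simps)
  also have "\<dots> = (\<integral>y. (G y)\<^sup>2 \<partial>P) - 2 * bil B G G + energy B G"
    unfolding energy_eq[OF assms] bil_def using assms
    by (subst Bochner_Integration.integral_add Bochner_Integration.integral_diff;
        (intro P.integrable_bmeas bmeas_intros bmeas_avg assms)?; simp)+
  finally show ?thesis by (simp add: energy_def)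
qed

lemma energy_mono:
  assumes "G \<in> bmeas P" "B \<subseteq> C"
  shows "energy B G \<le> energy C G"
proof -
  have "energy B G = bil (B \<inter> C) (avg C G) G"
    using assms by (simp add: bil_avg_left energy_def Int_absorb2)
  also have "\<dots> = energy B (avg C G)"
    using assms by (simp add: bil_avg_right bmeas_avg energy_def)
  also have "\<dots> \<le> (\<integral>y. (avg C G y)\<^sup>2 \<partial>P)"
    using assms by (intro energy_le bmeas_avg)
  finally show ?thesis
    using assms by (simp add: energy_eq)
qed

lemma integral_diff_avg:
  assumes "G \<in> bmeas P"
  shows "(\<integral>y. (G y - avg B G y)\<^sup>2 \<partial>P) = (\<integral>y. (G y)\<^sup>2 \<partial>P) - energy B G"
proof -
  have "(\<integral>y. (G y - avg B G y)\<^sup>2 \<partial>P) = (\<integral>y. (G y)\<^sup>2 - 2 * (G y * avg B G y) + (avg B G y)\<^sup>2 \<partial>P)"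
    by (simp add: power2_diff algebra_simps)
  also have "\<dots> = (\<integral>y. (G y)\<^sup>2 \<partial>P) - 2 * bil B G G + energy B G"
    unfolding energy_eq[OF assms] bil_def using assms
    by (subst Bochner_Integration.integral_add Bochner_Integration.integral_diff;
        (intro P.integrable_bmeas bmeas_intros bmeas_avg assms)?; simp)+
  finally show ?thesis by (simp add: energy_def)
qed

text \<open>Positivity of the Moebius transform of the energies, by induction: one step of the
  transform replaces \<open>G\<close> by its increment in one coordinate.\<close>

lemma energy_insert:
  assumes "G \<in> bmeas P" "h \<notin> C"
  shows "energy (insert h C) G - energy C G = energy (insert h C) (\<lambda>y. G y - avg (- {h}) G y)"
proof -
  have [simp]: "insert h C \<inter> - {h} = C" "C \<inter> - {h} = C"
    using assms by auto
  show ?thesis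
    unfolding energy_def using assms
    by (simp add: bil_diff_left bil_diff_right bmeas_avg bmeas_diff bil_avg_left bil_avg_right)
qed

lemma mob_energy_nonneg:
  assumes "finite A" "A \<inter> C = {}" "G \<in> bmeas P"
  shows "0 \<le> mob (\<lambda>B. energy (C \<union> B) G) A"
  using assms
proof (induction A arbitrary: C G rule: finite_induct)
  case empty
  then show ?case by (simp add: energy_nonneg)
next
  case (insert h A)
  let ?G = "\<lambda>y. G y - avg (- {h}) G y"
  have "mob (\<lambda>B. energy (C \<union> B) G) (insert h A) = mob (\<lambda>B. energy (C \<union> insert h B) G - energy (C \<union> B) G) A"
    using insert by (simp add: mob_insert)
  also have "\<dots> = mob (\<lambda>B. energy (insert h C \<union> B) ?G) A"
  proof (rule mob_cong)
    fix B assume "B \<subseteq> A"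
    with insert have "h \<notin> C \<union> B" by auto
    then show "energy (C \<union> insert h B) G - energy (C \<union> B) G = energy (insert h C \<union> B) ?G"
      using energy_insert[of G h "C \<union> B"] insert by simp
  qed
  also have "0 \<le> \<dots>"
    using insert by (intro insert.IH) (auto intro: bmeas_diff bmeas_avg)
  finally show ?case .
qed

text \<open>The squared norm of the part of G that depends on exactly the coordinates in A, in the
  orthogonal decomposition over finite sets of coordinates (Efron-Stein or Hoeffding). It is
  obtained from the energies alone, without constructing the components.\<close>

definition wt :: "'i set \<Rightarrow> (('i \<Rightarrow> 'z) \<Rightarrow> real) \<Rightarrow> real" where
  "wt A G = mob (\<lambda>B. energy B G) A"

lemma wt_nonneg: "finite A \<Longrightarrow> G \<in> bmeas P \<Longrightarrow> 0 \<le> wt A G"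
  using mob_energy_nonneg[of A "{}" G] by (simp add: wt_def)

lemma sum_wt: "finite D \<Longrightarrow> (\<Sum>A\<in>Pow D. wt A G) = energy D G"
  unfolding wt_def by (rule sum_mob)

text \<open>\<open>wt A\<close> is a nonnegative quadratic form q, so with D = H - G its cross term
  b obeys 2 |b| \<le> c q(G) + q(D) / c. The bound is kept linear with a free c, rather than as a
  product of square roots, so that it can be summed over A and integrated.\<close>

lemma wt_diff_bound:
  assumes "finite A" "G \<in> bmeas P" "H \<in> bmeas P" "c > 0"
  shows "\<bar>wt A H - wt A G\<bar> \<le> c * wt A G + (1 + 1 / c) * wt A (\<lambda>y. H y - G y)"
proof -
  let ?D = "\<lambda>y. H y - G y"
  define b where "b = mob (\<lambda>B. bil B G ?D) A"
  have D: "?D \<in> bmeas P" using assms by (intro bmeas_diff)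
  have exp: "wt A (\<lambda>y. s * G y + t * ?D y) = s\<^sup>2 * wt A G + 2 * s * t * b + t\<^sup>2 * wt A ?D" for s t
  proof -
    have "energy B (\<lambda>y. s * G y + t * ?D y) = s\<^sup>2 * energy B G + 2 * s * t * bil B G ?D + t\<^sup>2 * energy B ?D" for B
    proof -
      have "energy B (\<lambda>y. s * G y + t * ?D y)
          = s * (s * bil B G G) + s * (t * bil B G ?D) + (t * (s * bil B ?D G) + t * (t * bil B ?D ?D))"
        unfolding energy_def
        by (simp only: bil_add_left bil_add_right bil_scale_left bil_scale_right bmeas_scale bmeas_add D assms distrib_left)
      also have "bil B ?D G = bil B G ?D"
        by (rule bil_sym[OF D assms(2)])
      finally show ?thesis
        by (simp add: energy_def power2_eq_square)
    qed
    then show ?thesis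
      unfolding wt_def b_def by (simp add: mob_add mob_scale)
  qed
  have pos: "0 \<le> wt A (\<lambda>y. s * G y + t * ?D y)" for s t
    using assms D by (intro wt_nonneg bmeas_add bmeas_scale)
  have 1: "wt A H = wt A G + 2 * b + wt A ?D"
    using exp[of 1 1] by simp
  \<comment> \<open>The values of the form at c G + D and c G - D, with c factored out.\<close>
  have "0 \<le> c * (c * wt A G + 2 * b + wt A ?D / c)" "0 \<le> c * (c * wt A G - 2 * b + wt A ?D / c)"
    using pos[of c 1] pos[of c "-1"] exp[of c 1] exp[of c "-1"] assms(4)
    by (simp_all add: power2_eq_square algebra_simps)
  then have "0 \<le> c * wt A G + 2 * b + wt A ?D / c" "0 \<le> c * wt A G - 2 * b + wt A ?D / c"
    using assms(4) by (simp_all add: zero_le_mult_iff)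
  moreover have "0 \<le> wt A ?D" using wt_nonneg assms D by auto
  ultimately show ?thesis
    unfolding 1 by (auto simp: algebra_simps abs_le_iff)
qed

end

subsection \<open>Quantitative non-amenability\<close>

definition fa_prob :: "'g monoid \<Rightarrow> ('g set \<Rightarrow> real) \<Rightarrow> bool" where
  "fa_prob G p \<longleftrightarrow> (\<forall>A. A \<subseteq> carrier G \<longrightarrow> 0 \<le> p A) \<and> p (carrier G) = 1 \<and>
     (\<forall>A B. A \<subseteq> carrier G \<longrightarrow> B \<subseteq> carrier G \<longrightarrow> A \<inter> B = {} \<longrightarrow> p (A \<union> B) = p A + p B)"

lemma fa_prob_le_1:
  assumes "fa_prob G p" "A \<subseteq> carrier G"
  shows "p A \<le> 1"
proof -
  have "p (A \<union> (carrier G - A)) = p A + p (carrier G - A)"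
    using assms unfolding fa_prob_def by (elim conjE allE[of _ A] allE[of _ "carrier G - A"]) auto
  moreover have "0 \<le> p (carrier G - A)"
    using assms unfolding fa_prob_def by (elim conjE allE[of _ "carrier G - A"]) auto
  moreover have "A \<union> (carrier G - A) = carrier G" using assms by auto
  moreover have "p (carrier G) = 1" using assms by (simp add: fa_prob_def)
  ultimately have "p A + p (carrier G - A) = 1" "0 \<le> p (carrier G - A)"
    by metis+
  then show ?thesis by linarith
qed

text \<open>Compactness of the cube of functions from sets to [0,1]: finite additivity and
  invariance under h up to 1 / (n + 1) cut out closed sets, almost invariant means give the finite
  intersection property, and a common point is an invariant mean.\<close>

lemma amenableI:
  fixes G :: "'g monoid"
  assumes ex: "\<And>S \<kappa>. finite S \<Longrightarrow> S \<subseteq> carrier G \<Longrightarrow> \<kappa> > 0 \<Longrightarrow>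
     \<exists>p. fa_prob G p \<and> (\<forall>h\<in>S. \<forall>A\<subseteq>carrier G. \<bar>p (h <#\<^bsub>G\<^esub> A) - p A\<bar> < \<kappa>)"
    and lcos: "\<And>h A. h \<in> carrier G \<Longrightarrow> A \<subseteq> carrier G \<Longrightarrow> h <#\<^bsub>G\<^esub> A \<subseteq> carrier G"
  shows "amenable G"
proof -
  define box where "box = (PiE UNIV (\<lambda>_. {0..1}) :: ('g set \<Rightarrow> real) set)"
  define C where "C = (\<lambda>(h, n). {p. fa_prob G p \<and> (\<forall>A\<subseteq>carrier G. \<bar>p (h <#\<^bsub>G\<^esub> A) - p A\<bar> \<le> 1 / real (Suc n))})"
  have "compactin (product_topology (\<lambda>_. euclidean) UNIV) box"
    unfolding box_def by (subst compactin_PiE) auto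
  then have box: "compact box"
    by (simp add: euclidean_product_topology)
  have closed_C: "closed (C i)" for i
  proof -
    obtain h n where i: "i = (h, n)" by (cases i)
    have 1: "closed {p :: 'g set \<Rightarrow> real. A \<subseteq> carrier G \<longrightarrow> 0 \<le> p A}" for A
      by (cases "A \<subseteq> carrier G") (auto intro!: closed_Collect_le continuous_intros continuous_on_product_coordinates)
    have 2: "closed {p :: 'g set \<Rightarrow> real. p (carrier G) = 1}"
      by (auto intro!: closed_Collect_eq continuous_intros continuous_on_product_coordinates)
    have 3: "closed {p :: 'g set \<Rightarrow> real. A \<subseteq> carrier G \<longrightarrow> B \<subseteq> carrier G \<longrightarrow> A \<inter> B = {} \<longrightarrow> p (A \<union> B) = p A + p B}" for A B
      by (cases "A \<subseteq> carrier G \<and> B \<subseteq> carrier G \<and> A \<inter> B = {}")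
        (auto intro!: closed_Collect_eq continuous_intros continuous_on_product_coordinates)
    have 4: "closed {p :: 'g set \<Rightarrow> real. A \<subseteq> carrier G \<longrightarrow> \<bar>p (h <#\<^bsub>G\<^esub> A) - p A\<bar> \<le> 1 / real (Suc n)}" for A
      by (cases "A \<subseteq> carrier G") (auto intro!: closed_Collect_le continuous_intros continuous_on_product_coordinates)
    show ?thesis
      unfolding i C_def fa_prob_def prod.case
      by (intro closed_Collect_conj closed_Collect_all 1 2 3 4)
  qed
  have "box \<inter> (\<Inter>i\<in>carrier G \<times> UNIV. C i) \<noteq> {}"
  proof (rule compact_imp_fip_image[OF box closed_C])
    fix J assume J: "finite J" "J \<subseteq> carrier G \<times> (UNIV :: nat set)"
    define N where "N = Max (insert 0 (snd ` J))"
    have "finite (fst ` J)" "fst ` J \<subseteq> carrier G" using J by auto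
    then have "\<exists>p. fa_prob G p \<and> (\<forall>h\<in>fst ` J. \<forall>A\<subseteq>carrier G. \<bar>p (h <#\<^bsub>G\<^esub> A) - p A\<bar> < 1 / real (Suc N))"
      by (rule ex) simp
    then obtain p where p: "fa_prob G p"
      "\<And>h A. h \<in> fst ` J \<Longrightarrow> A \<subseteq> carrier G \<Longrightarrow> \<bar>p (h <#\<^bsub>G\<^esub> A) - p A\<bar> < 1 / real (Suc N)"
      by blast
    \<comment> \<open>\<open>p\<close> is arbitrary on sets outside the carrier, while a point of
      the cube needs all its values in [0,1].\<close>
    define p' where "p' A = p (A \<inter> carrier G)" for A
    have p'_eq: "p' A = p A" if "A \<subseteq> carrier G" for A
      using that by (simp add: p'_def Int_absorb2)
    have "fa_prob G p'"
      using p(1) unfolding fa_prob_def by (simp add: p'_eq)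
    moreover have "p' \<in> box"
      using fa_prob_le_1[OF p(1)] p(1) by (auto simp: box_def p'_def fa_prob_def)
    moreover have "\<bar>p' (h <#\<^bsub>G\<^esub> A) - p' A\<bar> \<le> 1 / real (Suc n)" if "(h, n) \<in> J" "A \<subseteq> carrier G" for h n A
    proof -
      have "h \<in> fst ` J" "n \<le> N" "h \<in> carrier G"
        using that J unfolding N_def by (auto simp: image_iff intro!: Max_ge) force+
      then have "\<bar>p (h <#\<^bsub>G\<^esub> A) - p A\<bar> \<le> 1 / real (Suc N)" "1 / real (Suc N) \<le> 1 / real (Suc n)"
        using p(2)[of h A] that by (auto simp: frac_le)
      with that lcos[OF \<open>h \<in> carrier G\<close>] show ?thesis by (simp add: p'_eq)
    qed
    ultimately have "p' \<in> box \<inter> (\<Inter>i\<in>J. C i)"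
      by (auto simp: C_def)
    then show "box \<inter> (\<Inter>i\<in>J. C i) \<noteq> {}" by blast
  qed
  then obtain p where p: "\<And>h n. h \<in> carrier G \<Longrightarrow> p \<in> C (h, n)" 
    by auto
  have inv: "p (h <#\<^bsub>G\<^esub> A) = p A" if "h \<in> carrier G" "A \<subseteq> carrier G" for h A
  proof (rule ccontr)
    assume "p (h <#\<^bsub>G\<^esub> A) \<noteq> p A"
    then have "\<bar>p (h <#\<^bsub>G\<^esub> A) - p A\<bar> > 0" by simp
    then obtain n where "1 / real (Suc n) < \<bar>p (h <#\<^bsub>G\<^esub> A) - p A\<bar>"
      using nat_approx_posE by metis
    moreover have "\<forall>A\<subseteq>carrier G. \<bar>p (h <#\<^bsub>G\<^esub> A) - p A\<bar> \<le> 1 / real (Suc n)"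
      using p[OF that(1), of n] unfolding C_def by simp
    ultimately show False
      using that(2) by (meson not_le)
  qed
  show ?thesis
  proof (cases "carrier G = {}")
    \<comment> \<open>With an empty carrier the intersection imposes no condition on its points, so
      the mean is taken from \<open>ex\<close> directly.\<close>
    case True
    then have "\<exists>p. fa_prob G p" using ex[of "{}" 1] by auto
    then show ?thesis unfolding amenable_def fa_prob_def using True by auto
  next
    case False
    then obtain h where "h \<in> carrier G" by blast
    then have "fa_prob G p" using p[of h 0] by (simp add: C_def)
    then show ?thesis
      unfolding amenable_def fa_prob_def using inv by (intro exI[of _ p]) simp
  qed
qed

text \<open>The contrapositive of \<open>amenableI\<close>. One finite S and one \<kappa> defeat all
  finitely additive probabilities at once, and this uniformity is what becomes a spectral
  gap.\<close>

lemma non_amenable_gap: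
  assumes "group G" "\<not> amenable G"
  obtains S \<kappa> where "finite S" "S \<subseteq> carrier G" "\<kappa> > 0"
    "\<And>p. fa_prob G p \<Longrightarrow> \<exists>h\<in>S. \<exists>A\<subseteq>carrier G. \<kappa> \<le> \<bar>p (h <#\<^bsub>G\<^esub> A) - p A\<bar>"
proof -
  interpret group G by fact
  have "h <#\<^bsub>G\<^esub> A \<subseteq> carrier G" if "h \<in> carrier G" "A \<subseteq> carrier G" for h A
    using that by (auto simp: l_coset_def)
  note lc = this
  have "\<exists>S. \<exists>\<kappa>>0. finite S \<and> S \<subseteq> carrier G \<and>
     \<not> (\<exists>p. fa_prob G p \<and> (\<forall>h\<in>S. \<forall>A\<subseteq>carrier G. \<bar>p (h <#\<^bsub>G\<^esub> A) - p A\<bar> < \<kappa>))"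
  proof (rule ccontr)
    assume "\<not> ?thesis"
    then have "amenable G"
      by (intro amenableI lc) blast+
    with assms(2) show False by simp
  qed
  then obtain S and \<kappa> :: real where *: "finite S" "S \<subseteq> carrier G" "\<kappa> > 0"
    and **: "\<not> (\<exists>p. fa_prob G p \<and> (\<forall>h\<in>S. \<forall>A\<subseteq>carrier G. \<bar>p (h <#\<^bsub>G\<^esub> A) - p A\<bar> < \<kappa>))"
    by blast
  show thesis
    using that[OF *] ** by (meson linorder_not_le)
qed

lemma non_amenable_infinite:
  assumes "group G" "\<not> amenable G"
  shows "infinite (carrier G)"
proof
  assume fin: "finite (carrier G)"
  interpret group G by fact
  have ne: "carrier G \<noteq> {}" by auto
  define p where "p A = real (card A) / real (card (carrier G))" for A :: "'a set"
  have "card (h <#\<^bsub>G\<^esub> A) = card A" if "h \<in> carrier G" "A \<subseteq> carrier G" for h A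
  proof -
    have "h <#\<^bsub>G\<^esub> A = (\<lambda>a. h \<otimes>\<^bsub>G\<^esub> a) ` A" by (auto simp: l_coset_def)
    moreover have "inj_on (\<lambda>a. h \<otimes>\<^bsub>G\<^esub> a) A"
      using that by (auto simp: inj_on_def subset_iff)
    ultimately show ?thesis by (simp add: card_image)
  qed
  moreover have "card (A \<union> B) = card A + card B" if "A \<subseteq> carrier G" "B \<subseteq> carrier G" "A \<inter> B = {}" for A B
    using that fin by (intro card_Un_disjoint) (auto intro: finite_subset)
  moreover have "p (carrier G) = 1"
    using fin ne by (simp add: p_def)
  ultimately have "amenable G"
    unfolding amenable_def by (intro exI[of _ p]) (simp add: p_def add_divide_distrib)
  with assms show False by simp
qed


subsection \<open>The shift\<close>

text \<open>The formula of \<open>bernoulli_action\<close> for all functions and not only for points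
  of the product space, so that the composition law holds without a side condition on y.\<close>

definition shift :: "'l monoid \<Rightarrow> 'l \<Rightarrow> ('l \<Rightarrow> 'z) \<Rightarrow> 'l \<Rightarrow> 'z" where
  "shift H g y = (\<lambda>h\<in>carrier H. y (inv\<^bsub>H\<^esub> g \<otimes>\<^bsub>H\<^esub> h))"

locale bern = H: group H for H :: "'l monoid" (structure) +
  fixes Z :: "'z measure"
  assumes prob_Z: "prob_space Z" and countable_H: "countable (carrier H)"
begin

sublocale prod_prob "carrier H" Z
proof (rule prod_prob.intro)
  show "carrier H \<noteq> {}"
    using H.one_closed by blast
qed (rule prob_Z)

lemma shift_in_space: "g \<in> carrier H \<Longrightarrow> y \<in> space P \<Longrightarrow> shift H g y \<in> space P"
  by (auto simp: shift_def space_PiM)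

lemma shift_mult: "g \<in> carrier H \<Longrightarrow> g' \<in> carrier H \<Longrightarrow> shift H (g \<otimes> g') y = shift H g (shift H g' y)"
  by (auto simp: shift_def H.inv_mult_group H.m_assoc fun_eq_iff)

lemma shift_one: "y \<in> space P \<Longrightarrow> shift H \<one> y = y"
  by (auto simp: shift_def space_PiM fun_eq_iff PiE_def extensional_def)

lemma shift_inv: "g \<in> carrier H \<Longrightarrow> y \<in> space P \<Longrightarrow> shift H (inv g) (shift H g y) = y"
  using shift_mult[of "inv g" g y] by (simp add: shift_one)

lemma shift_measurable1 [measurable]: "g \<in> carrier H \<Longrightarrow> shift H g \<in> measurable P P"
  unfolding shift_def by (intro measurable_restrict measurable_component_singleton) auto

text \<open>The amount of shift may vary measurably with the point because the group is countable.
  This is what allows shifts by a cocycle.\<close>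

lemma shift_measurable [measurable (raw)]:
  assumes [measurable]: "g \<in> measurable M (count_space (carrier H))" "f \<in> measurable M P"
  shows "(\<lambda>x. shift H (g x) (f x)) \<in> measurable M P"
  by (rule measurable_compose_countable'[where g=g and I="carrier H"])
    (auto intro!: measurable_compose[OF assms(2)] shift_measurable1 countable_H assms)

lemma distr_shift: "g \<in> carrier H \<Longrightarrow> distr P P (shift H g) = P"
proof -
  assume g: "g \<in> carrier H"
  have "distr P (PiM (carrier H) (\<lambda>_. Z)) (\<lambda>\<omega>. \<lambda>n\<in>carrier H. \<omega> (inv g \<otimes> n)) = PiM (carrier H) (\<lambda>_. Z)"
    using g by (intro distr_PiM_reindex) (auto simp: inj_on_def intro: prob_Z)
  then show ?thesis by (simp add: shift_def[abs_def])
qed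

lemma int_shift: "g \<in> carrier H \<Longrightarrow> G \<in> borel_measurable P \<Longrightarrow> (\<integral>y. G (shift H g y) \<partial>P) = (\<integral>y. G y \<partial>P :: real)"
  by (rule integral_mp[OF shift_measurable1 distr_shift])

lemma shift_mix:
  assumes "g \<in> carrier H" "B \<subseteq> carrier H"
  shows "shift H g (mix (carrier H) B y u) = mix (carrier H) ((\<lambda>b. g \<otimes> b) ` B) (shift H g y) (shift H g u)"
proof -
  have "inv g \<otimes> h \<in> B \<longleftrightarrow> h \<in> (\<lambda>b. g \<otimes> b) ` B" if "h \<in> carrier H" for h
  proof
    assume "inv g \<otimes> h \<in> B"
    then show "h \<in> (\<lambda>b. g \<otimes> b) ` B"
      using assms that by (intro image_eqI[of _ _ "inv g \<otimes> h"]) (auto simp: H.m_assoc[symmetric])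
  next
    assume "h \<in> (\<lambda>b. g \<otimes> b) ` B"
    then obtain b where "b \<in> B" "h = g \<otimes> b" by auto
    then show "inv g \<otimes> h \<in> B"
      using assms by (auto simp: H.m_assoc[symmetric] subset_iff)
  qed
  then show ?thesis
    using assms by (auto simp: shift_def mix_def fun_eq_iff)
qed

lemma avg_shift:
  assumes "g \<in> carrier H" "B \<subseteq> carrier H" "G \<in> bmeas P" "y \<in> space P"
  shows "avg B (\<lambda>y. G (shift H g y)) y = avg ((\<lambda>b. g \<otimes> b) ` B) G (shift H g y)"
proof -
  have "avg B (\<lambda>y. G (shift H g y)) y = (\<integral>u. G (mix (carrier H) ((\<lambda>b. g \<otimes> b) ` B) (shift H g y) (shift H g u)) \<partial>P)"
    unfolding avg_def using assms by (simp add: shift_mix)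
  also have "\<dots> = avg ((\<lambda>b. g \<otimes> b) ` B) G (shift H g y)"
    unfolding avg_def using assms
    by (intro int_shift[of g "\<lambda>u. G (mix _ _ _ u)"] bmeas_measurable bmeas_mix1 shift_in_space)
  finally show ?thesis .
qed

lemma energy_shift:
  assumes "g \<in> carrier H" "B \<subseteq> carrier H" "G \<in> bmeas P"
  shows "energy B (\<lambda>y. G (shift H g y)) = energy ((\<lambda>b. g \<otimes> b) ` B) G"
proof -
  have [measurable]: "G \<in> borel_measurable P" "avg C G \<in> borel_measurable P" for C
    using assms bmeas_avg[of G] by (auto dest: bmeas_measurable)
  have "energy B (\<lambda>y. G (shift H g y)) = (\<integral>y. G (shift H g y) * avg ((\<lambda>b. g \<otimes> b) ` B) G (shift H g y) \<partial>P)"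
    unfolding energy_def bil_def using assms by (intro Bochner_Integration.integral_cong refl) (simp add: avg_shift)
  also have "\<dots> = energy ((\<lambda>b. g \<otimes> b) ` B) G"
    unfolding energy_def bil_def using assms
    by (intro int_shift[of g "\<lambda>y. G y * avg _ G y"]) measurable
  finally show ?thesis .
qed

text \<open>Shifting a function translates the sets that carry its weights: every energy in the
  alternating sum moves by \<open>energy_shift\<close>. In this way the action on coordinates
  becomes an action on finite sets.\<close>

lemma wt_shift:
  assumes "g \<in> carrier H" "A \<subseteq> carrier H" "G \<in> bmeas P"
  shows "wt ((\<lambda>b. g \<otimes> b) ` A) G = wt A (\<lambda>y. G (shift H g y))"
proof -
  have "inj_on (\<lambda>b. g \<otimes> b) A"
    using assms by (auto simp: inj_on_def subset_iff)
  then have "wt ((\<lambda>b. g \<otimes> b) ` A) G = mob (\<lambda>B. energy ((\<lambda>b. g \<otimes> b) ` B) G) A"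
    unfolding wt_def by (rule mob_image)
  also have "\<dots> = wt A (\<lambda>y. G (shift H g y))"
    unfolding wt_def using assms by (intro mob_cong) (simp add: energy_shift subset_trans)
  finally show ?thesis .
qed

lemma avg_empty: "G \<in> bmeas P \<Longrightarrow> y \<in> space P \<Longrightarrow> avg {} G y = (\<integral>u. G u \<partial>P)"
  unfolding avg_def
  by (intro Bochner_Integration.integral_cong refl arg_cong[of _ _ G])
    (auto simp: mix_def space_PiM PiE_def extensional_def fun_eq_iff)

lemma energy_empty: "G \<in> bmeas P \<Longrightarrow> energy {} G = (\<integral>u. G u \<partial>P)\<^sup>2"
  by (simp add: energy_eq avg_empty P.prob_space cong: Bochner_Integration.integral_cong)

end

subsection \<open>Spectral gap for subrelations of Bernoulli actions\<close>

lemma borel_measurable_pair_countable: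
  fixes f :: "'t \<Rightarrow> 'a \<Rightarrow> real"
  assumes "countable A" "\<And>a. a \<in> A \<Longrightarrow> (\<lambda>t. f t a) \<in> borel_measurable T"
  shows "case_prod f \<in> borel_measurable (T \<Otimes>\<^sub>M count_space A)"
proof -
  have "(\<lambda>(a, t). f t a) \<in> borel_measurable (count_space A \<Otimes>\<^sub>M T)"
    using assms by (intro measurable_pair_measure_countable1) auto
  then have "(\<lambda>z. (\<lambda>(a, t). f t a) (snd z, fst z)) \<in> borel_measurable (T \<Otimes>\<^sub>M count_space A)"
    by (rule measurable_compose[rotated]) measurable
  then show ?thesis by (simp add: case_prod_beta')
qed

text \<open>Sums over a countable family are written as integrals over counting measure, so that
  their measurable dependence on a parameter follows from the theory of sigma-finite
  measures.\<close>

lemma integrable_count_space_bounded: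
  fixes f :: "'a \<Rightarrow> real"
  assumes "\<And>a. a \<in> A \<Longrightarrow> 0 \<le> f a" "\<And>D. finite D \<Longrightarrow> D \<subseteq> A \<Longrightarrow> sum f D \<le> c"
  shows "integrable (count_space A) f" "(\<integral>a. f a \<partial>count_space A) \<le> c"
proof -
  have s: "f summable_on A"
    using assms by (intro nonneg_bdd_above_summable_on) (auto simp: bdd_above_def)
  then have "(\<lambda>a. norm (f a)) summable_on A"
    using assms by (simp cong: summable_on_cong)
  then have abs: "Infinite_Set_Sum.abs_summable_on f A"
    by (subst abs_summable_equivalent[symmetric])
  then show "integrable (count_space A) f"
    by (simp add: abs_summable_on_def)
  have "(\<integral>a. f a \<partial>count_space A) = infsetsum f A"
    by (simp add: infsetsum_def)
  also have "\<dots> = infsum f A"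
    using abs by (simp add: infsetsum_infsum abs_summable_equivalent)
  also have "\<dots> \<le> c"
    using s assms by (intro infsum_le_finite_sums) auto
  finally show "(\<integral>a. f a \<partial>count_space A) \<le> c" .
qed

lemma integral_count_space_ge:
  fixes f :: "'a \<Rightarrow> real"
  assumes "integrable (count_space A) f" "\<And>a. a \<in> A \<Longrightarrow> 0 \<le> f a" "finite D" "D \<subseteq> A"
  shows "sum f D \<le> (\<integral>a. f a \<partial>count_space A)"
proof -
  have "sum f D = (\<integral>a. f a * indicator D a \<partial>count_space A)"
  proof -
    have "(\<integral>a. f a * indicator D a \<partial>count_space A) = (\<Sum>a | a \<in> A \<and> f a * indicator D a \<noteq> 0. f a * indicator D a)"
      using assms by (intro lebesgue_integral_count_space_finite_support)
        (auto intro: finite_subset[OF _ assms(3)] simp: indicator_def)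
    also have "\<dots> = sum f D"
      using assms by (intro sum.mono_neutral_cong_left) (auto simp: indicator_def)
    finally show ?thesis by simp
  qed
  also have "\<dots> \<le> (\<integral>a. f a \<partial>count_space A)"
    using assms by (intro integral_mono integrable_mult_indicator[where 'b=real, unfolded real_scaleR_def mult.commute[of "indicator _ _"]])
      (auto simp: indicator_def)
  finally show ?thesis .
qed

section \<open>Total weight of a function over the nonempty finite sets of coordinates\<close>

context bern
begin

text \<open>The empty set is left out because its weight is the squared mean. The weights over
  \<open>fins\<close> therefore measure variance.\<close>

definition fins :: "'l set set" where
  "fins = {A. finite A \<and> A \<noteq> {} \<and> A \<subseteq> carrier H}"

lemma countable_fins: "countable fins"
proof -
  have "countable {A. finite A \<and> A \<subseteq> carrier H}"
    by (rule countable_Collect_finite_subset[OF countable_H])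
  then show ?thesis
    by (rule countable_subset[rotated]) (auto simp: fins_def)
qed

lemma sum_wt_le:
  assumes "G \<in> bmeas P" "finite D" "D \<subseteq> fins"
  shows "(\<Sum>A\<in>D. wt A G) \<le> (\<integral>y. (G y)\<^sup>2 \<partial>P)"
proof -
  have fin: "finite (\<Union>D)" using assms by (auto simp: fins_def)
  have "(\<Sum>A\<in>D. wt A G) \<le> (\<Sum>A\<in>Pow (\<Union>D). wt A G)"
    using assms fin by (intro sum_mono2) (auto intro!: wt_nonneg intro: finite_subset)
  also have "\<dots> = energy (\<Union>D) G"
    by (rule sum_wt[OF fin])
  also have "\<dots> \<le> (\<integral>y. (G y)\<^sup>2 \<partial>P)"
    by (rule energy_le[OF assms(1)])
  finally show ?thesis .
qed

lemma wt_integrable: "G \<in> bmeas P \<Longrightarrow> integrable (count_space fins) (\<lambda>A. wt A G)"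
  by (rule integrable_count_space_bounded[OF _ sum_wt_le]) (auto simp: fins_def intro: wt_nonneg)

lemma integral_wt_le: "G \<in> bmeas P \<Longrightarrow> (\<integral>A. wt A G \<partial>count_space fins) \<le> (\<integral>y. (G y)\<^sup>2 \<partial>P)"
  by (rule integrable_count_space_bounded[OF _ sum_wt_le]) (auto simp: fins_def intro: wt_nonneg)

text \<open>For a function of the coordinates in L, \<open>energy L G\<close> is the full squared
  norm, so the nonempty subsets of L alone already carry the whole variance. Locality avoids a limit
  over growing finite sets.\<close>

lemma integral_wt_ge:
  assumes "G \<in> bmeas P" "finite L" "L \<subseteq> carrier H"
    and loc: "\<And>u v. u \<in> space P \<Longrightarrow> v \<in> space P \<Longrightarrow> (\<And>h. h \<in> L \<Longrightarrow> u h = v h) \<Longrightarrow> G u = G v"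
  shows "(\<integral>y. (G y)\<^sup>2 \<partial>P) - (\<integral>y. G y \<partial>P)\<^sup>2 \<le> (\<integral>A. wt A G \<partial>count_space fins)"
proof -
  have "avg L G y = G y" if "y \<in> space P" for y
  proof -
    have "avg L G y = (\<integral>u. G y \<partial>P)"
      unfolding avg_def using that assms(3)
      by (intro Bochner_Integration.integral_cong refl loc mix_in_space) (auto simp: mix_def)
    then show ?thesis by (simp add: P.prob_space)
  qed
  then have e: "energy L G = (\<integral>y. (G y)\<^sup>2 \<partial>P)"
    using assms(1) by (simp add: energy_eq cong: Bochner_Integration.integral_cong)
  have "(\<Sum>A\<in>Pow L. wt A G) = wt {} G + (\<Sum>A\<in>Pow L - {{}}. wt A G)"
    using assms by (subst sum.remove[of _ "{}"]) auto
  then have "(\<Sum>A\<in>Pow L - {{}}. wt A G) = energy L G - energy {} G"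
    using assms by (simp add: sum_wt) (simp add: wt_def)
  also have "\<dots> = (\<integral>y. (G y)\<^sup>2 \<partial>P) - (\<integral>y. G y \<partial>P)\<^sup>2"
    using assms by (simp add: e energy_empty)
  finally have "(\<integral>y. (G y)\<^sup>2 \<partial>P) - (\<integral>y. G y \<partial>P)\<^sup>2 = (\<Sum>A\<in>Pow L - {{}}. wt A G)" ..
  also have "\<dots> \<le> (\<integral>A. wt A G \<partial>count_space fins)"
    using assms
    by (intro integral_count_space_ge wt_integrable) (auto simp: fins_def intro: wt_nonneg finite_subset)
  finally show ?thesis .
qed

lemma bmeas_energy:
  assumes "F \<in> bmeas (T \<Otimes>\<^sub>M P)"
  shows "(\<lambda>t. energy B (\<lambda>u. F (t, u))) \<in> bmeas T"
proof -
  have *: "(\<lambda>z. F (fst (fst z), snd (fst z)) * F (fst (fst z), mix (carrier H) B (snd (fst z)) (snd z))) \<in> bmeas ((T \<Otimes>\<^sub>M P) \<Otimes>\<^sub>M P)"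
    by (intro bmeas_mult bmeas_compose[OF assms]) measurable
  have "(\<lambda>t. \<integral>y. \<integral>u. F (t, y) * F (t, mix (carrier H) B y u) \<partial>P \<partial>P) \<in> bmeas T"
    using P.bmeas_integral[OF P.bmeas_integral[OF *]] by simp
  then show ?thesis
    unfolding energy_def bil_def avg_def by simp
qed

lemma bmeas_wt:
  assumes "F \<in> bmeas (T \<Otimes>\<^sub>M P)"
  shows "(\<lambda>t. wt A (\<lambda>u. F (t, u))) \<in> bmeas T"
  unfolding wt_def mob_def by (intro bmeas_sum bmeas_scale bmeas_energy assms)

end

text \<open>A free action inside the orbits of the shift. The relations are required at every point
  of one conull set \<open>Y\<close> stable under both actions, so that arguments along orbits meet
  no exceptional null sets. \<open>eq_meas\<close>, measurability of the coincidence set of two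
  maps, is the form in which standardness of the space enters.\<close>

locale orbit_sub = bern H Z for H :: "'l monoid" (structure) and Z :: "'z measure" +
  fixes G :: "'g monoid" and \<sigma> :: "'g \<Rightarrow> ('l \<Rightarrow> 'z) \<Rightarrow> ('l \<Rightarrow> 'z)"
    and w :: "'g \<Rightarrow> ('l \<Rightarrow> 'z) \<Rightarrow> 'l" and Y :: "('l \<Rightarrow> 'z) set"
  assumes group_G: "group G" and countable_G: "countable (carrier G)"
    and \<sigma>_meas: "\<And>g. g \<in> carrier G \<Longrightarrow> \<sigma> g \<in> measurable P P"
    and \<sigma>_distr: "\<And>g. g \<in> carrier G \<Longrightarrow> distr P P (\<sigma> g) = P"
    and Y_space: "Y \<subseteq> space P" and AE_Y: "AE y in P. y \<in> Y"
    and Y_\<sigma>: "\<And>g y. g \<in> carrier G \<Longrightarrow> y \<in> Y \<Longrightarrow> \<sigma> g y \<in> Y"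
    and Y_shift: "\<And>l y. l \<in> carrier H \<Longrightarrow> y \<in> Y \<Longrightarrow> shift H l y \<in> Y"
    and \<sigma>_mult: "\<And>g g' y. g \<in> carrier G \<Longrightarrow> g' \<in> carrier G \<Longrightarrow> y \<in> Y \<Longrightarrow> \<sigma> (g \<otimes>\<^bsub>G\<^esub> g') y = \<sigma> g (\<sigma> g' y)"
    and \<sigma>_one: "\<And>y. y \<in> Y \<Longrightarrow> \<sigma> \<one>\<^bsub>G\<^esub> y = y"
    and \<sigma>_free: "\<And>g g' y. g \<in> carrier G \<Longrightarrow> g' \<in> carrier G \<Longrightarrow> y \<in> Y \<Longrightarrow> \<sigma> g y = \<sigma> g' y \<Longrightarrow> g = g'"
    and shift_free: "\<And>l l' y. l \<in> carrier H \<Longrightarrow> l' \<in> carrier H \<Longrightarrow> y \<in> Y \<Longrightarrow> shift H l y = shift H l' y \<Longrightarrow> l = l'"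
    and w_meas: "\<And>g. g \<in> carrier G \<Longrightarrow> w g \<in> measurable P (count_space (carrier H))"
    and \<sigma>_eq: "\<And>g y. g \<in> carrier G \<Longrightarrow> y \<in> Y \<Longrightarrow> \<sigma> g y = shift H (w g y) y"
    and eq_meas: "\<And>T1 T2. T1 \<in> measurable P P \<Longrightarrow> T2 \<in> measurable P P \<Longrightarrow> {y \<in> space P. T1 y = T2 y} \<in> sets P"
begin

sublocale G: group G by (rule group_G)

lemma w_in: "g \<in> carrier G \<Longrightarrow> y \<in> space P \<Longrightarrow> w g y \<in> carrier H"
  using measurable_space[OF w_meas, of g y] by simp


lemma shift_inv_Y: "l \<in> carrier H \<Longrightarrow> y \<in> Y \<Longrightarrow> shift H (inv l) (shift H l y) = y"
  using Y_space by (auto intro: shift_inv)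

text \<open>The orbit of \<open>(y, l)\<close> under \<open>g (y, l) = (\<sigma> g y, w g y l)\<close> lies over the fixed point
  \<open>z = l\<^sup>-\<^sup>1 y\<close>, and meets exactly once the set where \<open>l\<close> is the first index whose translate of \<open>z\<close>
  is in the same \<open>G\<close>-orbit; \<open>pos y l\<close> is the position of \<open>(y, l)\<close> relative to that point.\<close>

definition enH :: "nat \<Rightarrow> 'l" where "enH = from_nat_into (carrier H)"
definition enG :: "nat \<Rightarrow> 'g" where "enG = from_nat_into (carrier G)"

definition pt :: "nat \<Rightarrow> ('l \<Rightarrow> 'z) \<Rightarrow> 'l \<Rightarrow> ('l \<Rightarrow> 'z)" where
  "pt n y l = shift H (enH n) (shift H (inv l) y)"

definition first :: "('l \<Rightarrow> 'z) \<Rightarrow> 'l \<Rightarrow> nat" where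
  "first y l = (LEAST n. \<exists>k. \<sigma> (enG k) (pt n y l) = y)"

definition pos :: "('l \<Rightarrow> 'z) \<Rightarrow> 'l \<Rightarrow> 'g" where
  "pos y l = enG (LEAST k. \<sigma> (enG k) (pt (first y l) y l) = y)"

lemma enH_in [simp]: "enH n \<in> carrier H"
  unfolding enH_def using I_ne by (rule from_nat_into)

lemma enG_in [simp]: "enG n \<in> carrier G"
  unfolding enG_def using G.one_closed by (intro from_nat_into) auto

lemma enH_surj: "l \<in> carrier H \<Longrightarrow> \<exists>n. enH n = l"
  unfolding enH_def using from_nat_into_surj[OF countable_H] by blast

lemma enG_surj: "g \<in> carrier G \<Longrightarrow> \<exists>n. enG n = g"
  unfolding enG_def using from_nat_into_surj[OF countable_G] by blast

lemma pt_Y: "y \<in> Y \<Longrightarrow> l \<in> carrier H \<Longrightarrow> pt n y l \<in> Y"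
  unfolding pt_def by (intro Y_shift) auto

lemma pos_in [simp]: "pos y l \<in> carrier G"
  by (simp add: pos_def)

lemma pos_eq:
  assumes "y \<in> Y" "l \<in> carrier H"
  shows "\<sigma> (pos y l) (pt (first y l) y l) = y"
proof -
  obtain n k where nk: "enH n = l" "enG k = \<one>\<^bsub>G\<^esub>"
    using enH_surj[OF assms(2)] enG_surj[of "\<one>\<^bsub>G\<^esub>"] by auto
  have "pt n y l = shift H (inv (inv l)) (shift H (inv l) y)"
    using assms nk by (simp add: pt_def)
  also have "\<dots> = y"
    using assms by (intro shift_inv_Y) auto
  finally have "\<sigma> (enG k) (pt n y l) = y"
    using nk assms by (simp add: \<sigma>_one)
  then have "\<exists>n k. \<sigma> (enG k) (pt n y l) = y" by blast
  then have "\<exists>k. \<sigma> (enG k) (pt (first y l) y l) = y"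
    unfolding first_def by (rule LeastI_ex)
  then show ?thesis
    unfolding pos_def by (rule LeastI_ex)
qed

lemma pos_unique:
  assumes "y \<in> Y" "l \<in> carrier H" "g \<in> carrier G" "\<sigma> g (pt (first y l) y l) = y"
  shows "pos y l = g"
  using assms pos_eq[of y l] by (intro \<sigma>_free[of _ _ "pt (first y l) y l"]) (auto intro: pt_Y)

lemma pos_equivariant:
  assumes "y \<in> Y" "l \<in> carrier H" "g \<in> carrier G"
  shows "pos (\<sigma> g y) (w g y \<otimes> l) = g \<otimes>\<^bsub>G\<^esub> pos y l"
proof -
  have w: "w g y \<in> carrier H" using assms Y_space by (auto intro: w_in)
  have gy: "\<sigma> g y \<in> Y" using assms by (auto intro: Y_\<sigma>)
  \<comment> \<open>Acting by g replaces y by \<open>\<sigma> g y\<close> and l by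
    \<open>w g y \<otimes> l\<close>, which leaves the point \<open>shift H (inv l) y\<close> fixed.
    Only the target of the orbit segment moves.\<close>
  have pt: "pt n (\<sigma> g y) (w g y \<otimes> l) = pt n y l" for n
  proof -
    have "shift H (inv (w g y \<otimes> l)) (\<sigma> g y) = shift H (inv l) (shift H (inv (w g y)) (shift H (w g y) y))"
      using assms w by (simp add: H.inv_mult_group shift_mult \<sigma>_eq)
    also have "\<dots> = shift H (inv l) y"
      using assms w by (simp add: shift_inv_Y)
    finally show ?thesis by (simp add: pt_def)
  qed
  have ex: "(\<exists>k. \<sigma> (enG k) x = \<sigma> g y) \<longleftrightarrow> (\<exists>k. \<sigma> (enG k) x = y)" if x: "x \<in> Y" for x
  proof
    assume "\<exists>k. \<sigma> (enG k) x = \<sigma> g y"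
    then obtain k where k: "\<sigma> (enG k) x = \<sigma> g y" by blast
    obtain j where j: "enG j = inv\<^bsub>G\<^esub> g \<otimes>\<^bsub>G\<^esub> enG k"
      using enG_surj[of "inv\<^bsub>G\<^esub> g \<otimes>\<^bsub>G\<^esub> enG k"] assms by auto
    have "\<sigma> (enG j) x = \<sigma> (inv\<^bsub>G\<^esub> g) (\<sigma> g y)"
      using assms x k by (simp add: j \<sigma>_mult)
    also have "\<dots> = y"
      using assms by (simp add: \<sigma>_mult[symmetric] \<sigma>_one)
    finally show "\<exists>k. \<sigma> (enG k) x = y" by blast
  next
    assume "\<exists>k. \<sigma> (enG k) x = y"
    then obtain k where k: "\<sigma> (enG k) x = y" by blast
    obtain j where j: "enG j = g \<otimes>\<^bsub>G\<^esub> enG k"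
      using enG_surj[of "g \<otimes>\<^bsub>G\<^esub> enG k"] assms by auto
    have "\<sigma> (enG j) x = \<sigma> g y"
      using assms x k by (simp add: j \<sigma>_mult)
    then show "\<exists>k. \<sigma> (enG k) x = \<sigma> g y" by blast
  qed
  \<comment> \<open>Since y and \<open>\<sigma> g y\<close> lie in the same G-orbits, the selected
    index is an invariant of the orbit and does not depend on the position within it.\<close>
  have first: "first (\<sigma> g y) (w g y \<otimes> l) = first y l"
    unfolding first_def using assms by (simp add: pt ex pt_Y)
  show ?thesis
  proof (rule pos_unique[OF gy])
    show "\<sigma> (g \<otimes>\<^bsub>G\<^esub> pos y l) (pt (first (\<sigma> g y) (w g y \<otimes> l)) (\<sigma> g y) (w g y \<otimes> l)) = \<sigma> g y"
      using assms by (simp add: pt first \<sigma>_mult pt_Y pos_eq)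
  qed (use assms w in auto)
qed

lemma pos_measurable:
  assumes l: "l \<in> carrier H"
  shows "(\<lambda>y. pos y l) \<in> measurable P (count_space UNIV)"
proof -
  have ev: "Measurable.pred P (\<lambda>y. \<sigma> (enG k) (pt n y l) = y)" for k n
  proof -
    have "(\<lambda>y. \<sigma> (enG k) (pt n y l)) \<in> measurable P P"
      unfolding pt_def using l
      by (intro measurable_compose[OF _ \<sigma>_meas] measurable_compose[OF _ shift_measurable1]) auto
    from eq_meas[OF this measurable_ident] show ?thesis
      by (simp add: pred_def)
  qed
  note ev [measurable]
  have first: "(\<lambda>y. first y l) \<in> measurable P (count_space UNIV)"
    unfolding first_def by measurable
  have "(\<lambda>y. LEAST k. \<sigma> (enG k) (pt n y l) = y) \<in> measurable P (count_space UNIV)" for n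
    by measurable
  then have "(\<lambda>y. LEAST k. \<sigma> (enG k) (pt (first y l) y l) = y) \<in> measurable P (count_space UNIV)"
    by (rule measurable_compose_countable[OF _ first])
  then show ?thesis
    unfolding pos_def by (rule measurable_compose) simp
qed

text \<open>The image of the uniform distribution on A under \<open>pos y\<close>: for every
  nonempty finite A a finitely supported probability on G. It carries weights from
  \<open>fins\<close> over to G.\<close>

definition frac :: "'l set \<Rightarrow> 'g set \<Rightarrow> ('l \<Rightarrow> 'z) \<Rightarrow> real" where
  "frac A B y = (\<Sum>l\<in>A. indicator B (pos y l)) / real (card A)"

lemma frac_nonneg: "0 \<le> frac A B y"
  by (simp add: frac_def sum_nonneg)

lemma frac_le_1: "frac A B y \<le> 1"
proof -
  have "(\<Sum>l\<in>A. indicator B (pos y l) :: real) \<le> (\<Sum>l\<in>A. 1)"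
    by (intro sum_mono) (auto simp: indicator_def)
  then show ?thesis
    by (cases "card A = 0") (auto simp: frac_def divide_le_eq)
qed

lemma frac_Un: "B \<inter> C = {} \<Longrightarrow> frac A (B \<union> C) y = frac A B y + frac A C y"
  unfolding frac_def add_divide_distrib[symmetric] sum.distrib[symmetric]
  by (intro arg_cong2[of _ _ _ _ "(/)"] sum.cong refl) (auto simp: indicator_def)

lemma frac_carrier: "A \<in> fins \<Longrightarrow> frac A (carrier G) y = 1"
  by (auto simp: frac_def fins_def)

lemma bmeas_frac: "A \<in> fins \<Longrightarrow> frac A B \<in> bmeas P"
proof (rule bmeasI[where c=1])
  assume A: "A \<in> fins"
  have "(\<lambda>y. indicator B (pos y l) :: real) \<in> borel_measurable P" if "l \<in> A" for l
    using that A by (intro measurable_compose[OF pos_measurable]) (auto simp: fins_def)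
  then show "frac A B \<in> borel_measurable P"
    unfolding frac_def by (intro borel_measurable_divide borel_measurable_sum) auto
qed (use frac_nonneg frac_le_1 in \<open>auto simp: abs_le_iff intro: order_trans[of _ 0]\<close>)

text \<open>Moving (y, A) by g multiplies every position by g on the left, by
  \<open>pos_equivariant\<close>, and translating B by g compensates for this.\<close>

lemma frac_equivariant:
  assumes "y \<in> Y" "g \<in> carrier G" "A \<in> fins" "B \<subseteq> carrier G"
  shows "frac ((\<lambda>l. w g y \<otimes> l) ` A) (g <#\<^bsub>G\<^esub> B) (\<sigma> g y) = frac A B y"
proof -
  have w: "w g y \<in> carrier H" using assms Y_space by (auto intro: w_in)
  have A: "A \<subseteq> carrier H" using assms by (auto simp: fins_def)
  have inj: "inj_on (\<lambda>l. w g y \<otimes> l) A"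
    using w A by (auto simp: inj_on_def subset_iff)
  have "(\<Sum>l\<in>(\<lambda>l. w g y \<otimes> l) ` A. indicator (g <#\<^bsub>G\<^esub> B) (pos (\<sigma> g y) l) :: real)
      = (\<Sum>l\<in>A. indicator (g <#\<^bsub>G\<^esub> B) (g \<otimes>\<^bsub>G\<^esub> pos y l))"
    using assms A by (subst sum.reindex[OF inj]) (auto intro!: sum.cong simp: pos_equivariant subset_iff)
  also have "\<dots> = (\<Sum>l\<in>A. indicator B (pos y l))"
  proof (rule sum.cong[OF refl])
    fix l assume "l \<in> A"
    have "g \<otimes>\<^bsub>G\<^esub> pos y l \<in> g <#\<^bsub>G\<^esub> B \<longleftrightarrow> pos y l \<in> B"
      using assms by (auto simp: l_coset_def subset_iff)
    then show "indicator (g <#\<^bsub>G\<^esub> B) (g \<otimes>\<^bsub>G\<^esub> pos y l) = (indicator B (pos y l) :: real)"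
      by (simp add: indicator_def)
  qed
  finally show ?thesis
    unfolding frac_def using inj by (simp add: card_image)
qed

text \<open>F composed with a skew product over s. The cocycle is evaluated at \<open>q t\<close>
  and not at u, so for fixed t the second variable is moved by a single group element and its
  weights by a single translation.\<close>

definition twist :: "('g \<Rightarrow> 't \<Rightarrow> 't) \<Rightarrow> ('t \<Rightarrow> 'l \<Rightarrow> 'z) \<Rightarrow> ('t \<times> ('l \<Rightarrow> 'z) \<Rightarrow> real) \<Rightarrow> 'g \<Rightarrow> 't \<times> ('l \<Rightarrow> 'z) \<Rightarrow> real" where
  "twist s q F g = (\<lambda>(t, u). F (s g t, shift H (w g (q t)) u))"

text \<open>If \<open>F\<close> had variance but were almost invariant, the mean over \<open>A\<close> and \<open>t\<close> of \<open>frac A B (q t)\<close>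
  with weights \<open>wt A (F t)\<close> would be an almost invariant finitely additive probability in \<open>B\<close>.\<close>

lemma spectral_gap:
  fixes T :: "'t measure"
  assumes T: "prob_space T"
    and S: "S \<subseteq> carrier G"
    and gap: "\<And>p. fa_prob G p \<Longrightarrow> \<exists>h\<in>S. \<exists>A\<subseteq>carrier G. \<kappa> \<le> \<bar>p (h <#\<^bsub>G\<^esub> A) - p A\<bar>"
    and s_meas: "\<And>g. g \<in> S \<Longrightarrow> s g \<in> measurable T T"
    and s_distr: "\<And>g. g \<in> S \<Longrightarrow> distr T T (s g) = T"
    and q_meas: "q \<in> measurable T P"
    and q_Y: "AE t in T. q t \<in> Y"
    and q_s: "\<And>g. g \<in> S \<Longrightarrow> AE t in T. q (s g t) = \<sigma> g (q t)"
    and F: "F \<in> bmeas (T \<Otimes>\<^sub>M P)"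
    and L: "finite L" "L \<subseteq> carrier H"
    and loc: "\<And>t u v. t \<in> space T \<Longrightarrow> u \<in> space P \<Longrightarrow> v \<in> space P \<Longrightarrow> (\<And>h. h \<in> L \<Longrightarrow> u h = v h)
      \<Longrightarrow> F (t, u) = F (t, v)"
    and F1: "(\<integral>t. \<integral>u. (F (t, u))\<^sup>2 \<partial>P \<partial>T) \<le> 1"
    and d: "\<And>g. g \<in> S \<Longrightarrow> (\<integral>t. \<integral>u. (twist s q F g (t, u) - F (t, u))\<^sup>2 \<partial>P \<partial>T) \<le> d"
    and c: "c > 0"
  shows "\<kappa> * (\<integral>t. (\<integral>u. (F (t, u))\<^sup>2 \<partial>P) - (\<integral>u. F (t, u) \<partial>P)\<^sup>2 \<partial>T) \<le> c + (1 + 1 / c) * d"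
proof -
  interpret T: prob_space T by fact
  let ?fs = "count_space fins"
  interpret fs: sigma_finite_measure ?fs
    by (rule sigma_finite_measure_count_space_countable[OF countable_fins])
  \<comment> \<open>For fixed t the weights of F in its second variable are spread over G by
    \<open>frac\<close>. \<open>N F\<close> averages this over t: a finitely additive measure on G
    whose total mass is at least the mean variance of F.\<close>
  define K where "K F B t = (\<integral>A. frac A B (q t) * wt A (\<lambda>u. F (t, u)) \<partial>?fs)"
    for F :: "'t \<times> ('l \<Rightarrow> 'z) \<Rightarrow> real" and B t
  define N where "N F B = (\<integral>t. K F B t \<partial>T)" for F B
  have sec: "(\<lambda>u. F (t, u)) \<in> bmeas P" if "F \<in> bmeas (T \<Otimes>\<^sub>M P)" "t \<in> space T" for F t
    using that by (rule bmeas_section)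
  have qsp: "q t \<in> space P" if "t \<in> space T" for t
    using that q_meas by (auto dest: measurable_space)
  have K_int: "integrable ?fs (\<lambda>A. frac A B (q t) * wt A (\<lambda>u. F (t, u)))"
    if "F \<in> bmeas (T \<Otimes>\<^sub>M P)" "t \<in> space T" for F B t
  proof (rule Bochner_Integration.integrable_bound[OF wt_integrable[OF sec[OF that]]])
    show "AE A in ?fs. norm (frac A B (q t) * wt A (\<lambda>u. F (t, u))) \<le> norm (wt A (\<lambda>u. F (t, u)))"
      using frac_nonneg[of _ B "q t"] frac_le_1[of _ B "q t"] 
      by (auto simp: abs_mult intro!: mult_left_le_one_le)
  qed simp
  have sqb: "\<exists>M. \<forall>t\<in>space T. (\<integral>u. (F (t, u))\<^sup>2 \<partial>P) \<le> M" if F': "F \<in> bmeas (T \<Otimes>\<^sub>M P)" for F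
  proof -
    obtain M where M: "M \<ge> 0" "\<And>x. \<bar>F x\<bar> \<le> M" using bmeasE[OF F'] by blast
    have "(\<integral>u. (F (t, u))\<^sup>2 \<partial>P) \<le> M\<^sup>2" if "t \<in> space T" for t
      using M by (intro order_trans[OF abs_ge_self P.abs_integral_le]) (auto simp: abs_le_square_iff[symmetric])
    then show ?thesis by blast
  qed
  have K_le: "\<bar>K F B t\<bar> \<le> (\<integral>u. (F (t, u))\<^sup>2 \<partial>P)" if "F \<in> bmeas (T \<Otimes>\<^sub>M P)" "t \<in> space T" for F B t
  proof -
    have nn: "0 \<le> frac A B (q t) * wt A (\<lambda>u. F (t, u))" if "A \<in> fins" for A
      using that sec[OF \<open>F \<in> _\<close> \<open>t \<in> _\<close>] by (intro mult_nonneg_nonneg frac_nonneg wt_nonneg) (auto simp: fins_def)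
    have "K F B t \<le> (\<integral>A. wt A (\<lambda>u. F (t, u)) \<partial>?fs)"
      unfolding K_def
    proof (rule integral_mono[OF K_int[OF that] wt_integrable[OF sec[OF that]]])
      fix A assume "A \<in> space ?fs"
      then show "frac A B (q t) * wt A (\<lambda>u. F (t, u)) \<le> wt A (\<lambda>u. F (t, u))"
        using sec[OF that] frac_nonneg[of A B "q t"] frac_le_1[of A B "q t"]
        by (intro mult_left_le_one_le wt_nonneg) (auto simp: fins_def)
    qed
    also have "\<dots> \<le> (\<integral>u. (F (t, u))\<^sup>2 \<partial>P)"
      by (rule integral_wt_le[OF sec[OF that]])
    moreover have "0 \<le> K F B t"
      unfolding K_def using nn by (intro integral_nonneg_AE) auto
    ultimately show ?thesis by simp
  qed
  have K_meas: "K F B \<in> borel_measurable T" if "F \<in> bmeas (T \<Otimes>\<^sub>M P)" for F B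
  proof -
    have "(\<lambda>(t, A). frac A B (q t) * wt A (\<lambda>u. F (t, u))) \<in> borel_measurable (T \<Otimes>\<^sub>M ?fs)"
    proof (rule borel_measurable_pair_countable[OF countable_fins])
      fix A assume "A \<in> fins"
      then show "(\<lambda>t. frac A B (q t) * wt A (\<lambda>u. F (t, u))) \<in> borel_measurable T"
        by (intro bmeas_measurable bmeas_mult bmeas_compose[OF bmeas_frac q_meas] bmeas_wt that)
    qed
    then show ?thesis
      unfolding K_def[abs_def] by (intro fs.borel_measurable_lebesgue_integral) simp
  qed
  have K_integrable: "integrable T (K F B)" if F: "F \<in> bmeas (T \<Otimes>\<^sub>M P)" for F B
  proof -
    obtain M where "\<forall>t\<in>space T. (\<integral>u. (F (t, u))\<^sup>2 \<partial>P) \<le> M" using sqb[OF F] by blast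
    then have "\<bar>K F B t\<bar> \<le> M" if "t \<in> space T" for t
      using K_le[OF F that, of B] that by fastforce
    then show ?thesis
      by (intro T.integrable_const_bound[where B=M] K_meas[OF F]) auto
  qed
  have N_Un: "N F (B \<union> C) = N F B + N F C" if "F \<in> bmeas (T \<Otimes>\<^sub>M P)" "B \<inter> C = {}" for F B C
  proof -
    have "K F (B \<union> C) t = K F B t + K F C t" if "t \<in> space T" for t
      unfolding K_def frac_Un[OF \<open>B \<inter> C = {}\<close>] distrib_right
      by (intro Bochner_Integration.integral_add K_int that \<open>F \<in> _\<close>)
    then have "N F (B \<union> C) = (\<integral>t. K F B t + K F C t \<partial>T)"
      unfolding N_def by (intro Bochner_Integration.integral_cong) auto
    then show ?thesis
      unfolding N_def using K_integrable that by simp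
  qed
  have N_nonneg: "0 \<le> N F B" if "F \<in> bmeas (T \<Otimes>\<^sub>M P)" for F B
    unfolding N_def K_def
    using that sec by (intro integral_nonneg_AE AE_I2 mult_nonneg_nonneg frac_nonneg wt_nonneg) (auto simp: fins_def)
  have tw: "twist s q F g \<in> bmeas (T \<Otimes>\<^sub>M P)" if "g \<in> S" for g
  proof -
    have "(\<lambda>z. w g (q (fst z))) \<in> measurable (T \<Otimes>\<^sub>M P) (count_space (carrier H))"
      using that S by (intro measurable_compose[OF _ w_meas] measurable_compose[OF measurable_fst q_meas]) auto
    then have "(\<lambda>z. (s g (fst z), shift H (w g (q (fst z))) (snd z))) \<in> measurable (T \<Otimes>\<^sub>M P) (T \<Otimes>\<^sub>M P)"
      using s_meas[OF that] by measurable
    from bmeas_compose[OF F this] show ?thesis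
      by (simp add: twist_def case_prod_beta')
  qed
  \<comment> \<open>Translating the set in G amounts to moving F: substitute \<open>s g\<close> in
    t, reindex \<open>fins\<close> by the translation by \<open>w g (q t)\<close>, and use
    equivariance of \<open>frac\<close> and of \<open>wt\<close>.\<close>
  have N_twist: "N F (g <#\<^bsub>G\<^esub> B) = N (twist s q F g) B" if g: "g \<in> S" and B: "B \<subseteq> carrier G" for g B
  proof -
    have gG: "g \<in> carrier G" using g S by auto
    have "N F (g <#\<^bsub>G\<^esub> B) = (\<integral>t. K F (g <#\<^bsub>G\<^esub> B) (s g t) \<partial>T)"
      unfolding N_def by (rule integral_mp[symmetric, OF s_meas s_distr K_meas]) (use g F in auto)
    also have "\<dots> = N (twist s q F g) B"
      unfolding N_def
    proof (rule integral_cong_AE)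
      show "(\<lambda>t. K F (g <#\<^bsub>G\<^esub> B) (s g t)) \<in> borel_measurable T"
        using K_meas[OF F] s_meas[OF g] by measurable
      show "K (twist s q F g) B \<in> borel_measurable T"
        by (rule K_meas[OF tw[OF g]])
      show "AE t in T. K F (g <#\<^bsub>G\<^esub> B) (s g t) = K (twist s q F g) B t"
        using q_Y q_s[OF g] AE_space
      proof eventually_elim
        case (elim t)
        let ?w = "w g (q t)"
        have w: "?w \<in> carrier H" using elim gG by (auto intro: w_in qsp)
        have st: "s g t \<in> space T" using elim s_meas[OF g] by (auto dest: measurable_space)
        have bij: "bij_betw (\<lambda>A. (\<lambda>l. ?w \<otimes> l) ` A) fins fins"
        proof (rule bij_betw_byWitness[where f'="\<lambda>A. (\<lambda>l. inv ?w \<otimes> l) ` A"])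
          show "\<forall>A\<in>fins. (\<lambda>l. inv ?w \<otimes> l) ` (\<lambda>l. ?w \<otimes> l) ` A = A"
            using w by (auto simp: fins_def image_image H.m_assoc[symmetric] subset_iff)
          show "\<forall>A\<in>fins. (\<lambda>l. ?w \<otimes> l) ` (\<lambda>l. inv ?w \<otimes> l) ` A = A"
            using w by (auto simp: fins_def image_image H.m_assoc[symmetric] subset_iff)
        qed (use w in \<open>auto simp: fins_def\<close>)
        have "K F (g <#\<^bsub>G\<^esub> B) (s g t) = (\<integral>A. frac ((\<lambda>l. ?w \<otimes> l) ` A) (g <#\<^bsub>G\<^esub> B) (q (s g t)) *
             wt ((\<lambda>l. ?w \<otimes> l) ` A) (\<lambda>u. F (s g t, u)) \<partial>?fs)"
          unfolding K_def by (rule integral_bij_count_space[OF bij, symmetric])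
        also have "\<dots> = K (twist s q F g) B t"
          unfolding K_def
        proof (rule Bochner_Integration.integral_cong[OF refl])
          fix A assume "A \<in> space ?fs"
          then have A: "A \<in> fins" by simp
          have "wt ((\<lambda>l. ?w \<otimes> l) ` A) (\<lambda>u. F (s g t, u)) = wt A (\<lambda>u. F (s g t, shift H ?w u))"
            using A w by (intro wt_shift sec F st) (auto simp: fins_def)
          then show "frac ((\<lambda>l. ?w \<otimes> l) ` A) (g <#\<^bsub>G\<^esub> B) (q (s g t)) * wt ((\<lambda>l. ?w \<otimes> l) ` A) (\<lambda>u. F (s g t, u))
             = frac A B (q t) * wt A (\<lambda>u. twist s q F g (t, u))"
            using frac_equivariant[OF elim(1) gG A B] elim by (simp add: twist_def)
        qed
        finally show ?case .
      qed
    qed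
    finally show ?thesis .
  qed
  \<comment> \<open>Almost invariance of F enters here: the weights of two nearby functions are
    close by \<open>wt_diff_bound\<close>, which is summed over A and integrated over t.\<close>
  have N_close: "\<bar>N (twist s q F g) B - N F B\<bar> \<le> c + (1 + 1 / c) * d" if g: "g \<in> S" for g B
  proof -
    let ?F = "twist s q F g" and ?D = "\<lambda>z. twist s q F g z - F z"
    have D: "?D \<in> bmeas (T \<Otimes>\<^sub>M P)" by (intro bmeas_diff tw g F)
    have pw: "\<bar>K ?F B t - K F B t\<bar> \<le> c * (\<integral>u. (F (t, u))\<^sup>2 \<partial>P) + (1 + 1 / c) * (\<integral>u. (?D (t, u))\<^sup>2 \<partial>P)"
      if t: "t \<in> space T" for t
    proof -
      have "K ?F B t - K F B t = (\<integral>A. frac A B (q t) * (wt A (\<lambda>u. ?F (t, u)) - wt A (\<lambda>u. F (t, u))) \<partial>?fs)"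
        unfolding K_def right_diff_distrib
        by (rule Bochner_Integration.integral_diff[symmetric]) (intro K_int tw g F t)+
      also have "\<bar>\<dots>\<bar> \<le> (\<integral>A. \<bar>frac A B (q t) * (wt A (\<lambda>u. ?F (t, u)) - wt A (\<lambda>u. F (t, u)))\<bar> \<partial>?fs)"
        using integral_norm_bound[of ?fs] by simp
      also have "\<dots> \<le> (\<integral>A. c * wt A (\<lambda>u. F (t, u)) + (1 + 1 / c) * wt A (\<lambda>u. ?D (t, u)) \<partial>?fs)"
      proof (rule integral_mono)
        show "integrable ?fs (\<lambda>A. \<bar>frac A B (q t) * (wt A (\<lambda>u. ?F (t, u)) - wt A (\<lambda>u. F (t, u)))\<bar>)"
          unfolding right_diff_distrib
          by (intro integrable_abs Bochner_Integration.integrable_diff K_int tw g F t)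
        show "integrable ?fs (\<lambda>A. c * wt A (\<lambda>u. F (t, u)) + (1 + 1 / c) * wt A (\<lambda>u. ?D (t, u)))"
          by (intro Bochner_Integration.integrable_add integrable_mult_right wt_integrable sec F D t)
        fix A assume "A \<in> space ?fs"
        then have A: "finite A" by (simp add: fins_def)
        have "\<bar>frac A B (q t) * (wt A (\<lambda>u. ?F (t, u)) - wt A (\<lambda>u. F (t, u)))\<bar>
            \<le> \<bar>wt A (\<lambda>u. ?F (t, u)) - wt A (\<lambda>u. F (t, u))\<bar>"
          using frac_nonneg[of A B "q t"] frac_le_1[of A B "q t"] by (auto simp: abs_mult intro!: mult_left_le_one_le)
        also have "\<dots> \<le> c * wt A (\<lambda>u. F (t, u)) + (1 + 1 / c) * wt A (\<lambda>u. ?D (t, u))"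
          by (rule wt_diff_bound) (intro A sec tw g F t c)+
        finally show "\<bar>frac A B (q t) * (wt A (\<lambda>u. ?F (t, u)) - wt A (\<lambda>u. F (t, u)))\<bar>
          \<le> c * wt A (\<lambda>u. F (t, u)) + (1 + 1 / c) * wt A (\<lambda>u. ?D (t, u))" .
      qed
      also have "\<dots> = c * (\<integral>A. wt A (\<lambda>u. F (t, u)) \<partial>?fs) + (1 + 1 / c) * (\<integral>A. wt A (\<lambda>u. ?D (t, u)) \<partial>?fs)"
        by (subst Bochner_Integration.integral_add) (auto intro!: integrable_mult_right wt_integrable sec F D t)
      also have "\<dots> \<le> c * (\<integral>u. (F (t, u))\<^sup>2 \<partial>P) + (1 + 1 / c) * (\<integral>u. (?D (t, u))\<^sup>2 \<partial>P)"
        using c by (intro add_mono mult_left_mono integral_wt_le sec F D t) auto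
      finally show ?thesis .
    qed
    have sqi: "integrable T (\<lambda>t. \<integral>u. (E (t, u))\<^sup>2 \<partial>P)" if "E \<in> bmeas (T \<Otimes>\<^sub>M P)" for E
      using that by (intro T.integrable_bmeas P.bmeas_integral bmeas_power2)
    have "\<bar>N ?F B - N F B\<bar> = \<bar>\<integral>t. K ?F B t - K F B t \<partial>T\<bar>"
      unfolding N_def using K_integrable[OF tw[OF g]] K_integrable[OF F] by simp
    also have "\<dots> \<le> (\<integral>t. \<bar>K ?F B t - K F B t\<bar> \<partial>T)"
      using integral_norm_bound[of T] by simp
    also have "\<dots> \<le> (\<integral>t. c * (\<integral>u. (F (t, u))\<^sup>2 \<partial>P) + (1 + 1 / c) * (\<integral>u. (?D (t, u))\<^sup>2 \<partial>P) \<partial>T)"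
      by (rule integral_mono)
        (intro integrable_abs Bochner_Integration.integrable_diff Bochner_Integration.integrable_add
          integrable_mult_right K_integrable tw g F sqi D pw | assumption)+
    also have "\<dots> = c * (\<integral>t. \<integral>u. (F (t, u))\<^sup>2 \<partial>P \<partial>T) + (1 + 1 / c) * (\<integral>t. \<integral>u. (?D (t, u))\<^sup>2 \<partial>P \<partial>T)"
      by (subst Bochner_Integration.integral_add) (auto intro!: integrable_mult_right sqi F D)
    also have "\<dots> \<le> c * 1 + (1 + 1 / c) * d"
      using c F1 d[OF g] by (intro add_mono mult_left_mono) auto
    finally show ?thesis by simp
  qed
  define V where "V = (\<integral>t. (\<integral>u. (F (t, u))\<^sup>2 \<partial>P) - (\<integral>u. F (t, u) \<partial>P)\<^sup>2 \<partial>T)"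
  have V_le: "V \<le> N F (carrier G)"
    unfolding V_def N_def
  proof (rule integral_mono[OF _ K_integrable[OF F]])
    show "integrable T (\<lambda>t. (\<integral>u. (F (t, u))\<^sup>2 \<partial>P) - (\<integral>u. F (t, u) \<partial>P)\<^sup>2)"
      by (intro T.integrable_bmeas bmeas_diff bmeas_power2 P.bmeas_integral F bmeas_power2)
    fix t assume t: "t \<in> space T"
    have "K F (carrier G) t = (\<integral>A. wt A (\<lambda>u. F (t, u)) \<partial>?fs)"
      unfolding K_def by (intro Bochner_Integration.integral_cong) (auto simp: frac_carrier)
    moreover have "(\<integral>u. (F (t, u))\<^sup>2 \<partial>P) - (\<integral>u. F (t, u) \<partial>P)\<^sup>2 \<le> (\<integral>A. wt A (\<lambda>u. F (t, u)) \<partial>?fs)"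
      by (rule integral_wt_ge[OF sec[OF F t] L]) (auto intro: loc[OF t])
    ultimately show "(\<integral>u. (F (t, u))\<^sup>2 \<partial>P) - (\<integral>u. F (t, u) \<partial>P)\<^sup>2 \<le> K F (carrier G) t"
      by simp
  qed
  show ?thesis
  proof (cases "\<kappa> \<le> 0 \<or> N F (carrier G) \<le> 0")
    \<comment> \<open>\<open>N F\<close> cannot be normalised here, or \<kappa> is not positive; in
      both cases the left side is at most 0. That the right side is nonnegative needs an element of
      S, which \<open>gap\<close> supplies when tested on the point mass at the identity.\<close>
    case True
    have V_nn: "0 \<le> V"
      unfolding V_def using P.power2_integral_le[OF sec[OF F]] by (intro integral_nonneg_AE) auto
    have "S \<noteq> {}"
    proof -
      obtain p where "fa_prob G p"
      proof -
        have "fa_prob G (\<lambda>A. indicator A \<one>\<^bsub>G\<^esub>)"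
          by (auto simp: fa_prob_def indicator_def)
        then show thesis by (rule that)
      qed
      from gap[OF this] show ?thesis by auto
    qed
    then obtain g where "g \<in> S" by auto
    from N_close[OF this] have "0 \<le> c + (1 + 1 / c) * d"
      using abs_ge_zero order_trans by blast
    moreover have "\<kappa> * V \<le> 0"
      using True V_nn V_le by (auto simp: mult_le_0_iff)
    ultimately show ?thesis unfolding V_def by simp
  next
    case False
    then have pos: "\<kappa> > 0" "N F (carrier G) > 0" by auto
    define p where "p B = N F B / N F (carrier G)" for B
    have "fa_prob G p"
      using pos N_nonneg[OF F] N_Un[OF F] by (auto simp: fa_prob_def p_def add_divide_distrib)
    from gap[OF this] obtain h B where hB: "h \<in> S" "B \<subseteq> carrier G" "\<kappa> \<le> \<bar>p (h <#\<^bsub>G\<^esub> B) - p B\<bar>" by blast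
    have "\<bar>p (h <#\<^bsub>G\<^esub> B) - p B\<bar> * N F (carrier G) = \<bar>N (twist s q F h) B - N F B\<bar>"
      using pos hB by (simp add: p_def N_twist diff_divide_distrib[symmetric] abs_divide)
    also have "\<dots> \<le> c + (1 + 1 / c) * d"
      by (rule N_close[OF hB(1)])
    finally have "\<kappa> * N F (carrier G) \<le> c + (1 + 1 / c) * d"
      using hB pos by (meson mult_right_mono order_trans less_imp_le)
    moreover have "\<kappa> * V \<le> \<kappa> * N F (carrier G)"
      using pos V_le by (intro mult_left_mono) auto
    ultimately show ?thesis unfolding V_def by linarith
  qed
qed

end

subsection \<open>Resampling test functions\<close>

lemma sq_sum3: "(a + b + c)\<^sup>2 \<le> 3 * (a\<^sup>2 + b\<^sup>2 + c\<^sup>2)" for a b c :: real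
proof -
  have "0 \<le> (a - b)\<^sup>2 + (b - c)\<^sup>2 + (a - c)\<^sup>2" by simp
  then show ?thesis by (simp add: power2_eq_square algebra_simps)
qed

lemma sq_diff_le: "(a - b)\<^sup>2 \<le> 2 * a\<^sup>2 + 2 * b\<^sup>2" for a b :: real
proof -
  have "0 \<le> (a + b)\<^sup>2" by simp
  then show ?thesis by (simp add: power2_eq_square algebra_simps)
qed

lemma AE_mp_map:
  assumes "T \<in> measurable M N" "distr M N T = N" "AE x in N. Q x"
  shows "AE x in M. Q (T x)"
  by (rule AE_distrD[OF assms(1)]) (subst assms(2), rule assms(3))

lemma AE_pair_fst: "prob_space N \<Longrightarrow> AE x in M. Q x \<Longrightarrow> AE z in M \<Otimes>\<^sub>M N. Q (fst z)"
  by (rule AE_mp_map[OF measurable_fst prob_space.distr_pair_fst])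

text \<open>f is a family of unit vectors of L^2(X) indexed by y. The norm is prescribed for each y
  separately, so that substituting any other point for y, however it was resampled, preserves it.
  \<open>L\<close> is finite, but no estimate depends on its size.\<close>

locale test_fun = orbit_sub H Z G \<sigma> w Y
  for H :: "'l monoid" (structure) and Z :: "'z measure" and G :: "'g monoid" and \<sigma> w Y +
  fixes X :: "'x measure" and \<alpha> :: "'g \<Rightarrow> 'x \<Rightarrow> 'x" and S :: "'g set" and \<kappa> :: real
    and f :: "'x \<times> ('l \<Rightarrow> 'z) \<Rightarrow> real" and L :: "'l set" and \<delta> :: real
  assumes prob_X: "prob_space X"
    and \<alpha>_meas: "\<And>g. g \<in> carrier G \<Longrightarrow> \<alpha> g \<in> measurable X X"
    and \<alpha>_distr: "\<And>g. g \<in> carrier G \<Longrightarrow> distr X X (\<alpha> g) = X"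
    and S: "S \<subseteq> carrier G"
    and gap: "\<And>p. fa_prob G p \<Longrightarrow> \<exists>h\<in>S. \<exists>A\<subseteq>carrier G. \<kappa> \<le> \<bar>p (h <#\<^bsub>G\<^esub> A) - p A\<bar>"
    and f: "f \<in> bmeas (X \<Otimes>\<^sub>M P)" and f_nonneg: "\<And>z. 0 \<le> f z"
    and f_norm: "\<And>y. y \<in> space P \<Longrightarrow> (\<integral>x. (f (x, y))\<^sup>2 \<partial>X) = 1"
    and L: "finite L" "L \<subseteq> carrier H"
    and f_loc: "\<And>x y y'. y \<in> space P \<Longrightarrow> y' \<in> space P \<Longrightarrow> (\<And>h. h \<in> L \<Longrightarrow> y h = y' h) \<Longrightarrow> f (x, y) = f (x, y')"
    and f_inv: "\<And>g. g \<in> S \<Longrightarrow> (\<integral>y. \<integral>x. (f (\<alpha> g x, \<sigma> g y) - f (x, y))\<^sup>2 \<partial>X \<partial>P) \<le> \<delta>"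
begin

sublocale X: prob_space X by (rule prob_X)

lemma f_sec: "x \<in> space X \<Longrightarrow> (\<lambda>y. f (x, y)) \<in> bmeas P"
  using f by (rule bmeas_section)

lemma f_comp: "a \<in> measurable M X \<Longrightarrow> b \<in> measurable M P \<Longrightarrow> (\<lambda>z. f (a z, b z)) \<in> bmeas M"
  by (intro bmeas_compose[OF f] measurable_Pair)

lemma int_\<alpha>: "g \<in> carrier G \<Longrightarrow> F \<in> borel_measurable X \<Longrightarrow> (\<integral>x. F (\<alpha> g x) \<partial>X) = (\<integral>x. F x \<partial>X :: real)"
  by (rule integral_mp[OF \<alpha>_meas \<alpha>_distr])

lemma f_norm_\<alpha>:
  assumes "g \<in> carrier G" "y \<in> space P"
  shows "(\<integral>x. (f (\<alpha> g x, y))\<^sup>2 \<partial>X) = 1"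
proof -
  have "(\<lambda>x. (f (x, y))\<^sup>2) \<in> bmeas X"
    using assms by (intro bmeas_power2 f_comp) auto
  then show ?thesis
    using int_\<alpha>[OF assms(1), of "\<lambda>x. (f (x, y))\<^sup>2"] f_norm[OF assms(2)] by (simp add: bmeas_measurable)
qed

text \<open>Common form of both uses of the spectral gap. A base point b carries what is kept, u is
  fresh, and \<open>R (b, u)\<close> is the resampled point. \<open>Rg g\<close> is a variant of it,
  distributed like P, which \<sigma> g sends to the resampled point of the moved data outside a bad
  event \<open>E g\<close>. The three errors on the right come from the bad event, from the defect
  of f itself, and from passing from \<open>Rg g\<close> to \<open>R\<close>.\<close>

lemma resample_gap:
  fixes B :: "'b measure"
  assumes B: "prob_space B"
    and s_meas: "\<And>g. g \<in> S \<Longrightarrow> s g \<in> measurable B B"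
    and s_distr: "\<And>g. g \<in> S \<Longrightarrow> distr B B (s g) = B"
    and q_meas: "q \<in> measurable B P"
    and q_Y: "AE b in B. q b \<in> Y"
    and q_s: "\<And>g. g \<in> S \<Longrightarrow> AE b in B. q (s g b) = \<sigma> g (q b)"
    and R_meas: "R \<in> measurable (B \<Otimes>\<^sub>M P) P"
    and R_loc: "\<And>b u v h. u \<in> space P \<Longrightarrow> v \<in> space P \<Longrightarrow> h \<in> L \<Longrightarrow> u h = v h \<Longrightarrow> R (b, u) h = R (b, v) h"
    and Rg_meas: "\<And>g. g \<in> S \<Longrightarrow> Rg g \<in> measurable (B \<Otimes>\<^sub>M P) P"
    and Rg_distr: "\<And>g. g \<in> S \<Longrightarrow> distr (B \<Otimes>\<^sub>M P) P (Rg g) = P"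
    and E: "\<And>g. g \<in> S \<Longrightarrow> E g \<in> sets (B \<Otimes>\<^sub>M P)" "\<And>g. g \<in> S \<Longrightarrow> measure (B \<Otimes>\<^sub>M P) (E g) \<le> \<rho>"
    and good: "\<And>g. g \<in> S \<Longrightarrow> AE z in B \<Otimes>\<^sub>M P. z \<notin> E g \<longrightarrow>
        R (s g (fst z), shift H (w g (q (fst z))) (snd z)) = \<sigma> g (Rg g z)"
    and close: "\<And>g. g \<in> S \<Longrightarrow> (\<integral>z. \<integral>x. (f (x, Rg g z) - f (x, R z))\<^sup>2 \<partial>X \<partial>(B \<Otimes>\<^sub>M P)) \<le> \<rho>'"
    and c: "c > 0"
  shows "\<kappa> * (1 - (\<integral>b. \<integral>x. (\<integral>u. f (x, R (b, u)) \<partial>P)\<^sup>2 \<partial>X \<partial>B)) \<le> c + (1 + 1 / c) * (3 * (4 * \<rho> + \<delta> + \<rho>'))"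
proof -
  interpret B: prob_space B by fact
  interpret BP: pair_prob_space B P ..
  interpret BX: pair_prob_space B X ..
  interpret BPX: pair_prob_space "B \<Otimes>\<^sub>M P" X ..
  define F where "F z = f (snd (fst z), R (fst (fst z), snd z))" for z :: "('b \<times> 'x) \<times> ('l \<Rightarrow> 'z)"
  note [measurable] = R_meas q_meas
  have F: "F \<in> bmeas ((B \<Otimes>\<^sub>M X) \<Otimes>\<^sub>M P)"
    unfolding F_def[abs_def] by (intro f_comp) measurable
  \<comment> \<open>x is carried along as part of the base and moved by \<alpha>, so that the
    variance concerns u alone.\<close>
  define s' where "s' g = (\<lambda>(b, x). (s g b, \<alpha> g x))" for g
  have s'_meas: "s' g \<in> measurable (B \<Otimes>\<^sub>M X) (B \<Otimes>\<^sub>M X)" if "g \<in> S" for g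
  proof -
    have [measurable]: "s g \<in> measurable B B" "\<alpha> g \<in> measurable X X"
      using s_meas \<alpha>_meas that S by auto
    show ?thesis unfolding s'_def case_prod_beta by measurable
  qed
  have s'_distr: "distr (B \<Otimes>\<^sub>M X) (B \<Otimes>\<^sub>M X) (s' g) = B \<Otimes>\<^sub>M X" if "g \<in> S" for g
  proof -
    have "distr B B (s g) \<Otimes>\<^sub>M distr X X (\<alpha> g) = distr (B \<Otimes>\<^sub>M X) (B \<Otimes>\<^sub>M X) (s' g)"
      unfolding s'_def
    proof (rule pair_measure_distr)
      have "distr X X (\<alpha> g) = X" using that S \<alpha>_distr by auto
      then show "sigma_finite_measure (distr X X (\<alpha> g))"
        by (simp add: X.sigma_finite_measure_axioms)
    qed (use that S s_meas \<alpha>_meas in auto)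
    then show ?thesis using that S s_distr \<alpha>_distr by auto
  qed
  \<comment> \<open>The integral over x is brought to the inside, because the norm of f is known for
    fixed y.\<close>
  have reorder: "(\<integral>t. \<integral>u. A (t, u) \<partial>P \<partial>(B \<Otimes>\<^sub>M X)) = (\<integral>z. \<integral>x. A ((fst z, x), snd z) \<partial>X \<partial>(B \<Otimes>\<^sub>M P))"
    if A: "A \<in> bmeas ((B \<Otimes>\<^sub>M X) \<Otimes>\<^sub>M P)" for A
  proof -
    have A1: "(\<lambda>z. A ((fst z, fst (snd z)), snd (snd z))) \<in> bmeas (B \<Otimes>\<^sub>M (X \<Otimes>\<^sub>M P))"
      by (rule bmeas_compose[OF A]) measurable
    have A2: "(\<lambda>z. A ((fst (fst z), snd z), snd (fst z))) \<in> bmeas ((B \<Otimes>\<^sub>M P) \<Otimes>\<^sub>M X)"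
      by (rule bmeas_compose[OF A]) measurable
    have "(\<integral>t. \<integral>u. A (t, u) \<partial>P \<partial>(B \<Otimes>\<^sub>M X)) = (\<integral>b. \<integral>x. \<integral>u. A ((b, x), u) \<partial>P \<partial>X \<partial>B)"
      by (rule int_pair[OF B prob_X P.bmeas_integral[OF A]])
    also have "\<dots> = (\<integral>b. \<integral>u. \<integral>x. A ((b, x), u) \<partial>X \<partial>P \<partial>B)"
      using int_swap[OF prob_X P.prob_space_axioms bmeas_section[OF A1]]
      by (intro Bochner_Integration.integral_cong) auto
    also have "\<dots> = (\<integral>z. \<integral>x. A ((fst z, x), snd z) \<partial>X \<partial>(B \<Otimes>\<^sub>M P))"
      using int_pair[OF B P.prob_space_axioms X.bmeas_integral[OF A2]] by simp
    finally show ?thesis .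
  qed
  have Rsp: "R z \<in> space P" if "z \<in> space (B \<Otimes>\<^sub>M P)" for z
    using that by (rule measurable_space[OF R_meas])
  have normF: "(\<integral>t. \<integral>u. (F (t, u))\<^sup>2 \<partial>P \<partial>(B \<Otimes>\<^sub>M X)) = 1"
  proof -
    have "(\<integral>t. \<integral>u. (F (t, u))\<^sup>2 \<partial>P \<partial>(B \<Otimes>\<^sub>M X)) = (\<integral>z. \<integral>x. (f (x, R z))\<^sup>2 \<partial>X \<partial>(B \<Otimes>\<^sub>M P))"
      using reorder[OF bmeas_power2[OF F]] by (simp add: F_def)
    also have "\<dots> = (\<integral>z. 1 \<partial>(B \<Otimes>\<^sub>M P))"
      using Rsp by (intro Bochner_Integration.integral_cong) (auto simp: f_norm)
    finally show ?thesis by (simp add: BP.prob_space)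
  qed
  have defect: "(\<integral>t. \<integral>u. (twist s' (q \<circ> fst) F g (t, u) - F (t, u))\<^sup>2 \<partial>P \<partial>(B \<Otimes>\<^sub>M X)) \<le> 3 * (4 * \<rho> + \<delta> + \<rho>')"
    if g: "g \<in> S" for g
  proof -
    have gG: "g \<in> carrier G" using g S by auto
    note [measurable] = \<alpha>_meas[OF gG] s_meas[OF g] \<sigma>_meas[OF gG] Rg_meas[OF g]
    have wm [measurable]: "(\<lambda>z. w g (q (h z))) \<in> measurable M (count_space (carrier H))"
      if [measurable]: "h \<in> measurable M B" for h and M :: "'c measure"
      by (intro measurable_compose[OF _ w_meas[OF gG]]) measurable
    define N where "N z = R (s g (fst z), shift H (w g (q (fst z))) (snd z))" for z
    have wm1: "(\<lambda>z. w g (q (fst z))) \<in> measurable (B \<Otimes>\<^sub>M P) (count_space (carrier H))"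
      by (rule wm) measurable
    have N [measurable]: "N \<in> measurable (B \<Otimes>\<^sub>M P) P"
      unfolding N_def using wm1 by measurable
    \<comment> \<open>The sum of the three terms is the defect of F. a1 vanishes almost everywhere
      off the bad event, a2 is the defect of f at the point \<open>Rg g\<close>, and a3 compares
      \<open>Rg g\<close> with \<open>R\<close>. Squaring a sum of three terms costs the factor
      3.\<close>
    define a1 where "a1 z = (f (\<alpha> g (snd z), N (fst z)) - f (\<alpha> g (snd z), \<sigma> g (Rg g (fst z))))" for z
    define a2 where "a2 z = (f (\<alpha> g (snd z), \<sigma> g (Rg g (fst z))) - f (snd z, Rg g (fst z)))" for z
    define a3 where "a3 z = (f (snd z, Rg g (fst z)) - f (snd z, R (fst z)))" for z
    have a: "a1 \<in> bmeas ((B \<Otimes>\<^sub>M P) \<Otimes>\<^sub>M X)" "a2 \<in> bmeas ((B \<Otimes>\<^sub>M P) \<Otimes>\<^sub>M X)" "a3 \<in> bmeas ((B \<Otimes>\<^sub>M P) \<Otimes>\<^sub>M X)"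
      unfolding a1_def[abs_def] a2_def[abs_def] a3_def[abs_def] by (intro bmeas_diff f_comp; measurable)+
    have ai: "(\<lambda>z. \<integral>x. (A (z, x))\<^sup>2 \<partial>X) \<in> bmeas (B \<Otimes>\<^sub>M P)" if "A \<in> bmeas ((B \<Otimes>\<^sub>M P) \<Otimes>\<^sub>M X)" for A
      by (intro X.bmeas_integral bmeas_power2 that)
    have tw: "(\<lambda>z. (twist s' (q \<circ> fst) F g z - F z)\<^sup>2) \<in> bmeas ((B \<Otimes>\<^sub>M X) \<Otimes>\<^sub>M P)"
    proof -
      have wm2: "(\<lambda>z. w g (q (fst (fst z)))) \<in> measurable ((B \<Otimes>\<^sub>M X) \<Otimes>\<^sub>M P) (count_space (carrier H))"
        by (rule wm) measurable
      have "(\<lambda>z. f (\<alpha> g (snd (fst z)), R (s g (fst (fst z)), shift H (w g (q (fst (fst z)))) (snd z)))) \<in> bmeas ((B \<Otimes>\<^sub>M X) \<Otimes>\<^sub>M P)"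
        using wm2 by (intro f_comp) measurable
      then show ?thesis
        by (intro bmeas_power2 bmeas_diff F) (simp add: twist_def F_def s'_def case_prod_beta')
    qed
    have "(\<integral>t. \<integral>u. (twist s' (q \<circ> fst) F g (t, u) - F (t, u))\<^sup>2 \<partial>P \<partial>(B \<Otimes>\<^sub>M X))
      = (\<integral>z. \<integral>x. (a1 (z, x) + a2 (z, x) + a3 (z, x))\<^sup>2 \<partial>X \<partial>(B \<Otimes>\<^sub>M P))"
      using reorder[OF tw] by (simp add: twist_def F_def s'_def a1_def a2_def a3_def N_def)
    also have "\<dots> \<le> (\<integral>z. 3 * ((\<integral>x. (a1 (z, x))\<^sup>2 \<partial>X) + (\<integral>x. (a2 (z, x))\<^sup>2 \<partial>X) + (\<integral>x. (a3 (z, x))\<^sup>2 \<partial>X)) \<partial>(B \<Otimes>\<^sub>M P))"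
    proof (rule integral_mono)
      show "integrable (B \<Otimes>\<^sub>M P) (\<lambda>z. \<integral>x. (a1 (z, x) + a2 (z, x) + a3 (z, x))\<^sup>2 \<partial>X)"
        by (intro BP.integrable_bmeas X.bmeas_integral bmeas_power2 bmeas_add a)
      show "integrable (B \<Otimes>\<^sub>M P) (\<lambda>z. 3 * ((\<integral>x. (a1 (z, x))\<^sup>2 \<partial>X) + (\<integral>x. (a2 (z, x))\<^sup>2 \<partial>X) + (\<integral>x. (a3 (z, x))\<^sup>2 \<partial>X)))"
        by (intro BP.integrable_bmeas bmeas_scale bmeas_add ai a)
      fix z assume z: "z \<in> space (B \<Otimes>\<^sub>M P)"
      have i: "integrable X (\<lambda>x. (A (z, x))\<^sup>2)" if "A \<in> bmeas ((B \<Otimes>\<^sub>M P) \<Otimes>\<^sub>M X)" for A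
        by (intro X.integrable_bmeas bmeas_power2 bmeas_section[OF that z])
      have "(\<integral>x. (a1 (z, x) + a2 (z, x) + a3 (z, x))\<^sup>2 \<partial>X) \<le> (\<integral>x. 3 * ((a1 (z, x))\<^sup>2 + (a2 (z, x))\<^sup>2 + (a3 (z, x))\<^sup>2) \<partial>X)"
        using i[OF bmeas_add[OF bmeas_add[OF a(1,2)] a(3)]]
        by (intro integral_mono sq_sum3 integrable_mult_right Bochner_Integration.integrable_add i[OF a(1)] i[OF a(2)] i[OF a(3)])
      also have "\<dots> = 3 * ((\<integral>x. (a1 (z, x))\<^sup>2 \<partial>X) + (\<integral>x. (a2 (z, x))\<^sup>2 \<partial>X) + (\<integral>x. (a3 (z, x))\<^sup>2 \<partial>X))"
        using i[OF a(1)] i[OF a(2)] i[OF a(3)] by simp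
      finally show "(\<integral>x. (a1 (z, x) + a2 (z, x) + a3 (z, x))\<^sup>2 \<partial>X) \<le> \<dots>" .
    qed
    also have "\<dots> = 3 * ((\<integral>z. \<integral>x. (a1 (z, x))\<^sup>2 \<partial>X \<partial>(B \<Otimes>\<^sub>M P)) + (\<integral>z. \<integral>x. (a2 (z, x))\<^sup>2 \<partial>X \<partial>(B \<Otimes>\<^sub>M P))
        + (\<integral>z. \<integral>x. (a3 (z, x))\<^sup>2 \<partial>X \<partial>(B \<Otimes>\<^sub>M P)))"
      using BP.integrable_bmeas[OF ai[OF a(1)]] BP.integrable_bmeas[OF ai[OF a(2)]] BP.integrable_bmeas[OF ai[OF a(3)]]
      by simp
    also have "\<dots> \<le> 3 * (4 * \<rho> + \<delta> + \<rho>')"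
    proof (intro mult_left_mono add_mono)
      show "(\<integral>z. \<integral>x. (a3 (z, x))\<^sup>2 \<partial>X \<partial>(B \<Otimes>\<^sub>M P)) \<le> \<rho>'"
        using close[OF g] by (simp add: a3_def)
      have "(\<lambda>z. (f (\<alpha> g (snd z), \<sigma> g (fst z)) - f (snd z, fst z))\<^sup>2) \<in> bmeas (P \<Otimes>\<^sub>M X)"
        by (intro bmeas_power2 bmeas_diff f_comp) measurable
      from X.bmeas_integral[OF this]
      have m: "(\<lambda>y. \<integral>x. (f (\<alpha> g x, \<sigma> g y) - f (x, y))\<^sup>2 \<partial>X) \<in> borel_measurable P"
        by (simp add: bmeas_measurable)
      have "(\<integral>z. \<integral>x. (a2 (z, x))\<^sup>2 \<partial>X \<partial>(B \<Otimes>\<^sub>M P)) = (\<integral>y. \<integral>x. (f (\<alpha> g x, \<sigma> g y) - f (x, y))\<^sup>2 \<partial>X \<partial>P)"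
        using integral_mp[OF Rg_meas[OF g] Rg_distr[OF g] m] by (simp add: a2_def)
      then show "(\<integral>z. \<integral>x. (a2 (z, x))\<^sup>2 \<partial>X \<partial>(B \<Otimes>\<^sub>M P)) \<le> \<delta>"
        using f_inv[OF g] by simp
      have "(\<integral>z. \<integral>x. (a1 (z, x))\<^sup>2 \<partial>X \<partial>(B \<Otimes>\<^sub>M P)) \<le> (\<integral>z. 4 * indicator (E g) z \<partial>(B \<Otimes>\<^sub>M P))"
      proof (rule integral_mono_AE)
        show "integrable (B \<Otimes>\<^sub>M P) (\<lambda>z. \<integral>x. (a1 (z, x))\<^sup>2 \<partial>X)"
          by (intro BP.integrable_bmeas ai a)
        show "integrable (B \<Otimes>\<^sub>M P) (\<lambda>z. 4 * indicator (E g) z :: real)"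
          by (intro BP.integrable_bmeas bmeas_scale bmeas_indicator E g)
        show "AE z in B \<Otimes>\<^sub>M P. (\<integral>x. (a1 (z, x))\<^sup>2 \<partial>X) \<le> 4 * indicator (E g) z"
          using good[OF g] AE_space
        proof eventually_elim
          case (elim z)
          show ?case
          proof (cases "z \<in> E g")
            case False
            then have "N z = \<sigma> g (Rg g z)" using elim by (simp add: N_def)
            then show ?thesis using False by (simp add: a1_def)
          next
            case True
            have sp: "N z \<in> space P" "\<sigma> g (Rg g z) \<in> space P"
              using elim measurable_space[OF N] measurable_space[OF \<sigma>_meas[OF gG] measurable_space[OF Rg_meas[OF g]]] by auto
            have i: "integrable X (\<lambda>x. (f (\<alpha> g x, y))\<^sup>2)" if "y \<in> space P" for y
              using that by (intro X.integrable_bmeas bmeas_power2 f_comp) auto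
            \<comment> \<open>On the bad event only the norms are known: two unit vectors have
              squared distance at most 4.\<close>
            have "(\<integral>x. (a1 (z, x))\<^sup>2 \<partial>X) \<le> (\<integral>x. 2 * (f (\<alpha> g x, N z))\<^sup>2 + 2 * (f (\<alpha> g x, \<sigma> g (Rg g z)))\<^sup>2 \<partial>X)"
            proof (rule integral_mono)
              show "integrable X (\<lambda>x. (a1 (z, x))\<^sup>2)"
                by (intro X.integrable_bmeas bmeas_power2 bmeas_section[OF a(1)] elim)
            qed (use sp in \<open>auto simp: a1_def intro!: i sq_diff_le\<close>)
            also have "\<dots> = 4"
              using i[OF sp(1)] i[OF sp(2)] f_norm_\<alpha>[OF gG sp(1)] f_norm_\<alpha>[OF gG sp(2)] by simp
            finally show ?thesis using True by simp
          qed
        qed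
      qed
      also have "\<dots> \<le> 4 * \<rho>"
        using E[OF g] by simp
      finally show "(\<integral>z. \<integral>x. (a1 (z, x))\<^sup>2 \<partial>X \<partial>(B \<Otimes>\<^sub>M P)) \<le> 4 * \<rho>" .
    qed simp
    finally show ?thesis .
  qed
  have V: "(\<integral>t. (\<integral>u. (F (t, u))\<^sup>2 \<partial>P) - (\<integral>u. F (t, u) \<partial>P)\<^sup>2 \<partial>(B \<Otimes>\<^sub>M X))
     = 1 - (\<integral>b. \<integral>x. (\<integral>u. f (x, R (b, u)) \<partial>P)\<^sup>2 \<partial>X \<partial>B)"
  proof -
    have "(\<integral>t. (\<integral>u. (F (t, u))\<^sup>2 \<partial>P) - (\<integral>u. F (t, u) \<partial>P)\<^sup>2 \<partial>(B \<Otimes>\<^sub>M X))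
      = (\<integral>t. \<integral>u. (F (t, u))\<^sup>2 \<partial>P \<partial>(B \<Otimes>\<^sub>M X)) - (\<integral>t. (\<integral>u. F (t, u) \<partial>P)\<^sup>2 \<partial>(B \<Otimes>\<^sub>M X))"
      by (intro Bochner_Integration.integral_diff BX.integrable_bmeas P.bmeas_integral bmeas_power2 F)
    also have "(\<integral>t. (\<integral>u. F (t, u) \<partial>P)\<^sup>2 \<partial>(B \<Otimes>\<^sub>M X)) = (\<integral>b. \<integral>x. (\<integral>u. f (x, R (b, u)) \<partial>P)\<^sup>2 \<partial>X \<partial>B)"
      using int_pair[OF B prob_X bmeas_power2[OF P.bmeas_integral[OF F]]] by (simp add: F_def)
    finally show ?thesis by (simp add: normF)
  qed
  have AE_pair: "AE t in B \<Otimes>\<^sub>M X. Q (fst t)" if "AE b in B. Q b" for Q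
    using AE_pair_fst[OF prob_X that] .
  show ?thesis
    unfolding V[symmetric]
  proof (rule spectral_gap[where T="B \<Otimes>\<^sub>M X" and s=s' and q="q \<circ> fst" and L=L and S=S])
    show "prob_space (B \<Otimes>\<^sub>M X)" by (rule BX.prob_space_axioms)
    show "AE t in B \<Otimes>\<^sub>M X. (q \<circ> fst) t \<in> Y"
      using AE_pair[OF q_Y] by simp
    show "AE t in B \<Otimes>\<^sub>M X. (q \<circ> fst) (s' g t) = \<sigma> g ((q \<circ> fst) t)" if "g \<in> S" for g
      using AE_pair[OF q_s[OF that]] by (simp add: s'_def case_prod_beta)
    show "q \<circ> fst \<in> measurable (B \<Otimes>\<^sub>M X) P" by measurable
    fix t u v assume *: "t \<in> space (B \<Otimes>\<^sub>M X)" "u \<in> space P" "v \<in> space P" "\<And>h. h \<in> L \<Longrightarrow> u h = v h"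
    have "f (snd t, R (fst t, u)) = f (snd t, R (fst t, v))"
    proof (rule f_loc)
      show "R (fst t, u) \<in> space P" "R (fst t, v) \<in> space P"
        using * by (auto intro!: Rsp simp: space_pair_measure)
      show "R (fst t, u) h = R (fst t, v) h" if "h \<in> L" for h
        using R_loc[OF *(2,3) that *(4)[OF that]] .
    qed
    then show "F (t, u) = F (t, v)"
      by (simp add: F_def)
  qed (use S gap s'_meas s'_distr F L normF defect c in auto)
qed

end

subsection \<open>Joint laws\<close>

lemma distr_eqI:
  assumes "prob_space M" "prob_space N" "T \<in> measurable M N"
    and eq: "\<And>A. A \<in> sets N \<Longrightarrow> (\<integral>x. indicator A (T x) \<partial>M) = (\<integral>x. indicator A x \<partial>N :: real)"
  shows "distr M N T = N"
proof (rule measure_eqI)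
  interpret M: prob_space M by fact
  interpret N: prob_space N by fact
  fix A assume "A \<in> sets (distr M N T)"
  then have A: "A \<in> sets N" by simp
  have "measure M (T -` A \<inter> space M) = (\<integral>x. indicator (T -` A \<inter> space M) x \<partial>M)"
    using A assms(3) by simp
  also have "\<dots> = (\<integral>x. indicator A (T x) \<partial>M)"
    by (intro Bochner_Integration.integral_cong) (auto simp: indicator_def)
  also have "\<dots> = measure N A"
    using A by (simp add: eq)
  finally show "emeasure (distr M N T) A = emeasure N A"
    using A assms(3) by (simp add: emeasure_distr M.emeasure_eq_measure N.emeasure_eq_measure)
qed simp

lemma measure_mp:
  assumes "T \<in> measurable M N" "distr M N T = N" "{x \<in> space N. Q x} \<in> sets N"
  shows "measure M {x \<in> space M. Q (T x)} = measure N {x \<in> space N. Q x}"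
proof -
  have "measure N {x \<in> space N. Q x} = measure (distr M N T) {x \<in> space N. Q x}"
    by (subst assms(2)) (rule refl)
  also have "\<dots> = measure M (T -` {x \<in> space N. Q x} \<inter> space M)"
    using assms(1,3) by (rule measure_distr)
  also have "T -` {x \<in> space N. Q x} \<inter> space M = {x \<in> space M. Q (T x)}"
    using measurable_space[OF assms(1)] by auto
  finally show ?thesis by simp
qed

text \<open>The fibre is integrated before the base: \<open>b z\<close> preserves M for fixed z, and
  what remains is a function of \<open>a z\<close>.\<close>

lemma distr_skew:
  assumes B: "prob_space B" and M: "prob_space M"
    and a: "a \<in> measurable B B" "distr B B a = B"
    and b: "(\<lambda>(z, m). b z m) \<in> measurable (B \<Otimes>\<^sub>M M) M" "\<And>z. z \<in> space B \<Longrightarrow> distr M M (b z) = M"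
  shows "distr (B \<Otimes>\<^sub>M M) (B \<Otimes>\<^sub>M M) (\<lambda>(z, m). (a z, b z m)) = B \<Otimes>\<^sub>M M"
proof -
  interpret B: prob_space B by fact
  interpret M: prob_space M by fact
  interpret BM: pair_prob_space B M ..
  note [measurable] = a(1)
  have b': "(\<lambda>z. b (fst z) (snd z)) \<in> measurable (B \<Otimes>\<^sub>M M) M"
    using b(1) by (simp add: case_prod_beta')
  have T: "(\<lambda>(z, m). (a z, b z m)) \<in> measurable (B \<Otimes>\<^sub>M M) (B \<Otimes>\<^sub>M M)"
    unfolding case_prod_beta' by (intro measurable_Pair measurable_compose[OF measurable_fst a(1)] b')
  show ?thesis
  proof (rule distr_eqI[OF BM.prob_space_axioms BM.prob_space_axioms T])
    fix A assume A: "A \<in> sets (B \<Otimes>\<^sub>M M)"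
    let ?i = "indicator A :: _ \<Rightarrow> real"
    have i: "?i \<in> bmeas (B \<Otimes>\<^sub>M M)" by (rule bmeas_indicator[OF A])
    have "(\<integral>x. ?i ((\<lambda>(z, m). (a z, b z m)) x) \<partial>(B \<Otimes>\<^sub>M M)) = (\<integral>z. \<integral>m. ?i (a z, b z m) \<partial>M \<partial>B)"
      by (subst int_pair[OF B M bmeas_compose[OF i T]]) simp
    also have "\<dots> = (\<integral>z. \<integral>m. ?i (a z, m) \<partial>M \<partial>B)"
    proof (rule Bochner_Integration.integral_cong[OF refl])
      fix z assume z: "z \<in> space B"
      have "b z \<in> measurable M M"
        using measurable_compose[OF measurable_Pair1'[OF z] b(1)] by simp
      moreover have "(\<lambda>m. ?i (a z, m)) \<in> borel_measurable M"
        using z by (intro bmeas_measurable bmeas_section[OF i] measurable_space[OF a(1)])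
      ultimately show "(\<integral>m. ?i (a z, b z m) \<partial>M) = (\<integral>m. ?i (a z, m) \<partial>M)"
        using integral_mp[of "b z" M M "\<lambda>m. ?i (a z, m)"] b(2)[OF z] by simp
    qed
    also have "\<dots> = (\<integral>z. \<integral>m. ?i (z, m) \<partial>M \<partial>B)"
      by (rule integral_mp[OF a]) (rule bmeas_measurable[OF M.bmeas_integral[OF i]])
    also have "\<dots> = (\<integral>x. ?i x \<partial>(B \<Otimes>\<^sub>M M))"
      by (rule int_pair[OF B M i, symmetric])
    finally show "(\<integral>x. ?i ((\<lambda>(z, m). (a z, b z m)) x) \<partial>(B \<Otimes>\<^sub>M M)) = (\<integral>x. ?i x \<partial>(B \<Otimes>\<^sub>M M))" .
  qed
qed


lemma neq_sets:
  assumes "f \<in> measurable M (count_space A)" "g \<in> measurable M (count_space A)" "countable A"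
  shows "{x \<in> space M. f x \<noteq> g x} \<in> sets M"
proof -
  have "(\<Union>i\<in>A. (f -` {i} \<inter> space M) \<inter> (g -` {i} \<inter> space M)) \<in> sets M"
    using assms by (intro sets.countable_UN' sets.Int measurable_sets) auto
  also have "(\<Union>i\<in>A. (f -` {i} \<inter> space M) \<inter> (g -` {i} \<inter> space M)) = {x \<in> space M. f x = g x}"
    using measurable_space[OF assms(1)] measurable_space[OF assms(2)] by auto
  finally have "space M - {x \<in> space M. f x = g x} \<in> sets M" by auto
  also have "space M - {x \<in> space M. f x = g x} = {x \<in> space M. f x \<noteq> g x}" by auto
  finally show ?thesis .
qed


subsection \<open>Approximation by functions of finitely many coordinates\<close>

context prod_prob
begin

definition cyl :: "'i set \<Rightarrow> ('i \<Rightarrow> 'z) set \<Rightarrow> bool" where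
  "cyl F A \<longleftrightarrow> A \<in> sets P \<and> (\<forall>y\<in>space P. \<forall>y'\<in>space P. (\<forall>h\<in>F. y h = y' h) \<longrightarrow> (y \<in> A \<longleftrightarrow> y' \<in> A))"

text \<open>The sets that can be approximated form a sigma-algebra containing the generators. A
  countable union is cut off after finitely many terms, so that finitely many coordinates still
  suffice.\<close>

lemma cylinder_approx:
  assumes "A \<in> sets P" "\<epsilon> > 0"
  shows "\<exists>F A'. finite F \<and> F \<subseteq> I \<and> cyl F A' \<and> P.prob ((A - A') \<union> (A' - A)) < \<epsilon>"
proof -
  have "A \<in> sigma_sets (\<Pi>\<^sub>E i\<in>I. space Z) {{f \<in> \<Pi>\<^sub>E i\<in>I. space Z. f i \<in> B} |i B. i \<in> I \<and> B \<in> sets Z}"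
    using assms(1) by (simp add: sets_PiM_single)
  then show ?thesis using \<open>\<epsilon> > 0\<close>
  proof (induction A arbitrary: \<epsilon> rule: sigma_sets.induct)
    case (Basic a)
    then obtain i B where a: "a = {f \<in> \<Pi>\<^sub>E i\<in>I. space Z. f i \<in> B}" "i \<in> I" "B \<in> sets Z" by auto
    have "a \<in> sets P"
      unfolding sets_PiM_single using Basic(1) by (rule sigma_sets.Basic)
    then have "cyl {i} a"
      using a by (auto simp: cyl_def space_PiM)
    then show ?case using a Basic(2) by (intro exI[of _ "{i}"] exI[of _ a]) auto
  next
    case Empty
    then show ?case by (intro exI[of _ "{}"]) (auto simp: cyl_def)
  next
    case (Compl a)
    from Compl.IH[OF Compl.prems] obtain F A' where F: "finite F" "F \<subseteq> I" "cyl F A'" "P.prob ((a - A') \<union> (A' - a)) < \<epsilon>"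
      by blast
    have "a \<in> sets P"
      unfolding sets_PiM_single by (rule Compl.hyps)
    moreover have "A' \<in> sets P" using F(3) by (simp add: cyl_def)
    ultimately have sub: "A' \<subseteq> space P" "a \<subseteq> space P"
      by (auto dest: sets.sets_into_space)
    have "cyl F (space P - A')"
      unfolding cyl_def
    proof (intro conjI ballI impI)
      show "space P - A' \<in> sets P" using F(3) by (auto simp: cyl_def)
      fix y y' assume y: "y \<in> space P" "y' \<in> space P" "\<forall>h\<in>F. y h = y' h"
      then have "y \<in> A' \<longleftrightarrow> y' \<in> A'" using F(3) unfolding cyl_def by blast
      with y show "y \<in> space P - A' \<longleftrightarrow> y' \<in> space P - A'" by blast
    qed
    moreover have "((\<Pi>\<^sub>E i\<in>I. space Z) - a - (space P - A')) \<union> (space P - A' - ((\<Pi>\<^sub>E i\<in>I. space Z) - a)) = (a - A') \<union> (A' - a)"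
      using sub by (auto simp: space_PiM)
    ultimately show ?case
      using F(1,2,4) by (intro exI[of _ F] exI[of _ "space P - A'"]) simp
  next
    case (Union a)
    have a: "a n \<in> sets P" for n
      unfolding sets_PiM_single by (rule Union.hyps)
    have "(\<lambda>n. P.prob (\<Union>i<n. a i)) \<longlonglongrightarrow> P.prob (\<Union>n. \<Union>i<n. a i)"
      using a by (intro P.finite_Lim_measure_incseq monoI UN_mono) auto
    moreover have "(\<Union>n. \<Union>i<n. a i) = (\<Union>i. a i)" by auto
    ultimately have lim: "(\<lambda>n. P.prob (\<Union>i<n. a i)) \<longlonglongrightarrow> P.prob (\<Union>i. a i)" by simp
    have "\<forall>\<^sub>F n in sequentially. P.prob (\<Union>i. a i) - \<epsilon> / 2 < P.prob (\<Union>i<n. a i)"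
      by (rule order_tendstoD[OF lim]) (use Union.prems in simp)
    from eventually_happens'[OF sequentially_bot this]
    obtain n where "P.prob (\<Union>i. a i) - \<epsilon> / 2 < P.prob (\<Union>i<n. a i)" ..
    then have n: "P.prob (\<Union>i. a i) - P.prob (\<Union>i<n. a i) < \<epsilon> / 2"
      by linarith
    \<comment> \<open>Half of the error is spent on the cut-off at n and half on the n
      approximations; \<open>Suc n\<close> avoids a division by 0.\<close>
    have "\<exists>F A'. finite F \<and> F \<subseteq> I \<and> cyl F A' \<and> P.prob ((a i - A') \<union> (A' - a i)) < \<epsilon> / (2 * real (Suc n))" for i
      using Union.prems by (intro Union.IH) auto
    then obtain F A' where FA: "\<And>i. finite (F i)" "\<And>i. F i \<subseteq> I" "\<And>i. cyl (F i) (A' i)"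
      "\<And>i. P.prob ((a i - A' i) \<union> (A' i - a i)) < \<epsilon> / (2 * real (Suc n))"
      by metis
    have A': "A' i \<in> sets P" for i using FA(3) by (auto simp: cyl_def)
    let ?F = "\<Union>i<n. F i" and ?A = "\<Union>i<n. A' i"
    have cy: "cyl ?F ?A"
      unfolding cyl_def
    proof (intro conjI ballI impI)
      show "?A \<in> sets P" using A' by auto
      fix y y' assume y: "y \<in> space P" "y' \<in> space P" "\<forall>h\<in>?F. y h = y' h"
      have "y \<in> A' i \<longleftrightarrow> y' \<in> A' i" if "i < n" for i
        using FA(3)[of i] y that unfolding cyl_def by blast
      then show "y \<in> ?A \<longleftrightarrow> y' \<in> ?A" by auto
    qed
    have "P.prob (((\<Union>i. a i) - ?A) \<union> (?A - (\<Union>i. a i)))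
        \<le> P.prob (((\<Union>i. a i) - (\<Union>i<n. a i)) \<union> (\<Union>i<n. (a i - A' i) \<union> (A' i - a i)))"
      using a A' by (intro P.finite_measure_mono) auto
    also have "\<dots> \<le> P.prob ((\<Union>i. a i) - (\<Union>i<n. a i)) + P.prob (\<Union>i<n. (a i - A' i) \<union> (A' i - a i))"
      using a A' by (intro measure_Un_le) auto
    also have "P.prob ((\<Union>i. a i) - (\<Union>i<n. a i)) = P.prob (\<Union>i. a i) - P.prob (\<Union>i<n. a i)"
      using a by (intro P.finite_measure_Diff) auto
    also have "P.prob (\<Union>i<n. (a i - A' i) \<union> (A' i - a i)) \<le> (\<Sum>i<n. P.prob ((a i - A' i) \<union> (A' i - a i)))"
      using a A' by (intro measure_UNION_le) auto
    also have "\<dots> \<le> (\<Sum>i<n. \<epsilon> / (2 * real (Suc n)))"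
      using FA(4) by (intro sum_mono less_imp_le)
    also have "\<dots> \<le> \<epsilon> / 2"
      using Union.prems by (simp add: field_simps)
    finally have "P.prob (((\<Union>i. a i) - ?A) \<union> (?A - (\<Union>i. a i))) < \<epsilon>"
      using n by linarith
    then show ?case
      using FA(1,2) cy by (intro exI[of _ ?F] exI[of _ ?A]) auto
  qed
qed

lemma finite_range_approx:
  assumes "countable A" "h \<in> measurable P (count_space A)" "\<epsilon> > 0"
  shows "\<exists>R. finite R \<and> R \<subseteq> A \<and> P.prob {y \<in> space P. h y \<notin> R} < \<epsilon>"
proof -
  have h: "h y \<in> A" if "y \<in> space P" for y
    using measurable_space[OF assms(2) that] by simp
  obtain y0 where "y0 \<in> space P" using P.not_empty by blast
  with h have ne: "A \<noteq> {}" by blast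
  note [measurable] = assms(2)
  define R where "R n = from_nat_into A ` {..<n}" for n :: nat
  have R: "finite (R n)" "R n \<subseteq> A" for n
    using from_nat_into[OF ne] by (auto simp: R_def)
  have m: "{y \<in> space P. h y \<in> R n} \<in> sets P" for n
  proof -
    have "h -` R n \<inter> space P \<in> sets P"
      using R by (intro measurable_sets[OF assms(2)]) auto
    moreover have "h -` R n \<inter> space P = {y \<in> space P. h y \<in> R n}" by auto
    ultimately show ?thesis by simp
  qed
  have "(\<lambda>n. P.prob {y \<in> space P. h y \<in> R n}) \<longlonglongrightarrow> P.prob (\<Union>n. {y \<in> space P. h y \<in> R n})"
    using m by (intro P.finite_Lim_measure_incseq) (auto simp: incseq_def R_def)
  moreover have "(\<Union>n. {y \<in> space P. h y \<in> R n}) = space P"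
  proof -
    have "\<exists>n. h y \<in> R n" if y: "y \<in> space P" for y
    proof -
      obtain k where "from_nat_into A k = h y"
        using from_nat_into_surj[OF assms(1) h[OF y]] by blast
      then have "h y \<in> R (Suc k)" by (auto simp: R_def intro: image_eqI[of _ _ k])
      then show ?thesis ..
    qed
    then show ?thesis by auto
  qed
  ultimately have "(\<lambda>n. P.prob {y \<in> space P. h y \<in> R n}) \<longlonglongrightarrow> 1"
    by (simp add: P.prob_space)
  then have "\<forall>\<^sub>F n in sequentially. P.prob {y \<in> space P. h y \<in> R n} > 1 - \<epsilon>"
    using assms(3) by (intro order_tendstoD) auto
  from eventually_happens'[OF sequentially_bot this]
  obtain n where n: "P.prob {y \<in> space P. h y \<in> R n} > 1 - \<epsilon>" ..
  have "P.prob {y \<in> space P. h y \<notin> R n} = 1 - P.prob {y \<in> space P. h y \<in> R n}"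
    using P.prob_neg[of "\<lambda>y. h y \<in> R n"] m[of n] by simp
  with n R[of n] show ?thesis by (intro exI[of _ "R n"]) auto
qed

lemma cylinder_approx_fun:
  assumes R: "finite R" "R \<noteq> {}" and h: "h \<in> measurable P (count_space R)" and "\<epsilon> > 0"
  shows "\<exists>F h'. finite F \<and> F \<subseteq> I \<and> h' \<in> measurable P (count_space R) \<and>
     (\<forall>y\<in>space P. \<forall>y'\<in>space P. (\<forall>i\<in>F. y i = y' i) \<longrightarrow> h' y = h' y') \<and>
     P.prob {y \<in> space P. h y \<noteq> h' y} < \<epsilon>"
proof -
  obtain r0 where r0: "r0 \<in> R" using R by auto
  have hR: "h y \<in> R" if "y \<in> space P" for y
    using measurable_space[OF h that] by simp
  define A where "A r = {y \<in> space P. h y = r}" for r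
  have A: "A r \<in> sets P" if "r \<in> R" for r
  proof -
    have "h -` {r} \<inter> space P \<in> sets P"
      using that by (intro measurable_sets[OF h]) auto
    moreover have "h -` {r} \<inter> space P = A r" by (auto simp: A_def)
    ultimately show ?thesis by simp
  qed
  have "\<exists>F A'. finite F \<and> F \<subseteq> I \<and> cyl F A' \<and> P.prob ((A r - A') \<union> (A' - A r)) < \<epsilon> / real (card R)" if "r \<in> R" for r
    using R that assms by (intro cylinder_approx A) (auto simp: card_gt_0_iff)
  then obtain F A' where FA: "\<And>r. r \<in> R \<Longrightarrow> finite (F r)" "\<And>r. r \<in> R \<Longrightarrow> F r \<subseteq> I" "\<And>r. r \<in> R \<Longrightarrow> cyl (F r) (A' r)"
      "\<And>r. r \<in> R \<Longrightarrow> P.prob ((A r - A' r) \<union> (A' r - A r)) < \<epsilon> / real (card R)"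
    by metis
  have A': "A' r \<in> sets P" if "r \<in> R" for r using FA(3)[OF that] by (simp add: cyl_def)
  \<comment> \<open>The approximating cylinders need neither be disjoint nor cover the space. The
    value is r where exactly the cylinder of r contains y, and the default \<open>r0\<close>
    otherwise; this errs only where one of the approximations errs.\<close>
  define only where "only y r \<longleftrightarrow> y \<in> A' r \<and> (\<forall>s\<in>R. s \<noteq> r \<longrightarrow> y \<notin> A' s)" for y r
  define h' where "h' y = (if \<exists>r\<in>R. only y r then THE r. r \<in> R \<and> only y r else r0)" for y
  have only_h': "h' y = r" if "r \<in> R" "only y r" for y r
  proof -
    have "(THE r. r \<in> R \<and> only y r) = r"
      using that by (intro the_equality) (auto simp: only_def)
    then show ?thesis using that by (auto simp: h'_def)
  qed
  have h'_iff: "h' y = r \<longleftrightarrow> only y r \<or> (r = r0 \<and> (\<forall>s\<in>R. \<not> only y s))" if "r \<in> R" for y r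
  proof (cases "\<exists>s\<in>R. only y s")
    case True
    then obtain s where "s \<in> R" "only y s" by blast
    with only_h' that show ?thesis by metis
  qed (use that in \<open>auto simp: h'_def\<close>)
  have h'R: "h' y \<in> R" for y
  proof (cases "\<exists>s\<in>R. only y s")
    case True
    then obtain s where "s \<in> R" "only y s" by blast
    with only_h' show ?thesis by metis
  qed (use r0 in \<open>auto simp: h'_def\<close>)
  have only_m: "{y \<in> space P. only y r} \<in> sets P" if "r \<in> R" for r
  proof -
    have "{y \<in> space P. only y r} = A' r - (\<Union>s\<in>R - {r}. A' s)"
      using sets.sets_into_space[OF A'[OF that]] by (auto simp: only_def)
    also have "\<dots> \<in> sets P"
      using A' that R by (intro sets.Diff sets.finite_UN) auto
    finally show ?thesis .
  qed
  have h'_m: "h' \<in> measurable P (count_space R)"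
  proof (subst measurable_count_space_eq2[OF R(1)], intro conjI ballI)
    show "h' \<in> space P \<rightarrow> R" using h'R by auto
    fix r assume r: "r \<in> R"
    have "h' -` {r} \<inter> space P = {y \<in> space P. only y r} \<union> (if r = r0 then space P - (\<Union>s\<in>R. {y \<in> space P. only y s}) else {})"
      using h'_iff[OF r] by auto
    then show "h' -` {r} \<inter> space P \<in> sets P"
      using only_m r R by (auto intro!: sets.Un sets.Diff sets.finite_UN simp del: space_PiM)
  qed
  have loc: "h' y = h' y'" if y: "y \<in> space P" "y' \<in> space P" "\<forall>i\<in>\<Union>r\<in>R. F r. y i = y' i" for y y'
  proof -
    have "y \<in> A' r \<longleftrightarrow> y' \<in> A' r" if "r \<in> R" for r
      using FA(3)[OF that] y that unfolding cyl_def by blast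
    then have "only y r = only y' r" if "r \<in> R" for r
      using that by (auto simp: only_def)
    then show ?thesis
      using h'_iff[OF h'R, of y y'] h'_iff[OF h'R, of y' y'] h'R by auto
  qed
  have "{y \<in> space P. h y \<noteq> h' y} \<subseteq> (\<Union>r\<in>R. (A r - A' r) \<union> (A' r - A r))"
  proof (rule ccontr)
    assume "\<not> ?thesis"
    then obtain y where y: "y \<in> space P" "h y \<noteq> h' y" "\<And>r. r \<in> R \<Longrightarrow> y \<in> A r \<longleftrightarrow> y \<in> A' r"
      by auto
    then have "only y (h y)"
      using hR[OF y(1)] by (auto simp: only_def A_def)
    with only_h' hR y show False by metis
  qed
  then have "P.prob {y \<in> space P. h y \<noteq> h' y} \<le> P.prob (\<Union>r\<in>R. (A r - A' r) \<union> (A' r - A r))"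
    using A A' R by (intro P.finite_measure_mono) auto
  also have "\<dots> \<le> (\<Sum>r\<in>R. P.prob ((A r - A' r) \<union> (A' r - A r)))"
    using A A' R by (intro measure_UNION_le) auto
  also have "\<dots> < (\<Sum>r\<in>R. \<epsilon> / real (card R))"
    using FA(4) R by (intro sum_strict_mono) auto
  also have "\<dots> = \<epsilon>" using R by simp
  finally have "P.prob {y \<in> space P. h y \<noteq> h' y} < \<epsilon>" .
  then show ?thesis
    using FA(1,2) R h'_m loc by (intro exI[of _ "\<Union>r\<in>R. F r"] exI[of _ h']) blast
qed

lemma distr_mix: "distr (P \<Otimes>\<^sub>M P) P (\<lambda>z. mix I C (fst z) (snd z)) = P"
proof (rule distr_eqI[OF PP.prob_space_axioms P.prob_space_axioms])
  fix A assume A: "A \<in> sets P"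
  have i: "(indicator A :: _ \<Rightarrow> real) \<in> bmeas P" by (rule bmeas_indicator[OF A])
  have "(\<integral>z. indicator A (mix I C (fst z) (snd z)) \<partial>(P \<Otimes>\<^sub>M P)) = (\<integral>y. \<integral>u. indicator A (mix I C y u) \<partial>P \<partial>P :: real)"
    using int_pair[OF P.prob_space_axioms P.prob_space_axioms bmeas_mix[OF i]] by simp
  also have "\<dots> = (\<integral>y. indicator A y \<partial>P)"
    by (rule int_mix[OF i])
  finally show "(\<integral>z. indicator A (mix I C (fst z) (snd z)) \<partial>(P \<Otimes>\<^sub>M P)) = (\<integral>y. indicator A y \<partial>P :: real)" .
qed measurable

end

subsection \<open>Influences and noise\<close>

text \<open>The transform of \<psi> is a probability distribution on the subsets A of the union. A
  set with more than n elements loses at least half of its mass under the noise, so such sets have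
  total mass at most 2 \<epsilon>. A set with at most n elements meets at most n of the disjoint
  \<open>D j\<close>. Averaged over j, the mass of the sets meeting \<open>D j\<close> is therefore
  at most n / card J + 2 \<epsilon> \<le> 3 \<epsilon>.\<close>

lemma pigeonhole_influence:
  fixes \<psi> :: "'i set \<Rightarrow> real" and D :: "'j \<Rightarrow> 'i set"
  assumes J: "finite J" "J \<noteq> {}" and D: "\<And>j. j \<in> J \<Longrightarrow> finite (D j)" "disjoint_family_on D J"
    and pos: "\<And>A. A \<subseteq> (\<Union>j\<in>J. D j) \<Longrightarrow> 0 \<le> mob \<psi> A"
    and one: "\<psi> (\<Union>j\<in>J. D j) = 1"
    and t: "0 \<le> t" "t \<le> 1"
    and noise: "1 - \<epsilon> \<le> (\<Sum>A\<in>Pow (\<Union>j\<in>J. D j). (1 - t) ^ card A * mob \<psi> A)"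
    and n: "(1 - t) ^ n \<le> 1 / 2" "real n \<le> \<epsilon> * real (card J)"
  shows "\<exists>j\<in>J. 1 - \<psi> ((\<Union>j\<in>J. D j) - D j) \<le> 3 * \<epsilon>"
proof -
  let ?D = "\<Union>j\<in>J. D j" and ?\<mu> = "mob \<psi>" and ?m = "real (card J)"
  have fin: "finite ?D" using J D by auto
  have sum1: "(\<Sum>A\<in>Pow ?D. ?\<mu> A) = 1"
    using sum_mob[OF fin, of \<psi>] one by simp
  have loss: "1 - \<psi> (?D - D j) = (\<Sum>A\<in>Pow ?D. if A \<inter> D j \<noteq> {} then ?\<mu> A else 0)" if "j \<in> J" for j
  proof -
    have "\<psi> (?D - D j) = (\<Sum>A\<in>Pow (?D - D j). ?\<mu> A)"
      using sum_mob[of "?D - D j" \<psi>] fin by simp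
    also have "\<dots> = (\<Sum>A\<in>Pow ?D. if A \<inter> D j = {} then ?\<mu> A else 0)"
      using fin by (intro sum.mono_neutral_cong_left) auto
    finally have "1 - \<psi> (?D - D j) = (\<Sum>A\<in>Pow ?D. ?\<mu> A - (if A \<inter> D j = {} then ?\<mu> A else 0))"
      using sum1 by (simp add: sum_subtractf)
    also have "\<dots> = (\<Sum>A\<in>Pow ?D. if A \<inter> D j \<noteq> {} then ?\<mu> A else 0)"
      by (intro sum.cong) auto
    finally show ?thesis .
  qed
  \<comment> \<open>One bound for both sizes: a small set is covered by n, a large one by the other
    summand, which is then at least \<open>card J\<close>.\<close>
  have count: "real (card {j \<in> J. A \<inter> D j \<noteq> {}}) \<le> real n + 2 * ?m * (1 - (1 - t) ^ card A)" if A: "A \<subseteq> ?D" for A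
  proof (cases "card A \<le> n")
    case True
    have "card {j \<in> J. A \<inter> D j \<noteq> {}} = (\<Sum>j\<in>{j \<in> J. A \<inter> D j \<noteq> {}}. 1)" by simp
    also have "\<dots> \<le> (\<Sum>j\<in>{j \<in> J. A \<inter> D j \<noteq> {}}. card (A \<inter> D j))"
      using D by (intro sum_mono) (auto simp: Suc_le_eq card_gt_0_iff)
    also have "\<dots> = card (\<Union>j\<in>{j \<in> J. A \<inter> D j \<noteq> {}}. A \<inter> D j)"
      using J D by (intro card_UN_disjoint[symmetric]) (auto simp: disjoint_family_on_def)
    also have "\<dots> \<le> card A"
      using A fin by (intro card_mono) (auto intro: finite_subset)
    finally have "real (card {j \<in> J. A \<inter> D j \<noteq> {}}) \<le> real n" using True by linarith
    moreover have "0 \<le> 2 * ?m * (1 - (1 - t) ^ card A)"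
      using t by (auto intro!: mult_nonneg_nonneg power_le_one)
    ultimately show ?thesis by linarith
  next
    case False
    then have "(1 - t) ^ card A \<le> (1 - t) ^ n"
      using t by (intro power_decreasing) auto
    then have "1 / 2 \<le> 1 - (1 - t) ^ card A" using n by linarith
    then have "2 * ?m * (1 / 2) \<le> 2 * ?m * (1 - (1 - t) ^ card A)"
      by (intro mult_left_mono) auto
    moreover have "card {j \<in> J. A \<inter> D j \<noteq> {}} \<le> card J"
      using J by (intro card_mono) auto
    ultimately show ?thesis by simp
  qed
  have "(\<Sum>j\<in>J. 1 - \<psi> (?D - D j)) = (\<Sum>j\<in>J. \<Sum>A\<in>Pow ?D. if A \<inter> D j \<noteq> {} then ?\<mu> A else 0)"
    by (intro sum.cong refl loss)
  also have "\<dots> = (\<Sum>A\<in>Pow ?D. \<Sum>j\<in>J. if A \<inter> D j \<noteq> {} then ?\<mu> A else 0)"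
    by (rule sum.swap)
  also have "\<dots> = (\<Sum>A\<in>Pow ?D. real (card {j \<in> J. A \<inter> D j \<noteq> {}}) * ?\<mu> A)"
    using J by (intro sum.cong refl) (simp add: sum.If_cases Int_def)
  also have "\<dots> \<le> (\<Sum>A\<in>Pow ?D. (real n + 2 * ?m * (1 - (1 - t) ^ card A)) * ?\<mu> A)"
    using count pos by (intro sum_mono mult_right_mono) auto
  also have "\<dots> = (\<Sum>A\<in>Pow ?D. (real n + 2 * ?m) * ?\<mu> A - 2 * ?m * ((1 - t) ^ card A * ?\<mu> A))"
    by (intro sum.cong refl) (simp add: algebra_simps)
  also have "\<dots> = (real n + 2 * ?m) * 1 - 2 * ?m * (\<Sum>A\<in>Pow ?D. (1 - t) ^ card A * ?\<mu> A)"
    by (simp only: sum_subtractf sum_distrib_left[symmetric] sum1)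
  also have "\<dots> \<le> (real n + 2 * ?m) - 2 * ?m * (1 - \<epsilon>)"
    using noise by (simp add: mult_left_mono)
  also have "\<dots> \<le> (\<Sum>j\<in>J. 3 * \<epsilon>)"
    using n by (simp add: algebra_simps)
  finally have le: "(\<Sum>j\<in>J. 1 - \<psi> (?D - D j)) \<le> (\<Sum>j\<in>J. 3 * \<epsilon>)" .
  show ?thesis
  proof (rule ccontr)
    assume "\<not> ?thesis"
    then have "(\<Sum>j\<in>J. 3 * \<epsilon>) < (\<Sum>j\<in>J. 1 - \<psi> (?D - D j))"
      using J by (intro sum_strict_mono) auto
    with le show False by simp
  qed
qed

context test_fun
begin

abbreviation I where "I \<equiv> carrier H"

text \<open>The squared norm of the projection of f to the functions of x and the coordinates in C.
  By normalisation it lies between 0 and 1, and 1 - \<open>Phi C\<close> is the squared distance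
  from f to that projection.\<close>

definition Phi :: "'l set \<Rightarrow> real" where
  "Phi C = (\<integral>x. energy C (\<lambda>y. f (x, y)) \<partial>X)"

lemma bmeas_energy_f: "(\<lambda>x. energy C (\<lambda>y. f (x, y))) \<in> bmeas X"
  by (rule bmeas_energy[OF f])

definition favg :: "'l set \<Rightarrow> 'x \<times> ('l \<Rightarrow> 'z) \<Rightarrow> real" where
  "favg C z = avg C (\<lambda>y. f (fst z, y)) (snd z)"

lemma favg_bmeas: "favg C \<in> bmeas (X \<Otimes>\<^sub>M P)"
proof -
  have "(\<lambda>z. f (fst (fst z), mix (carrier H) C (snd (fst z)) (snd z))) \<in> bmeas ((X \<Otimes>\<^sub>M P) \<Otimes>\<^sub>M P)"
    by (intro f_comp) measurable
  from P.bmeas_integral[OF this] show ?thesis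
    by (simp add: favg_def[abs_def] avg_def)
qed

lemma favg_nonneg: "0 \<le> favg C z"
  unfolding favg_def avg_def using f_nonneg by (intro integral_nonneg_AE) auto

lemma swapXP: "F \<in> bmeas (X \<Otimes>\<^sub>M P) \<Longrightarrow> (\<integral>x. \<integral>y. F (x, y) \<partial>P \<partial>X) = (\<integral>y. \<integral>x. F (x, y) \<partial>X \<partial>P)"
  by (rule int_swap[OF prob_X P.prob_space_axioms])

lemma Phi_eq: "Phi C = (\<integral>y. \<integral>x. (favg C (x, y))\<^sup>2 \<partial>X \<partial>P)"
proof -
  have "Phi C = (\<integral>x. \<integral>y. (favg C (x, y))\<^sup>2 \<partial>P \<partial>X)"
    unfolding Phi_def favg_def by (intro Bochner_Integration.integral_cong refl) (simp add: energy_eq f_sec)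
  also have "\<dots> = (\<integral>y. \<integral>x. (favg C (x, y))\<^sup>2 \<partial>X \<partial>P)"
    by (rule swapXP[OF bmeas_power2[OF favg_bmeas]])
  finally show ?thesis .
qed

lemma f_norm2: "(\<integral>x. \<integral>y. (f (x, y))\<^sup>2 \<partial>P \<partial>X) = 1"
proof -
  have "(\<integral>x. \<integral>y. (f (x, y))\<^sup>2 \<partial>P \<partial>X) = (\<integral>y. \<integral>x. (f (x, y))\<^sup>2 \<partial>X \<partial>P)"
    by (rule swapXP[OF bmeas_power2[OF f]])
  also have "\<dots> = (\<integral>y. 1 \<partial>P)"
    by (intro Bochner_Integration.integral_cong refl) (simp add: f_norm)
  finally show ?thesis by (simp add: P.prob_space)
qed

lemma Phi_full: "I \<subseteq> C \<Longrightarrow> Phi C = 1"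
  unfolding Phi_def by (simp add: energy_full f_norm2)

lemma Phi_mono: "B \<subseteq> C \<Longrightarrow> Phi B \<le> Phi C"
  unfolding Phi_def by (intro integral_mono X.integrable_bmeas bmeas_energy_f energy_mono f_sec)

lemma Phi_dist: "(\<integral>y. \<integral>x. (f (x, y) - favg C (x, y))\<^sup>2 \<partial>X \<partial>P) = 1 - Phi C"
proof -
  have "(\<integral>y. \<integral>x. (f (x, y) - favg C (x, y))\<^sup>2 \<partial>X \<partial>P) = (\<integral>x. \<integral>y. (f (x, y) - favg C (x, y))\<^sup>2 \<partial>P \<partial>X)"
    by (rule swapXP[symmetric]) (intro bmeas_power2 bmeas_diff f favg_bmeas)
  also have "\<dots> = (\<integral>x. (\<integral>y. (f (x, y))\<^sup>2 \<partial>P) - energy C (\<lambda>y. f (x, y)) \<partial>X)"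
    unfolding favg_def by (intro Bochner_Integration.integral_cong refl) (simp add: integral_diff_avg f_sec)
  also have "\<dots> = 1 - Phi C"
    unfolding Phi_def f_norm2[symmetric]
    by (intro Bochner_Integration.integral_diff X.integrable_bmeas bmeas_energy_f P.bmeas_integral bmeas_power2 f)
  finally show ?thesis .
qed

text \<open>The transform is a finite linear combination, so it commutes with integration over x,
  and positivity passes from the energies to \<open>Phi\<close>.\<close>

lemma mob_Phi: 
  assumes "finite A"
  shows "mob (\<lambda>B. Phi (C \<union> B)) A = (\<integral>x. mob (\<lambda>B. energy (C \<union> B) (\<lambda>y. f (x, y))) A \<partial>X)"
  unfolding mob_def Phi_def
  by (subst Bochner_Integration.integral_sum)
    (auto intro!: integrable_mult_right X.integrable_bmeas bmeas_energy_f)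

lemma mob_Phi_nonneg: "finite A \<Longrightarrow> A \<inter> C = {} \<Longrightarrow> 0 \<le> mob (\<lambda>B. Phi (C \<union> B)) A"
  unfolding mob_Phi by (intro integral_nonneg_AE AE_I2 mob_energy_nonneg f_sec)


text \<open>\<open>M\<close> marks the coordinates to be resampled; \<open>mask t\<close> marks each with probability \<open>t\<close>.\<close>

definition nmix :: "('l \<Rightarrow> bool) \<Rightarrow> ('l \<Rightarrow> 'z) \<Rightarrow> ('l \<Rightarrow> 'z) \<Rightarrow> 'l \<Rightarrow> 'z" where
  "nmix M y u = mix I {h. \<not> M h} y u"

lemma nmix_shift: "g \<in> I \<Longrightarrow> nmix (shift H g M) (shift H g y) (shift H g u) = shift H g (nmix M y u)"
  by (auto simp: nmix_def mix_def shift_def fun_eq_iff)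

definition mask :: "real \<Rightarrow> ('l \<Rightarrow> bool) measure" where
  "mask t = PiM I (\<lambda>_. measure_pmf (bernoulli_pmf t))"

lemma prob_mask: "prob_space (mask t)"
  unfolding mask_def by (intro prob_space_PiM prob_space_measure_pmf)

lemma mask_coord: "h \<in> I \<Longrightarrow> (\<lambda>M. M h) \<in> measurable (mask t) (count_space UNIV)"
proof -
  assume "h \<in> I"
  then have "(\<lambda>M. M h) \<in> measurable (mask t) (measure_pmf (bernoulli_pmf t))"
    unfolding mask_def by (rule measurable_component_singleton)
  then show ?thesis by simp
qed

lemma nmix_measurable:
  assumes a: "a \<in> measurable M (mask t)" and b: "b \<in> measurable M P" and c: "c \<in> measurable M P"
  shows "(\<lambda>z. nmix (a z) (b z) (c z)) \<in> measurable M P"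
  unfolding nmix_def mix_def
proof (rule measurable_restrict)
  fix i assume i: "i \<in> I"
  note [measurable] = measurable_compose[OF a mask_coord[OF i]]
    measurable_compose[OF b measurable_component_singleton[OF i]]
    measurable_compose[OF c measurable_component_singleton[OF i]]
  show "(\<lambda>x. if i \<in> {h. \<not> a x h} then b x i else c x i) \<in> measurable M Z"
    by simp measurable
qed

lemma mask_avoid:
  assumes "finite A" "A \<subseteq> I" "0 \<le> t" "t \<le> 1"
  shows "measure (mask t) {M \<in> space (mask t). \<forall>h\<in>A. \<not> M h} = (1 - t) ^ card A"
proof -
  interpret prob_space "mask t" by (rule prob_mask)
  interpret pp: product_prob_space "\<lambda>_ :: 'l. measure_pmf (bernoulli_pmf t)" I
    by unfold_locales
  have PE: "restrict M A = (\<lambda>h\<in>A. False) \<longleftrightarrow> (\<forall>h\<in>A. \<not> M h)" for M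
  proof
    assume "restrict M A = (\<lambda>h\<in>A. False)"
    then have eq: "restrict M A h = (\<lambda>h\<in>A. False) h" for h by (rule fun_cong)
    show "\<forall>h\<in>A. \<not> M h"
    proof
      fix h assume "h \<in> A"
      with eq[of h] show "\<not> M h" by simp
    qed
  qed (auto simp: fun_eq_iff)
  have "{M \<in> space (mask t). \<forall>h\<in>A. \<not> M h} = prod_emb I (\<lambda>_. measure_pmf (bernoulli_pmf t)) A (\<Pi>\<^sub>E h\<in>A. {False})"
    by (auto simp: mask_def space_PiM prod_emb_def PE)
  then have "measure (mask t) {M \<in> space (mask t). \<forall>h\<in>A. \<not> M h} = (\<Prod>h\<in>A. measure (measure_pmf (bernoulli_pmf t)) {False})"
    unfolding mask_def using pp.measure_PiM_emb[OF assms(2,1), of "\<lambda>_. {False}"] by simp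
  also have "\<dots> = (1 - t) ^ card A"
    using assms by (simp add: measure_pmf_single)
  finally show ?thesis .
qed

lemma mask_hit:
  assumes "finite A" "A \<subseteq> I" "0 \<le> t" "t \<le> 1"
  shows "measure (mask t) {M \<in> space (mask t). \<exists>h\<in>A. M h} \<le> t * real (card A)"
proof -
  interpret prob_space "mask t" by (rule prob_mask)
  have m: "{M \<in> space (mask t). M h} \<in> sets (mask t)" if "h \<in> I" for h
    using mask_coord[OF that] by (simp add: pred_def)
  have "{M \<in> space (mask t). \<exists>h\<in>A. M h} = (\<Union>h\<in>A. {M \<in> space (mask t). M h})" by auto
  then have "measure (mask t) {M \<in> space (mask t). \<exists>h\<in>A. M h} \<le> (\<Sum>h\<in>A. measure (mask t) {M \<in> space (mask t). M h})"
    using assms m by (auto intro!: measure_UNION_le)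
  also have "\<dots> = (\<Sum>h\<in>A. t)"
  proof (rule sum.cong[OF refl])
    fix h assume "h \<in> A"
    then have h: "h \<in> I" using assms by auto
    have "measure (mask t) {M \<in> space (mask t). \<not> M h} = 1 - t"
      using mask_avoid[of "{h}" t] assms h by simp
    then show "measure (mask t) {M \<in> space (mask t). M h} = t"
      using prob_neg[of "\<lambda>M. M h"] m[OF h] by simp
  qed
  finally show ?thesis by (simp add: mult.commute)
qed

lemma distr_nmix: "distr ((P \<Otimes>\<^sub>M mask t) \<Otimes>\<^sub>M P) P (\<lambda>z. nmix (snd (fst z)) (fst (fst z)) (snd z)) = P"
proof (rule distr_eqI)
  interpret M: prob_space "mask t" by (rule prob_mask)
  interpret PM: pair_prob_space P "mask t" ..
  interpret PMP: pair_prob_space "P \<Otimes>\<^sub>M mask t" P ..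
  show "prob_space ((P \<Otimes>\<^sub>M mask t) \<Otimes>\<^sub>M P)" by (rule PMP.prob_space_axioms)
  show "prob_space P" by (rule P.prob_space_axioms)
  show m: "(\<lambda>z. nmix (snd (fst z)) (fst (fst z)) (snd z)) \<in> measurable ((P \<Otimes>\<^sub>M mask t) \<Otimes>\<^sub>M P) P"
    by (intro nmix_measurable) measurable
  fix A assume A: "A \<in> sets P"
  let ?i = "indicator A :: _ \<Rightarrow> real"
  have i: "?i \<in> bmeas P" by (rule bmeas_indicator[OF A])
  have i2: "(\<lambda>z. ?i (nmix (snd (fst z)) (fst (fst z)) (snd z))) \<in> bmeas ((P \<Otimes>\<^sub>M mask t) \<Otimes>\<^sub>M P)"
    by (rule bmeas_compose[OF i m])
  have "(\<integral>z. ?i (nmix (snd (fst z)) (fst (fst z)) (snd z)) \<partial>((P \<Otimes>\<^sub>M mask t) \<Otimes>\<^sub>M P))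
     = (\<integral>b. \<integral>u. ?i (nmix (snd b) (fst b) u) \<partial>P \<partial>(P \<Otimes>\<^sub>M mask t))"
    by (subst int_pair[OF PM.prob_space_axioms P.prob_space_axioms i2]) simp
  also have "\<dots> = (\<integral>y. \<integral>M. \<integral>u. ?i (nmix M y u) \<partial>P \<partial>mask t \<partial>P)"
    using int_pair[OF P.prob_space_axioms prob_mask P.bmeas_integral[OF i2]] by simp
  also have "\<dots> = (\<integral>M. \<integral>y. \<integral>u. ?i (nmix M y u) \<partial>P \<partial>P \<partial>mask t)"
    using int_swap[OF P.prob_space_axioms prob_mask P.bmeas_integral[OF i2]] by simp
  also have "\<dots> = (\<integral>M. \<integral>y. ?i y \<partial>P \<partial>mask t)"
    unfolding nmix_def by (intro Bochner_Integration.integral_cong refl int_mix[OF i])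
  finally show "(\<integral>z. ?i (nmix (snd (fst z)) (fst (fst z)) (snd z)) \<partial>((P \<Otimes>\<^sub>M mask t) \<Otimes>\<^sub>M P)) = (\<integral>y. ?i y \<partial>P)"
    by (simp add: M.prob_space)
qed

text \<open>The resampled point \<open>nmix M y u\<close> agrees with \<open>y\<close> on \<open>F0\<close> up to a small probability, so \<open>W g\<close>
  computes the same value at both points and the noise commutes with \<open>\<sigma> g\<close> there.\<close>

lemma noise_step:
  assumes t: "0 \<le> t" "t \<le> 1"
    and F0: "finite F0" "F0 \<subseteq> I" "t * real (card F0) \<le> \<epsilon>"
    and W: "\<And>g. g \<in> S \<Longrightarrow> W g \<in> measurable P (count_space I)"
    and W_loc: "\<And>g y y'. g \<in> S \<Longrightarrow> y \<in> space P \<Longrightarrow> y' \<in> space P \<Longrightarrow> (\<And>h. h \<in> F0 \<Longrightarrow> y h = y' h) \<Longrightarrow> W g y = W g y'"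
    and W_close: "\<And>g. g \<in> S \<Longrightarrow> P.prob {y \<in> space P. w g y \<noteq> W g y} \<le> \<epsilon>"
    and c: "c > 0"
  shows "\<kappa> * (1 - (\<integral>M. Phi {h. \<not> M h} \<partial>mask t)) \<le> c + (1 + 1 / c) * (3 * (4 * (3 * \<epsilon>) + \<delta> + 0))"
proof -
  \<comment> \<open>The masks form a second Bernoulli system over the same group. Shifting the mask
    together with y is what makes the resampling equivariant, by \<open>nmix_shift\<close>.\<close>
  interpret M: bern H "measure_pmf (bernoulli_pmf t)"
    by unfold_locales (auto intro: prob_space_measure_pmf countable_H)
  have MP: "M.P = mask t" by (simp add: mask_def)
  interpret MM: prob_space "mask t" by (rule prob_mask)
  interpret PM: pair_prob_space P "mask t" ..
  let ?B = "P \<Otimes>\<^sub>M mask t"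
  interpret BP: pair_prob_space ?B P ..
  define s where "s g = (\<lambda>(y, M :: 'l \<Rightarrow> bool). (\<sigma> g y, shift H (w g y) M))" for g :: 'g
  define R where "R z = nmix (snd (fst z)) (fst (fst z)) (snd z)" for z :: "(('l \<Rightarrow> 'z) \<times> ('l \<Rightarrow> bool)) \<times> ('l \<Rightarrow> 'z)"
  have R: "R \<in> measurable (?B \<Otimes>\<^sub>M P) P"
    unfolding R_def[abs_def] by (intro nmix_measurable) measurable
  have RP: "distr (?B \<Otimes>\<^sub>M P) P R = P"
    unfolding R_def[abs_def] by (rule distr_nmix)
  have ff: "(\<lambda>z. fst (fst z)) \<in> measurable (?B \<Otimes>\<^sub>M P) P" "distr (?B \<Otimes>\<^sub>M P) P (\<lambda>z. fst (fst z)) = P"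
  proof -
    show m: "(\<lambda>z. fst (fst z)) \<in> measurable (?B \<Otimes>\<^sub>M P) P" by measurable
    have "distr (distr (?B \<Otimes>\<^sub>M P) ?B fst) P fst = distr (?B \<Otimes>\<^sub>M P) P (fst \<circ> fst)"
      by (rule distr_distr) measurable
    then show "distr (?B \<Otimes>\<^sub>M P) P (\<lambda>z. fst (fst z)) = P"
      by (simp add: P.distr_pair_fst MM.distr_pair_fst comp_def)
  qed
  have fm: "(\<lambda>z. snd (fst z)) \<in> measurable (?B \<Otimes>\<^sub>M P) (mask t)" "distr (?B \<Otimes>\<^sub>M P) (mask t) (\<lambda>z. snd (fst z)) = mask t"
  proof -
    show m: "(\<lambda>z. snd (fst z)) \<in> measurable (?B \<Otimes>\<^sub>M P) (mask t)" by measurable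
    have "distr ?B (mask t) snd = mask t"
    proof (rule distr_eqI[OF PM.prob_space_axioms prob_mask])
      fix A assume A: "A \<in> sets (mask t)"
      have "(\<lambda>z. indicator A (snd z) :: real) \<in> bmeas ?B"
        by (rule bmeas_compose[OF bmeas_indicator[OF A]]) measurable
      from int_pair[OF P.prob_space_axioms prob_mask this]
      show "(\<integral>x. indicator A (snd x) \<partial>?B) = (\<integral>x. indicator A x \<partial>mask t :: real)"
        by (simp add: P.prob_space)
    qed measurable
    moreover have "distr (distr (?B \<Otimes>\<^sub>M P) ?B fst) (mask t) snd = distr (?B \<Otimes>\<^sub>M P) (mask t) (snd \<circ> fst)"
      by (rule distr_distr) measurable
    ultimately show "distr (?B \<Otimes>\<^sub>M P) (mask t) (\<lambda>z. snd (fst z)) = mask t"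
      by (simp add: P.distr_pair_fst comp_def)
  qed
  have gG: "g \<in> carrier G" if "g \<in> S" for g using that S by auto
  define N where "N g = {y \<in> space P. w g y \<noteq> W g y}" for g
  have N: "N g \<in> sets P" if "g \<in> S" for g
    unfolding N_def using that by (intro neq_sets[where A="carrier H"] w_meas gG W countable_H)
  define H0 where "H0 = {M \<in> space (mask t). \<exists>h\<in>F0. M h}"
  have H0: "H0 \<in> sets (mask t)"
  proof -
    have "H0 = (\<Union>h\<in>F0. {M \<in> space (mask t). M h})" by (auto simp: H0_def)
    also have "\<dots> \<in> sets (mask t)"
      using F0 mask_coord by (intro sets.finite_UN) (auto simp: pred_def subset_iff)
    finally show ?thesis .
  qed
  \<comment> \<open>Outside E, \<open>w g\<close> and \<open>W g\<close> agree both at y and at the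
    resampled point, and no coordinate in \<open>F0\<close> is marked; hence \<open>w g\<close> has
    the same value at both points. Each of the three events has probability at most
    \<epsilon>.\<close>
  define E where "E g = {z \<in> space (?B \<Otimes>\<^sub>M P). fst (fst z) \<in> N g} \<union> {z \<in> space (?B \<Otimes>\<^sub>M P). R z \<in> N g}
     \<union> {z \<in> space (?B \<Otimes>\<^sub>M P). snd (fst z) \<in> H0}" for g
  have Em: "{z \<in> space (?B \<Otimes>\<^sub>M P). fst (fst z) \<in> N g} \<in> sets (?B \<Otimes>\<^sub>M P)"
     "{z \<in> space (?B \<Otimes>\<^sub>M P). R z \<in> N g} \<in> sets (?B \<Otimes>\<^sub>M P)"
     "{z \<in> space (?B \<Otimes>\<^sub>M P). snd (fst z) \<in> H0} \<in> sets (?B \<Otimes>\<^sub>M P)" if "g \<in> S" for g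
    using measurable_sets[OF ff(1) N[OF that]] measurable_sets[OF R N[OF that]] measurable_sets[OF fm(1) H0]
    by (simp_all add: vimage_def Int_def conj_commute)
  have Nset: "{y \<in> space P. y \<in> N g} = N g" for g by (auto simp: N_def)
  have Hset: "{y \<in> space (mask t). y \<in> H0} = H0" by (auto simp: H0_def)
  have E: "E g \<in> sets (?B \<Otimes>\<^sub>M P)" "measure (?B \<Otimes>\<^sub>M P) (E g) \<le> 3 * \<epsilon>" if g: "g \<in> S" for g
  proof -
    show "E g \<in> sets (?B \<Otimes>\<^sub>M P)"
      unfolding E_def by (intro sets.Un Em[OF g])
    have "measure (?B \<Otimes>\<^sub>M P) (E g) \<le> measure (?B \<Otimes>\<^sub>M P) {z \<in> space (?B \<Otimes>\<^sub>M P). fst (fst z) \<in> N g}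
      + measure (?B \<Otimes>\<^sub>M P) {z \<in> space (?B \<Otimes>\<^sub>M P). R z \<in> N g} + measure (?B \<Otimes>\<^sub>M P) {z \<in> space (?B \<Otimes>\<^sub>M P). snd (fst z) \<in> H0}"
      unfolding E_def by (intro order_trans[OF measure_Un_le] add_mono order_refl sets.Un Em[OF g])
    also have "measure (?B \<Otimes>\<^sub>M P) {z \<in> space (?B \<Otimes>\<^sub>M P). fst (fst z) \<in> N g} = measure P (N g)"
      using measure_mp[OF ff, of "\<lambda>y. y \<in> N g"] N[OF g] by (simp add: Nset)
    also have "measure (?B \<Otimes>\<^sub>M P) {z \<in> space (?B \<Otimes>\<^sub>M P). R z \<in> N g} = measure P (N g)"
      using measure_mp[OF R RP, of "\<lambda>y. y \<in> N g"] N[OF g] by (simp add: Nset)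
    also have "measure (?B \<Otimes>\<^sub>M P) {z \<in> space (?B \<Otimes>\<^sub>M P). snd (fst z) \<in> H0} = measure (mask t) H0"
      using measure_mp[OF fm, of "\<lambda>y. y \<in> H0"] H0 by (simp add: Hset)
    also have "measure (mask t) H0 \<le> \<epsilon>"
      using mask_hit[OF F0(1,2) t] F0(3) by (simp add: H0_def)
    finally show "measure (?B \<Otimes>\<^sub>M P) (E g) \<le> 3 * \<epsilon>"
      using W_close[OF g] by (simp add: N_def)
  qed
  have s_meas: "s g \<in> measurable ?B ?B" and s_distr: "distr ?B ?B (s g) = ?B" if g: "g \<in> S" for g
  proof -
    have sh: "(\<lambda>(y, M). shift H (w g y) M) \<in> measurable ?B (mask t)"
      unfolding case_prod_beta' MP[symmetric]
      by (intro M.shift_measurable measurable_compose[OF measurable_fst w_meas] gG g measurable_snd)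
    then show "s g \<in> measurable ?B ?B"
      unfolding s_def case_prod_beta'
      by (intro measurable_Pair measurable_compose[OF measurable_fst \<sigma>_meas] gG g)
    show "distr ?B ?B (s g) = ?B"
      unfolding s_def
    proof (rule distr_skew[OF P.prob_space_axioms prob_mask \<sigma>_meas \<sigma>_distr sh])
      fix y assume "y \<in> space P"
      then show "distr (mask t) (mask t) (shift H (w g y)) = mask t"
        unfolding MP[symmetric] by (intro M.distr_shift w_in gG g)
    qed (use gG g in auto)
  qed
  have "\<kappa> * (1 - (\<integral>b. \<integral>x. (\<integral>u. f (x, R (b, u)) \<partial>P)\<^sup>2 \<partial>X \<partial>?B)) \<le> c + (1 + 1 / c) * (3 * (4 * (3 * \<epsilon>) + \<delta> + 0))"
  \<comment> \<open>Taking \<open>R\<close> itself for \<open>Rg g\<close> leaves no replacement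
    error; this is the summand 0.\<close>
  proof (rule resample_gap[where s=s and q=fst and Rg="\<lambda>_. R" and E=E])
    show "prob_space ?B" by (rule PM.prob_space_axioms)
    show "AE b in ?B. fst b \<in> Y" by (rule AE_pair_fst[OF prob_mask AE_Y])
    show "AE z in ?B \<Otimes>\<^sub>M P. z \<notin> E g \<longrightarrow> R (s g (fst z), shift H (w g (fst (fst z))) (snd z)) = \<sigma> g (R z)"
      if g: "g \<in> S" for g
      using AE_mp_map[OF ff AE_Y] AE_mp_map[OF R RP AE_Y] AE_space
    proof eventually_elim
      case (elim z)
      obtain y M u where z: "z = ((y, M), u)" by (metis surj_pair)
      have sp: "y \<in> space P" "M \<in> space (mask t)" "u \<in> space P"
        using elim by (auto simp: z space_pair_measure)
      show ?case
      proof
        assume "z \<notin> E g"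
        then have nE: "y \<notin> N g" "R z \<notin> N g" "M \<notin> H0"
          using elim by (auto simp: E_def z)
        have "W g (R z) = W g y"
        proof (rule W_loc[OF g])
          show "R z h = y h" if "h \<in> F0" for h
            using nE(3) that F0 sp by (auto simp: R_def z nmix_def mix_def H0_def)
        qed (use elim Y_space sp in auto)
        then have eq: "w g (R z) = w g y"
          using nE sp elim Y_space by (auto simp: N_def)
        have "\<sigma> g (R z) = shift H (w g y) (R z)"
          using \<sigma>_eq[OF gG[OF g] elim(2)] eq by simp
        also have "\<dots> = nmix (shift H (w g y) M) (shift H (w g y) y) (shift H (w g y) u)"
          using sp g by (simp add: R_def z nmix_shift w_in gG)
        also have "shift H (w g y) y = \<sigma> g y"
          using \<sigma>_eq[OF gG[OF g], of y] elim(1) by (simp add: z)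
        finally show "R (s g (fst z), shift H (w g (fst (fst z))) (snd z)) = \<sigma> g (R z)"
          by (simp add: R_def s_def z)
      qed
    qed
    show "AE b in ?B. fst (s g b) = \<sigma> g (fst b)" for g
      by (simp add: s_def case_prod_beta)
    show "R (b, u) h = R (b, v) h" if "u h = v h" for b u v h
      using that by (simp add: R_def nmix_def mix_def)
  qed (use s_meas s_distr R RP E c in auto)
  \<comment> \<open>For a fixed mask, averaging over u is the projection to the unmarked
    coordinates.\<close>
  moreover have "(\<integral>b. \<integral>x. (\<integral>u. f (x, R (b, u)) \<partial>P)\<^sup>2 \<partial>X \<partial>?B) = (\<integral>M. Phi {h. \<not> M h} \<partial>mask t)"
  proof -
    define K where "K z = (\<integral>x. (\<integral>u. f (x, R (z, u)) \<partial>P)\<^sup>2 \<partial>X)" for z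
    have "(\<lambda>z. f (snd (fst z), R (fst (fst z), snd z))) \<in> bmeas ((?B \<Otimes>\<^sub>M X) \<Otimes>\<^sub>M P)"
      by (intro f_comp measurable_compose[OF _ R]) measurable
    from X.bmeas_integral[OF bmeas_power2[OF P.bmeas_integral[OF this]]]
    have K: "K \<in> bmeas ?B" by (simp add: K_def[abs_def])
    have "(\<integral>b. K b \<partial>?B) = (\<integral>y. \<integral>M. K (y, M) \<partial>mask t \<partial>P)"
      by (rule int_pair[OF P.prob_space_axioms prob_mask K])
    also have "\<dots> = (\<integral>M. \<integral>y. K (y, M) \<partial>P \<partial>mask t)"
      by (rule int_swap[OF P.prob_space_axioms prob_mask K])
    also have "\<dots> = (\<integral>M. Phi {h. \<not> M h} \<partial>mask t)"
      by (simp add: K_def Phi_eq favg_def avg_def R_def nmix_def)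
    finally show ?thesis by (simp add: K_def)
  qed
  ultimately show ?thesis by simp
qed

end

subsection \<open>From noise to a finite set of coordinates\<close>

lemma sq_sum5: "(a + b + c + d + e)\<^sup>2 \<le> 5 * (a\<^sup>2 + b\<^sup>2 + c\<^sup>2 + d\<^sup>2 + e\<^sup>2)" for a b c d e :: real
proof -
  have "0 \<le> (a - b)\<^sup>2 + (a - c)\<^sup>2 + (a - d)\<^sup>2 + (a - e)\<^sup>2 + (b - c)\<^sup>2 + (b - d)\<^sup>2 + (b - e)\<^sup>2
     + (c - d)\<^sup>2 + (c - e)\<^sup>2 + (d - e)\<^sup>2" by simp
  then show ?thesis by (simp add: power2_eq_square algebra_simps)
qed

context test_fun
begin

lemma Phi_Int: "Phi C = Phi (C \<inter> I)"
proof -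
  have "mix I C y u = mix I (C \<inter> I) y u" for y u :: "'l \<Rightarrow> 'z"
    by (auto simp: mix_def fun_eq_iff)
  then show ?thesis
    by (simp add: Phi_def energy_def bil_def avg_def)
qed

text \<open>Ignoring the marks outside D keeps more coordinates and can only increase
  \<open>Phi\<close>. What remains depends on the finite set of unmarked elements of D; in its
  Moebius expansion the term of A is present exactly when no element of A is marked, which has
  probability (1 - t)^card A.\<close>

lemma noise_expand:
  assumes t: "0 \<le> t" "t \<le> 1" and D: "finite D" "D \<subseteq> I"
  shows "(\<integral>M. Phi {h. \<not> M h} \<partial>mask t) \<le> (\<Sum>A\<in>Pow D. (1 - t) ^ card A * mob (\<lambda>B. Phi ((I - D) \<union> B)) A)"
proof -
  interpret MM: prob_space "mask t" by (rule prob_mask)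
  let ?\<mu> = "mob (\<lambda>B. Phi ((I - D) \<union> B))"
  have pos: "0 \<le> ?\<mu> A" if "A \<in> Pow D" for A
    using that D by (intro mob_Phi_nonneg) (auto intro: finite_subset)
  define av where "av A = {M \<in> space (mask t). \<forall>h\<in>A. \<not> M h}" for A
  have av: "av A \<in> sets (mask t)" if "A \<in> Pow D" for A
  proof -
    have "av A = space (mask t) - (\<Union>h\<in>A. {M \<in> space (mask t). M h})"
      by (auto simp: av_def)
    also have "\<dots> \<in> sets (mask t)"
      using that D mask_coord by (intro sets.Diff sets.finite_UN) (auto simp: pred_def subset_iff intro: finite_subset)
    finally show ?thesis .
  qed
  have int: "integrable (mask t) (\<lambda>M. indicator (av A) M * ?\<mu> A)" if "A \<in> Pow D" for A
    by (intro MM.integrable_bmeas bmeas_mult bmeas_indicator bmeas_const av that)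
  have pw: "Phi {h. \<not> M h} \<le> (\<Sum>A\<in>Pow D. indicator (av A) M * ?\<mu> A)" if M: "M \<in> space (mask t)" for M
  proof -
    have "Phi {h. \<not> M h} = Phi ({h. \<not> M h} \<inter> I)" by (rule Phi_Int)
    also have "\<dots> \<le> Phi ((I - D) \<union> {h \<in> D. \<not> M h})"
      by (rule Phi_mono) auto
    also have "\<dots> = (\<Sum>A\<in>Pow {h \<in> D. \<not> M h}. ?\<mu> A)"
      using D by (subst sum_mob) auto
    also have "\<dots> = (\<Sum>A\<in>Pow D. indicator (av A) M * ?\<mu> A)"
      using D M by (intro sum.mono_neutral_cong_left) (auto simp: av_def indicator_def)
    finally show ?thesis .
  qed
  have rhs: "(\<integral>M. (\<Sum>A\<in>Pow D. indicator (av A) M * ?\<mu> A) \<partial>mask t) = (\<Sum>A\<in>Pow D. (1 - t) ^ card A * ?\<mu> A)"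
  proof -
    have "(\<integral>M. (\<Sum>A\<in>Pow D. indicator (av A) M * ?\<mu> A) \<partial>mask t) = (\<Sum>A\<in>Pow D. \<integral>M. indicator (av A) M * ?\<mu> A \<partial>mask t)"
      by (rule Bochner_Integration.integral_sum[OF int])
    also have "\<dots> = (\<Sum>A\<in>Pow D. (1 - t) ^ card A * ?\<mu> A)"
    proof (rule sum.cong[OF refl])
      fix A assume A: "A \<in> Pow D"
      then have "measure (mask t) (av A) = (1 - t) ^ card A"
        unfolding av_def using D t by (intro mask_avoid) (auto intro: finite_subset)
      then show "(\<integral>M. indicator (av A) M * ?\<mu> A \<partial>mask t) = (1 - t) ^ card A * ?\<mu> A"
        using av[OF A] by simp
    qed
    finally show ?thesis .
  qed
  show ?thesis
  proof (cases "integrable (mask t) (\<lambda>M. Phi {h. \<not> M h})")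
    case True
    then have "(\<integral>M. Phi {h. \<not> M h} \<partial>mask t) \<le> (\<integral>M. (\<Sum>A\<in>Pow D. indicator (av A) M * ?\<mu> A) \<partial>mask t)"
      by (intro integral_mono pw Bochner_Integration.integrable_sum int)
    then show ?thesis by (simp only: rhs)
  next
    \<comment> \<open>Without integrability the left side is 0 by convention, and all terms on the
      right are nonnegative.\<close>
    case False
    then show ?thesis
      using t pos by (auto simp: not_integrable_integral_eq intro!: sum_nonneg mult_nonneg_nonneg)
  qed
qed

lemma law_int:
  assumes M: "prob_space M" and T: "T \<in> measurable M P" "distr M P T = P" and Q: "Q \<in> bmeas (X \<Otimes>\<^sub>M P)"
  shows "(\<integral>z. \<integral>x. Q (x, T z) \<partial>X \<partial>M) = (\<integral>y. \<integral>x. Q (x, y) \<partial>X \<partial>P)"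
proof -
  have "(\<lambda>z. Q (snd z, fst z)) \<in> bmeas (P \<Otimes>\<^sub>M X)"
    by (rule bmeas_compose[OF Q]) measurable
  from X.bmeas_integral[OF this] show ?thesis
    using integral_mp[OF T, of "\<lambda>y. \<integral>x. Q (x, y) \<partial>X"] by (simp add: bmeas_measurable)
qed

lemma distr_fst_PP: "distr (P \<Otimes>\<^sub>M P) P fst = P"
  by (rule P.distr_pair_fst)

text \<open>Resampling off \<open>F\<close> does not commute with \<open>\<sigma> g\<close>, since \<open>F\<close> is moved by \<open>W g\<close>; but the moved set
  differs from \<open>F\<close> only inside the shell \<open>F2 - F1\<close>, on which \<open>f\<close> hardly depends.\<close>

lemma local_step:
  assumes F0: "F0 \<subseteq> F1" and F: "F1 \<subseteq> F" "F \<subseteq> F2" "F \<subseteq> I"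
    and Q: "finite Q" "Q \<subseteq> I" "Q \<noteq> {}"
    and QF: "\<And>l. l \<in> Q \<Longrightarrow> F1 \<subseteq> (\<lambda>b. inv l \<otimes> b) ` F" "\<And>l. l \<in> Q \<Longrightarrow> (\<lambda>b. inv l \<otimes> b) ` F \<subseteq> F2"
    and W: "\<And>g. g \<in> S \<Longrightarrow> W g \<in> measurable P (count_space Q)"
    and W_loc: "\<And>g y y'. g \<in> S \<Longrightarrow> y \<in> space P \<Longrightarrow> y' \<in> space P \<Longrightarrow> (\<And>h. h \<in> F0 \<Longrightarrow> y h = y' h) \<Longrightarrow> W g y = W g y'"
    and W_close: "\<And>g. g \<in> S \<Longrightarrow> P.prob {y \<in> space P. w g y \<noteq> W g y} \<le> \<epsilon>"
    and infl: "1 - Phi (I - (F2 - F1)) \<le> \<epsilon>'"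
    and c: "c > 0"
  shows "\<kappa> * (1 - Phi F) \<le> c + (1 + 1 / c) * (3 * (4 * (2 * \<epsilon>) + \<delta> + 4 * \<epsilon>'))"
proof -
  define R where "R z = mix I F (fst z) (snd z)" for z :: "('l \<Rightarrow> 'z) \<times> ('l \<Rightarrow> 'z)"
  define C where "C l = (\<lambda>b. inv l \<otimes> b) ` F" for l
  \<comment> \<open>The kept set is F pulled back by l = \<open>W g y\<close>, so that the shift by
    l carries it exactly to F and turns this point into \<open>R\<close> at the moved data.\<close>
  define Rg where "Rg g z = mix I (C (W g (fst z))) (fst z) (snd z)" for g and z :: "('l \<Rightarrow> 'z) \<times> ('l \<Rightarrow> 'z)"
  have gG: "g \<in> carrier G" if "g \<in> S" for g using that S by auto
  have R: "R \<in> measurable (P \<Otimes>\<^sub>M P) P" "distr (P \<Otimes>\<^sub>M P) P R = P"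
    unfolding R_def[abs_def] by (measurable, rule distr_mix)
  have Wf: "(\<lambda>z. W g (fst z)) \<in> measurable (P \<Otimes>\<^sub>M P) (count_space Q)" if "g \<in> S" for g
    by (rule measurable_compose[OF measurable_fst W[OF that]])
  have Wsp: "W g y \<in> Q" if "g \<in> S" "y \<in> space P" for g y
    using measurable_space[OF W[OF that(1)] that(2)] by simp
  have C: "F1 \<subseteq> C l" "C l \<subseteq> F2" if "l \<in> Q" for l
    using QF[OF that] by (simp_all add: C_def)
  have Rg: "Rg g \<in> measurable (P \<Otimes>\<^sub>M P) P" if "g \<in> S" for g
    unfolding Rg_def
    by (rule measurable_compose_countable'[OF _ Wf[OF that] countable_finite[OF Q(1)]]) measurable
  \<comment> \<open>\<open>W g\<close> reads only \<open>F0\<close>, which is contained in every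
    pulled back set, so the resampling does not disturb the choice of l that it depends on.\<close>
  have WRg: "W g (Rg g z) = W g (fst z)" if g: "g \<in> S" and z: "z \<in> space (P \<Otimes>\<^sub>M P)" for g z
  proof (rule W_loc[OF g])
    show "Rg g z \<in> space P" using measurable_space[OF Rg[OF g] z] .
    show "fst z \<in> space P" using z by (auto simp: space_pair_measure)
    show "Rg g z h = fst z h" if "h \<in> F0" for h
    proof -
      have "W g (fst z) \<in> Q" using z by (intro Wsp g) (auto simp: space_pair_measure)
      then have "h \<in> C (W g (fst z))" using C(1) that F0 by auto
      moreover have "h \<in> I" using that F0 F by auto
      ultimately show ?thesis by (simp add: Rg_def mix_def)
    qed
  qed
  have lev: "{y \<in> space P. W g y = l} \<in> sets P" if "g \<in> S" "l \<in> Q" for g l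
  proof -
    have "W g -` {l} \<inter> space P \<in> sets P"
      using that by (intro measurable_sets[OF W]) auto
    then show ?thesis by (simp add: vimage_def Int_def conj_commute)
  qed
  \<comment> \<open>For each value l of \<open>W g\<close> the map is an ordinary \<open>mix\<close>
    with a fixed set, and it preserves that value. The pieces are summed over the finite set
    Q.\<close>
  have Rg_distr: "distr (P \<Otimes>\<^sub>M P) P (Rg g) = P" if g: "g \<in> S" for g
  proof (rule distr_eqI[OF PP.prob_space_axioms P.prob_space_axioms Rg[OF g]])
    fix A assume A: "A \<in> sets P"
    let ?i = "\<lambda>l. indicator (A \<inter> {y \<in> space P. W g y = l}) :: _ \<Rightarrow> real"
    have i: "?i l \<in> bmeas P" if "l \<in> Q" for l
      by (intro bmeas_indicator sets.Int A lev g that)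
    have ind: "indicator A y = (\<Sum>l\<in>Q. ?i l y)" if y: "y \<in> space P" for y
    proof -
      have "(\<Sum>l\<in>Q. ?i l y) = (\<Sum>l\<in>Q. if l = W g y then indicator A y else 0)"
        using y by (intro sum.cong) (auto simp: indicator_def)
      then show ?thesis using Q Wsp[OF g y] by simp
    qed
    have "(\<integral>z. indicator A (Rg g z) \<partial>(P \<Otimes>\<^sub>M P)) = (\<integral>z. (\<Sum>l\<in>Q. ?i l (mix I (C l) (fst z) (snd z))) \<partial>(P \<Otimes>\<^sub>M P))"
    proof (rule Bochner_Integration.integral_cong[OF refl])
      fix z assume z: "z \<in> space (P \<Otimes>\<^sub>M P)"
      have zP: "fst z \<in> space P" "snd z \<in> space P" using z by (auto simp: space_pair_measure)
      have "?i l (mix I (C l) (fst z) (snd z)) = (if l = W g (fst z) then indicator A (Rg g z) else 0)" if l: "l \<in> Q" for l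
      proof -
        have "W g (mix I (C l) (fst z) (snd z)) = W g (fst z)"
        proof (rule W_loc[OF g])
          show "mix I (C l) (fst z) (snd z) h = fst z h" if "h \<in> F0" for h
            using that F0 F C(1)[OF l] by (auto simp: mix_def)
        qed (use zP in \<open>auto intro: mix_in_space\<close>)
        then show ?thesis
          using zP by (auto simp: indicator_def Rg_def mix_in_space)
      qed
      then show "indicator A (Rg g z) = (\<Sum>l\<in>Q. ?i l (mix I (C l) (fst z) (snd z)))"
        using Q Wsp[OF g zP(1)] by simp
    qed
    also have "\<dots> = (\<Sum>l\<in>Q. \<integral>z. ?i l (mix I (C l) (fst z) (snd z)) \<partial>(P \<Otimes>\<^sub>M P))"
      by (intro Bochner_Integration.integral_sum PP.integrable_bmeas bmeas_mix i)
    also have "\<dots> = (\<Sum>l\<in>Q. \<integral>y. ?i l y \<partial>P)"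
    proof (rule sum.cong[OF refl])
      fix l assume l: "l \<in> Q"
      show "(\<integral>z. ?i l (mix I (C l) (fst z) (snd z)) \<partial>(P \<Otimes>\<^sub>M P)) = (\<integral>y. ?i l y \<partial>P)"
        using int_pair[OF P.prob_space_axioms P.prob_space_axioms bmeas_mix[OF i[OF l]]] int_mix[OF i[OF l]] by simp
    qed
    also have "\<dots> = (\<integral>y. (\<Sum>l\<in>Q. ?i l y) \<partial>P)"
      by (intro Bochner_Integration.integral_sum[symmetric] P.integrable_bmeas i)
    also have "\<dots> = (\<integral>y. indicator A y \<partial>P)"
      using ind by (intro Bochner_Integration.integral_cong) auto
    finally show "(\<integral>z. indicator A (Rg g z) \<partial>(P \<Otimes>\<^sub>M P)) = (\<integral>y. indicator A y \<partial>P :: real)" .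
  qed
  define N where "N g = {y \<in> space P. w g y \<noteq> W g y}" for g
  have Nm: "N g \<in> sets P" if "g \<in> S" for g
  proof -
    have "W g \<in> measurable P (count_space I)"
      by (rule measurable_compose[OF W[OF that], where g="\<lambda>x. x", simplified]) (use Q in auto)
    then show ?thesis
      unfolding N_def using that by (intro neq_sets[where A="carrier H"] w_meas gG countable_H)
  qed
  define E where "E g = {z \<in> space (P \<Otimes>\<^sub>M P). fst z \<in> N g} \<union> {z \<in> space (P \<Otimes>\<^sub>M P). Rg g z \<in> N g}" for g
  have Em: "{z \<in> space (P \<Otimes>\<^sub>M P). fst z \<in> N g} \<in> sets (P \<Otimes>\<^sub>M P)"
     "{z \<in> space (P \<Otimes>\<^sub>M P). Rg g z \<in> N g} \<in> sets (P \<Otimes>\<^sub>M P)" if "g \<in> S" for g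
    using measurable_sets[OF measurable_fst Nm[OF that], of P] measurable_sets[OF Rg[OF that] Nm[OF that]]
    by (simp_all add: vimage_def Int_def conj_commute)
  have Nset: "{y \<in> space P. y \<in> N g} = N g" for g by (auto simp: N_def)
  have E: "E g \<in> sets (P \<Otimes>\<^sub>M P)" "measure (P \<Otimes>\<^sub>M P) (E g) \<le> 2 * \<epsilon>" if g: "g \<in> S" for g
  proof -
    show "E g \<in> sets (P \<Otimes>\<^sub>M P)"
      unfolding E_def by (intro sets.Un Em[OF g])
    have "measure (P \<Otimes>\<^sub>M P) (E g) \<le> measure (P \<Otimes>\<^sub>M P) {z \<in> space (P \<Otimes>\<^sub>M P). fst z \<in> N g}
      + measure (P \<Otimes>\<^sub>M P) {z \<in> space (P \<Otimes>\<^sub>M P). Rg g z \<in> N g}"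
      unfolding E_def by (intro measure_Un_le Em[OF g])
    also have "measure (P \<Otimes>\<^sub>M P) {z \<in> space (P \<Otimes>\<^sub>M P). fst z \<in> N g} = measure P (N g)"
      using measure_mp[OF measurable_fst distr_fst_PP, of "\<lambda>y. y \<in> N g"] Nm[OF g] by (simp add: Nset)
    also have "measure (P \<Otimes>\<^sub>M P) {z \<in> space (P \<Otimes>\<^sub>M P). Rg g z \<in> N g} = measure P (N g)"
      using measure_mp[OF Rg[OF g] Rg_distr[OF g], of "\<lambda>y. y \<in> N g"] Nm[OF g] by (simp add: Nset)
    finally show "measure (P \<Otimes>\<^sub>M P) (E g) \<le> 2 * \<epsilon>"
      using W_close[OF g] by (simp add: N_def)
  qed
  \<comment> \<open>On K the points \<open>R z\<close> and \<open>Rg g z\<close> coincide, since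
    both kept sets contain \<open>F1\<close> and are contained in \<open>F2\<close>. Each value of f
    is therefore compared with the common value of \<open>favg K\<close>, and
    \<open>sq_diff_le\<close> turns two errors \<epsilon>' into 4 \<epsilon>'.\<close>
  define K where "K = I - (F2 - F1)"
  define h where "h z = (f z - favg K z)\<^sup>2" for z
  have h: "h \<in> bmeas (X \<Otimes>\<^sub>M P)"
    unfolding h_def[abs_def] by (intro bmeas_power2 bmeas_diff f favg_bmeas)
  have h_int: "(\<integral>z. \<integral>x. h (x, T z) \<partial>X \<partial>(P \<Otimes>\<^sub>M P)) \<le> \<epsilon>'"
    if "T \<in> measurable (P \<Otimes>\<^sub>M P) P" "distr (P \<Otimes>\<^sub>M P) P T = P" for T
    using law_int[OF PP.prob_space_axioms that h] infl Phi_dist[of K] by (simp add: h_def K_def)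
  have close: "(\<integral>z. \<integral>x. (f (x, Rg g z) - f (x, R z))\<^sup>2 \<partial>X \<partial>(P \<Otimes>\<^sub>M P)) \<le> 4 * \<epsilon>'" if g: "g \<in> S" for g
  proof -
    have hT: "(\<lambda>z. h (snd z, T (fst z))) \<in> bmeas ((P \<Otimes>\<^sub>M P) \<Otimes>\<^sub>M X)" if "T \<in> measurable (P \<Otimes>\<^sub>M P) P" for T
      by (intro bmeas_compose[OF h] measurable_Pair measurable_compose[OF measurable_fst that] measurable_snd)
    have fT: "(\<lambda>z. f (snd z, T (fst z))) \<in> bmeas ((P \<Otimes>\<^sub>M P) \<Otimes>\<^sub>M X)" if "T \<in> measurable (P \<Otimes>\<^sub>M P) P" for T
      by (intro f_comp measurable_compose[OF measurable_fst that] measurable_snd)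
    have i1: "(\<lambda>z. \<integral>x. h (x, T z) \<partial>X) \<in> bmeas (P \<Otimes>\<^sub>M P)" if "T \<in> measurable (P \<Otimes>\<^sub>M P) P" for T
      using X.bmeas_integral[OF hT[OF that]] by simp
    have sq: "(\<lambda>z. (f (snd z, Rg g (fst z)) - f (snd z, R (fst z)))\<^sup>2) \<in> bmeas ((P \<Otimes>\<^sub>M P) \<Otimes>\<^sub>M X)"
      by (intro bmeas_power2 bmeas_diff fT Rg g R)
    have "(\<integral>z. \<integral>x. (f (x, Rg g z) - f (x, R z))\<^sup>2 \<partial>X \<partial>(P \<Otimes>\<^sub>M P))
        \<le> (\<integral>z. 2 * (\<integral>x. h (x, Rg g z) \<partial>X) + 2 * (\<integral>x. h (x, R z) \<partial>X) \<partial>(P \<Otimes>\<^sub>M P))"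
    proof (rule integral_mono)
      show "integrable (P \<Otimes>\<^sub>M P) (\<lambda>z. \<integral>x. (f (x, Rg g z) - f (x, R z))\<^sup>2 \<partial>X)"
        using PP.integrable_bmeas[OF X.bmeas_integral[OF sq]] by simp
      show "integrable (P \<Otimes>\<^sub>M P) (\<lambda>z. 2 * (\<integral>x. h (x, Rg g z) \<partial>X) + 2 * (\<integral>x. h (x, R z) \<partial>X))"
        by (intro PP.integrable_bmeas bmeas_add bmeas_scale i1 Rg g R)
      fix z assume z: "z \<in> space (P \<Otimes>\<^sub>M P)"
      have ix: "integrable X (\<lambda>x. h (x, T z))" if "T \<in> measurable (P \<Otimes>\<^sub>M P) P" for T
        using X.integrable_bmeas[OF bmeas_section[OF hT[OF that] z]] by simp
      have "favg K (x, Rg g z) = favg K (x, R z)" for x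
        unfolding favg_def
      proof (simp, rule avg_local)
        fix k assume k: "k \<in> I" "k \<in> K"
        have "W g (fst z) \<in> Q" using z by (intro Wsp g) (auto simp: space_pair_measure)
        then show "Rg g z k = R z k"
          using k F C[of "W g (fst z)"] by (auto simp: Rg_def R_def mix_def K_def)
      qed
      then have "(f (x, Rg g z) - f (x, R z))\<^sup>2 \<le> 2 * h (x, Rg g z) + 2 * h (x, R z)" for x
        using sq_diff_le[of "f (x, Rg g z) - favg K (x, Rg g z)" "f (x, R z) - favg K (x, R z)"]
        by (simp add: h_def)
      then have "(\<integral>x. (f (x, Rg g z) - f (x, R z))\<^sup>2 \<partial>X) \<le> (\<integral>x. 2 * h (x, Rg g z) + 2 * h (x, R z) \<partial>X)"
        using X.integrable_bmeas[OF bmeas_section[OF sq z]] ix[OF Rg[OF g]] ix[OF R(1)]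
        by (intro integral_mono) auto
      also have "\<dots> = 2 * (\<integral>x. h (x, Rg g z) \<partial>X) + 2 * (\<integral>x. h (x, R z) \<partial>X)"
        using ix[OF Rg[OF g]] ix[OF R(1)] by simp
      finally show "(\<integral>x. (f (x, Rg g z) - f (x, R z))\<^sup>2 \<partial>X) \<le> \<dots>" .
    qed
    also have "\<dots> = 2 * (\<integral>z. \<integral>x. h (x, Rg g z) \<partial>X \<partial>(P \<Otimes>\<^sub>M P)) + 2 * (\<integral>z. \<integral>x. h (x, R z) \<partial>X \<partial>(P \<Otimes>\<^sub>M P))"
      using PP.integrable_bmeas[OF i1[OF Rg[OF g]]] PP.integrable_bmeas[OF i1[OF R(1)]] by simp
    also have "\<dots> \<le> 4 * \<epsilon>'"
      using h_int[OF Rg[OF g] Rg_distr[OF g]] h_int[OF R] by simp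
    finally show ?thesis .
  qed
  have "\<kappa> * (1 - (\<integral>b. \<integral>x. (\<integral>u. f (x, R (b, u)) \<partial>P)\<^sup>2 \<partial>X \<partial>P)) \<le> c + (1 + 1 / c) * (3 * (4 * (2 * \<epsilon>) + \<delta> + 4 * \<epsilon>'))"
  proof (rule resample_gap[where s=\<sigma> and q="\<lambda>y. y" and Rg=Rg and E=E])
    show "AE z in P \<Otimes>\<^sub>M P. z \<notin> E g \<longrightarrow> R (\<sigma> g (fst z), shift H (w g (fst z)) (snd z)) = \<sigma> g (Rg g z)"
      if g: "g \<in> S" for g
      using AE_mp_map[OF measurable_fst distr_fst_PP AE_Y] AE_mp_map[OF Rg[OF g] Rg_distr[OF g] AE_Y] AE_space
    proof eventually_elim
      case (elim z)
      have sp: "fst z \<in> space P" "snd z \<in> space P" using elim by (auto simp: space_pair_measure)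
      let ?l = "w g (fst z)"
      have l: "?l \<in> I" using sp by (intro w_in gG g)
      show ?case
      proof
        assume "z \<notin> E g"
        then have "fst z \<notin> N g" "Rg g z \<notin> N g" using elim by (auto simp: E_def)
        then have eqs: "W g (fst z) = ?l" "w g (Rg g z) = ?l"
          using elim sp Y_space WRg[OF g] by (auto simp: N_def)
        have CF: "(\<lambda>b. ?l \<otimes> b) ` C ?l = F"
        proof -
          have "(\<lambda>b. ?l \<otimes> b) ` C ?l = (\<lambda>b. b) ` F"
            unfolding C_def image_image using F l by (intro image_cong) (auto simp: H.m_assoc[symmetric] subset_iff)
          then show ?thesis by simp
        qed
        have "\<sigma> g (Rg g z) = shift H ?l (Rg g z)"
          using \<sigma>_eq[OF gG[OF g] elim(2)] eqs by simp
        also have "\<dots> = mix I F (shift H ?l (fst z)) (shift H ?l (snd z))"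
          unfolding Rg_def eqs
          using shift_mix[of ?l "C ?l" "fst z" "snd z"] l F CF by (auto simp: C_def)
        also have "shift H ?l (fst z) = \<sigma> g (fst z)"
          using \<sigma>_eq[OF gG[OF g] elim(1)] by simp
        finally show "R (\<sigma> g (fst z), shift H ?l (snd z)) = \<sigma> g (Rg g z)"
          by (simp add: R_def)
      qed
    qed
    show "R (b, u) h = R (b, v) h" if "u h = v h" for b u v h
      using that by (simp add: R_def mix_def)
  qed (use gG \<sigma>_meas \<sigma>_distr AE_Y P.prob_space_axioms R Rg Rg_distr E close c in auto)
  moreover have "(\<integral>b. \<integral>x. (\<integral>u. f (x, R (b, u)) \<partial>P)\<^sup>2 \<partial>X \<partial>P) = Phi F"
    by (simp add: Phi_eq favg_def avg_def R_def)
  ultimately show ?thesis by simp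
qed

end

section \<open>Locality, a far group element and a small mean are incompatible\<close>

context test_fun
begin

lemma favg_norm_le:
  assumes y: "y \<in> space P"
  shows "(\<integral>x. (favg C (x, y))\<^sup>2 \<partial>X) \<le> 1"
proof -
  have b: "(\<lambda>z. (f (fst z, mix I C y (snd z)))\<^sup>2) \<in> bmeas (X \<Otimes>\<^sub>M P)"
    using y by (intro bmeas_power2 f_comp) measurable
  have "(\<integral>x. (favg C (x, y))\<^sup>2 \<partial>X) \<le> (\<integral>x. \<integral>u. (f (x, mix I C y u))\<^sup>2 \<partial>P \<partial>X)"
  proof (rule integral_mono)
    show "integrable X (\<lambda>x. (favg C (x, y))\<^sup>2)"
      using y by (intro X.integrable_bmeas bmeas_power2 bmeas_compose[OF favg_bmeas]) auto
    show "integrable X (\<lambda>x. \<integral>u. (f (x, mix I C y u))\<^sup>2 \<partial>P)"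
      using X.integrable_bmeas[OF P.bmeas_integral[OF b]] by simp
    fix x assume x: "x \<in> space X"
    show "(favg C (x, y))\<^sup>2 \<le> (\<integral>u. (f (x, mix I C y u))\<^sup>2 \<partial>P)"
      using P.power2_integral_le[OF bmeas_mix1[OF f_sec[OF x] y, of C]] by (simp add: favg_def avg_def)
  qed
  also have "\<dots> = (\<integral>u. \<integral>x. (f (x, mix I C y u))\<^sup>2 \<partial>X \<partial>P)"
    using swapXP[OF b] by simp
  also have "\<dots> = (\<integral>u. 1 \<partial>P)"
    using y by (intro Bochner_Integration.integral_cong refl f_norm mix_in_space)
  finally show ?thesis by (simp add: P.prob_space)
qed

lemma integral_favg: "x \<in> space X \<Longrightarrow> (\<integral>y. favg C (x, y) \<partial>P) = (\<integral>y. f (x, y) \<partial>P)"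
  unfolding favg_def avg_def using int_mix[OF f_sec] by simp

text \<open>\<open>f\<close> is almost a function of the coordinates in \<open>F\<close>, and \<open>f \<circ> (\<alpha> g \<times> \<sigma> g)\<close> almost one of the
  coordinates in a translate of \<open>F\<close> disjoint from it, hence nearly independent of the former.\<close>

lemma final_step:
  assumes g: "g \<in> carrier G"
    and g_inv: "(\<integral>y. \<integral>x. (f (\<alpha> g x, \<sigma> g y) - f (x, y))\<^sup>2 \<partial>X \<partial>P) \<le> 1 / 100"
    and F: "F \<subseteq> I" "1 - Phi F \<le> 1 / 100"
    and A: "finite A" "A \<subseteq> I" "\<And>l. l \<in> A \<Longrightarrow> (\<lambda>b. inv l \<otimes> b) ` F \<inter> F = {}"
    and w_A: "P.prob {y \<in> space P. w g y \<notin> A} \<le> 1 / 5"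
    and flat: "(\<integral>x. (\<integral>y. f (x, y) \<partial>P)\<^sup>2 \<partial>X) \<le> \<eta>" "real (card A) * \<eta> \<le> 1 / 10"
  shows False
proof -
  let ?PP = "P \<Otimes>\<^sub>M P"
  define \<theta> where "\<theta> z = mix I F (fst z) (snd z)" for z :: "('l \<Rightarrow> 'z) \<times> ('l \<Rightarrow> 'z)"
  have \<theta>: "\<theta> \<in> measurable ?PP P" "distr ?PP P \<theta> = P"
    unfolding \<theta>_def[abs_def] by (measurable, rule distr_mix)
  note fst_law = measurable_fst[of P P] distr_fst_PP
  note [measurable] = \<theta>(1) \<alpha>_meas[OF g] \<sigma>_meas[OF g]
  have \<sigma>\<theta>: "(\<lambda>z. \<sigma> g (\<theta> z)) \<in> measurable ?PP P" "distr ?PP P (\<lambda>z. \<sigma> g (\<theta> z)) = P"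
  proof -
    show "(\<lambda>z. \<sigma> g (\<theta> z)) \<in> measurable ?PP P" by measurable
    have "distr (distr ?PP P \<theta>) P (\<sigma> g) = distr ?PP P (\<sigma> g \<circ> \<theta>)"
      by (rule distr_distr) measurable
    then show "distr ?PP P (\<lambda>z. \<sigma> g (\<theta> z)) = P"
      by (simp add: \<theta>(2) \<sigma>_distr[OF g] comp_def)
  qed
  let ?fl = "favg F"
  note fl = favg_bmeas[of F]
  have flc: "(\<lambda>z. ?fl (a z, b z)) \<in> bmeas M" if "a \<in> measurable M X" "b \<in> measurable M P" for a b and M :: "'c measure"
    using that by (intro bmeas_compose[OF fl] measurable_Pair)
  \<comment> \<open>A1 and B1 have squared norms 1 and \<open>Phi F\<close>, and inner product at
    most 3/10. Their squared distance is then at least 1 + 99/100 - 6/10, while approximate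
    invariance and locality bound it by 1/4.\<close>
  define A1 where "A1 z = f (\<alpha> g (snd z), \<sigma> g (fst (fst z)))" for z :: "(('l \<Rightarrow> 'z) \<times> ('l \<Rightarrow> 'z)) \<times> 'x"
  define B1 where "B1 z = ?fl (\<alpha> g (snd z), \<sigma> g (\<theta> (fst z)))" for z :: "(('l \<Rightarrow> 'z) \<times> ('l \<Rightarrow> 'z)) \<times> 'x"
  have A1: "A1 \<in> bmeas (?PP \<Otimes>\<^sub>M X)" and B1: "B1 \<in> bmeas (?PP \<Otimes>\<^sub>M X)"
    unfolding A1_def[abs_def] B1_def[abs_def] by (intro f_comp flc; measurable)+
  have spP: "fst z \<in> space P" "snd z \<in> space P" "\<theta> z \<in> space P" if "z \<in> space ?PP" for z
    using that measurable_space[OF \<theta>(1) that] by (auto simp: space_pair_measure)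
  have int_A: "(\<integral>z. \<integral>x. (A1 (z, x))\<^sup>2 \<partial>X \<partial>?PP) = 1"
  proof -
    have "(\<integral>x. (A1 (z, x))\<^sup>2 \<partial>X) = 1" if "z \<in> space ?PP" for z
      using f_norm_\<alpha>[OF g measurable_space[OF \<sigma>_meas[OF g] spP(1)[OF that]]] by (simp add: A1_def)
    then have "(\<integral>z. \<integral>x. (A1 (z, x))\<^sup>2 \<partial>X \<partial>?PP) = (\<integral>z. 1 \<partial>?PP)"
      by (intro Bochner_Integration.integral_cong) auto
    then show ?thesis by (simp add: PP.prob_space)
  qed
  have shift_\<alpha>: "(\<integral>x. q (\<alpha> g x, y) \<partial>X) = (\<integral>x. q (x, y) \<partial>X)" if "q \<in> bmeas (X \<Otimes>\<^sub>M P)" "y \<in> space P" for q y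
    using int_\<alpha>[OF g, of "\<lambda>x. q (x, y)"] bmeas_compose[OF that(1), of "\<lambda>x. (x, y)" X] that(2)
    by (simp add: bmeas_measurable)
  have \<alpha>_law: "(\<integral>z. \<integral>x. q (\<alpha> g x, T z) \<partial>X \<partial>?PP) = (\<integral>y. \<integral>x. q (x, y) \<partial>X \<partial>P)"
    if q: "q \<in> bmeas (X \<Otimes>\<^sub>M P)" and T: "T \<in> measurable ?PP P" "distr ?PP P T = P" for q T
  proof -
    have "(\<integral>z. \<integral>x. q (\<alpha> g x, T z) \<partial>X \<partial>?PP) = (\<integral>z. \<integral>x. q (x, T z) \<partial>X \<partial>?PP)"
      by (intro Bochner_Integration.integral_cong refl shift_\<alpha>[OF q] measurable_space[OF T(1)])
    then show ?thesis using law_int[OF PP.prob_space_axioms T q] by simp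
  qed
  have int_B: "(\<integral>z. \<integral>x. (B1 (z, x))\<^sup>2 \<partial>X \<partial>?PP) = Phi F"
    using \<alpha>_law[OF bmeas_power2[OF fl] \<sigma>\<theta>] by (simp add: B1_def Phi_eq)
  have iPP: "integrable ?PP (\<lambda>z. \<integral>x. q (z, x) \<partial>X)" if "q \<in> bmeas (?PP \<Otimes>\<^sub>M X)" for q
    using PP.integrable_bmeas[OF X.bmeas_integral[OF that]] .
  have iX: "integrable X (\<lambda>x. q (z, x))" if "q \<in> bmeas (?PP \<Otimes>\<^sub>M X)" "z \<in> space ?PP" for q z
    by (intro X.integrable_bmeas bmeas_section[OF that])
  have upper: "(\<integral>z. \<integral>x. A1 (z, x) * B1 (z, x) \<partial>X \<partial>?PP) \<le> 3 / 10"
  proof -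
    define Bad where "Bad = {y \<in> space P. w g y \<notin> A}"
    have Bad: "Bad \<in> sets P"
    proof -
      have "w g -` A \<inter> space P \<in> sets P"
        using A by (intro measurable_sets[OF w_meas[OF g]]) auto
      then have "space P - (w g -` A \<inter> space P) \<in> sets P" by auto
      moreover have "space P - (w g -` A \<inter> space P) = Bad" by (auto simp: Bad_def)
      ultimately show ?thesis by simp
    qed
    have Bad2: "(\<lambda>z. indicator Bad (\<theta> z) :: real) \<in> bmeas ?PP"
      by (rule bmeas_compose[OF bmeas_indicator[OF Bad] \<theta>(1)])
    \<comment> \<open>With l frozen, one factor reads only y and the other only u, so that the
      integral over both factorises into the square of the mean of f over y.\<close>
    define q where "q l z = A1 z * ?fl (\<alpha> g (snd z), shift H l (snd (fst z)))" for l and z :: "(('l \<Rightarrow> 'z) \<times> ('l \<Rightarrow> 'z)) \<times> 'x"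
    have q: "q l \<in> bmeas (?PP \<Otimes>\<^sub>M X)" if "l \<in> A" for l
    proof -
      have [measurable]: "shift H l \<in> measurable P P" using that A by (intro shift_measurable1) auto
      show ?thesis unfolding q_def[abs_def] by (intro bmeas_mult A1 flc) measurable
    qed
    have q_nonneg: "0 \<le> q l z" for l z
      unfolding q_def A1_def by (intro mult_nonneg_nonneg f_nonneg favg_nonneg)
    have q_int: "(\<integral>z. \<integral>x. q l (z, x) \<partial>X \<partial>?PP) \<le> \<eta>" if l: "l \<in> A" for l
    proof -
      have lI: "l \<in> I" using l A by auto
      note [measurable] = shift_measurable1[OF lI]
      define r where "r z = f (snd z, \<sigma> g (fst (fst z))) * ?fl (snd z, shift H l (snd (fst z)))" for z :: "(('l \<Rightarrow> 'z) \<times> ('l \<Rightarrow> 'z)) \<times> 'x"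
      have r: "r \<in> bmeas (?PP \<Otimes>\<^sub>M X)"
        unfolding r_def[abs_def] by (intro bmeas_mult f_comp flc) measurable
      have r3: "(\<lambda>z. f (fst z, \<sigma> g (fst (snd z))) * ?fl (fst z, shift H l (snd (snd z)))) \<in> bmeas (X \<Otimes>\<^sub>M ?PP)"
        by (intro bmeas_mult f_comp flc) measurable
      have "(\<integral>x. q l (z, x) \<partial>X) = (\<integral>x. r (z, x) \<partial>X)" if z: "z \<in> space ?PP" for z
        using int_\<alpha>[OF g, of "\<lambda>x. r (z, x)"] bmeas_section[OF r z]
        by (simp add: q_def r_def A1_def bmeas_measurable)
      then have "(\<integral>z. \<integral>x. q l (z, x) \<partial>X \<partial>?PP) = (\<integral>z. \<integral>x. r (z, x) \<partial>X \<partial>?PP)"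
        by (rule Bochner_Integration.integral_cong[OF refl])
      also have "\<dots> = (\<integral>x. \<integral>z. r (z, x) \<partial>?PP \<partial>X)"
        by (rule int_swap[OF PP.prob_space_axioms prob_X r])
      also have "\<dots> = (\<integral>x. (\<integral>y. f (x, y) \<partial>P)\<^sup>2 \<partial>X)"
      proof (rule Bochner_Integration.integral_cong[OF refl])
        fix x assume x: "x \<in> space X"
        have b: "(\<lambda>z. f (x, \<sigma> g (fst z)) * ?fl (x, shift H l (snd z))) \<in> bmeas ?PP"
          using bmeas_section[OF r3 x] by simp
        have "(\<integral>z. r (z, x) \<partial>?PP) = (\<integral>y. \<integral>u. f (x, \<sigma> g y) * ?fl (x, shift H l u) \<partial>P \<partial>P)"
          using int_pair[OF P.prob_space_axioms P.prob_space_axioms b] by (simp add: r_def)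
        also have "\<dots> = (\<integral>y. f (x, \<sigma> g y) \<partial>P) * (\<integral>u. ?fl (x, shift H l u) \<partial>P)"
          by simp
        also have "(\<integral>y. f (x, \<sigma> g y) \<partial>P) = (\<integral>y. f (x, y) \<partial>P)"
          by (rule integral_mp[OF \<sigma>_meas[OF g] \<sigma>_distr[OF g]]) (rule bmeas_measurable[OF f_sec[OF x]])
        also have "(\<integral>u. ?fl (x, shift H l u) \<partial>P) = (\<integral>u. ?fl (x, u) \<partial>P)"
          by (rule int_shift[OF lI]) (rule bmeas_measurable[OF bmeas_section[OF fl x]])
        also have "\<dots> = (\<integral>y. f (x, y) \<partial>P)"
          by (rule integral_favg[OF x])
        finally show "(\<integral>z. r (z, x) \<partial>?PP) = (\<integral>y. f (x, y) \<partial>P)\<^sup>2"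
          by (simp add: power2_eq_square)
      qed
      finally show ?thesis using flat by simp
    qed
    have "(\<integral>z. \<integral>x. A1 (z, x) * B1 (z, x) \<partial>X \<partial>?PP)
       \<le> (\<integral>z. indicator Bad (\<theta> z) + (\<Sum>l\<in>A. \<integral>x. q l (z, x) \<partial>X) \<partial>?PP)"
    proof (rule integral_mono_AE)
      show "integrable ?PP (\<lambda>z. \<integral>x. A1 (z, x) * B1 (z, x) \<partial>X)"
        by (intro iPP bmeas_mult A1 B1)
      show "integrable ?PP (\<lambda>z. indicator Bad (\<theta> z) + (\<Sum>l\<in>A. \<integral>x. q l (z, x) \<partial>X))"
        by (intro Bochner_Integration.integrable_add Bochner_Integration.integrable_sum iPP q PP.integrable_bmeas Bad2)
      show "AE z in ?PP. (\<integral>x. A1 (z, x) * B1 (z, x) \<partial>X) \<le> indicator Bad (\<theta> z) + (\<Sum>l\<in>A. \<integral>x. q l (z, x) \<partial>X)"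
        using AE_mp_map[OF \<theta> AE_Y] AE_space
      proof eventually_elim
        case (elim z)
        have S_nonneg: "0 \<le> (\<Sum>l\<in>A. \<integral>x. q l (z, x) \<partial>X)"
          by (intro sum_nonneg integral_nonneg_AE) (auto simp: q_nonneg)
        show ?case
        proof (cases "\<theta> z \<in> Bad")
          case True
          have B_le: "(\<integral>x. (B1 (z, x))\<^sup>2 \<partial>X) \<le> 1"
            using shift_\<alpha>[OF bmeas_power2[OF fl], of "\<sigma> g (\<theta> z)"] favg_norm_le[of "\<sigma> g (\<theta> z)" F]
              measurable_space[OF \<sigma>\<theta>(1) elim(2)] by (simp add: B1_def)
          have A_le: "(\<integral>x. (A1 (z, x))\<^sup>2 \<partial>X) = 1"
            using f_norm_\<alpha>[OF g measurable_space[OF \<sigma>_meas[OF g] spP(1)[OF elim(2)]]] by (simp add: A1_def)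
          have "(\<integral>x. A1 (z, x) * B1 (z, x) \<partial>X) \<le> (\<integral>x. 1 / 2 * (A1 (z, x))\<^sup>2 + 1 / 2 * (B1 (z, x))\<^sup>2 \<partial>X)"
          proof (rule integral_mono)
            show "A1 (z, x) * B1 (z, x) \<le> 1 / 2 * (A1 (z, x))\<^sup>2 + 1 / 2 * (B1 (z, x))\<^sup>2" for x
              using sum_squares_bound[of "A1 (z, x)" "B1 (z, x)"] by simp
          qed (intro Bochner_Integration.integrable_add integrable_mult_right iX[OF bmeas_mult[OF A1 B1]]
              iX[OF bmeas_power2[OF A1]] iX[OF bmeas_power2[OF B1]] elim)+
          also have "\<dots> = 1 / 2 * (\<integral>x. (A1 (z, x))\<^sup>2 \<partial>X) + 1 / 2 * (\<integral>x. (B1 (z, x))\<^sup>2 \<partial>X)"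
            using iX[OF bmeas_power2[OF A1] elim(2)] iX[OF bmeas_power2[OF B1] elim(2)] by simp
          also have "\<dots> \<le> 1" using A_le B_le by simp
          finally show ?thesis using True S_nonneg by simp
        next
          case False
          then have l: "w g (\<theta> z) \<in> A" using spP(3)[OF elim(2)] by (auto simp: Bad_def)
          let ?l = "w g (\<theta> z)"
          have lI: "?l \<in> I" using l A by auto
          have "?fl (x, \<sigma> g (\<theta> z)) = ?fl (x, shift H ?l (snd z))" for x
            unfolding favg_def
          proof (simp, rule avg_local)
            fix h assume h: "h \<in> I" "h \<in> F"
            \<comment> \<open>The shifted point at h takes the value of \<theta> z at
              \<open>inv l \<otimes> h\<close>. This index lies outside F, where \<theta> z is the
              fresh point.\<close>
            have "inv ?l \<otimes> h \<notin> F" using A(3)[OF l] h by auto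
            then have "shift H ?l (\<theta> z) h = shift H ?l (snd z) h"
              using h lI by (simp add: shift_def \<theta>_def mix_def)
            then show "\<sigma> g (\<theta> z) h = shift H ?l (snd z) h"
              using \<sigma>_eq[OF g elim(1)] by simp
          qed
          then have "(\<integral>x. A1 (z, x) * B1 (z, x) \<partial>X) = (\<integral>x. q ?l (z, x) \<partial>X)"
            by (simp add: B1_def q_def)
          \<comment> \<open>Which l occurs depends on z. Because f is nonnegative, the sum over all
            of A is an upper bound in which l is no longer a function of z.\<close>
          also have "\<dots> \<le> (\<Sum>l\<in>A. \<integral>x. q l (z, x) \<partial>X)"
            using l A q_nonneg by (intro member_le_sum integral_nonneg_AE) auto
          finally show ?thesis by (simp add: indicator_def)
        qed
      qed
    qed
    also have "\<dots> = (\<integral>z. indicator Bad (\<theta> z) \<partial>?PP) + (\<Sum>l\<in>A. \<integral>z. \<integral>x. q l (z, x) \<partial>X \<partial>?PP)"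
      using PP.integrable_bmeas[OF Bad2] iPP[OF q]
      by (subst Bochner_Integration.integral_add) (auto simp: Bochner_Integration.integral_sum)
    also have "(\<integral>z. indicator Bad (\<theta> z) \<partial>?PP) = P.prob Bad"
      using integral_mp[OF \<theta>, of "indicator Bad"] Bad by simp
    also have "(\<Sum>l\<in>A. \<integral>z. \<integral>x. q l (z, x) \<partial>X \<partial>?PP) \<le> real (card A) * \<eta>"
      using sum_mono[OF q_int] by simp
    finally show ?thesis
      using w_A flat(2) by (simp add: Bad_def)
  qed
  define h where "h z = f z - ?fl z" for z
  have h: "h \<in> bmeas (X \<Otimes>\<^sub>M P)"
    unfolding h_def[abs_def] by (intro bmeas_diff f fl)
  define e where "e z = f (\<alpha> g (fst z), \<sigma> g (snd z)) - f z" for z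
  have e: "e \<in> bmeas (X \<Otimes>\<^sub>M P)"
    unfolding e_def[abs_def] by (intro bmeas_diff f f_comp) measurable
  have he_int: "(\<integral>y. \<integral>x. (h (x, y))\<^sup>2 \<partial>X \<partial>P) \<le> 1 / 100" "(\<integral>y. \<integral>x. (e (x, y))\<^sup>2 \<partial>X \<partial>P) \<le> 1 / 100"
    using Phi_dist[of F] F g_inv by (simp_all add: h_def e_def)
  \<comment> \<open>A telescope from A1 to B1: from f at the moved y to f at y, to its F-average
    there, which is the same at \<theta> z, back to f at \<theta> z, on to f at the moved \<theta>
    z, and to its F-average. Five errors of squared norm at most 1/100 give 5 * 5/100 = 1/4.\<close>
  define b1 where "b1 z = e (snd z, fst (fst z))" for z :: "(('l \<Rightarrow> 'z) \<times> ('l \<Rightarrow> 'z)) \<times> 'x"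
  define b2 where "b2 z = h (snd z, fst (fst z))" for z :: "(('l \<Rightarrow> 'z) \<times> ('l \<Rightarrow> 'z)) \<times> 'x"
  define b3 where "b3 z = - h (snd z, \<theta> (fst z))" for z :: "(('l \<Rightarrow> 'z) \<times> ('l \<Rightarrow> 'z)) \<times> 'x"
  define b4 where "b4 z = - e (snd z, \<theta> (fst z))" for z :: "(('l \<Rightarrow> 'z) \<times> ('l \<Rightarrow> 'z)) \<times> 'x"
  define b5 where "b5 z = h (\<alpha> g (snd z), \<sigma> g (\<theta> (fst z)))" for z :: "(('l \<Rightarrow> 'z) \<times> ('l \<Rightarrow> 'z)) \<times> 'x"
  have comp: "(\<lambda>z. q (a z, b z)) \<in> bmeas (?PP \<Otimes>\<^sub>M X)"
    if "q \<in> bmeas (X \<Otimes>\<^sub>M P)" "a \<in> measurable (?PP \<Otimes>\<^sub>M X) X" "b \<in> measurable (?PP \<Otimes>\<^sub>M X) P" for q a b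
    using that by (intro bmeas_compose[OF that(1)] measurable_Pair)
  have neg: "(\<lambda>z. - q z) \<in> bmeas M" if "q \<in> bmeas M" for q and M :: "'c measure"
    using bmeas_scale[OF that, of "-1"] by simp
  have b: "b1 \<in> bmeas (?PP \<Otimes>\<^sub>M X)" "b2 \<in> bmeas (?PP \<Otimes>\<^sub>M X)" "b3 \<in> bmeas (?PP \<Otimes>\<^sub>M X)"
     "b4 \<in> bmeas (?PP \<Otimes>\<^sub>M X)" "b5 \<in> bmeas (?PP \<Otimes>\<^sub>M X)"
    unfolding b1_def[abs_def] b2_def[abs_def] b3_def[abs_def] b4_def[abs_def] b5_def[abs_def]
    by (intro neg comp h e; measurable)+
  have b_int: "(\<integral>z. \<integral>x. (b1 (z, x))\<^sup>2 \<partial>X \<partial>?PP) \<le> 1 / 100" "(\<integral>z. \<integral>x. (b2 (z, x))\<^sup>2 \<partial>X \<partial>?PP) \<le> 1 / 100"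
    "(\<integral>z. \<integral>x. (b3 (z, x))\<^sup>2 \<partial>X \<partial>?PP) \<le> 1 / 100" "(\<integral>z. \<integral>x. (b4 (z, x))\<^sup>2 \<partial>X \<partial>?PP) \<le> 1 / 100"
    "(\<integral>z. \<integral>x. (b5 (z, x))\<^sup>2 \<partial>X \<partial>?PP) \<le> 1 / 100"
    using he_int law_int[OF PP.prob_space_axioms fst_law bmeas_power2[OF h]] law_int[OF PP.prob_space_axioms fst_law bmeas_power2[OF e]]
      law_int[OF PP.prob_space_axioms \<theta> bmeas_power2[OF h]] law_int[OF PP.prob_space_axioms \<theta> bmeas_power2[OF e]]
      \<alpha>_law[OF bmeas_power2[OF h] \<sigma>\<theta>]
    by (simp_all add: b1_def b2_def b3_def b4_def b5_def)
  have split: "A1 (z, x) - B1 (z, x) = b1 (z, x) + b2 (z, x) + b3 (z, x) + b4 (z, x) + b5 (z, x)" for z x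
  proof -
    have "?fl (x, \<theta> z) = ?fl (x, fst z)"
      unfolding favg_def by (simp, rule avg_local) (simp add: \<theta>_def mix_def)
    then show ?thesis
      by (simp add: A1_def B1_def b1_def b2_def b3_def b4_def b5_def h_def e_def)
  qed
  have "(\<integral>z. \<integral>x. (A1 (z, x) - B1 (z, x))\<^sup>2 \<partial>X \<partial>?PP)
     \<le> (\<integral>z. \<integral>x. 5 * ((b1 (z, x))\<^sup>2 + (b2 (z, x))\<^sup>2 + (b3 (z, x))\<^sup>2 + (b4 (z, x))\<^sup>2 + (b5 (z, x))\<^sup>2) \<partial>X \<partial>?PP)"
    unfolding split
    by (intro integral_mono iPP iX sq_sum5 bmeas_scale bmeas_add bmeas_power2 b)
  also have "\<dots> = 5 * ((\<integral>z. \<integral>x. (b1 (z, x))\<^sup>2 \<partial>X \<partial>?PP) + (\<integral>z. \<integral>x. (b2 (z, x))\<^sup>2 \<partial>X \<partial>?PP)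
     + (\<integral>z. \<integral>x. (b3 (z, x))\<^sup>2 \<partial>X \<partial>?PP) + (\<integral>z. \<integral>x. (b4 (z, x))\<^sup>2 \<partial>X \<partial>?PP) + (\<integral>z. \<integral>x. (b5 (z, x))\<^sup>2 \<partial>X \<partial>?PP))"
  proof -
    have "(\<integral>z. \<integral>x. 5 * ((b1 (z, x))\<^sup>2 + (b2 (z, x))\<^sup>2 + (b3 (z, x))\<^sup>2 + (b4 (z, x))\<^sup>2 + (b5 (z, x))\<^sup>2) \<partial>X \<partial>?PP)
      = (\<integral>z. 5 * ((\<integral>x. (b1 (z, x))\<^sup>2 \<partial>X) + (\<integral>x. (b2 (z, x))\<^sup>2 \<partial>X) + (\<integral>x. (b3 (z, x))\<^sup>2 \<partial>X)
         + (\<integral>x. (b4 (z, x))\<^sup>2 \<partial>X) + (\<integral>x. (b5 (z, x))\<^sup>2 \<partial>X)) \<partial>?PP)"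
      by (intro Bochner_Integration.integral_cong refl) (simp add: iX[OF bmeas_power2] b)
    then show ?thesis
      by (simp add: iPP[OF bmeas_power2] b)
  qed
  also have "\<dots> \<le> 1 / 4" using b_int by simp
  finally have small: "(\<integral>z. \<integral>x. (A1 (z, x) - B1 (z, x))\<^sup>2 \<partial>X \<partial>?PP) \<le> 1 / 4" .
  have "(\<integral>z. \<integral>x. (A1 (z, x) - B1 (z, x))\<^sup>2 \<partial>X \<partial>?PP)
     = (\<integral>z. (\<integral>x. (A1 (z, x))\<^sup>2 \<partial>X) + (\<integral>x. (B1 (z, x))\<^sup>2 \<partial>X) - 2 * (\<integral>x. A1 (z, x) * B1 (z, x) \<partial>X) \<partial>?PP)"
  proof (rule Bochner_Integration.integral_cong[OF refl])
    fix z assume z: "z \<in> space ?PP"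
    have "(A1 (z, x) - B1 (z, x))\<^sup>2 = (A1 (z, x))\<^sup>2 + (B1 (z, x))\<^sup>2 - 2 * (A1 (z, x) * B1 (z, x))" for x
      by (simp add: power2_diff algebra_simps)
    then show "(\<integral>x. (A1 (z, x) - B1 (z, x))\<^sup>2 \<partial>X) = (\<integral>x. (A1 (z, x))\<^sup>2 \<partial>X) + (\<integral>x. (B1 (z, x))\<^sup>2 \<partial>X) - 2 * (\<integral>x. A1 (z, x) * B1 (z, x) \<partial>X)"
      using iX[OF bmeas_power2[OF A1] z] iX[OF bmeas_power2[OF B1] z] iX[OF bmeas_mult[OF A1 B1] z] by simp
  qed
  also have "\<dots> = 1 + Phi F - 2 * (\<integral>z. \<integral>x. A1 (z, x) * B1 (z, x) \<partial>X \<partial>?PP)"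
    using iPP[OF bmeas_power2[OF A1]] iPP[OF bmeas_power2[OF B1]] iPP[OF bmeas_mult[OF A1 B1]] int_A int_B by simp
  finally show False
    using small upper F(2) by linarith
qed

end

subsection \<open>Test functions contradict non-amenability\<close>

lemma (in group) inv_image_cancel:
  assumes "l \<in> carrier G" "A \<subseteq> carrier G"
  shows "(\<lambda>b. inv l \<otimes> b) ` (\<lambda>b. l \<otimes> b) ` A = A"
proof -
  have "(\<lambda>b. inv l \<otimes> b) ` (\<lambda>b. l \<otimes> b) ` A = (\<lambda>b. b) ` A"
    unfolding image_image using assms by (intro image_cong refl) (auto simp: m_assoc[symmetric] subset_iff)
  then show ?thesis by simp
qed

context orbit_sub
begin

lemma w_inj: "y \<in> Y \<Longrightarrow> inj_on (\<lambda>g. w g y) (carrier G)"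
  by (rule inj_onI) (metis \<sigma>_eq \<sigma>_free)

text \<open>By freeness the values \<open>w g y\<close> for distinct g are distinct, so for almost
  every y at most \<open>card R\<close> of them lie in R. Among N elements the average probability
  is then at most \<open>card R\<close> / N.\<close>

lemma w_far:
  assumes inf: "infinite (carrier G)" and R: "finite R" and \<epsilon>: "\<epsilon> > 0"
  shows "\<exists>g\<in>carrier G. P.prob {y \<in> space P. w g y \<in> R} \<le> \<epsilon>"
proof (rule ccontr)
  assume "\<not> ?thesis"
  then have large: "\<epsilon> < P.prob {y \<in> space P. w g y \<in> R}" if "g \<in> carrier G" for g
    using that by auto
  obtain N :: nat where N: "real (card R) < real N * \<epsilon>"
    using reals_Archimedean3[OF \<epsilon>] by blast
  obtain B where B: "finite B" "card B = N" "B \<subseteq> carrier G"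
    using infinite_arbitrarily_large[OF inf] by blast
  define A where "A g = {y \<in> space P. w g y \<in> R}" for g
  have A: "A g \<in> sets P" if "g \<in> B" for g
  proof -
    have "w g -` (R \<inter> carrier H) \<inter> space P \<in> sets P"
      using that B by (intro measurable_sets[OF w_meas]) auto
    moreover have "w g -` (R \<inter> carrier H) \<inter> space P = A g"
      using that B w_in[of g] by (auto simp: A_def)
    ultimately show ?thesis by simp
  qed
  have "real N * \<epsilon> = (\<Sum>g\<in>B. \<epsilon>)" using B by simp
  also have "\<dots> \<le> (\<Sum>g\<in>B. P.prob (A g))"
    using large B by (intro sum_mono less_imp_le) (auto simp: A_def)
  also have "\<dots> = (\<integral>y. (\<Sum>g\<in>B. indicator (A g) y) \<partial>P)"
    using A by (subst Bochner_Integration.integral_sum) (auto intro!: P.integrable_bmeas bmeas_indicator)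
  also have "\<dots> \<le> (\<integral>y. real (card R) \<partial>P)"
  proof (rule integral_mono_AE)
    show "integrable P (\<lambda>y. \<Sum>g\<in>B. indicator (A g) y :: real)"
      using A by (intro Bochner_Integration.integrable_sum P.integrable_bmeas bmeas_indicator)
    show "AE y in P. (\<Sum>g\<in>B. indicator (A g) y) \<le> real (card R)"
      using AE_Y
    proof eventually_elim
      case (elim y)
      have "(\<Sum>g\<in>B. indicator (A g) y :: real) = real (card {g \<in> B. y \<in> A g})"
        using B by (simp add: indicator_def sum.If_cases Int_def)
      also have "card {g \<in> B. y \<in> A g} \<le> card R"
        using w_inj[OF elim] B R by (intro card_inj_on_le[of "\<lambda>g. w g y"]) (auto simp: A_def inj_on_def)
      finally show ?case by simp
    qed
  qed auto
  also have "\<dots> = real (card R)" by (simp add: P.prob_space)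
  finally show False using N by simp
qed

lemma cocycle_approx:
  assumes S: "finite S" "S \<subseteq> carrier G" and \<epsilon>: "\<epsilon> > 0"
  shows "\<exists>Q F0 W. finite Q \<and> Q \<noteq> {} \<and> Q \<subseteq> carrier H \<and> finite F0 \<and> F0 \<subseteq> carrier H \<and>
    (\<forall>g\<in>S. W g \<in> measurable P (count_space Q)) \<and>
    (\<forall>g\<in>S. \<forall>y\<in>space P. \<forall>y'\<in>space P. (\<forall>h\<in>F0. y h = y' h) \<longrightarrow> W g y = W g y') \<and>
    (\<forall>g\<in>S. P.prob {y \<in> space P. w g y \<noteq> W g y} \<le> \<epsilon>)"
proof -
  have "\<forall>g\<in>S. \<exists>R. finite R \<and> R \<subseteq> carrier H \<and> P.prob {y \<in> space P. w g y \<notin> R} < \<epsilon> / 2"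
    using S \<epsilon> by (intro ballI finite_range_approx w_meas countable_H) auto
  from bchoice[OF this] obtain R where R: "\<And>g. g \<in> S \<Longrightarrow> finite (R g)" "\<And>g. g \<in> S \<Longrightarrow> R g \<subseteq> carrier H"
    "\<And>g. g \<in> S \<Longrightarrow> P.prob {y \<in> space P. w g y \<notin> R g} < \<epsilon> / 2"
    by auto
  \<comment> \<open>The identity is added as the value of h where \<open>w g\<close> leaves Q; it
    also makes Q nonempty.\<close>
  define Q where "Q = insert \<one> (\<Union>g\<in>S. R g)"
  have Q: "finite Q" "Q \<noteq> {}" "Q \<subseteq> carrier H"
    using R S by (auto simp: Q_def)
  define h where "h g y = (if w g y \<in> Q then w g y else \<one>)" for g y
  have wm: "w g \<in> measurable P (count_space (carrier H))" if "g \<in> S" for g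
    using that S by (auto intro: w_meas)
  have h: "h g \<in> measurable P (count_space Q)" if "g \<in> S" for g
  proof -
    have "(\<lambda>l. if l \<in> Q then l else \<one>) \<in> measurable (count_space (carrier H)) (count_space Q)"
      by (auto simp: Q_def)
    from measurable_compose[OF wm[OF that] this] show ?thesis
      by (simp add: h_def[abs_def])
  qed
  have "\<forall>g\<in>S. \<exists>p. finite (fst p) \<and> fst p \<subseteq> carrier H \<and> snd p \<in> measurable P (count_space Q) \<and>
     (\<forall>y\<in>space P. \<forall>y'\<in>space P. (\<forall>i\<in>fst p. y i = y' i) \<longrightarrow> snd p y = snd p y') \<and>
     P.prob {y \<in> space P. h g y \<noteq> snd p y} < \<epsilon> / 2"
  proof
    fix g assume g: "g \<in> S"
    have "\<epsilon> / 2 > 0" using \<epsilon> by simp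
    from cylinder_approx_fun[OF Q(1,2) h[OF g] this]
    show "\<exists>p. finite (fst p) \<and> fst p \<subseteq> carrier H \<and> snd p \<in> measurable P (count_space Q) \<and>
     (\<forall>y\<in>space P. \<forall>y'\<in>space P. (\<forall>i\<in>fst p. y i = y' i) \<longrightarrow> snd p y = snd p y') \<and>
     P.prob {y \<in> space P. h g y \<noteq> snd p y} < \<epsilon> / 2"
      by simp
  qed
  from bchoice[OF this] obtain p where p: "\<forall>g\<in>S. finite (fst (p g)) \<and> fst (p g) \<subseteq> carrier H \<and> snd (p g) \<in> measurable P (count_space Q) \<and>
     (\<forall>y\<in>space P. \<forall>y'\<in>space P. (\<forall>i\<in>fst (p g). y i = y' i) \<longrightarrow> snd (p g) y = snd (p g) y') \<and>
     P.prob {y \<in> space P. h g y \<noteq> snd (p g) y} < \<epsilon> / 2" ..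
  define F W where "F = fst \<circ> p" and "W = snd \<circ> p"
  have FW: "\<And>g. g \<in> S \<Longrightarrow> finite (F g)" "\<And>g. g \<in> S \<Longrightarrow> F g \<subseteq> carrier H"
    "\<And>g. g \<in> S \<Longrightarrow> W g \<in> measurable P (count_space Q)"
    "\<And>g y y'. g \<in> S \<Longrightarrow> y \<in> space P \<Longrightarrow> y' \<in> space P \<Longrightarrow> (\<forall>i\<in>F g. y i = y' i) \<Longrightarrow> W g y = W g y'"
    "\<And>g. g \<in> S \<Longrightarrow> P.prob {y \<in> space P. h g y \<noteq> W g y} < \<epsilon> / 2"
    using p unfolding F_def W_def comp_def by blast+
  have close: "P.prob {y \<in> space P. w g y \<noteq> W g y} \<le> \<epsilon>" if g: "g \<in> S" for g
  proof -
    have m1: "{y \<in> space P. h g y \<noteq> W g y} \<in> sets P"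
      by (rule neq_sets[OF h[OF g] FW(3)[OF g] countable_finite[OF Q(1)]])
    have m2: "{y \<in> space P. w g y \<notin> R g} \<in> sets P"
    proof -
      have "w g -` R g \<inter> space P \<in> sets P"
        using R(2)[OF g] by (intro measurable_sets[OF wm[OF g]]) auto
      then have "space P - (w g -` R g \<inter> space P) \<in> sets P" by auto
      moreover have "space P - (w g -` R g \<inter> space P) = {y \<in> space P. w g y \<notin> R g}" by auto
      ultimately show ?thesis by simp
    qed
    have "{y \<in> space P. w g y \<noteq> W g y} \<subseteq> {y \<in> space P. w g y \<notin> R g} \<union> {y \<in> space P. h g y \<noteq> W g y}"
      using g by (auto simp: h_def Q_def)
    then have "P.prob {y \<in> space P. w g y \<noteq> W g y} \<le> P.prob ({y \<in> space P. w g y \<notin> R g} \<union> {y \<in> space P. h g y \<noteq> W g y})"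
      using m1 m2 by (intro P.finite_measure_mono) auto
    also have "\<dots> \<le> P.prob {y \<in> space P. w g y \<notin> R g} + P.prob {y \<in> space P. h g y \<noteq> W g y}"
      using m1 m2 by (intro measure_Un_le) auto
    finally show ?thesis using R(3)[OF g] FW(5)[OF g] by simp
  qed
  have FF: "finite (\<Union>g\<in>S. F g)" "(\<Union>g\<in>S. F g) \<subseteq> carrier H"
    using FW(1,2) S by auto
  have loc: "\<forall>g\<in>S. \<forall>y\<in>space P. \<forall>y'\<in>space P. (\<forall>h\<in>(\<Union>g\<in>S. F g). y h = y' h) \<longrightarrow> W g y = W g y'"
    using FW(4) by blast
  show ?thesis
    by (rule exI[of _ Q], rule exI[of _ "\<Union>g\<in>S. F g"], rule exI[of _ W], intro conjI Q FF loc)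
      (auto intro: FW(3) close)
qed

lemma main_contradiction:
  fixes X :: "'x measure" and \<alpha> :: "'g \<Rightarrow> 'x \<Rightarrow> 'x"
  assumes non_amenable: "\<not> amenable G"
    and prob_X: "prob_space X"
    and \<alpha>_meas: "\<And>g. g \<in> carrier G \<Longrightarrow> \<alpha> g \<in> measurable X X"
    and \<alpha>_distr: "\<And>g. g \<in> carrier G \<Longrightarrow> distr X X (\<alpha> g) = X"
    and test: "\<And>S \<delta> \<eta>. finite S \<Longrightarrow> S \<subseteq> carrier G \<Longrightarrow> \<delta> > 0 \<Longrightarrow> \<eta> > 0 \<Longrightarrow>
      \<exists>f L. f \<in> bmeas (X \<Otimes>\<^sub>M P) \<and> (\<forall>z. 0 \<le> f z) \<and> (\<forall>y\<in>space P. (\<integral>x. (f (x, y))\<^sup>2 \<partial>X) = 1) \<and>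
        finite L \<and> L \<subseteq> carrier H \<and>
        (\<forall>x. \<forall>y\<in>space P. \<forall>y'\<in>space P. (\<forall>h\<in>L. y h = y' h) \<longrightarrow> f (x, y) = f (x, y')) \<and>
        (\<forall>g\<in>S. (\<integral>y. \<integral>x. (f (\<alpha> g x, \<sigma> g y) - f (x, y))\<^sup>2 \<partial>X \<partial>P) \<le> \<delta>) \<and>
        (\<integral>x. (\<integral>y. f (x, y) \<partial>P)\<^sup>2 \<partial>X) \<le> \<eta>"
  shows False
proof -
  let ?I = "carrier H"
  obtain S \<kappa> where S: "finite S" "S \<subseteq> carrier G" and \<kappa>: "\<kappa> > 0"
    and gap: "\<And>p. fa_prob G p \<Longrightarrow> \<exists>h\<in>S. \<exists>A\<subseteq>carrier G. \<kappa> \<le> \<bar>p (h <#\<^bsub>G\<^esub> A) - p A\<bar>"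
    by (rule non_amenable_gap[OF group_G non_amenable]) (rule that)
  have inf: "infinite (carrier G)" by (rule non_amenable_infinite[OF group_G non_amenable])
  have cancel: "a * (b / a) = b" if "a \<noteq> 0" for a b :: real
    using that by simp
  define c2 where "c2 = \<kappa> / 200"
  define \<tau>2 where "\<tau>2 = (\<kappa> / 200) / (1 + 1 / c2)"
  define \<epsilon>2 where "\<epsilon>2 = \<tau>2 / 144"
  define c1 where "c1 = \<kappa> * \<epsilon>2 / 2"
  define \<tau>1 where "\<tau>1 = (\<kappa> * \<epsilon>2 / 2) / (1 + 1 / c1)"
  define \<epsilon> where "\<epsilon> = min (\<tau>1 / 39) (\<tau>2 / 108)"
  define \<delta> where "\<delta> = min \<epsilon> (1 / 100)"
  have c2: "c2 > 0" using \<kappa> by (simp add: c2_def)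
  have \<tau>2: "\<tau>2 > 0" unfolding \<tau>2_def using \<kappa> c2 by (intro divide_pos_pos add_pos_pos) auto
  have \<epsilon>2: "\<epsilon>2 > 0" using \<tau>2 by (simp add: \<epsilon>2_def)
  have c1: "c1 > 0" using \<kappa> \<epsilon>2 by (simp add: c1_def)
  have \<tau>1: "\<tau>1 > 0" unfolding \<tau>1_def using \<kappa> \<epsilon>2 c1 by (intro divide_pos_pos add_pos_pos) auto
  have \<epsilon>: "\<epsilon> > 0" using \<tau>1 \<tau>2 by (simp add: \<epsilon>_def)
  have \<delta>: "\<delta> > 0" "\<delta> \<le> \<epsilon>" "\<delta> \<le> 1 / 100" using \<epsilon> by (simp_all add: \<delta>_def)
  obtain Q F0 W where QW: "finite Q \<and> Q \<noteq> {} \<and> Q \<subseteq> carrier H \<and> finite F0 \<and> F0 \<subseteq> carrier H \<and>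
    (\<forall>g\<in>S. W g \<in> measurable P (count_space Q)) \<and>
    (\<forall>g\<in>S. \<forall>y\<in>space P. \<forall>y'\<in>space P. (\<forall>h\<in>F0. y h = y' h) \<longrightarrow> W g y = W g y') \<and>
    (\<forall>g\<in>S. P.prob {y \<in> space P. w g y \<noteq> W g y} \<le> \<epsilon>)"
    using cocycle_approx[OF S \<epsilon>] by (elim exE) (rule that)
  then have Q: "finite Q" "Q \<noteq> {}" "Q \<subseteq> ?I" and F0: "finite F0" "F0 \<subseteq> ?I"
    and W: "\<And>g. g \<in> S \<Longrightarrow> W g \<in> measurable P (count_space Q)"
    and W_close: "\<And>g. g \<in> S \<Longrightarrow> P.prob {y \<in> space P. w g y \<noteq> W g y} \<le> \<epsilon>"
    by blast+
  from QW have W_loc: "W g y = W g y'"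
    if "g \<in> S" "y \<in> space P" "y' \<in> space P" "\<And>h. h \<in> F0 \<Longrightarrow> y h = y' h" for g y y'
    using that by blast
  define t where "t = min 1 (\<epsilon> / real (card F0 + 1))"
  have t: "0 < t" "t \<le> 1" using \<epsilon> by (simp_all add: t_def)
  have t_F0: "t * real (card F0) \<le> \<epsilon>"
  proof -
    have "t * real (card F0) \<le> t * real (card F0 + 1)" using t by (intro mult_left_mono) auto
    also have "\<dots> \<le> \<epsilon> / real (card F0 + 1) * real (card F0 + 1)"
      by (intro mult_right_mono) (auto simp: t_def)
    finally show ?thesis by simp
  qed
  \<comment> \<open>Sets with more than n elements lose at least half of their weight to noise at
    rate t; \<open>m0\<close> is the number of shells that \<open>pigeonhole_influence\<close>
    demands for this n.\<close>
  obtain n where n: "(1 - t) ^ n \<le> 1 / 2"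
    using real_arch_pow_inv[of "1 / 2" "1 - t"] t by (auto intro: less_imp_le)
  obtain m0 :: nat where "real n < real m0 * \<epsilon>2"
    using reals_Archimedean3[OF \<epsilon>2] by blast
  then have m: "real n \<le> \<epsilon>2 * real m0" "m0 > 0"
    using \<epsilon>2 by (auto simp: mult.commute intro: gr0I)
  \<comment> \<open>One enlargement adds the translates by Q and by the inverses of Q. Hence the
    translate of \<open>Fc (2 * j)\<close> by \<open>inv l\<close>, for l in Q, contains
    \<open>Fc (2 * j - 1)\<close> and is contained in \<open>Fc (2 * j + 1)\<close>: a shell of two
    enlargements is the room that \<open>local_step\<close> asks for.\<close>
  define E where "E A = A \<union> (\<Union>l\<in>Q. (\<lambda>b. l \<otimes> b) ` A) \<union> (\<Union>l\<in>Q. (\<lambda>b. inv l \<otimes> b) ` A)" for A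
  define Fc where "Fc j = (E ^^ j) F0" for j
  have Fc_Suc: "Fc (Suc j) = E (Fc j)" for j by (simp add: Fc_def)
  have Fc: "finite (Fc j)" "Fc j \<subseteq> ?I" for j
  proof (induction j)
    case (Suc j)
    { case 1 show ?case using Suc Q by (simp add: Fc_Suc E_def) }
    { case 2 show ?case using Suc Q by (auto simp: Fc_Suc E_def subset_iff) }
  qed (use F0 in \<open>simp_all add: Fc_def\<close>)
  have Fc_mono: "Fc i \<subseteq> Fc j" if "i \<le> j" for i j
    using that by (rule lift_Suc_mono_le[rotated]) (auto simp: Fc_Suc E_def)
  have Fc_0: "Fc 0 = F0" by (simp add: Fc_def)
  define D where "D j = Fc (2 * j + 1) - Fc (2 * j - 1)" for j
  \<comment> \<open>Counting from 1 makes 2 * j - 1 a genuine predecessor of 2 * j despite truncated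
    subtraction.\<close>
  let ?J = "{1..m0}"
  have D_disj: "disjoint_family_on D ?J"
    unfolding disjoint_family_on_def
  proof (intro ballI impI)
    fix i j assume ij: "i \<in> ?J" "j \<in> ?J" "i \<noteq> j"
    have *: "D i \<inter> D j = {}" if "i < j" for i j
    proof -
      have "Fc (2 * i + 1) \<subseteq> Fc (2 * j - 1)" using that by (intro Fc_mono) simp
      then show ?thesis unfolding D_def by blast
    qed
    show "D i \<inter> D j = {}"
      using *[of i j] *[of j i] ij by (cases "i < j") auto
  qed
  define DD where "DD = (\<Union>j\<in>?J. D j)"
  have DD: "finite DD" "DD \<subseteq> ?I" using Fc by (auto simp: DD_def D_def)
  let ?FM = "Fc (2 * m0 + 1)"
  \<comment> \<open>The elements l for which the translate of \<open>?FM\<close> by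
    \<open>inv l\<close> meets \<open>?FM\<close>. The largest set is taken because the shell j is
    found only after f, whereas \<open>g0\<close> has to be fixed before f.\<close>
  define R where "R = (\<lambda>(a, b). b \<otimes> inv a) ` (?FM \<times> ?FM)"
  have R: "finite R" using Fc by (simp add: R_def)
  obtain g0 where g0: "g0 \<in> carrier G" "P.prob {y \<in> space P. w g0 y \<in> R} \<le> 1 / 10"
    using w_far[OF inf R, of "1 / 10"] by auto
  obtain Q' where Q': "finite Q'" "Q' \<subseteq> ?I" "P.prob {y \<in> space P. w g0 y \<notin> Q'} < 1 / 10"
    using finite_range_approx[OF countable_H w_meas[OF g0(1)], of "1 / 10"] by auto
  define A where "A = Q' - R"
  have A: "finite A" "A \<subseteq> ?I" using Q' by (auto simp: A_def)
  have w_A: "P.prob {y \<in> space P. w g0 y \<notin> A} \<le> 1 / 5"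
  proof -
    have m: "{y \<in> space P. w g0 y \<in> B} \<in> sets P" for B
    proof -
      have "w g0 -` (B \<inter> ?I) \<inter> space P \<in> sets P"
        by (intro measurable_sets[OF w_meas[OF g0(1)]]) auto
      moreover have "w g0 -` (B \<inter> ?I) \<inter> space P = {y \<in> space P. w g0 y \<in> B}"
        using w_in[OF g0(1)] by auto
      ultimately show ?thesis by simp
    qed
    have m': "{y \<in> space P. w g0 y \<notin> B} \<in> sets P" for B using m[of "- B"] by simp
    have "P.prob {y \<in> space P. w g0 y \<notin> A} \<le> P.prob ({y \<in> space P. w g0 y \<notin> Q'} \<union> {y \<in> space P. w g0 y \<in> R})"
      using m m' by (intro P.finite_measure_mono) (auto simp: A_def)
    also have "\<dots> \<le> P.prob {y \<in> space P. w g0 y \<notin> Q'} + P.prob {y \<in> space P. w g0 y \<in> R}"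
      using m m' by (intro measure_Un_le) auto
    finally show ?thesis using g0(2) Q'(3) by linarith
  qed
  \<comment> \<open>\<open>final_step\<close> sums over A, so the mean of f has to be small relative
    to \<open>card A\<close>, which is known at this point.\<close>
  define \<eta> where "\<eta> = 1 / (10 * real (card A + 1))"
  have \<eta>: "\<eta> > 0" "real (card A) * \<eta> \<le> 1 / 10" by (simp_all add: \<eta>_def field_simps)
  have "finite (insert g0 S)" "insert g0 S \<subseteq> carrier G" using S g0 by auto
  note fin_S = this
  obtain f L where
    fL: "f \<in> bmeas (X \<Otimes>\<^sub>M P)" "\<forall>z. 0 \<le> f z" "\<forall>y\<in>space P. (\<integral>x. (f (x, y))\<^sup>2 \<partial>X) = 1"
      "finite L" "L \<subseteq> carrier H"
      "\<forall>x. \<forall>y\<in>space P. \<forall>y'\<in>space P. (\<forall>h\<in>L. y h = y' h) \<longrightarrow> f (x, y) = f (x, y')"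
      "\<forall>g\<in>insert g0 S. (\<integral>y. \<integral>x. (f (\<alpha> g x, \<sigma> g y) - f (x, y))\<^sup>2 \<partial>X \<partial>P) \<le> \<delta>"
      "(\<integral>x. (\<integral>y. f (x, y) \<partial>P)\<^sup>2 \<partial>X) \<le> \<eta>"
    using test[OF fin_S \<delta>(1) \<eta>(1)] by (elim exE conjE) (rule that)
  note f = fL(1) spec[OF fL(2)] bspec[OF fL(3)] fL(4-6) bspec[OF fL(7)] fL(8)
  interpret f: test_fun H Z G \<sigma> w Y X \<alpha> S \<kappa> f L \<delta>
  proof (intro test_fun.intro test_fun_axioms.intro)
    show "orbit_sub H Z G \<sigma> w Y" by (rule orbit_sub_axioms)
    show "f (x, y) = f (x, y')" if "y \<in> space P" "y' \<in> space P" "\<And>h. h \<in> L \<Longrightarrow> y h = y' h" for x y y'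
      using f(6) that by blast
    show "\<exists>h\<in>S. \<exists>A\<subseteq>carrier G. \<kappa> \<le> \<bar>p (h <#\<^bsub>G\<^esub> A) - p A\<bar>" if "fa_prob G p" for p
      by (rule gap[OF that])
    show "(\<integral>y. \<integral>x. (f (\<alpha> g x, \<sigma> g y) - f (x, y))\<^sup>2 \<partial>X \<partial>P) \<le> \<delta>" if "g \<in> S" for g
      using that by (intro f(7)) simp
    show "distr X X (\<alpha> g) = X" if "g \<in> carrier G" for g
      by (rule \<alpha>_distr[OF that])
    show "\<alpha> g \<in> measurable X X" if "g \<in> carrier G" for g
      by (rule \<alpha>_meas[OF that])
  qed (rule prob_X S f(1-5) | assumption)+
  have noise: "1 - \<epsilon>2 \<le> (\<Sum>A\<in>Pow DD. (1 - t) ^ card A * mob (\<lambda>B. f.Phi ((?I - DD) \<union> B)) A)"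
  proof -
    have "\<kappa> * (1 - (\<integral>M. f.Phi {h. \<not> M h} \<partial>f.mask t)) \<le> c1 + (1 + 1 / c1) * (3 * (4 * (3 * \<epsilon>) + \<delta> + 0))"
    proof (rule f.noise_step[OF _ t(2) F0 t_F0, where W=W])
      show "W g \<in> measurable P (count_space ?I)" if "g \<in> S" for g
        by (rule measurable_compose[OF W[OF that], where g="\<lambda>x. x", simplified]) (use Q in auto)
      show "W g y = W g y'" if "g \<in> S" "y \<in> space P" "y' \<in> space P" "\<And>h. h \<in> F0 \<Longrightarrow> y h = y' h" for g y y'
        by (rule W_loc[OF that])
    qed (rule W_close c1 less_imp_le[OF t(1)] | assumption)+
    also have "\<dots> \<le> c1 + (1 + 1 / c1) * \<tau>1"
      using \<delta> c1 by (intro add_left_mono mult_left_mono) (auto simp: \<epsilon>_def)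
    also have "\<dots> = \<kappa> * \<epsilon>2"
    proof -
      have "1 + 1 / c1 \<noteq> 0" using c1 by (metis add_pos_pos divide_pos_pos less_irrefl zero_less_one)
      then have "(1 + 1 / c1) * \<tau>1 = \<kappa> * \<epsilon>2 / 2"
        unfolding \<tau>1_def by (rule cancel)
      then show ?thesis by (simp add: c1_def)
    qed
    finally have "1 - (\<integral>M. f.Phi {h. \<not> M h} \<partial>f.mask t) \<le> \<epsilon>2"
      using \<kappa> by simp
    with f.noise_expand[of t DD] t DD show ?thesis by simp
  qed
  have "\<exists>j\<in>?J. 1 - f.Phi ((?I - DD) \<union> ((\<Union>j\<in>?J. D j) - D j)) \<le> 3 * \<epsilon>2"
  proof (rule pigeonhole_influence[where \<psi>="\<lambda>B. f.Phi ((?I - DD) \<union> B)" and t=t and n=n])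
    show "0 \<le> mob (\<lambda>B. f.Phi (?I - DD \<union> B)) A" if "A \<subseteq> (\<Union>j\<in>?J. D j)" for A
    proof (rule f.mob_Phi_nonneg)
      have A: "A \<subseteq> DD" using that by (simp only: DD_def)
      show "finite A" using A DD(1) by (rule finite_subset)
      show "A \<inter> (?I - DD) = {}" using A by blast
    qed
    show "f.Phi (?I - DD \<union> (\<Union>j\<in>?J. D j)) = 1"
      by (rule f.Phi_full) (auto simp: DD_def)
    show "1 - \<epsilon>2 \<le> (\<Sum>A\<in>Pow (\<Union>j\<in>?J. D j). (1 - t) ^ card A * mob (\<lambda>B. f.Phi (?I - DD \<union> B)) A)"
      using noise by (simp only: DD_def)
    show "finite (D j)" for j using Fc by (simp add: D_def)
  qed (use m n t D_disj in auto)
  then obtain j where j: "j \<in> ?J" "1 - f.Phi ((?I - DD) \<union> (DD - D j)) \<le> 3 * \<epsilon>2"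
    by (auto simp: DD_def)
  have "(?I - DD) \<union> (DD - D j) = ?I - D j"
    using DD j by (auto simp: DD_def)
  with j(2) have infl: "1 - f.Phi (?I - (Fc (2 * j + 1) - Fc (2 * j - 1))) \<le> 3 * \<epsilon>2"
    by (simp add: D_def)
  have j1: "2 * j = Suc (2 * j - 1)" using j by auto
  let ?F = "Fc (2 * j)"
  have "\<kappa> * (1 - f.Phi ?F) \<le> c2 + (1 + 1 / c2) * (3 * (4 * (2 * \<epsilon>) + \<delta> + 4 * (3 * \<epsilon>2)))"
  proof (rule f.local_step[where W=W and Q=Q, OF _ _ _ _ Q(1) Q(3,2)])
    show "F0 \<subseteq> Fc (2 * j - 1)" using Fc_mono[of 0 "2 * j - 1"] by (simp add: Fc_0)
    show "Fc (2 * j - 1) \<subseteq> ?F" by (rule Fc_mono) simp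
    show "?F \<subseteq> Fc (2 * j + 1)" by (rule Fc_mono) simp
    show "(\<lambda>b. inv l \<otimes> b) ` ?F \<subseteq> Fc (2 * j + 1)" if "l \<in> Q" for l
      using that by (auto simp: Fc_Suc E_def)
    show "Fc (2 * j - 1) \<subseteq> (\<lambda>b. inv l \<otimes> b) ` ?F" if l: "l \<in> Q" for l
    proof -
    have "(\<lambda>b. l \<otimes> b) ` Fc (2 * j - 1) \<subseteq> ?F"
      using l by (subst j1) (auto simp: Fc_Suc E_def)
    then have "(\<lambda>b. inv l \<otimes> b) ` (\<lambda>b. l \<otimes> b) ` Fc (2 * j - 1) \<subseteq> (\<lambda>b. inv l \<otimes> b) ` ?F"
      by (rule image_mono)
    then show ?thesis
      using H.inv_image_cancel[of l "Fc (2 * j - 1)"] l Q Fc by auto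
    qed
    show "W g y = W g y'" if "g \<in> S" "y \<in> space P" "y' \<in> space P" "\<And>h. h \<in> F0 \<Longrightarrow> y h = y' h" for g y y'
      by (rule W_loc[OF that])
  qed (rule W W_close infl c2 Fc | assumption)+
  also have "\<dots> \<le> c2 + (1 + 1 / c2) * \<tau>2"
  proof -
    have "3 * (4 * (2 * \<epsilon>) + \<delta> + 4 * (3 * \<epsilon>2)) \<le> \<tau>2"
      using \<delta> \<tau>2 by (auto simp: \<epsilon>_def \<epsilon>2_def)
    then show ?thesis using c2 by (intro add_left_mono mult_left_mono) auto
  qed
  also have "\<dots> = \<kappa> * (1 / 100)"
  proof -
    have "1 + 1 / c2 \<noteq> 0" using c2 by (metis add_pos_pos divide_pos_pos less_irrefl zero_less_one)
    then have "(1 + 1 / c2) * \<tau>2 = \<kappa> / 200"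
      unfolding \<tau>2_def by (rule cancel)
    then show ?thesis by (simp add: c2_def)
  qed
  finally have F_loc: "1 - f.Phi ?F \<le> 1 / 100"
    using \<kappa> by (meson mult_le_cancel_left_pos)
  show False
  proof (rule f.final_step[OF g0(1) _ _ F_loc A _ w_A f(8) \<eta>(2)])
    show "(\<integral>y. \<integral>x. (f (\<alpha> g0 x, \<sigma> g0 y) - f (x, y))\<^sup>2 \<partial>X \<partial>P) \<le> 1 / 100"
      using f(7)[of g0] \<delta> by simp
    show "?F \<subseteq> ?I" by (rule Fc)
    fix l assume l: "l \<in> A"
    show "(\<lambda>b. inv l \<otimes> b) ` ?F \<inter> ?F = {}"
    proof (rule ccontr)
      assume "\<not> ?thesis"
      then obtain b where b: "b \<in> ?F" "inv l \<otimes> b \<in> ?F" by auto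
      have FM: "?F \<subseteq> ?FM" using j by (intro Fc_mono) auto
      have bl: "b \<in> ?I" "l \<in> ?I" using b Fc l A by auto
      have "inv (inv l \<otimes> b) = inv b \<otimes> l" using bl by (simp add: H.inv_mult_group)
      then have "l = b \<otimes> inv (inv l \<otimes> b)"
        using bl by (simp add: H.m_assoc[symmetric])
      then have "l \<in> R"
        unfolding R_def using b FM by (intro image_eqI[of _ _ "(inv l \<otimes> b, b)"]) auto
      with l show False by (simp add: A_def)
    qed
  qed
qed

end

subsection \<open>Invariant pseudo-metrics on compact groups\<close>

text \<open>Lower semicontinuity is that of any supremum of continuous functions. Upper
  semicontinuity uses compactness: by the tube lemma a strict bound over all of C persists on a
  neighbourhood of y.\<close>

lemma continuous_map_SUP_compact:
  fixes \<phi> :: "'a \<times> 'b \<Rightarrow> real"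
  assumes C: "compact_space C" "topspace C \<noteq> {}"
    and \<phi>: "continuous_map (prod_topology C Y) euclideanreal \<phi>"
    and bd: "\<And>c y. c \<in> topspace C \<Longrightarrow> y \<in> topspace Y \<Longrightarrow> \<phi> (c, y) \<le> M"
  shows "continuous_map Y euclideanreal (\<lambda>y. SUP c\<in>topspace C. \<phi> (c, y))"
  unfolding continuous_map_upper_lower_semicontinuous_lt
proof (intro conjI allI)
  fix r :: real
  let ?s = "\<lambda>y. SUP c\<in>topspace C. \<phi> (c, y)"
  have bdd: "bdd_above ((\<lambda>c. \<phi> (c, y)) ` topspace C)" if "y \<in> topspace Y" for y
    using bd that by (auto simp: bdd_above_def)
  have up: "openin (prod_topology C Y) {z \<in> topspace (prod_topology C Y). r < \<phi> z}"
    and dn: "openin (prod_topology C Y) {z \<in> topspace (prod_topology C Y). \<phi> z < r}" for r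
    using \<phi> by (simp_all add: continuous_map_upper_lower_semicontinuous_lt)
  have "{y \<in> topspace Y. r < ?s y} = (\<Union>c\<in>topspace C. {y \<in> topspace Y. r < \<phi> (c, y)})"
    using less_cSUP_iff[OF C(2) bdd] by auto
  moreover have "openin Y {y \<in> topspace Y. r < \<phi> (c, y)}" if "c \<in> topspace C" for c
  proof -
    have "continuous_map Y (prod_topology C Y) (\<lambda>y. (c, y))"
      using that by (simp add: continuous_map_pairwise comp_def)
    from openin_continuous_map_preimage[OF this up[of r]] show ?thesis
      using that by (simp add: conj_commute conj_left_commute)
  qed
  ultimately show "openin Y {y \<in> topspace Y. r < ?s y}"
    by auto
  show "openin Y {y \<in> topspace Y. ?s y < r}"
  proof (subst openin_subopen, intro ballI)
    fix y assume y: "y \<in> {y \<in> topspace Y. ?s y < r}"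
    \<comment> \<open>Strict pointwise bounds pass to the supremum only as \<le>, so a level
      strictly below r is used.\<close>
    define r' where "r' = (?s y + r) / 2"
    have r': "?s y < r'" "r' < r" using y by (auto simp: r'_def)
    have "\<phi> (c, y) < r'" if "c \<in> topspace C" for c
      using cSUP_upper[OF that bdd, of y] y r' by auto
    then have "topspace C \<times> {y} \<subseteq> {z \<in> topspace (prod_topology C Y). \<phi> z < r'}"
      using y by auto
    moreover have "compactin C (topspace C)" using C(1) by (simp add: compact_space_def)
    ultimately obtain U V where UV: "openin C U" "openin Y V" "topspace C \<subseteq> U" "y \<in> V"
        "U \<times> V \<subseteq> {z \<in> topspace (prod_topology C Y). \<phi> z < r'}"
      using tube_lemma_left[OF dn, of "topspace C" y r'] y by auto
    have "?s v < r" if v: "v \<in> V" for v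
    proof -
      have "\<phi> (c, v) < r'" if "c \<in> topspace C" for c
        using UV that v by auto
      then have "?s v \<le> r'"
        using C(2) by (intro cSUP_least) (auto intro: less_imp_le)
      then show ?thesis using r' by simp
    qed
    then show "\<exists>V. openin Y V \<and> y \<in> V \<and> V \<subseteq> {y \<in> topspace Y. ?s y < r}"
      using UV openin_subset[OF UV(2)] by (intro exI[of _ V]) auto
  qed
qed

locale compact_top_group =
  fixes K :: "'k monoid" (structure) and T :: "'k topology"
  assumes compact_group: "compact_group K T"
begin

sublocale group K
  using compact_group by (simp add: compact_group_def)

lemma topspace_T [simp]: "topspace T = carrier K"
  using compact_group by (simp add: compact_group_def)

lemma compact_T: "compact_space T" and Hausdorff_T: "Hausdorff_space T"
  using compact_group by (simp_all add: compact_group_def)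

lemma cont_mult:
  assumes "continuous_map Y T f" "continuous_map Y T g"
  shows "continuous_map Y T (\<lambda>y. f y \<otimes> g y)"
proof -
  have "continuous_map Y (prod_topology T T) (\<lambda>y. (f y, g y))"
    using assms by (simp add: continuous_map_pairwise comp_def)
  moreover have "continuous_map (prod_topology T T) T (\<lambda>(x, y). x \<otimes> y)"
    using compact_group by (simp add: compact_group_def)
  ultimately show ?thesis
    using continuous_map_compose[of Y "prod_topology T T" "\<lambda>y. (f y, g y)" T "\<lambda>(x, y). x \<otimes> y"]
    by (simp add: comp_def)
qed

lemma cont_left: "a \<in> carrier K \<Longrightarrow> continuous_map T T (\<lambda>x. a \<otimes> x)"
  by (intro cont_mult) auto

lemma compactin_coset:
  assumes "closedin T L" "a \<in> carrier K"
  shows "closedin T (a <#\<^bsub>K\<^esub> L)"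
proof -
  have "compactin T L"
    using assms(1) compact_T by (simp add: closedin_compact_space)
  then have "compactin T ((\<lambda>x. a \<otimes> x) ` L)"
    by (rule image_compactin) (rule cont_left[OF assms(2)])
  also have "(\<lambda>x. a \<otimes> x) ` L = a <#\<^bsub>K\<^esub> L" by (auto simp: l_coset_def)
  finally show ?thesis
    by (rule compactin_imp_closedin[OF Hausdorff_T])
qed

text \<open>K need not be metrizable, so only finitely many cosets are separated. Urysohn functions
  give a continuous function with distinct integer values on them, a supremum over L makes it right
  invariant, and comparing two points after all left translations gives a left invariant
  pseudo-metric. Compactness keeps both suprema continuous.\<close>

lemma invariant_pseudometric:
  assumes L: "subgroup L K" "closedin T L"
    and A: "finite A" "A \<subseteq> carrier K" "inj_on (\<lambda>a. a <#\<^bsub>K\<^esub> L) A"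
  shows "\<exists>d :: 'k \<Rightarrow> 'k \<Rightarrow> real.
    (\<forall>a\<in>carrier K. d a a = 0) \<and>
    (\<forall>a\<in>carrier K. \<forall>b\<in>carrier K. d a b = d b a \<and> 0 \<le> d a b) \<and>
    (\<forall>a\<in>carrier K. \<forall>b\<in>carrier K. \<forall>c\<in>carrier K. d a c \<le> d a b + d b c) \<and>
    (\<forall>k\<in>carrier K. \<forall>a\<in>carrier K. \<forall>b\<in>carrier K. d (k \<otimes> a) (k \<otimes> b) = d a b) \<and>
    (\<forall>a\<in>carrier K. \<forall>b\<in>carrier K. \<forall>l\<in>L. d a (b \<otimes> l) = d a b) \<and>
    (\<forall>a\<in>carrier K. \<forall>r. openin T {b \<in> carrier K. d a b < r}) \<and>
    (\<forall>a\<in>A. \<forall>b\<in>A. a \<noteq> b \<longrightarrow> 1 \<le> d a b)"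
proof -
  interpret L: subgroup L K by fact
  \<comment> \<open>Distinct natural numbers differ by at least 1; this is the separation claimed
    for A.\<close>
  obtain e :: "'k \<Rightarrow> nat" where e: "inj_on e A"
    using finite_imp_inj_to_nat_seg[OF A(1)] by blast
  have normal: "normal_space T"
    using compact_T Hausdorff_T by (simp add: compact_Hausdorff_or_regular_imp_normal_space)
  have "\<forall>a\<in>A. \<exists>g. continuous_map T (top_of_set {0..1::real}) g \<and> g ` (\<Union>b\<in>A - {a}. b <#\<^bsub>K\<^esub> L) \<subseteq> {0} \<and> g ` (a <#\<^bsub>K\<^esub> L) \<subseteq> {1}"
  proof
    fix a assume a: "a \<in> A"
    have 1: "closedin T (\<Union>b\<in>A - {a}. b <#\<^bsub>K\<^esub> L)"
      using A by (intro closedin_Union) (auto intro: compactin_coset[OF L(2)])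
    have 2: "closedin T (a <#\<^bsub>K\<^esub> L)" using a A by (intro compactin_coset[OF L(2)]) auto
    have 3: "disjnt (\<Union>b\<in>A - {a}. b <#\<^bsub>K\<^esub> L) (a <#\<^bsub>K\<^esub> L)"
    proof -
      have "(b <#\<^bsub>K\<^esub> L) \<inter> (a <#\<^bsub>K\<^esub> L) = {}" if "b \<in> A" "b \<noteq> a" for b
      proof (rule ccontr)
        assume "\<not> ?thesis"
        then obtain x where x: "x \<in> b <#\<^bsub>K\<^esub> L" "x \<in> a <#\<^bsub>K\<^esub> L" by auto
        then have "b <#\<^bsub>K\<^esub> L = x <#\<^bsub>K\<^esub> L" "a <#\<^bsub>K\<^esub> L = x <#\<^bsub>K\<^esub> L"
          using l_repr_independence[OF x(1) _ L(1)] l_repr_independence[OF x(2) _ L(1)] a that A by (simp_all add: subset_iff)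
        then show False using A(3) a that by (auto simp: inj_on_def)
      qed
      then show ?thesis by (auto simp: disjnt_def)
    qed
    show "\<exists>g. continuous_map T (top_of_set {0..1::real}) g \<and> g ` (\<Union>b\<in>A - {a}. b <#\<^bsub>K\<^esub> L) \<subseteq> {0} \<and> g ` (a <#\<^bsub>K\<^esub> L) \<subseteq> {1}"
      using Urysohn_lemma[OF normal 1 2 3, of 0 1] by (metis zero_le_one)
  qed
  from bchoice[OF this] obtain g where
    g: "\<forall>a\<in>A. continuous_map T (top_of_set {0..1::real}) (g a) \<and> g a ` (\<Union>b\<in>A - {a}. b <#\<^bsub>K\<^esub> L) \<subseteq> {0} \<and> g a ` (a <#\<^bsub>K\<^esub> L) \<subseteq> {1}" ..
  define f where "f x = (\<Sum>a\<in>A. real (e a) * g a x)" for x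
  define M where "M = (\<Sum>a\<in>A. real (e a))"
  have f_cont: "continuous_map T euclideanreal f"
    unfolding f_def[abs_def] using A(1) g
    by (intro continuous_map_sum continuous_map_real_mult_left) (auto intro: continuous_map_into_fulltopology)
  have g01: "g a x \<in> {0..1}" if "a \<in> A" "x \<in> carrier K" for a x
  proof -
    have "continuous_map T (top_of_set {0..1}) (g a)" using g that by blast
    then show ?thesis using that by (auto simp: continuous_map_def Pi_iff)
  qed
  have f_bd: "0 \<le> f x" "f x \<le> M" if "x \<in> carrier K" for x
  proof -
    show "0 \<le> f x" unfolding f_def using g01 that by (intro sum_nonneg mult_nonneg_nonneg) auto
    show "f x \<le> M" unfolding f_def M_def
    proof (rule sum_mono)
      fix a assume "a \<in> A"
      then show "real (e a) * g a x \<le> real (e a)"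
        using g01[OF _ that] by (intro mult_left_le) auto
    qed
  qed
  have f_val: "f x = real (e a)" if "a \<in> A" "x \<in> a <#\<^bsub>K\<^esub> L" for a x
  proof -
    have "f x = (\<Sum>b\<in>A. if b = a then real (e a) else 0)"
      unfolding f_def
    proof (rule sum.cong[OF refl])
      fix b assume b: "b \<in> A"
      show "real (e b) * g b x = (if b = a then real (e a) else 0)"
        using g b that by (cases "b = a") (auto simp: image_subset_iff)
    qed
    then show ?thesis using A that by simp
  qed
  \<comment> \<open>On the coset of an element a of A the function f is already constant, so the
    supremum keeps the value e a.\<close>
  define F where "F a = (SUP l\<in>L. f (a \<otimes> l))" for a
  have Lne: "L \<noteq> {}" using L.one_closed by blast
  have LK: "L \<subseteq> carrier K" by (rule L.subset)
  have F_cont: "continuous_map T euclideanreal F"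
  proof -
    have tL: "topspace (subtopology T L) = L" using LK by auto
    have "continuous_map T euclideanreal (\<lambda>a. SUP l\<in>topspace (subtopology T L). (\<lambda>(l, a). f (a \<otimes> l)) (l, a))"
    proof (rule continuous_map_SUP_compact)
      show "compact_space (subtopology T L)"
        using L(2) compact_T by (simp add: compact_space_subtopology closedin_compact_space)
      have "continuous_map (prod_topology (subtopology T L) T) T (\<lambda>z. snd z \<otimes> fst z)"
        by (intro cont_mult continuous_map_snd continuous_map_into_fulltopology[OF continuous_map_fst])
      from continuous_map_compose[OF this f_cont]
      show "continuous_map (prod_topology (subtopology T L) T) euclideanreal (\<lambda>(l, a). f (a \<otimes> l))"
        by (simp add: comp_def case_prod_beta')
      show "(\<lambda>(l, a). f (a \<otimes> l)) (l, a) \<le> M" if "l \<in> topspace (subtopology T L)" "a \<in> topspace T" for l a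
        using that LK by (auto intro!: f_bd)
    qed (use Lne tL in auto)
    then show ?thesis unfolding tL by (simp add: F_def[abs_def])
  qed
  have F_inv: "F (a \<otimes> l) = F a" if "a \<in> carrier K" "l \<in> L" for a l
  proof -
    have "(\<lambda>l'. f (a \<otimes> l \<otimes> l')) ` L = (\<lambda>l'. f (a \<otimes> l')) ` L"
    proof -
      have "(\<lambda>l'. l \<otimes> l') ` L = L"
      proof
        show "L \<subseteq> (\<lambda>l'. l \<otimes> l') ` L"
        proof
          fix x assume "x \<in> L"
          then show "x \<in> (\<lambda>l'. l \<otimes> l') ` L"
            using that LK by (intro image_eqI[of _ _ "inv l \<otimes> x"]) (auto simp: m_assoc[symmetric] subset_iff)
        qed
      qed (use that in auto)
      then have "(\<lambda>l'. f (a \<otimes> l')) ` L = (\<lambda>l'. f (a \<otimes> l')) ` ((\<lambda>l'. l \<otimes> l') ` L)" by simp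
      also have "\<dots> = (\<lambda>l'. f (a \<otimes> l \<otimes> l')) ` L"
        unfolding image_image using that LK by (intro image_cong) (auto simp: m_assoc subset_iff)
      finally show ?thesis by simp
    qed
    then show ?thesis by (simp add: F_def)
  qed
  have F_bd: "0 \<le> F a" "F a \<le> M" if "a \<in> carrier K" for a
  proof -
    have *: "0 \<le> f (a \<otimes> l)" "f (a \<otimes> l) \<le> M" if "l \<in> L" for l
      using that \<open>a \<in> _\<close> LK by (auto intro!: f_bd)
    then show "F a \<le> M" unfolding F_def using Lne by (intro cSUP_least) auto
    have "f (a \<otimes> \<one>) \<le> F a"
      unfolding F_def using * by (intro cSUP_upper) (auto simp: bdd_above_def)
    then show "0 \<le> F a" using *(1)[of \<one>] by simp
  qed
  have F_val: "F a = real (e a)" if "a \<in> A" for a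
  proof -
    have "f (a \<otimes> l) = real (e a)" if "l \<in> L" for l
      using that \<open>a \<in> A\<close> by (intro f_val) (auto simp: l_coset_def)
    then have "F a = (SUP l\<in>L. real (e a))" unfolding F_def by (intro SUP_cong) auto
    then show ?thesis using Lne by simp
  qed
  define d where "d a b = (SUP k\<in>carrier K. \<bar>F (k \<otimes> a) - F (k \<otimes> b)\<bar>)" for a b
  have Kne: "carrier K \<noteq> {}" using one_closed by blast
  have F_diff: "\<bar>F a - F b\<bar> \<le> M" if "a \<in> carrier K" "b \<in> carrier K" for a b
    using F_bd[OF that(1)] F_bd[OF that(2)] by linarith
  have d_upper: "\<bar>F (k \<otimes> a) - F (k \<otimes> b)\<bar> \<le> d a b" if "k \<in> carrier K" "a \<in> carrier K" "b \<in> carrier K" for k a b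
    unfolding d_def
  proof (rule cSUP_upper[OF that(1)])
    show "bdd_above ((\<lambda>k. \<bar>F (k \<otimes> a) - F (k \<otimes> b)\<bar>) ` carrier K)"
      using that by (intro bdd_aboveI2[where M=M] F_diff) auto
  qed
  have d_least: "d a b \<le> c" if "\<And>k. k \<in> carrier K \<Longrightarrow> \<bar>F (k \<otimes> a) - F (k \<otimes> b)\<bar> \<le> c" for a b c
    unfolding d_def using Kne that by (intro cSUP_least) auto
  show ?thesis
  proof (rule exI[of _ d], intro conjI ballI allI impI)
    show "d a a = 0" for a using Kne by (simp add: d_def)
    show "d a b = d b a" for a b by (simp add: d_def abs_minus_commute)
    show "0 \<le> d a b" if "a \<in> carrier K" "b \<in> carrier K" for a b
      using d_upper[of \<one> a b] that by (meson abs_ge_zero one_closed order_trans)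
    show "d a c \<le> d a b + d b c" if "a \<in> carrier K" "b \<in> carrier K" "c \<in> carrier K" for a b c
    proof (rule d_least)
      fix k assume "k \<in> carrier K"
      then show "\<bar>F (k \<otimes> a) - F (k \<otimes> c)\<bar> \<le> d a b + d b c"
        using d_upper[of k a b] d_upper[of k b c] that by linarith
    qed
    show "d (k \<otimes> a) (k \<otimes> b) = d a b" if k: "k \<in> carrier K" "a \<in> carrier K" "b \<in> carrier K" for k a b
    proof (rule antisym)
      show "d (k \<otimes> a) (k \<otimes> b) \<le> d a b"
      proof (rule d_least)
        fix h assume "h \<in> carrier K"
        then show "\<bar>F (h \<otimes> (k \<otimes> a)) - F (h \<otimes> (k \<otimes> b))\<bar> \<le> d a b"
          using d_upper[of "h \<otimes> k" a b] k by (simp add: m_assoc)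
      qed
      show "d a b \<le> d (k \<otimes> a) (k \<otimes> b)"
      proof (rule d_least)
        fix h assume h: "h \<in> carrier K"
        have "h \<otimes> inv k \<otimes> (k \<otimes> x) = h \<otimes> x" if "x \<in> carrier K" for x
          using h k that by (simp add: m_assoc) (simp add: m_assoc[symmetric])
        then show "\<bar>F (h \<otimes> a) - F (h \<otimes> b)\<bar> \<le> d (k \<otimes> a) (k \<otimes> b)"
          using d_upper[of "h \<otimes> inv k" "k \<otimes> a" "k \<otimes> b"] k h by simp
      qed
    qed
    show "d a (b \<otimes> l) = d a b" if "a \<in> carrier K" "b \<in> carrier K" "l \<in> L" for a b l
      unfolding d_def using that LK by (intro SUP_cong refl) (simp add: m_assoc[symmetric] F_inv subset_iff)
    show "openin T {b \<in> carrier K. d a b < r}" if a: "a \<in> carrier K" for a r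
    proof -
      have "continuous_map T euclideanreal (\<lambda>b. SUP k\<in>topspace T. (\<lambda>(k, b). \<bar>F (k \<otimes> a) - F (k \<otimes> b)\<bar>) (k, b))"
      proof (rule continuous_map_SUP_compact[OF compact_T])
        have 1: "continuous_map (prod_topology T T) T (\<lambda>z. fst z \<otimes> a)"
          using a by (intro cont_mult continuous_map_fst) simp
        have 2: "continuous_map (prod_topology T T) T (\<lambda>z. fst z \<otimes> snd z)"
          by (intro cont_mult continuous_map_fst continuous_map_snd)
        show "continuous_map (prod_topology T T) euclideanreal (\<lambda>(k, b). \<bar>F (k \<otimes> a) - F (k \<otimes> b)\<bar>)"
          using continuous_map_compose[OF 1 F_cont] continuous_map_compose[OF 2 F_cont]
          by (simp add: comp_def case_prod_beta' continuous_map_real_abs continuous_map_diff)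
        show "(\<lambda>(k, b). \<bar>F (k \<otimes> a) - F (k \<otimes> b)\<bar>) (k, b) \<le> M" if "k \<in> topspace T" "b \<in> topspace T" for k b
          using that a by (auto intro!: F_diff)
      qed (use Kne in auto)
      then have "continuous_map T euclideanreal (d a)" by (simp add: d_def[abs_def])
      then show ?thesis by (simp add: continuous_map_upper_lower_semicontinuous_lt)
    qed
    show "1 \<le> d a b" if "a \<in> A" "b \<in> A" "a \<noteq> b" for a b
    proof -
      have ab: "a \<in> carrier K" "b \<in> carrier K" using that A by auto
      have "e a \<noteq> e b" using e that by (auto simp: inj_on_def)
      then have "1 \<le> \<bar>real (e a) - real (e b)\<bar>" by linarith
      also have "\<dots> \<le> d a b"
        using d_upper[OF one_closed ab] ab that by (simp add: F_val)
      finally show ?thesis .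
    qed
  qed
qed

end

subsection \<open>Kernels on compact actions\<close>

lemma (in prob_space) AE_ex:
  assumes "AE x in M. Q x"
  shows "\<exists>x\<in>space M. Q x"
proof (rule ccontr)
  assume neg: "\<not> ?thesis"
  have "AE x in M. False"
    using assms AE_space by eventually_elim (use neg in blast)
  then show False by simp
qed

locale pmp =
  fixes G :: "'g monoid" and X :: "'x measure" and \<alpha> :: "'g \<Rightarrow> 'x \<Rightarrow> 'x"
  assumes pmp_action: "pmp_action G X \<alpha>"
begin

sublocale group_action G "space X" \<alpha>
  using pmp_action by (simp add: pmp_action_def)

sublocale X: prob_space X
  using pmp_action by (simp add: pmp_action_def)

lemma act_meas: "g \<in> carrier G \<Longrightarrow> \<alpha> g \<in> measurable X X"
  using pmp_action by (simp add: pmp_action_def)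

lemma act_distr: "g \<in> carrier G \<Longrightarrow> distr X X (\<alpha> g) = X"
  using pmp_action by (simp add: pmp_action_def)

lemma act_inv: "g \<in> carrier G \<Longrightarrow> x \<in> space X \<Longrightarrow> \<alpha> (inv\<^bsub>G\<^esub> g) (\<alpha> g x) = x"
  by (rule orbit_sym_aux) auto

lemma act_space: "g \<in> carrier G \<Longrightarrow> x \<in> space X \<Longrightarrow> \<alpha> g x \<in> space X"
  using measurable_space[OF act_meas] .

lemma act_one: "x \<in> space X \<Longrightarrow> \<alpha> \<one>\<^bsub>G\<^esub> x = x"
  using fun_cong[OF id_eq_one, of x] by simp

text \<open>Weak containment speaks of images, the estimates of points with a property. Invariance
  under g identifies the two measures.\<close>

lemma measure_image_Int:
  assumes "g \<in> carrier G" "A \<in> sets X" "B \<in> sets X"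
  shows "{x \<in> A. \<alpha> g x \<in> B} \<in> sets X" "\<alpha> g ` A \<inter> B \<in> sets X"
    "measure X (\<alpha> g ` A \<inter> B) = measure X {x \<in> A. \<alpha> g x \<in> B}"
proof -
  have ginv: "inv\<^bsub>G\<^esub> g \<in> carrier G" using assms by (simp add: group.inv_closed[OF group_hom.axioms(1)[OF group_hom]])
  have sub: "A \<subseteq> space X" "B \<subseteq> space X" using assms sets.sets_into_space by auto
  have "A \<inter> (\<alpha> g -` B \<inter> space X) \<in> sets X"
    using assms act_meas[OF assms(1)] by (intro sets.Int measurable_sets)
  moreover have "A \<inter> (\<alpha> g -` B \<inter> space X) = {x \<in> A. \<alpha> g x \<in> B}" using sub by auto
  ultimately show 1: "{x \<in> A. \<alpha> g x \<in> B} \<in> sets X" by simp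
  have im: "\<alpha> g ` A = \<alpha> (inv\<^bsub>G\<^esub> g) -` A \<inter> space X"
  proof
    show "\<alpha> g ` A \<subseteq> \<alpha> (inv\<^bsub>G\<^esub> g) -` A \<inter> space X"
      using sub assms act_inv act_space by auto
    have "inv\<^bsub>G\<^esub> (inv\<^bsub>G\<^esub> g) = g"
      using assms by (simp add: group.inv_inv[OF group_hom.axioms(1)[OF group_hom]])
    then have "\<alpha> g (\<alpha> (inv\<^bsub>G\<^esub> g) x) = x" if "x \<in> space X" for x
      using act_inv[OF ginv that] by simp
    then show "\<alpha> (inv\<^bsub>G\<^esub> g) -` A \<inter> space X \<subseteq> \<alpha> g ` A"
      by (metis (no_types, lifting) IntE image_eqI subsetI vimageE)
  qed
  then show 2: "\<alpha> g ` A \<inter> B \<in> sets X"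
    using assms measurable_sets[OF act_meas[OF ginv] assms(2)] by simp
  have "measure X (\<alpha> g ` A \<inter> B) = measure (distr X X (\<alpha> g)) (\<alpha> g ` A \<inter> B)"
    by (simp add: act_distr[OF assms(1)])
  also have "\<dots> = measure X (\<alpha> g -` (\<alpha> g ` A \<inter> B) \<inter> space X)"
    by (rule measure_distr[OF act_meas[OF assms(1)] 2])
  also have "\<alpha> g -` (\<alpha> g ` A \<inter> B) \<inter> space X = {x \<in> A. \<alpha> g x \<in> B}"
  proof -
    have "x \<in> A" if "\<alpha> g x = \<alpha> g a" "a \<in> A" "x \<in> space X" for x a
      using act_inv[OF assms(1), of x] act_inv[OF assms(1), of a] that sub by auto
    then show ?thesis using sub by auto
  qed
  finally show "measure X (\<alpha> g ` A \<inter> B) = measure X {x \<in> A. \<alpha> g x \<in> B}" .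
qed

lemma AE_act: "g \<in> carrier G \<Longrightarrow> AE x in X. Q x \<Longrightarrow> AE x in X. Q (\<alpha> g x)"
  by (rule AE_mp_map[OF act_meas act_distr])

lemma free_inj:
  assumes "stabilizer G \<alpha> x = {\<one>\<^bsub>G\<^esub>}" "x \<in> space X" "g \<in> carrier G" "h \<in> carrier G" "\<alpha> g x = \<alpha> h x"
  shows "g = h"
proof -
  interpret G: group G by (rule group_hom.axioms(1)[OF group_hom])
  have "\<alpha> (inv\<^bsub>G\<^esub> h \<otimes>\<^bsub>G\<^esub> g) x = \<alpha> (inv\<^bsub>G\<^esub> h) (\<alpha> g x)"
    using assms by (intro composition_rule) auto
  also have "\<dots> = x" using assms by (simp add: act_inv)
  finally have "inv\<^bsub>G\<^esub> h \<otimes>\<^bsub>G\<^esub> g \<in> stabilizer G \<alpha> x"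
    using assms(3,4) by (simp add: stabilizer_def)
  then have "inv\<^bsub>G\<^esub> h \<otimes>\<^bsub>G\<^esub> g = \<one>\<^bsub>G\<^esub>" unfolding assms(1) by (rule singletonD)
  then show ?thesis using assms by (metis G.inv_equality G.inv_inv G.inv_closed)
qed

end

lemma (in group) lcoset_of_lcoset:
  assumes "subgroup L G" "a \<in> carrier G" "x \<in> a <#\<^bsub>G\<^esub> L"
  obtains l where "l \<in> L" "x = a \<otimes> l"
  using assms by (auto simp: l_coset_def)

text \<open>The k i are bumps of one shape around the points b i of a fine net in the coset space,
  taken with respect to an invariant pseudo-metric and pulled back by \<pi>; translation by \<tau> g
  carries bumps to bumps. The double sum is small because a bump overlaps only with those of nearby
  centres, and their cells lie in one ball of small measure.\<close>

lemma compact_kernel: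
  fixes G :: "'g monoid" and X :: "'x measure" and \<alpha> :: "'g \<Rightarrow> 'x \<Rightarrow> 'x"
  assumes cpt: "compact_action TYPE('k) G X \<alpha>" and free: "essentially_free G X \<alpha>"
    and countable: "countable (carrier G)" and infinite: "infinite (carrier G)"
    and \<delta>: "\<delta> > 0" and \<eta>: "\<eta> > 0"
  shows "\<exists>n A k. measurable_partition X n A \<and> (\<forall>i. k i \<in> bmeas X) \<and> (\<forall>i x. 0 \<le> k i x) \<and>
     (\<forall>i. (\<integral>x. (k i x)\<^sup>2 \<partial>X) = 1) \<and>
     (\<forall>g\<in>carrier G. \<forall>i\<in>{1..n}. \<forall>j\<in>{1..n}. 0 < measure X (\<alpha> g ` A i \<inter> A j) \<longrightarrow>
        (\<integral>x. (k j (\<alpha> g x) - k i x)\<^sup>2 \<partial>X) \<le> \<delta>) \<and>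
     (\<Sum>i\<in>{1..n}. \<Sum>j\<in>{1..n}. measure X (A i) * measure X (A j) * (\<integral>x. k i x * k j x \<partial>X)) \<le> \<eta>"
proof -
  interpret pmp G X \<alpha>
    using cpt by unfold_locales (simp add: compact_action_def)
  from cpt obtain K :: "'k monoid" and T L m \<tau> \<pi> where
    K: "compact_group K T" and L: "subgroup L K" "closedin T L" and m: "coset_space_measure K T L m"
    and \<tau>: "\<tau> \<in> hom G K" and \<pi>: "\<pi> \<in> measurable X m" "distr X m \<pi> = m"
    and equiv: "\<forall>g\<in>carrier G. AE x in X. \<pi> (\<alpha> g x) = \<tau> g <#\<^bsub>K\<^esub> \<pi> x"
    and inj: "\<exists>X0\<in>sets X. measure X X0 = 1 \<and> inj_on \<pi> X0"
    unfolding compact_action_def by blast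
  interpret K: compact_top_group K T by unfold_locales (rule K)
  let ?q = "\<lambda>k. k <#\<^bsub>K\<^esub> L"
  from m obtain Q where Q: "quotient_map T Q ?q" "space m = topspace Q" "sets m = borel_sets_of Q"
    and m_std: "standard_prob_space m"
    and m_inv: "\<And>k. k \<in> carrier K \<Longrightarrow> distr m m (\<lambda>C. k <#\<^bsub>K\<^esub> C) = m"
    unfolding coset_space_measure_def by blast
  interpret m: prob_space m using m_std by (simp add: standard_prob_space_def)
  have LK: "L \<subseteq> carrier K" by (rule subgroup.subset[OF L(1)])
  have spm: "space m = ?q ` carrier K"
    using Q(1,2) by (simp add: quotient_map_def)
  have open_m: "{C \<in> space m. R C} \<in> sets m" if "openin T {a \<in> carrier K. R (?q a)}" for R
  proof -
    have "{a. a \<in> topspace T \<and> ?q a \<in> {C \<in> space m. R C}} = {a \<in> carrier K. R (?q a)}"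
      by (auto simp: spm)
    moreover have "openin T {a. a \<in> topspace T \<and> ?q a \<in> {C \<in> space m. R C}} \<longleftrightarrow> openin Q {C \<in> space m. R C}"
    proof -
      have all: "\<forall>U. U \<subseteq> topspace Q \<longrightarrow> (openin T {a. a \<in> topspace T \<and> ?q a \<in> U} \<longleftrightarrow> openin Q U)"
        using Q(1) unfolding quotient_map_def by (rule conjunct2)
      have "{C \<in> space m. R C} \<subseteq> topspace Q" using Q(2) by auto
      with all show ?thesis by (elim allE[of _ "{C \<in> space m. R C}"] impE)
    qed
    ultimately have "openin Q {C \<in> space m. R C}" using that by (simp only:)
    then show ?thesis unfolding Q(3) borel_sets_of_def by (intro sigma_sets.Basic) simp
  qed
  \<comment> \<open>Freeness is used here: \<pi> is injective on the orbit of a generic point, and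
    this orbit is infinite.\<close>
  have inf_cosets: "infinite (space m)"
  proof
    assume fin: "finite (space m)"
    obtain X0 where X0: "X0 \<in> sets X" "measure X X0 = 1" "inj_on \<pi> X0" using inj by blast
    have AE_X0: "AE x in X. x \<in> X0" using X0 by (simp add: X.AE_in_set_eq_1)
    have "AE x in X. \<forall>g\<in>carrier G. \<alpha> g x \<in> X0"
      using AE_act[OF _ AE_X0] countable by (simp add: AE_ball_countable)
    moreover have "AE x in X. stabilizer G \<alpha> x = {\<one>\<^bsub>G\<^esub>}"
      using free by (simp add: essentially_free_def)
    ultimately have "AE x in X. (\<forall>g\<in>carrier G. \<alpha> g x \<in> X0) \<and> stabilizer G \<alpha> x = {\<one>\<^bsub>G\<^esub>}"
      by eventually_elim simp
    from X.AE_ex[OF this]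
    obtain x where x: "x \<in> space X" "\<forall>g\<in>carrier G. \<alpha> g x \<in> X0" "stabilizer G \<alpha> x = {\<one>\<^bsub>G\<^esub>}"
      by blast
    have "inj_on (\<lambda>g. \<pi> (\<alpha> g x)) (carrier G)"
      using X0(3) x free_inj[OF x(3,1)] by (auto simp: inj_on_def)
    moreover have "(\<lambda>g. \<pi> (\<alpha> g x)) ` carrier G \<subseteq> space m"
      using x act_space measurable_space[OF \<pi>(1)] by auto
    ultimately show False
      using fin infinite by (meson finite_imageD finite_subset)
  qed
  \<comment> \<open>N separated cosets give N disjoint balls of equal measure, hence of measure at
    most 1 / N < \<eta>.\<close>
  obtain N :: nat where N: "1 < real N * \<eta>" using reals_Archimedean3[OF \<eta>] by blast
  obtain C0 where C0: "C0 \<subseteq> ?q ` carrier K" "finite C0" "card C0 = N"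
    using infinite_arbitrarily_large[OF inf_cosets] unfolding spm by blast
  then obtain R where R: "R \<subseteq> carrier K" "inj_on ?q R" "C0 = ?q ` R"
    using subset_image_inj[of C0 ?q "carrier K"] by blast
  have R': "finite R" "card R = N"
    using C0 R by (auto simp: card_image finite_image_iff)
  obtain d :: "'k \<Rightarrow> 'k \<Rightarrow> real" where
    d0: "\<forall>a\<in>carrier K. d a a = 0" and
    dsym: "\<forall>a\<in>carrier K. \<forall>b\<in>carrier K. d a b = d b a \<and> 0 \<le> d a b" and
    dtri: "\<forall>a\<in>carrier K. \<forall>b\<in>carrier K. \<forall>c\<in>carrier K. d a c \<le> d a b + d b c" and
    dinv: "\<forall>k\<in>carrier K. \<forall>a\<in>carrier K. \<forall>b\<in>carrier K. d (k \<otimes>\<^bsub>K\<^esub> a) (k \<otimes>\<^bsub>K\<^esub> b) = d a b" and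
    dL: "\<forall>a\<in>carrier K. \<forall>b\<in>carrier K. \<forall>l\<in>L. d a (b \<otimes>\<^bsub>K\<^esub> l) = d a b" and
    dopen: "\<forall>a\<in>carrier K. \<forall>r. openin T {b \<in> carrier K. d a b < r}" and
    dsep: "\<forall>a\<in>R. \<forall>b\<in>R. a \<noteq> b \<longrightarrow> 1 \<le> d a b"
    using K.invariant_pseudometric[OF L R'(1) R(1,2)] by (elim exE conjE) (rule that)
  \<comment> \<open>Any representative serves, because d is invariant under L on the right:
    \<open>d b (rep C)\<close> is a function on the coset space.\<close>
  define rep where "rep C = (SOME a. a \<in> C)" for C :: "'k set"
  have rep: "rep (?q a) \<in> carrier K" "\<And>b. b \<in> carrier K \<Longrightarrow> d b (rep (?q a)) = d b a" if a: "a \<in> carrier K" for a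
  proof -
    have "a \<in> ?q a" by (rule K.lcos_self[OF a L(1)])
    then have "rep (?q a) \<in> ?q a" unfolding rep_def by (rule someI)
    then obtain l where "l \<in> L" "rep (?q a) = a \<otimes>\<^bsub>K\<^esub> l"
      by (rule K.lcoset_of_lcoset[OF L(1) a])
    then show "rep (?q a) \<in> carrier K" "\<And>b. b \<in> carrier K \<Longrightarrow> d b (rep (?q a)) = d b a"
      using a LK dL by auto
  qed
  have rep_m: "rep C \<in> carrier K" if "C \<in> space m" for C
    using that rep by (auto simp: spm)
  define E where "E a C = d a (rep C)" for a C
  have E_meas: "E a \<in> borel_measurable m" if a: "a \<in> carrier K" for a
  proof (rule borel_measurableI_less)
    fix r
    have "{b \<in> carrier K. E a (?q b) < r} = {b \<in> carrier K. d a b < r}"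
      using a rep by (auto simp: E_def)
    then show "{C \<in> space m. E a C < r} \<in> sets m"
      using dopen a by (intro open_m) auto
  qed
  have trans: "(\<lambda>C. k <#\<^bsub>K\<^esub> C) \<in> measurable m m" "\<And>C. C \<in> space m \<Longrightarrow> k <#\<^bsub>K\<^esub> C \<in> space m"
    "\<And>C b. C \<in> space m \<Longrightarrow> b \<in> carrier K \<Longrightarrow> E b (k <#\<^bsub>K\<^esub> C) = d b (k \<otimes>\<^bsub>K\<^esub> rep C)" if k: "k \<in> carrier K" for k
  proof -
    have assoc: "k <#\<^bsub>K\<^esub> ?q a = ?q (k \<otimes>\<^bsub>K\<^esub> a)" if "a \<in> carrier K" for a
      using K.lcos_m_assoc[OF LK k that] .
    show sp: "\<And>C. C \<in> space m \<Longrightarrow> k <#\<^bsub>K\<^esub> C \<in> space m"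
      using assoc k by (auto simp: spm)
    show "E b (k <#\<^bsub>K\<^esub> C) = d b (k \<otimes>\<^bsub>K\<^esub> rep C)" if C: "C \<in> space m" "b \<in> carrier K" for C b
    proof -
      obtain a where a: "a \<in> carrier K" "C = ?q a" using C by (auto simp: spm)
      have "E b (k <#\<^bsub>K\<^esub> C) = d b (k \<otimes>\<^bsub>K\<^esub> a)"
        using rep(2)[of "k \<otimes>\<^bsub>K\<^esub> a" b] k a C by (simp add: E_def assoc)
      also have "\<dots> = d (inv\<^bsub>K\<^esub> k \<otimes>\<^bsub>K\<^esub> b) (inv\<^bsub>K\<^esub> k \<otimes>\<^bsub>K\<^esub> (k \<otimes>\<^bsub>K\<^esub> a))"
        using dinv k a C by simp
      also have "inv\<^bsub>K\<^esub> k \<otimes>\<^bsub>K\<^esub> (k \<otimes>\<^bsub>K\<^esub> a) = a" using k a by (simp add: K.m_assoc[symmetric])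
      also have "d (inv\<^bsub>K\<^esub> k \<otimes>\<^bsub>K\<^esub> b) a = d (inv\<^bsub>K\<^esub> k \<otimes>\<^bsub>K\<^esub> b) (rep C)"
        using rep(2)[of a] a k C by simp
      also have "\<dots> = d (k \<otimes>\<^bsub>K\<^esub> (inv\<^bsub>K\<^esub> k \<otimes>\<^bsub>K\<^esub> b)) (k \<otimes>\<^bsub>K\<^esub> rep C)"
        using dinv k C rep_m by simp
      also have "k \<otimes>\<^bsub>K\<^esub> (inv\<^bsub>K\<^esub> k \<otimes>\<^bsub>K\<^esub> b) = b" using k C by (simp add: K.m_assoc[symmetric])
      finally show ?thesis .
    qed
    show "(\<lambda>C. k <#\<^bsub>K\<^esub> C) \<in> measurable m m"
    proof (rule measurable_sigma_sets[where A="{U. openin Q U}" and \<Omega>="topspace Q"])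
      show "sets m = sigma_sets (topspace Q) {U. openin Q U}"
        using Q(3) by (simp add: borel_sets_of_def)
      show "{U. openin Q U} \<subseteq> Pow (topspace Q)" by (auto dest: openin_subset)
      show "(\<lambda>C. k <#\<^bsub>K\<^esub> C) \<in> space m \<rightarrow> topspace Q" using sp Q(2) by auto
      fix U assume U: "U \<in> {U. openin Q U}"
      have "openin T {a \<in> topspace T. ?q a \<in> U}"
        using Q(1) U openin_subset[of Q U] by (auto simp: quotient_map_def)
      from openin_continuous_map_preimage[OF K.cont_left[OF k] this]
      have "openin T {a \<in> carrier K. k <#\<^bsub>K\<^esub> ?q a \<in> U}"
        using k by (auto simp: assoc cong: conj_cong)
      then have "{C \<in> space m. k <#\<^bsub>K\<^esub> C \<in> U} \<in> sets m" by (rule open_m)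
      moreover have "(\<lambda>C. k <#\<^bsub>K\<^esub> C) -` U \<inter> space m = {C \<in> space m. k <#\<^bsub>K\<^esub> C \<in> U}" by auto
      ultimately show "(\<lambda>C. k <#\<^bsub>K\<^esub> C) -` U \<inter> space m \<in> sets m" by simp
    qed
  qed
  define D where "D a x = E a (\<pi> x)" for a x
  define \<rho> where "\<rho> x = rep (\<pi> x)" for x
  have \<rho>: "\<rho> x \<in> carrier K" if "x \<in> space X" for x
    unfolding \<rho>_def by (rule rep_m[OF measurable_space[OF \<pi>(1) that]])
  have D_\<rho>: "D a x = d a (\<rho> x)" for a x by (simp add: D_def E_def \<rho>_def)
  have D_meas: "D a \<in> borel_measurable X" if "a \<in> carrier K" for a
    unfolding D_def[abs_def] by (rule measurable_compose[OF \<pi>(1) E_meas[OF that]])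
  \<comment> \<open>Translation by a carries distances from the identity to distances from a, and it
    preserves m.\<close>
  have D_law: "distr X borel (D a) = distr X borel (D \<one>\<^bsub>K\<^esub>)" if a: "a \<in> carrier K" for a
  proof -
    have 1: "distr X borel (D b) = distr m borel (E b)" if "b \<in> carrier K" for b
    proof -
      have "distr (distr X m \<pi>) borel (E b) = distr X borel (E b \<circ> \<pi>)"
        by (rule distr_distr[OF E_meas[OF that] \<pi>(1)])
      then show ?thesis by (simp add: \<pi>(2) D_def[abs_def] comp_def)
    qed
    have "distr m borel (E a) = distr (distr m m (\<lambda>C. a <#\<^bsub>K\<^esub> C)) borel (E a)"
      by (simp add: m_inv[OF a])
    also have "\<dots> = distr m borel (E a \<circ> (\<lambda>C. a <#\<^bsub>K\<^esub> C))"
      by (rule distr_distr[OF E_meas[OF a] trans(1)[OF a]])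
    also have "\<dots> = distr m borel (E \<one>\<^bsub>K\<^esub>)"
    proof (rule distr_cong[OF refl refl])
      fix C assume C: "C \<in> space m"
      have "E a (a <#\<^bsub>K\<^esub> C) = d (a \<otimes>\<^bsub>K\<^esub> \<one>\<^bsub>K\<^esub>) (a \<otimes>\<^bsub>K\<^esub> rep C)"
        using trans(3)[OF a C a] a by simp
      also have "\<dots> = E \<one>\<^bsub>K\<^esub> C"
        unfolding E_def by (rule bspec[OF bspec[OF bspec[OF dinv a] K.one_closed] rep_m[OF C]])
      finally show "(E a \<circ> (\<lambda>C. a <#\<^bsub>K\<^esub> C)) C = E \<one>\<^bsub>K\<^esub> C" by simp
    qed
    finally show ?thesis using 1 a by simp
  qed
  have D_int: "(\<integral>x. \<psi> (D a x) \<partial>X) = (\<integral>x. \<psi> (D \<one>\<^bsub>K\<^esub> x) \<partial>X)"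
    if "a \<in> carrier K" and \<psi>: "\<psi> \<in> borel_measurable borel" for a and \<psi> :: "real \<Rightarrow> real"
    using integral_distr[OF D_meas[OF that(1)] \<psi>] integral_distr[OF D_meas[OF K.one_closed] \<psi>] D_law[OF that(1)] by simp
  define ball where "ball a r = {x \<in> space X. D a x < r}" for a r
  have ball: "ball a r \<in> sets X" if "a \<in> carrier K" for a r
    using D_meas[OF that] by (simp add: ball_def)
  have ball_eq: "measure X (ball a r) = measure X (ball \<one>\<^bsub>K\<^esub> r)" if a: "a \<in> carrier K" for a r
  proof -
    have "measure X (ball b r) = (\<integral>x. indicator {..<r} (D b x) \<partial>X)" if "b \<in> carrier K" for b
    proof -
      have "(\<integral>x. indicator {..<r} (D b x) \<partial>X) = (\<integral>x. indicator (ball b r) x \<partial>X :: real)"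
        by (intro Bochner_Integration.integral_cong) (auto simp: ball_def indicator_def)
      then show ?thesis using ball[OF that] by simp
    qed
    then show ?thesis using D_int[OF a, of "indicator {..<r}"] a by simp
  qed
  have cover: "\<exists>B. finite B \<and> B \<subseteq> carrier K \<and> (\<forall>x\<in>space X. \<exists>b\<in>B. x \<in> ball b r)" if r: "r > 0" for r
  proof -
    let ?U = "(\<lambda>a. {b \<in> carrier K. d a b < r}) ` carrier K"
    have "compactin T (carrier K)" using K.compact_T by (simp add: compact_space_def)
    moreover have "carrier K \<subseteq> \<Union>?U" using d0 r by auto
    moreover have "\<forall>U\<in>?U. openin T U" using dopen by auto
    ultimately obtain V where V: "finite V" "V \<subseteq> ?U" "carrier K \<subseteq> \<Union>V"
      unfolding compactin_def by (elim conjE allE[of _ ?U]) blast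
    then obtain B where B: "B \<subseteq> carrier K" "finite B" "V = (\<lambda>a. {b \<in> carrier K. d a b < r}) ` B"
      using finite_subset_image[OF V(1,2)] by blast
    have "\<exists>b\<in>B. x \<in> ball b r" if x: "x \<in> space X" for x
    proof -
      have "\<rho> x \<in> \<Union>V" using V(3) \<rho>[OF x] by auto
      then show ?thesis using B(3) x by (auto simp: ball_def D_\<rho>)
    qed
    then show ?thesis using B by blast
  qed
  have small: "measure X (ball a (1 / 2)) \<le> \<eta>" if a: "a \<in> carrier K" for a
  proof -
    have disj: "disjoint_family_on (\<lambda>b. ball b (1 / 2)) R"
      unfolding disjoint_family_on_def
    proof (intro ballI impI)
      fix b b' assume b: "b \<in> R" "b' \<in> R" "b \<noteq> b'"
      show "ball b (1 / 2) \<inter> ball b' (1 / 2) = {}"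
      proof (rule ccontr)
        assume "\<not> ?thesis"
        then obtain x where x: "x \<in> space X" "d b (\<rho> x) < 1 / 2" "d b' (\<rho> x) < 1 / 2"
          by (auto simp: ball_def D_\<rho>)
        have K': "b \<in> carrier K" "b' \<in> carrier K" "\<rho> x \<in> carrier K" using b R \<rho> x by auto
        have "d b b' \<le> d b (\<rho> x) + d (\<rho> x) b'" using dtri K' by blast
        moreover have "d (\<rho> x) b' = d b' (\<rho> x)" using dsym K' by blast
        moreover have "1 \<le> d b b'" using dsep b by blast
        ultimately show False using x by linarith
      qed
    qed
    have "real N * measure X (ball a (1 / 2)) = (\<Sum>b\<in>R. measure X (ball a (1 / 2)))"
      using R' by simp
    also have "\<dots> = (\<Sum>b\<in>R. measure X (ball b (1 / 2)))"
      unfolding ball_eq[OF a] by (intro sum.cong refl ball_eq[symmetric]) (use R in auto)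
    also have "\<dots> = measure X (\<Union>b\<in>R. ball b (1 / 2))"
      using R R' disj ball by (intro X.finite_measure_finite_Union[symmetric]) auto
    also have "\<dots> \<le> 1" by (rule X.prob_le_1)
    finally have "real N * measure X (ball a (1 / 2)) \<le> real N * \<eta>" using N by linarith
    moreover have "0 < real N" using N by (cases "N = 0") auto
    ultimately show ?thesis by (rule mult_left_le_imp_le)
  qed
  \<comment> \<open>A tent of height 1 supported on [0, 1/8] with Lipschitz constant 8. Two bumps of
    this shape overlap only if their centres are at distance less than 1/4.\<close>
  define ks where "ks t = max 0 (1 - 8 * t)" for t :: real
  have ks: "0 \<le> ks t" "t \<ge> 0 \<Longrightarrow> ks t \<le> 1" "\<bar>ks t - ks t'\<bar> \<le> 8 * \<bar>t - t'\<bar>" for t t'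
    by (auto simp: ks_def max_def abs_if)
  have ks_meas: "ks \<in> borel_measurable borel"
    unfolding ks_def[abs_def] by measurable
  define c where "c = (\<integral>x. (ks (D \<one>\<^bsub>K\<^esub> x))\<^sup>2 \<partial>X)"
  have D_nonneg: "0 \<le> D a x" if "a \<in> carrier K" "x \<in> space X" for a x
    using dsym that \<rho> by (simp add: D_\<rho>)
  define \<kappa> where "\<kappa> a x = (if x \<in> space X then ks (D a x) else 0)" for a x
  have \<kappa>: "\<kappa> a \<in> bmeas X" "\<And>x. 0 \<le> \<kappa> a x" if "a \<in> carrier K" for a
  proof -
    have "(\<lambda>x. ks (D a x)) \<in> borel_measurable X"
      by (rule measurable_compose[OF D_meas[OF that] ks_meas])
    then have "\<kappa> a \<in> borel_measurable X" by (simp add: \<kappa>_def cong: measurable_cong)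
    then show "\<kappa> a \<in> bmeas X"
      by (rule bmeasI[where c=1]) (use ks(1,2) D_nonneg[OF that] in \<open>auto simp: \<kappa>_def\<close>)
    show "0 \<le> \<kappa> a x" for x using ks by (simp add: \<kappa>_def)
  qed
  have \<kappa>_sq: "(\<integral>x. (\<kappa> a x)\<^sup>2 \<partial>X) = c" if "a \<in> carrier K" for a
  proof -
    have "(\<integral>x. (\<kappa> a x)\<^sup>2 \<partial>X) = (\<integral>x. (\<lambda>t. (ks t)\<^sup>2) (D a x) \<partial>X)"
      by (intro Bochner_Integration.integral_cong) (auto simp: \<kappa>_def)
    also have "\<dots> = c"
      unfolding c_def using ks_meas by (subst D_int[OF that]) auto
    finally show ?thesis .
  qed
  \<comment> \<open>Finitely many balls of radius 1/16 cover the space and have equal measure, so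
    this measure is positive; on such a ball the bump is at least 1/2.\<close>
  have c: "c > 0"
  proof -
    obtain B where B: "finite B" "B \<subseteq> carrier K" "\<forall>x\<in>space X. \<exists>b\<in>B. x \<in> ball b (1 / 16)"
      using cover[of "1 / 16"] by auto
    have "1 = measure X (space X)" by (simp add: X.prob_space)
    also have "\<dots> \<le> measure X (\<Union>b\<in>B. ball b (1 / 16))"
      using B ball by (intro X.finite_measure_mono sets.finite_UN) auto
    also have "\<dots> \<le> (\<Sum>b\<in>B. measure X (ball b (1 / 16)))"
      using B ball by (intro measure_UNION_le) auto
    also have "\<dots> = (\<Sum>b\<in>B. measure X (ball \<one>\<^bsub>K\<^esub> (1 / 16)))"
      by (intro sum.cong refl ball_eq) (use B in auto)
    also have "\<dots> = real (card B) * measure X (ball \<one>\<^bsub>K\<^esub> (1 / 16))"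
      by simp
    finally have "0 < measure X (ball \<one>\<^bsub>K\<^esub> (1 / 16))"
      by (metis less_eq_real_def measure_nonneg mult_zero_right not_one_le_zero)
    moreover have "1 / 4 * measure X (ball \<one>\<^bsub>K\<^esub> (1 / 16)) \<le> (\<integral>x. (\<kappa> \<one>\<^bsub>K\<^esub> x)\<^sup>2 \<partial>X)"
    proof -
      have "1 / 4 * measure X (ball \<one>\<^bsub>K\<^esub> (1 / 16)) = (\<integral>x. 1 / 4 * indicator (ball \<one>\<^bsub>K\<^esub> (1 / 16)) x \<partial>X)"
        using ball by simp
      also have "\<dots> \<le> (\<integral>x. (\<kappa> \<one>\<^bsub>K\<^esub> x)\<^sup>2 \<partial>X)"
      proof (rule integral_mono)
        show "integrable X (\<lambda>x. 1 / 4 * indicator (ball \<one>\<^bsub>K\<^esub> (1 / 16)) x :: real)"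
          using ball by (intro X.integrable_bmeas bmeas_scale bmeas_indicator) auto
        show "integrable X (\<lambda>x. (\<kappa> \<one>\<^bsub>K\<^esub> x)\<^sup>2)"
          by (intro X.integrable_bmeas bmeas_power2 \<kappa>) auto
        fix x assume x: "x \<in> space X"
        show "1 / 4 * indicator (ball \<one>\<^bsub>K\<^esub> (1 / 16)) x \<le> (\<kappa> \<one>\<^bsub>K\<^esub> x)\<^sup>2"
        proof (cases "x \<in> ball \<one>\<^bsub>K\<^esub> (1 / 16)")
          case True
          then have "1 / 2 \<le> \<kappa> \<one>\<^bsub>K\<^esub> x" using x by (auto simp: \<kappa>_def ks_def ball_def)
          then have "(1 / 2)\<^sup>2 \<le> (\<kappa> \<one>\<^bsub>K\<^esub> x)\<^sup>2" by (intro power_mono) auto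
          then show ?thesis using True by (simp add: power2_eq_square)
        qed simp
      qed
      finally show ?thesis .
    qed
    ultimately show ?thesis using \<kappa>_sq[OF K.one_closed] by linarith
  qed
  \<comment> \<open>Centres matched by g are within 2 r, so the bumps differ by at most 8 * 2 r = 16
    r before division by the root of c; this explains the second entry. The entry 1/4 serves
    \<open>row\<close>, where 1/4 + r must not exceed 1/2.\<close>
  define r where "r = min (1 / 4) (sqrt (\<delta> * c) / 16)"
  have r: "r > 0" "r \<le> 1 / 4" "(16 * r)\<^sup>2 \<le> \<delta> * c"
  proof -
    show "r > 0" "r \<le> 1 / 4" using \<delta> c by (auto simp: r_def)
    have "(16 * r)\<^sup>2 \<le> (sqrt (\<delta> * c))\<^sup>2"
      using \<open>r > 0\<close> by (intro power_mono) (auto simp: r_def)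
    then show "(16 * r)\<^sup>2 \<le> \<delta> * c" using \<delta> c by simp
  qed
  obtain B where B: "finite B" "B \<subseteq> carrier K" "\<forall>x\<in>space X. \<exists>b\<in>B. x \<in> ball b r"
    using cover[OF r(1)] by blast
  obtain b0 where b0: "bij_betw b0 {1..card B} B"
    using ex_bij_betw_nat_finite_1[OF B(1)] by blast
  define n where "n = card B"
  \<comment> \<open>The default value keeps every k i a unit vector, also for i outside the index
    range.\<close>
  define b where "b i = (if i \<in> {1..n} then b0 i else \<one>\<^bsub>K\<^esub>)" for i
  have b: "b i \<in> carrier K" for i
    using b0 B(2) by (auto simp: b_def n_def bij_betw_def)
  define k where "k i x = \<kappa> (b i) x / sqrt c" for i x
  define A where "A i = ball (b i) r - (\<Union>j\<in>{1..<i}. ball (b j) r)" for i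
  have A: "A i \<in> sets X" for i unfolding A_def using ball b by auto
  have A_ball: "A i \<subseteq> ball (b i) r" for i by (auto simp: A_def)
  have part: "measurable_partition X n A"
    unfolding measurable_partition_def
  proof (intro conjI ballI)
    show "disjoint_family_on A {1..n}"
      unfolding disjoint_family_on_def
    proof (intro ballI impI)
      fix i j assume ij: "i \<in> {1..n}" "j \<in> {1..n}" "i \<noteq> j"
      have *: "A i \<inter> A j = {}" if "i < j" "1 \<le> i" for i j
        using that by (auto simp: A_def)
      show "A i \<inter> A j = {}" using *[of i j] *[of j i] ij by (cases "i < j") auto
    qed
    show "(\<Union>i\<in>{1..n}. A i) = space X"
    proof
      show "(\<Union>i\<in>{1..n}. A i) \<subseteq> space X" by (auto simp: A_def ball_def)
      show "space X \<subseteq> (\<Union>i\<in>{1..n}. A i)"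
      proof
        fix x assume "x \<in> space X"
        then obtain a where a: "a \<in> B" "x \<in> ball a r" using B(3) by blast
        then have "a \<in> b0 ` {1..n}" using b0 by (simp add: bij_betw_def n_def)
        then obtain i where i: "i \<in> {1..n}" "b0 i = a" by (elim imageE) simp
        define i0 where "i0 = (LEAST i. i \<in> {1..n} \<and> x \<in> ball (b i) r)"
        have "i \<in> {1..n} \<and> x \<in> ball (b i) r" using i a by (auto simp: b_def)
        then have i0: "i0 \<in> {1..n} \<and> x \<in> ball (b i0) r" unfolding i0_def by (rule LeastI)
        have "x \<notin> ball (b j) r" if "j \<in> {1..<i0}" for j
          using not_less_Least[of j "\<lambda>i. i \<in> {1..n} \<and> x \<in> ball (b i) r"] that i0 unfolding i0_def[symmetric] by auto
        then show "x \<in> (\<Union>i\<in>{1..n}. A i)" using i0 by (auto simp: A_def)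
      qed
    qed
  qed (rule A)
  have k: "k i \<in> bmeas X" "\<And>x. 0 \<le> k i x" for i
  proof -
    show "k i \<in> bmeas X"
      using bmeas_scale[OF \<kappa>(1)[OF b[of i]], of "1 / sqrt c"] by (simp add: k_def[abs_def])
    show "0 \<le> k i x" for x using \<kappa>(2)[OF b[of i]] c by (simp add: k_def)
  qed
  have k_sq: "(\<integral>x. (k i x)\<^sup>2 \<partial>X) = 1" for i
    using \<kappa>_sq[OF b[of i]] c by (simp add: k_def power_divide)
  have kk: "integrable X (\<lambda>x. k i x * k j x)" for i j
    by (intro X.integrable_bmeas bmeas_mult k)
  have inv: "(\<integral>x. (k j (\<alpha> g x) - k i x)\<^sup>2 \<partial>X) \<le> \<delta>"
    if g: "g \<in> carrier G" and ij: "0 < measure X (\<alpha> g ` A i \<inter> A j)" for g i j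
  proof -
    have \<tau>g: "\<tau> g \<in> carrier K" using \<tau> g by (auto simp: hom_def)
    have eq: "AE x in X. \<forall>a\<in>carrier K. D a (\<alpha> g x) = d a (\<tau> g \<otimes>\<^bsub>K\<^esub> \<rho> x)"
    proof -
      have "AE x in X. \<pi> (\<alpha> g x) = \<tau> g <#\<^bsub>K\<^esub> \<pi> x" using equiv g by blast
      then show ?thesis using AE_space
      proof eventually_elim
        case (elim x)
        then show ?case
          using trans(3)[OF \<tau>g measurable_space[OF \<pi>(1) elim(2)]] by (simp add: D_def \<rho>_def)
      qed
    qed
    \<comment> \<open>Positive measure of the overlap provides one point at which equivariance
      holds. This single point locates the translate of b i by \<tau> g within 2 r of b j.\<close>
    have "\<exists>x\<in>space X. x \<in> A i \<and> \<alpha> g x \<in> A j \<and> (\<forall>a\<in>carrier K. D a (\<alpha> g x) = d a (\<tau> g \<otimes>\<^bsub>K\<^esub> \<rho> x))"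
    proof (rule ccontr)
      assume neg: "\<not> ?thesis"
      have "AE x in X. x \<notin> {x \<in> A i. \<alpha> g x \<in> A j}"
        using eq AE_space by eventually_elim (use neg in blast)
      then have "measure X {x \<in> A i. \<alpha> g x \<in> A j} = 0"
        using measure_image_Int(1)[OF g A[of i] A[of j]] by (simp add: X.prob_eq_0)
      then show False using ij measure_image_Int(3)[OF g A[of i] A[of j]] by simp
    qed
    then obtain y where y: "y \<in> space X" "y \<in> A i" "\<alpha> g y \<in> A j"
      "\<forall>a\<in>carrier K. D a (\<alpha> g y) = d a (\<tau> g \<otimes>\<^bsub>K\<^esub> \<rho> y)" by blast
    have yK: "\<rho> y \<in> carrier K" "\<tau> g \<otimes>\<^bsub>K\<^esub> \<rho> y \<in> carrier K" "\<tau> g \<otimes>\<^bsub>K\<^esub> b i \<in> carrier K"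
      using \<rho>[OF y(1)] \<tau>g b by auto
    have "d (b j) (\<tau> g \<otimes>\<^bsub>K\<^esub> \<rho> y) < r"
      using y(3,4) A_ball[of j] b[of j] by (auto simp: ball_def)
    moreover have "d (\<tau> g \<otimes>\<^bsub>K\<^esub> \<rho> y) (\<tau> g \<otimes>\<^bsub>K\<^esub> b i) < r"
    proof -
      have "d (\<tau> g \<otimes>\<^bsub>K\<^esub> \<rho> y) (\<tau> g \<otimes>\<^bsub>K\<^esub> b i) = d (b i) (\<rho> y)"
        using dinv dsym \<tau>g yK b by metis
      then show ?thesis using y(2) A_ball[of i] by (auto simp: ball_def D_\<rho>)
    qed
    moreover have "d (b j) (\<tau> g \<otimes>\<^bsub>K\<^esub> b i) \<le> d (b j) (\<tau> g \<otimes>\<^bsub>K\<^esub> \<rho> y) + d (\<tau> g \<otimes>\<^bsub>K\<^esub> \<rho> y) (\<tau> g \<otimes>\<^bsub>K\<^esub> b i)"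
      using dtri b yK by blast
    ultimately have close: "d (b j) (\<tau> g \<otimes>\<^bsub>K\<^esub> b i) < 2 * r" by linarith
    have pw: "AE x in X. (k j (\<alpha> g x) - k i x)\<^sup>2 \<le> \<delta>"
      using eq AE_space
    proof eventually_elim
      case (elim x)
      have xK: "\<rho> x \<in> carrier K" "\<tau> g \<otimes>\<^bsub>K\<^esub> \<rho> x \<in> carrier K" using \<rho>[OF elim(2)] \<tau>g by auto
      have e1: "D (b j) (\<alpha> g x) = d (b j) (\<tau> g \<otimes>\<^bsub>K\<^esub> \<rho> x)" using elim b by blast
      have e2: "D (b i) x = d (\<tau> g \<otimes>\<^bsub>K\<^esub> b i) (\<tau> g \<otimes>\<^bsub>K\<^esub> \<rho> x)" using dinv \<tau>g xK b by (simp add: D_\<rho>)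
      have "d (b j) (\<tau> g \<otimes>\<^bsub>K\<^esub> \<rho> x) \<le> d (b j) (\<tau> g \<otimes>\<^bsub>K\<^esub> b i) + d (\<tau> g \<otimes>\<^bsub>K\<^esub> b i) (\<tau> g \<otimes>\<^bsub>K\<^esub> \<rho> x)"
        using dtri b yK xK by blast
      moreover have "d (\<tau> g \<otimes>\<^bsub>K\<^esub> b i) (\<tau> g \<otimes>\<^bsub>K\<^esub> \<rho> x) \<le> d (\<tau> g \<otimes>\<^bsub>K\<^esub> b i) (b j) + d (b j) (\<tau> g \<otimes>\<^bsub>K\<^esub> \<rho> x)"
        using dtri b yK xK by blast
      moreover have "d (\<tau> g \<otimes>\<^bsub>K\<^esub> b i) (b j) = d (b j) (\<tau> g \<otimes>\<^bsub>K\<^esub> b i)" using dsym b yK by blast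
      ultimately have "\<bar>D (b j) (\<alpha> g x) - D (b i) x\<bar> \<le> 2 * r"
        using close unfolding e1 e2 by linarith
      then have "\<bar>\<kappa> (b j) (\<alpha> g x) - \<kappa> (b i) x\<bar> \<le> 16 * r"
        using ks(3)[of "D (b j) (\<alpha> g x)" "D (b i) x"] elim act_space[OF g] by (simp add: \<kappa>_def)
      then have "(\<kappa> (b j) (\<alpha> g x) - \<kappa> (b i) x)\<^sup>2 \<le> (16 * r)\<^sup>2"
        by (metis abs_le_square_iff abs_of_nonneg abs_ge_zero order_trans)
      then have "(\<kappa> (b j) (\<alpha> g x) - \<kappa> (b i) x)\<^sup>2 / c \<le> \<delta>"
        using r(3) c by (simp add: divide_le_eq)
      moreover have "(k j (\<alpha> g x) - k i x)\<^sup>2 = (\<kappa> (b j) (\<alpha> g x) - \<kappa> (b i) x)\<^sup>2 / c"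
        using c by (simp add: k_def diff_divide_distrib[symmetric] power_divide)
      ultimately show ?case by simp
    qed
    have "(\<integral>x. (k j (\<alpha> g x) - k i x)\<^sup>2 \<partial>X) \<le> (\<integral>x. \<delta> \<partial>X)"
    proof (rule integral_mono_AE[OF _ _ pw])
      show "integrable X (\<lambda>x. (k j (\<alpha> g x) - k i x)\<^sup>2)"
        by (intro X.integrable_bmeas bmeas_power2 bmeas_diff bmeas_compose[OF k(1) act_meas[OF g]] k)
    qed simp
    then show ?thesis by (simp add: X.prob_space)
  qed
  have kk_le: "(\<integral>x. k i x * k j x \<partial>X) \<le> 1" for i j
  proof -
    have "(\<integral>x. k i x * k j x \<partial>X) \<le> (\<integral>x. 1 / 2 * (k i x)\<^sup>2 + 1 / 2 * (k j x)\<^sup>2 \<partial>X)"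
    proof (rule integral_mono[OF kk])
      show "integrable X (\<lambda>x. 1 / 2 * (k i x)\<^sup>2 + 1 / 2 * (k j x)\<^sup>2)"
        by (intro X.integrable_bmeas bmeas_add bmeas_scale bmeas_power2 k)
      show "k i x * k j x \<le> 1 / 2 * (k i x)\<^sup>2 + 1 / 2 * (k j x)\<^sup>2" for x
        using sum_squares_bound[of "k i x" "k j x"] by simp
    qed
    also have "\<dots> = 1"
      using X.integrable_bmeas[OF bmeas_power2[OF k(1)[of i]]] X.integrable_bmeas[OF bmeas_power2[OF k(1)[of j]]]
      by (simp add: k_sq)
    finally show ?thesis .
  qed
  have kk_zero: "(\<integral>x. k i x * k j x \<partial>X) = 0" if "1 / 4 \<le> d (b i) (b j)" for i j
  proof -
    have "k i x * k j x = 0" if x: "x \<in> space X" for x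
    proof (rule ccontr)
      assume "k i x * k j x \<noteq> 0"
      then have "d (b i) (\<rho> x) < 1 / 8" "d (b j) (\<rho> x) < 1 / 8"
        using x by (auto simp: k_def \<kappa>_def ks_def D_\<rho> max_def split: if_splits)
      moreover have "d (b i) (b j) \<le> d (b i) (\<rho> x) + d (\<rho> x) (b j)" using dtri b \<rho>[OF x] by blast
      moreover have "d (\<rho> x) (b j) = d (b j) (\<rho> x)" using dsym b \<rho>[OF x] by blast
      ultimately show False using that \<open>1 / 4 \<le> d (b i) (b j)\<close> by linarith
    qed
    then have "(\<integral>x. k i x * k j x \<partial>X) = (\<integral>x. 0 \<partial>X)" by (intro Bochner_Integration.integral_cong) auto
    then show ?thesis by simp
  qed
  have A_disj: "disjoint_family_on A {1..n}" using part by (simp add: measurable_partition_def)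
  \<comment> \<open>By \<open>kk_zero\<close> only indices with centres within 1/4 of b i
    contribute; their cells are disjoint and lie in the ball of radius 1/2, whose measure is bounded
    by \<open>small\<close>.\<close>
  have row: "(\<Sum>j\<in>{1..n}. measure X (A j) * (\<integral>x. k i x * k j x \<partial>X)) \<le> \<eta>" for i
  proof -
    let ?J = "{j \<in> {1..n}. d (b i) (b j) < 1 / 4}"
    have "(\<Sum>j\<in>{1..n}. measure X (A j) * (\<integral>x. k i x * k j x \<partial>X)) \<le> (\<Sum>j\<in>{1..n}. if d (b i) (b j) < 1 / 4 then measure X (A j) else 0)"
    proof (rule sum_mono)
      fix j
      show "measure X (A j) * (\<integral>x. k i x * k j x \<partial>X) \<le> (if d (b i) (b j) < 1 / 4 then measure X (A j) else 0)"
        using kk_le[of i j] kk_zero[of i j] by (auto intro: mult_left_le)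
    qed
    also have "\<dots> = (\<Sum>j\<in>?J. measure X (A j))"
      by (simp add: sum.If_cases Int_def)
    also have "\<dots> = measure X (\<Union>j\<in>?J. A j)"
      using A A_disj by (intro X.finite_measure_finite_Union[symmetric]) (auto simp: disjoint_family_on_def)
    also have "\<dots> \<le> measure X (ball (b i) (1 / 2))"
    proof (rule X.finite_measure_mono)
      show "(\<Union>j\<in>?J. A j) \<subseteq> ball (b i) (1 / 2)"
      proof
        fix x assume "x \<in> (\<Union>j\<in>?J. A j)"
        then obtain j where j: "d (b i) (b j) < 1 / 4" "x \<in> A j" by auto
        then have x: "x \<in> space X" "d (b j) (\<rho> x) < r" using A_ball[of j] by (auto simp: ball_def D_\<rho>)
        have "d (b i) (\<rho> x) \<le> d (b i) (b j) + d (b j) (\<rho> x)" using dtri b \<rho>[OF x(1)] by blast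
        then show "x \<in> ball (b i) (1 / 2)" using j x r(2) by (simp add: ball_def D_\<rho>)
      qed
    qed (rule ball[OF b])
    also have "\<dots> \<le> \<eta>" by (rule small[OF b])
    finally show ?thesis .
  qed
  have flat: "(\<Sum>i\<in>{1..n}. \<Sum>j\<in>{1..n}. measure X (A i) * measure X (A j) * (\<integral>x. k i x * k j x \<partial>X)) \<le> \<eta>"
  proof -
    have "(\<Sum>i\<in>{1..n}. \<Sum>j\<in>{1..n}. measure X (A i) * measure X (A j) * (\<integral>x. k i x * k j x \<partial>X))
      = (\<Sum>i\<in>{1..n}. measure X (A i) * (\<Sum>j\<in>{1..n}. measure X (A j) * (\<integral>x. k i x * k j x \<partial>X)))"
      by (simp add: sum_distrib_left mult.assoc)
    also have "\<dots> \<le> (\<Sum>i\<in>{1..n}. measure X (A i) * \<eta>)"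
      by (intro sum_mono mult_left_mono row) auto
    also have "\<dots> = measure X (\<Union>i\<in>{1..n}. A i) * \<eta>"
      using A A_disj by (subst X.finite_measure_finite_Union) (auto simp: sum_distrib_right)
    also have "\<dots> \<le> \<eta>"
      using \<eta> by (simp add: mult_left_le_one_le)
    finally show ?thesis .
  qed
  show ?thesis
    by (rule exI[of _ n], rule exI[of _ A], rule exI[of _ k], intro conjI allI ballI impI part k k_sq flat)
      (rule inv; assumption)
qed

subsection \<open>Separating sequences and freeness\<close>

text \<open>The form in which standardness is used: a countable separating family makes coincidence
  sets measurable and describes points by finite codes of increasing precision.\<close>

definition separates :: "'a measure \<Rightarrow> (nat \<Rightarrow> 'a set) \<Rightarrow> bool" where
  "separates M U \<longleftrightarrow> (\<forall>n. U n \<in> sets M) \<and> (\<forall>x\<in>space M. \<forall>y\<in>space M. (\<forall>n. x \<in> U n \<longleftrightarrow> y \<in> U n) \<longrightarrow> x = y)"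

lemma standard_separates:
  assumes "standard_prob_space M"
  shows "\<exists>U. separates M U"
proof -
  from assms obtain T where T: "completely_metrizable_space T" "second_countable T"
    "topspace T = space M" "sets M = borel_sets_of T"
    unfolding standard_prob_space_def by blast
  have H: "Hausdorff_space T"
    using T(1) by (simp add: completely_metrizable_imp_metrizable_space metrizable_imp_Hausdorff_space)
  obtain B where B: "countable B" "\<And>V. V \<in> B \<Longrightarrow> openin T V"
    "\<And>U x. openin T U \<Longrightarrow> x \<in> U \<Longrightarrow> \<exists>V\<in>B. x \<in> V \<and> V \<subseteq> U"
    using T(2) unfolding second_countable_def by metis
  let ?B = "insert {} B"
  define U where "U = from_nat_into ?B"
  have U: "U n \<in> ?B" for n unfolding U_def by (rule from_nat_into) simp
  have surj: "\<exists>n. U n = V" if "V \<in> ?B" for V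
    unfolding U_def using B(1) that from_nat_into_surj[of ?B V] by auto
  have "U n \<in> sets M" for n
  proof -
    have "openin T (U n)" using U[of n] B(2) by auto
    then show ?thesis unfolding T(4) borel_sets_of_def by (intro sigma_sets.Basic) simp
  qed
  moreover have "x = y" if x: "x \<in> space M" "y \<in> space M" "\<forall>n. x \<in> U n \<longleftrightarrow> y \<in> U n" for x y
  proof (rule ccontr)
    assume "x \<noteq> y"
    then obtain V W where VW: "openin T V" "openin T W" "x \<in> V" "y \<in> W" "disjnt V W"
      using H x T(3) unfolding Hausdorff_space_def by metis
    obtain V' where V': "V' \<in> B" "x \<in> V'" "V' \<subseteq> V" using B(3)[OF VW(1,3)] by blast
    obtain n where "U n = V'" using surj[of V'] V' by blast
    then have "y \<in> V" using x(3) V' by blast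
    with VW show False by (auto simp: disjnt_def)
  qed
  ultimately show ?thesis unfolding separates_def by blast
qed

lemma separates_eq_sets:
  assumes U: "separates M U" and f: "f \<in> measurable N M" and g: "g \<in> measurable N M"
  shows "{x \<in> space N. f x = g x} \<in> sets N"
proof -
  have m: "{x \<in> space N. f x \<in> U n} \<in> sets N" "{x \<in> space N. g x \<in> U n} \<in> sets N" for n
  proof -
    have "f -` U n \<inter> space N \<in> sets N" "g -` U n \<inter> space N \<in> sets N"
      using U f g by (auto simp: separates_def)
    then show "{x \<in> space N. f x \<in> U n} \<in> sets N" "{x \<in> space N. g x \<in> U n} \<in> sets N"
      by (simp_all add: vimage_def Int_def conj_commute)
  qed
  have "{x \<in> space N. \<forall>n. f x \<in> U n \<longleftrightarrow> g x \<in> U n} \<in> sets N"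
    using m by (intro sets.sets_Collect_countable_All) (simp add: sets.sets_Collect)
  also have "{x \<in> space N. \<forall>n. f x \<in> U n \<longleftrightarrow> g x \<in> U n} = {x \<in> space N. f x = g x}"
    using U measurable_space[OF f] measurable_space[OF g] by (auto simp: separates_def)
  finally show ?thesis .
qed

text \<open>\<open>code U n x\<close> numbers, from \<open>2 ^ n\<close> on, the atoms of the partition generated by the first \<open>n\<close> sets;
  partitions are indexed from 1.\<close>

fun code :: "(nat \<Rightarrow> 'a set) \<Rightarrow> nat \<Rightarrow> 'a \<Rightarrow> nat" where
  "code U 0 x = 1"
| "code U (Suc n) x = 2 * code U n x + (if x \<in> U n then 1 else 0)"

lemma code_range: "code U n x \<in> {1..2 ^ Suc n}" and code_lt: "code U n x < 2 ^ Suc n"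
  by (induction n) auto

lemma code_Suc_eq: "code U (Suc n) x = code U (Suc n) y \<longleftrightarrow> code U n x = code U n y \<and> (x \<in> U n \<longleftrightarrow> y \<in> U n)"
  by (auto split: if_splits) presburger+

lemma code_sets:
  assumes "\<And>n. U n \<in> sets M"
  shows "{x \<in> space M. code U n x = i} \<in> sets M"
proof -
  have "code U n \<in> measurable M (count_space UNIV)"
  proof (induction n)
    case (Suc n)
    note [measurable] = Suc assms
    show ?case unfolding code.simps[abs_def] by measurable
  qed simp
  from measurable_sets[OF this, of "{i}"] show ?thesis
    by (simp add: vimage_def Int_def conj_commute)
qed

text \<open>The set \<open>E n\<close> of points sharing their n-th cell with their image under
  \<alpha> g decreases to the fixed points of \<alpha> g, so its measure tends to 0. A fixed point
  of \<sigma> g always shares its cell with its image; hence a copy of a fine partition in Y bounds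
  the measure of the fixed points.\<close>

lemma weakly_contained_free:
  assumes X: "pmp_action G X \<alpha>" "standard_prob_space X"
    and Y: "pmp_action G Y \<sigma>" "separates Y W"
    and wc: "weakly_contained G X \<alpha> Y \<sigma>"
    and g: "g \<in> carrier G" "AE x in X. \<alpha> g x \<noteq> x"
  shows "AE y in Y. \<sigma> g y \<noteq> y"
proof -
  interpret A: pmp G X \<alpha> by unfold_locales fact
  interpret S: pmp G Y \<sigma> by unfold_locales fact
  obtain U where U: "separates X U" using standard_separates[OF X(2)] by blast
  have Um: "U n \<in> sets X" for n using U by (simp add: separates_def)
  have fix_m: "{y \<in> space Y. \<sigma> g y = y} \<in> sets Y"
    using separates_eq_sets[OF Y(2) S.act_meas[OF g(1)], of "\<lambda>y. y"] by simp
  have le: "measure Y {y \<in> space Y. \<sigma> g y = y} \<le> \<epsilon>" if \<epsilon>: "\<epsilon> > 0" for \<epsilon>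
  proof -
    define E where "E n = {x \<in> space X. code U n (\<alpha> g x) = code U n x}" for n
    have E: "E n \<in> sets X" for n
    proof -
      have "{x \<in> space X. code U n (\<alpha> g x) = code U n x} = (\<Union>i\<in>{1..2 ^ Suc n}. {x \<in> {x \<in> space X. code U n x = i}. \<alpha> g x \<in> {x \<in> space X. code U n x = i}})"
        using code_range[of U n] A.act_space[OF g(1)] by auto
      also have "\<dots> \<in> sets X"
        by (intro sets.finite_UN A.measure_image_Int(1)[OF g(1)] code_sets Um) auto
      finally show ?thesis by (simp add: E_def)
    qed
    have "(\<lambda>n. measure X (E n)) \<longlonglongrightarrow> measure X (\<Inter>n. E n)"
    proof (rule A.X.finite_Lim_measure_decseq)
      show "range E \<subseteq> sets X" using E by auto
      show "decseq E"
        unfolding decseq_Suc_iff E_def by (auto simp only: code_Suc_eq)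
    qed
    moreover have "measure X (\<Inter>n. E n) = 0"
    proof -
      have "(\<Inter>n. E n) = {x \<in> space X. \<alpha> g x = x}"
      proof
        show "{x \<in> space X. \<alpha> g x = x} \<subseteq> (\<Inter>n. E n)" by (auto simp: E_def)
        show "(\<Inter>n. E n) \<subseteq> {x \<in> space X. \<alpha> g x = x}"
        proof
          fix x assume x: "x \<in> (\<Inter>n. E n)"
          then have sp: "x \<in> space X" by (auto simp: E_def)
          have "\<alpha> g x \<in> U n \<longleftrightarrow> x \<in> U n" for n
          proof -
            have "code U (Suc n) (\<alpha> g x) = code U (Suc n) x" using x by (auto simp: E_def simp del: code.simps)
            then show ?thesis unfolding code_Suc_eq by simp
          qed
          then show "x \<in> {x \<in> space X. \<alpha> g x = x}"
            using U sp A.act_space[OF g(1) sp] by (auto simp: separates_def)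
        qed
      qed
      moreover have "{x \<in> space X. \<alpha> g x = x} \<in> sets X"
        using separates_eq_sets[OF U A.act_meas[OF g(1)], of "\<lambda>x. x"] by simp
      moreover have "AE x in X. x \<notin> {x \<in> space X. \<alpha> g x = x}"
        using g(2) by eventually_elim simp
      ultimately show ?thesis by (simp add: A.X.prob_eq_0)
    qed
    ultimately have lim: "(\<lambda>n. measure X (E n)) \<longlonglongrightarrow> 0" by simp
    have "\<forall>\<^sub>F n in sequentially. measure X (E n) < \<epsilon> / 2"
      by (rule order_tendstoD[OF lim]) (use \<epsilon> in simp)
    from eventually_happens'[OF sequentially_bot this] obtain n where n: "measure X (E n) < \<epsilon> / 2" ..
    let ?N = "2 ^ Suc n :: nat"
    define A where "A i = {x \<in> space X. code U n x = i}" for i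
    have Am: "A i \<in> sets X" for i unfolding A_def by (rule code_sets[OF Um])
    have "measurable_partition X ?N A"
      unfolding measurable_partition_def
    proof (intro conjI ballI)
      show "(\<Union>i\<in>{1..?N}. A i) = space X" using code_range[of U n] by (auto simp: A_def)
    qed (use Am in \<open>auto simp: A_def disjoint_family_on_def\<close>)
    \<comment> \<open>The error is divided among the ?N diagonal pairs of cells.\<close>
    moreover have "\<epsilon> / (2 * real ?N) > 0" using \<epsilon> by simp
    ultimately have "\<exists>B. measurable_partition Y ?N B \<and> (\<forall>g\<in>{g}. \<forall>i\<in>{1..?N}. \<forall>j\<in>{1..?N}.
        \<bar>measure X (\<alpha> g ` A i \<inter> A j) - measure Y (\<sigma> g ` B i \<inter> B j)\<bar> < \<epsilon> / (2 * real ?N))"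
      using wc g(1) unfolding weakly_contained_def
      by (elim allE[of _ "{g}"] allE[of _ ?N] allE[of _ A] allE[of _ "\<epsilon> / (2 * real ?N)"] impE) auto
    then obtain B where B: "measurable_partition Y ?N B"
      "\<And>i j. i \<in> {1..?N} \<Longrightarrow> j \<in> {1..?N} \<Longrightarrow> \<bar>measure X (\<alpha> g ` A i \<inter> A j) - measure Y (\<sigma> g ` B i \<inter> B j)\<bar> < \<epsilon> / (2 * real ?N)"
      by blast
    have Bm: "B i \<in> sets Y" if "i \<in> {1..?N}" for i using B(1) that by (auto simp: measurable_partition_def)
    have im: "\<sigma> g ` B i \<inter> B i \<in> sets Y" if "i \<in> {1..?N}" for i
      using S.measure_image_Int(2)[OF g(1) Bm[OF that] Bm[OF that]] .
    have "measure Y {y \<in> space Y. \<sigma> g y = y} \<le> measure Y (\<Union>i\<in>{1..?N}. \<sigma> g ` B i \<inter> B i)"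
    proof (rule S.X.finite_measure_mono)
      show "{y \<in> space Y. \<sigma> g y = y} \<subseteq> (\<Union>i\<in>{1..?N}. \<sigma> g ` B i \<inter> B i)"
      proof
        fix y assume y: "y \<in> {y \<in> space Y. \<sigma> g y = y}"
        then have "y \<in> (\<Union>i\<in>{1..?N}. B i)" using B(1) by (simp add: measurable_partition_def)
        then obtain i where i: "i \<in> {1..?N}" "y \<in> B i" by blast
        moreover have "y \<in> \<sigma> g ` B i" using i y by (intro image_eqI[of _ _ y]) auto
        ultimately show "y \<in> (\<Union>i\<in>{1..?N}. \<sigma> g ` B i \<inter> B i)" by blast
      qed
    qed (use im in \<open>auto intro!: sets.finite_UN\<close>)
    also have "\<dots> \<le> (\<Sum>i\<in>{1..?N}. measure Y (\<sigma> g ` B i \<inter> B i))"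
      using im by (intro measure_UNION_le) auto
    also have "\<dots> \<le> (\<Sum>i\<in>{1..?N}. measure X (\<alpha> g ` A i \<inter> A i) + \<epsilon> / (2 * real ?N))"
    proof (rule sum_mono)
      fix i assume i: "i \<in> {1..?N}"
      show "measure Y (\<sigma> g ` B i \<inter> B i) \<le> measure X (\<alpha> g ` A i \<inter> A i) + \<epsilon> / (2 * real ?N)"
        using B(2)[OF i i] by linarith
    qed
    also have "\<dots> = (\<Sum>i\<in>{1..?N}. measure X {x \<in> A i. \<alpha> g x \<in> A i}) + \<epsilon> / 2"
      using A.measure_image_Int(3)[OF g(1) Am Am] by (simp add: sum.distrib)
    also have "(\<Sum>i\<in>{1..?N}. measure X {x \<in> A i. \<alpha> g x \<in> A i}) = measure X (\<Union>i\<in>{1..?N}. {x \<in> A i. \<alpha> g x \<in> A i})"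
      using A.measure_image_Int(1)[OF g(1) Am Am]
      by (intro A.X.finite_measure_finite_Union[symmetric]) (auto simp: disjoint_family_on_def A_def)
    also have "(\<Union>i\<in>{1..?N}. {x \<in> A i. \<alpha> g x \<in> A i}) = E n"
      using code_range[of U n] A.act_space[OF g(1)] by (auto simp: A_def E_def)
    finally show ?thesis using n by linarith
  qed
  have "measure Y {y \<in> space Y. \<sigma> g y = y} = 0"
    using field_le_epsilon[of "measure Y {y \<in> space Y. \<sigma> g y = y}" 0] le
      measure_nonneg[of Y "{y \<in> space Y. \<sigma> g y = y}"] by (intro order_antisym) simp_all
  then have "AE y in Y. y \<notin> {y \<in> space Y. \<sigma> g y = y}"
    using fix_m by (simp add: S.X.prob_eq_0)
  then show ?thesis using AE_space by eventually_elim simp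
qed

context bern
begin

text \<open>A point of the product is determined by the codes of its coordinates;
  \<open>prod_decode\<close> enumerates the pairs of a coordinate and a set of the base.\<close>

lemma PiM_separates:
  assumes U: "separates Z U"
  shows "\<exists>W. separates P W"
proof -
  define W where "W n = {y \<in> space P. y (from_nat_into (carrier H) (fst (prod_decode n))) \<in> U (snd (prod_decode n))}" for n
  have fn: "from_nat_into (carrier H) n \<in> carrier H" for n by (rule from_nat_into[OF I_ne])
  have "W n \<in> sets P" for n
  proof -
    have "U k \<in> sets Z" for k using U by (simp add: separates_def)
    from measurable_sets[OF measurable_component_singleton[OF fn] this[of "snd (prod_decode n)"]]
    have "(\<lambda>y. y (from_nat_into (carrier H) (fst (prod_decode n)))) -` U (snd (prod_decode n)) \<inter> space P \<in> sets P" .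
    moreover have "W n = (\<lambda>y. y (from_nat_into (carrier H) (fst (prod_decode n)))) -` U (snd (prod_decode n)) \<inter> space P"
      by (auto simp: W_def)
    ultimately show ?thesis by simp
  qed
  moreover have "x = y" if xy: "x \<in> space P" "y \<in> space P" "\<forall>n. x \<in> W n \<longleftrightarrow> y \<in> W n" for x y
  proof
    fix h
    show "x h = y h"
    proof (cases "h \<in> carrier H")
      case True
      then obtain m where m: "from_nat_into (carrier H) m = h" using from_nat_into_surj[OF countable_H] by blast
      have "x h \<in> U k \<longleftrightarrow> y h \<in> U k" for k
        using spec[OF xy(3), of "prod_encode (m, k)"] xy(1,2) m by (simp add: W_def)
      moreover have "x h \<in> space Z" "y h \<in> space Z" using xy True by (auto simp: space_PiM)
      ultimately show ?thesis using U by (auto simp: separates_def)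
    next
      case False
      then show ?thesis using xy by (auto simp: space_PiM PiE_def extensional_def)
    qed
  qed
  ultimately show ?thesis unfolding separates_def by blast
qed

text \<open>Resampling off F leaves membership in A to y and hands membership in B over to the fresh
  point.\<close>

lemma cyl_indep:
  assumes A: "cyl F A" and B: "cyl F' B" and FF: "F \<inter> F' = {}"
  shows "P.prob (A \<inter> B) = P.prob A * P.prob B"
proof -
  have m: "A \<in> sets P" "B \<in> sets P" using A B by (auto simp: cyl_def)
  have sp: "A \<subseteq> space P" "B \<subseteq> space P" using m sets.sets_into_space by auto
  have "P.prob (A \<inter> B) = (\<integral>y. indicator (A \<inter> B) y \<partial>P)" using m by simp
  also have "\<dots> = (\<integral>y. \<integral>u. indicator (A \<inter> B) (mix (carrier H) F y u) \<partial>P \<partial>P)"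
    using m by (intro int_mix[symmetric] bmeas_indicator) auto
  also have "\<dots> = (\<integral>y. \<integral>u. indicator A y * indicator B u \<partial>P \<partial>P)"
  proof (intro Bochner_Integration.integral_cong refl)
    fix y u assume yu: "y \<in> space P" "u \<in> space P"
    let ?m = "mix (carrier H) F y u"
    have ms: "?m \<in> space P" using yu by (intro mix_in_space)
    have ext: "\<And>h. h \<notin> carrier H \<Longrightarrow> y h = undefined" "\<And>h. h \<notin> carrier H \<Longrightarrow> u h = undefined"
      using yu by (auto simp: space_PiM PiE_def extensional_def)
    have "\<forall>h\<in>F. ?m h = y h" "\<forall>h\<in>F'. ?m h = u h"
      using FF ext by (auto simp: mix_def)
    then have "?m \<in> A \<longleftrightarrow> y \<in> A" "?m \<in> B \<longleftrightarrow> u \<in> B"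
      using A B ms yu unfolding cyl_def by blast+
    then show "(indicator (A \<inter> B) ?m :: real) = indicator A y * indicator B u"
      by (simp add: indicator_def)
  qed
  also have "\<dots> = P.prob A * P.prob B" using m by simp
  finally show ?thesis .
qed

lemma cyl_coord:
  assumes "h \<in> carrier H" "V \<in> sets Z"
  shows "cyl {h} {y \<in> space P. y h \<in> V}" "P.prob {y \<in> space P. y h \<in> V} = measure Z V"
proof -
  have m: "(\<lambda>y. y h) \<in> measurable P Z" using assms by simp
  have eq: "(\<lambda>y. y h) -` V \<inter> space P = {y \<in> space P. y h \<in> V}" by auto
  show "cyl {h} {y \<in> space P. y h \<in> V}"
    using measurable_sets[OF m assms(2)] unfolding eq by (auto simp: cyl_def)
  have "measure Z V = measure (distr P Z (\<lambda>y. y h)) V"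
    using assms by (subst distr_PiM_component) (auto intro: prob_Z)
  also have "\<dots> = P.prob {y \<in> space P. y h \<in> V}"
    using measure_distr[OF m assms(2)] by (simp add: eq)
  finally show "P.prob {y \<in> space P. y h \<in> V} = measure Z V" ..
qed

text \<open>The fixed points of \<open>shift H l\<close> avoid every event \<open>y h \<in> V\<close>, \<open>y (l\<^sup>-\<^sup>1 h) \<notin> V\<close>; almost all of these
  are independent of a given cylinder.\<close>

lemma shift_essentially_free:
  assumes inf: "infinite (carrier H)" and V: "V \<in> sets Z" "0 < measure Z V" "measure Z V < 1"
    and eq_meas: "\<And>T1 T2. T1 \<in> measurable P P \<Longrightarrow> T2 \<in> measurable P P \<Longrightarrow> {y \<in> space P. T1 y = T2 y} \<in> sets P"
    and l: "l \<in> carrier H" "l \<noteq> \<one>"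
  shows "AE y in P. shift H l y \<noteq> y"
proof -
  interpret Z: prob_space Z by (rule prob_Z)
  define A where "A = {y \<in> space P. shift H l y = y}"
  have A: "A \<in> sets P" unfolding A_def using eq_meas[OF shift_measurable1[OF l(1)], of "\<lambda>y. y"] by simp
  \<comment> \<open>The probability that of two given distinct coordinates one lies in V and the
    other does not, in a prescribed order.\<close>
  define \<kappa> where "\<kappa> = measure Z V * (1 - measure Z V)"
  have \<kappa>: "\<kappa> > 0" using V by (simp add: \<kappa>_def)
  have le: "P.prob A * \<kappa> \<le> \<epsilon>" if \<epsilon>: "\<epsilon> > 0" for \<epsilon>
  proof -
    obtain F A' where F: "finite F" "F \<subseteq> carrier H" "cyl F A'" "P.prob ((A - A') \<union> (A' - A)) < \<epsilon> / 2"
      using cylinder_approx[OF A, of "\<epsilon> / 2"] \<epsilon> by auto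
    have A': "A' \<in> sets P" using F(3) by (simp add: cyl_def)
    \<comment> \<open>Both h and \<open>inv l \<otimes> h\<close> have to avoid F, which excludes F
      and its translate by l.\<close>
    have "infinite (carrier H - (F \<union> (\<lambda>b. l \<otimes> b) ` F))" using inf F(1) by (intro Diff_infinite_finite) auto
    then obtain h where h: "h \<in> carrier H" "h \<notin> F" "h \<notin> (\<lambda>b. l \<otimes> b) ` F"
      by (metis Diff_iff UnCI ex_in_conv finite.emptyI)
    let ?h' = "inv l \<otimes> h"
    have h': "?h' \<in> carrier H" "?h' \<notin> F" "?h' \<noteq> h"
    proof -
      show "?h' \<in> carrier H" using h l by simp
      have "l \<otimes> ?h' = h" using h l by (simp add: H.m_assoc[symmetric])
      then show "?h' \<notin> F" using h(3) by (metis image_eqI)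
      show "?h' \<noteq> h"
      proof
        assume "?h' = h"
        then have "l \<otimes> h = h" using \<open>l \<otimes> ?h' = h\<close> by simp
        then have "l = \<one>" using h l by (metis H.l_one H.one_closed H.right_cancel)
        then show False using l by simp
      qed
    qed
    define B1 where "B1 = {y \<in> space P. y h \<in> V}"
    define B2 where "B2 = {y \<in> space P. y ?h' \<in> space Z - V}"
    have cB: "cyl {h} B1" "P.prob B1 = measure Z V" "cyl {?h'} B2" "P.prob B2 = 1 - measure Z V"
      unfolding B1_def B2_def using cyl_coord[OF h(1) V(1)] cyl_coord[OF h'(1), of "space Z - V"] V Z.prob_compl[OF V(1)] by auto
    have Bm: "B1 \<in> sets P" "B2 \<in> sets P" using cB by (auto simp: cyl_def)
    have cB12: "cyl {h, ?h'} (B1 \<inter> B2)"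
      using Bm by (auto simp: cyl_def B1_def B2_def)
    have "P.prob (B1 \<inter> B2) = \<kappa>"
      using cyl_indep[OF cB(1,3)] h'(3) cB by (simp add: \<kappa>_def)
    then have prod: "P.prob (A' \<inter> (B1 \<inter> B2)) = P.prob A' * \<kappa>"
      using cyl_indep[OF F(3) cB12] h h' by simp
    have "A \<inter> (B1 \<inter> B2) = {}"
    proof (rule ccontr)
      assume "\<not> ?thesis"
      then obtain y where y: "shift H l y = y" "y h \<in> V" "y ?h' \<notin> V" by (auto simp: A_def B1_def B2_def)
      have "y h = shift H l y h" using y by simp
      also have "\<dots> = y ?h'" using h by (simp add: shift_def)
      finally show False using y by simp
    qed
    then have "A' \<inter> (B1 \<inter> B2) \<subseteq> (A - A') \<union> (A' - A)" by auto
    then have "P.prob (A' \<inter> (B1 \<inter> B2)) \<le> P.prob ((A - A') \<union> (A' - A))"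
      using A A' by (intro P.finite_measure_mono) auto
    then have 1: "P.prob A' * \<kappa> < \<epsilon> / 2" using prod F(4) by simp
    have "P.prob A \<le> P.prob (A' \<union> ((A - A') \<union> (A' - A)))"
      using A A' by (intro P.finite_measure_mono) auto
    also have "\<dots> \<le> P.prob A' + P.prob ((A - A') \<union> (A' - A))"
      using A A' by (intro measure_Un_le) auto
    finally have "P.prob A \<le> P.prob A' + \<epsilon> / 2" using F(4) by linarith
    then have "P.prob A * \<kappa> \<le> (P.prob A' + \<epsilon> / 2) * \<kappa>" using \<kappa> by (intro mult_right_mono) auto
    also have "\<dots> = P.prob A' * \<kappa> + \<epsilon> / 2 * \<kappa>" by (simp add: algebra_simps)
    also have "\<epsilon> / 2 * \<kappa> \<le> \<epsilon> / 2 * 1"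
      using \<epsilon> V unfolding \<kappa>_def by (intro mult_left_mono mult_le_one) auto
    finally show ?thesis using 1 by linarith
  qed
  have "P.prob A * \<kappa> \<le> 0" using le by (rule field_le_epsilon[of _ 0, simplified])
  then have "P.prob A = 0" using \<kappa> by (metis measure_nonneg mult_le_0_iff not_le order_antisym)
  then have "AE y in P. y \<notin> A" using A by (simp add: P.prob_eq_0)
  then show ?thesis using AE_space by eventually_elim (simp add: A_def)
qed

text \<open>If every separating set is null or conull, all coordinates of almost every point have
  the same code. P is then concentrated on a single point, which a measure preserving map has to fix
  almost everywhere.\<close>

lemma deterministic_base:
  assumes U: "separates Z U" and det: "\<And>n. measure Z (U n) = 0 \<or> measure Z (U n) = 1"
    and T: "T \<in> measurable P P" "distr P P T = P"
  shows "AE y in P. T y = y"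
proof -
  interpret Z: prob_space Z by (rule prob_Z)
  have Um: "U n \<in> sets Z" for n using U by (simp add: separates_def)
  have "AE z in Z. z \<in> U n \<longleftrightarrow> measure Z (U n) = 1" for n
  proof (cases "measure Z (U n) = 1")
    case True
    then show ?thesis using Um by (simp add: Z.AE_in_set_eq_1)
  next
    case False
    then have "measure Z (U n) = 0" using det by blast
    then have "AE z in Z. z \<notin> U n" using Um by (simp add: Z.prob_eq_0)
    then show ?thesis using False by simp
  qed
  then have all: "AE z in Z. \<forall>n. z \<in> U n \<longleftrightarrow> measure Z (U n) = 1"
    by (simp add: AE_all_countable)
  have "AE y in P. \<forall>n. y h \<in> U n \<longleftrightarrow> measure Z (U n) = 1" if "h \<in> carrier H" for h
    by (rule AE_PiM_component[OF prob_Z that all])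
  then have AEy: "AE y in P. \<forall>h\<in>carrier H. \<forall>n. y h \<in> U n \<longleftrightarrow> measure Z (U n) = 1"
    using countable_H by (simp add: AE_ball_countable)
  show ?thesis
    using AEy AE_mp_map[OF T AEy] AE_space
  proof eventually_elim
    case (elim y)
    have Ty: "T y \<in> space P" using measurable_space[OF T(1) elim(3)] .
    show ?case
    proof
      fix h
      show "T y h = y h"
      proof (cases "h \<in> carrier H")
        case True
        then have "\<forall>n. T y h \<in> U n \<longleftrightarrow> y h \<in> U n" using elim by blast
        moreover have "T y h \<in> space Z" "y h \<in> space Z" using True Ty elim(3) by (auto simp: space_PiM)
        ultimately show ?thesis using U unfolding separates_def by blast
      next
        case False
        then show ?thesis using Ty elim(3) by (auto simp: space_PiM PiE_def extensional_def)
      qed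
    qed
  qed
qed

end

subsection \<open>Test functions from weak containment\<close>

lemma (in prob_space) kernel_bounds:
  fixes a b :: "'a \<Rightarrow> real"
  assumes ab: "a \<in> bmeas M" "b \<in> bmeas M" and n: "(\<integral>x. (a x)\<^sup>2 \<partial>M) = 1" "(\<integral>x. (b x)\<^sup>2 \<partial>M) = 1"
  shows "(\<integral>x. (b x - a x)\<^sup>2 \<partial>M) \<le> 4" "(\<integral>x. a x * b x \<partial>M) \<le> 1"
proof -
  note i = integrable_bmeas
  have sq: "(\<lambda>x. (a x)\<^sup>2) \<in> bmeas M" "(\<lambda>x. (b x)\<^sup>2) \<in> bmeas M" using ab by (auto intro: bmeas_power2)
  have "(\<integral>x. (b x - a x)\<^sup>2 \<partial>M) \<le> (\<integral>x. 2 * (b x)\<^sup>2 + 2 * (a x)\<^sup>2 \<partial>M)"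
    by (intro integral_mono sq_diff_le i bmeas_intros ab)
  also have "\<dots> = 4" using i[OF sq(1)] i[OF sq(2)] n by simp
  finally show "(\<integral>x. (b x - a x)\<^sup>2 \<partial>M) \<le> 4" .
  have "(\<integral>x. a x * b x \<partial>M) \<le> (\<integral>x. 1/2 * (a x)\<^sup>2 + 1/2 * (b x)\<^sup>2 \<partial>M)"
  proof (rule integral_mono)
    fix x show "a x * b x \<le> 1/2 * (a x)\<^sup>2 + 1/2 * (b x)\<^sup>2"
      using zero_le_power2[of "a x - b x"] by (simp add: power2_diff)
  qed (intro i bmeas_intros ab)+
  also have "\<dots> = 1" using i[OF sq(1)] i[OF sq(2)] n by simp
  finally show "(\<integral>x. a x * b x \<partial>M) \<le> 1" .
qed

context bern
begin

text \<open>The index of the copied cell containing y selects a kernel. Up to small probability, the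
  indices of y and of \<sigma> g y are a pair whose cells in X overlap after moving by g, so that
  the two kernels are close. Replacing the index by a function of finitely many coordinates provides
  L.\<close>

lemma test_functions:
  fixes G :: "'g monoid" and X :: "'x measure" and \<alpha> :: "'g \<Rightarrow> 'x \<Rightarrow> 'x"
  assumes cpt: "compact_action TYPE('k) G X \<alpha>" and free: "essentially_free G X \<alpha>"
    and countable: "countable (carrier G)" and infinite: "infinite (carrier G)"
    and \<sigma>: "pmp_action G P \<sigma>" and wc: "weakly_contained G X \<alpha> P \<sigma>"
    and S: "finite S" "S \<subseteq> carrier G" and \<delta>: "\<delta> > 0" and \<eta>: "\<eta> > 0"
  shows "\<exists>f L. f \<in> bmeas (X \<Otimes>\<^sub>M P) \<and> (\<forall>z. 0 \<le> f z) \<and> (\<forall>y\<in>space P. (\<integral>x. (f (x, y))\<^sup>2 \<partial>X) = 1) \<and>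
        finite L \<and> L \<subseteq> carrier H \<and>
        (\<forall>x. \<forall>y\<in>space P. \<forall>y'\<in>space P. (\<forall>h\<in>L. y h = y' h) \<longrightarrow> f (x, y) = f (x, y')) \<and>
        (\<forall>g\<in>S. (\<integral>y. \<integral>x. (f (\<alpha> g x, \<sigma> g y) - f (x, y))\<^sup>2 \<partial>X \<partial>P) \<le> \<delta>) \<and>
        (\<integral>x. (\<integral>y. f (x, y) \<partial>P)\<^sup>2 \<partial>X) \<le> \<eta>"
proof -
  interpret A: pmp G X \<alpha> using cpt by unfold_locales (simp add: compact_action_def)
  interpret S: pmp G P \<sigma> by unfold_locales (rule \<sigma>)
  interpret G: group G by (rule group_hom.axioms(1)[OF A.group_hom])
  have half: "\<delta> / 2 > 0" "\<eta> / 2 > 0" using \<delta> \<eta> by auto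
  obtain n A k0 where A: "measurable_partition X n A" and k0_meas: "\<forall>i. k0 i \<in> bmeas X"
    and k0_nonneg: "\<forall>i x. 0 \<le> k0 i x" and k0_norm: "\<forall>i. (\<integral>x. (k0 i x)\<^sup>2 \<partial>X) = 1"
    and k0_inv: "\<forall>g\<in>carrier G. \<forall>i\<in>{1..n}. \<forall>j\<in>{1..n}. 0 < measure X (\<alpha> g ` A i \<inter> A j) \<longrightarrow>
        (\<integral>x. (k0 j (\<alpha> g x) - k0 i x)\<^sup>2 \<partial>X) \<le> \<delta> / 2"
    and k0_flat: "(\<Sum>i\<in>{1..n}. \<Sum>j\<in>{1..n}. measure X (A i) * measure X (A j) * (\<integral>x. k0 i x * k0 j x \<partial>X)) \<le> \<eta> / 2"
    using compact_kernel[OF cpt free countable infinite half] by (elim exE conjE) (rule that)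
  \<comment> \<open>Only finitely many functions remain, so f is uniformly bounded over all
    indices.\<close>
  define k where "k i = (if i \<in> {1..n} then k0 i else k0 1)" for i
  have k_meas: "k i \<in> bmeas X" and k_nonneg: "0 \<le> k i x" and k_norm: "(\<integral>x. (k i x)\<^sup>2 \<partial>X) = 1" for i x
    using k0_meas k0_nonneg k0_norm by (simp_all add: k_def)
  obtain C where C: "\<And>i. 0 \<le> C i" "\<And>i x. \<bar>k i x\<bar> \<le> C i"
  proof -
    have "\<forall>i. \<exists>c. 0 \<le> c \<and> (\<forall>x. \<bar>k i x\<bar> \<le> c)" using bmeasE[OF k_meas] by metis
    then show ?thesis using that by metis
  qed
  have k_bound: "\<bar>k i x\<bar> \<le> C 0 + (\<Sum>i\<in>{1..n}. C i)" for i x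
  proof (cases "i \<in> {1..n}")
    case True
    then have "C i \<le> (\<Sum>i\<in>{1..n}. C i)" using C(1) by (intro member_le_sum) auto
    then show ?thesis using C(2)[of i x] C(1)[of 0] by linarith
  next
    case False
    then have "k i = k 0" unfolding k_def by (subst if_not_P) auto
    then show ?thesis using C(2)[of 0 x] sum_nonneg[of "{1..n}" C] C(1) by simp
  qed
  have n: "0 < n"
  proof (rule ccontr)
    assume "\<not> 0 < n"
    then show False using A A.X.not_empty by (simp add: measurable_partition_def)
  qed
  \<comment> \<open>There are n^2 pairs of indices. The bad event contributes at most 4 (2 + n^2)
    \<epsilon> to the invariance error, the approximation at most 4 n^2 \<epsilon> to the mean; each
    is to stay below half of its allowance.\<close>
  define \<epsilon> where "\<epsilon> = min (\<delta> / (16 * (1 + real n * real n))) (\<eta> / (8 * (1 + real n * real n)))"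
  have npos: "0 < 1 + real n * real n" by (simp add: add_pos_nonneg)
  have \<epsilon>: "\<epsilon> > 0" using \<delta> \<eta> npos by (simp add: \<epsilon>_def)
  have \<epsilon>_\<delta>: "8 * (1 + real n * real n) * \<epsilon> \<le> \<delta> / 2"
  proof -
    have "\<epsilon> \<le> \<delta> / (16 * (1 + real n * real n))" by (simp add: \<epsilon>_def)
    then have "\<epsilon> * (16 * (1 + real n * real n)) \<le> \<delta>" using npos by (simp add: pos_le_divide_eq)
    then show ?thesis by (simp add: algebra_simps)
  qed
  have \<epsilon>_\<eta>: "4 * (1 + real n * real n) * \<epsilon> \<le> \<eta> / 2"
  proof -
    have "\<epsilon> \<le> \<eta> / (8 * (1 + real n * real n))" by (simp add: \<epsilon>_def)
    then have "\<epsilon> * (8 * (1 + real n * real n)) \<le> \<eta>" using npos by (simp add: pos_le_divide_eq)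
    then show ?thesis by (simp add: algebra_simps)
  qed
  \<comment> \<open>The identity is included because its diagonal terms compare the measures of A i
    and B i.\<close>
  have S': "finite (insert \<one>\<^bsub>G\<^esub> S)" "insert \<one>\<^bsub>G\<^esub> S \<subseteq> carrier G" using S by auto
  obtain B where B: "measurable_partition P n B"
    "\<forall>g\<in>insert \<one>\<^bsub>G\<^esub> S. \<forall>i\<in>{1..n}. \<forall>j\<in>{1..n}. \<bar>measure X (\<alpha> g ` A i \<inter> A j) - P.prob (\<sigma> g ` B i \<inter> B j)\<bar> < \<epsilon>"
    using wc[unfolded weakly_contained_def, THEN spec, of "insert \<one>\<^bsub>G\<^esub> S", THEN spec, of n, THEN spec, of A, THEN spec, of \<epsilon>]
      S' \<epsilon> A by blast
  have Am: "A i \<in> sets X" if "i \<in> {1..n}" for i using A that by (simp add: measurable_partition_def)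
  have Bm: "B i \<in> sets P" if "i \<in> {1..n}" for i using B(1) that by (simp add: measurable_partition_def)
  define h0 where "h0 y = (LEAST i. i \<in> {1..n} \<and> y \<in> B i)" for y
  have h0_in: "h0 y \<in> {1..n} \<and> y \<in> B (h0 y)" if "y \<in> space P" for y
  proof -
    have "y \<in> (\<Union>i\<in>{1..n}. B i)" using B(1) that by (simp add: measurable_partition_def)
    then obtain i where "i \<in> {1..n} \<and> y \<in> B i" by blast
    then show ?thesis unfolding h0_def by (rule LeastI)
  qed
  have h0_eq: "h0 y = i" if "i \<in> {1..n}" "y \<in> B i" for i y
  proof (rule ccontr)
    assume ne: "h0 y \<noteq> i"
    have "y \<in> space P" using sets.sets_into_space[OF Bm[OF that(1)]] that(2) by blast
    from h0_in[OF this] show False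
      using B(1) ne that unfolding measurable_partition_def disjoint_family_on_def by blast
  qed
  have h0_meas: "h0 \<in> measurable P (count_space {1..n})"
  proof (subst measurable_count_space_eq2)
    have "h0 -` {i} \<inter> space P = B i" if "i \<in> {1..n}" for i
      using h0_in h0_eq[OF that] sets.sets_into_space[OF Bm[OF that]] by blast
    then show "h0 \<in> space P \<rightarrow> {1..n} \<and> (\<forall>a\<in>{1..n}. h0 -` {a} \<inter> space P \<in> sets P)"
      using h0_in Bm by auto
  qed simp
  have ne: "{1..n} \<noteq> {}" using n by auto
  obtain F idx where F: "finite F" "F \<subseteq> carrier H" and idx_meas: "idx \<in> measurable P (count_space {1..n})"
    and idx_loc: "\<forall>y\<in>space P. \<forall>y'\<in>space P. (\<forall>i\<in>F. y i = y' i) \<longrightarrow> idx y = idx y'"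
    and idx_h0: "P.prob {y \<in> space P. h0 y \<noteq> idx y} < \<epsilon>"
    using cylinder_approx_fun[OF finite_atLeastAtMost ne h0_meas \<epsilon>] by (elim exE conjE) (rule that)
  have idx_in: "idx y \<in> {1..n}" if "y \<in> space P" for y
    using measurable_space[OF idx_meas that] by simp
  have D_meas: "{y \<in> space P. h0 y \<noteq> idx y} \<in> sets P"
    by (rule neq_sets[OF h0_meas idx_meas]) simp
  define f where "f z = k (idx (snd z)) (fst z)" for z
  have f_eq: "f (x, y) = k (idx y) x" for x y by (simp add: f_def)
  have f_bmeas: "f \<in> bmeas (X \<Otimes>\<^sub>M P)"
  proof (rule bmeasI[where c="C 0 + (\<Sum>i\<in>{1..n}. C i)"])
    show "f \<in> borel_measurable (X \<Otimes>\<^sub>M P)"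
      unfolding f_def
      by (rule measurable_compose_countable'[OF measurable_compose[OF measurable_fst bmeas_measurable[OF k_meas]]
        measurable_compose[OF measurable_snd idx_meas]]) simp
  qed (simp only: f_def k_bound)
  have invariance: "(\<integral>y. \<integral>x. (f (\<alpha> g x, \<sigma> g y) - f (x, y))\<^sup>2 \<partial>X \<partial>P) \<le> \<delta>" if g: "g \<in> S" for g
  proof -
    have gG: "g \<in> carrier G" using g S by blast
    define I where "I i j = (\<integral>x. (k j (\<alpha> g x) - k i x)\<^sup>2 \<partial>X)" for i j
    have I0: "0 \<le> I i j" for i j unfolding I_def by simp
    have I4: "I i j \<le> 4" for i j
      unfolding I_def
    proof (rule A.X.kernel_bounds(1)[OF k_meas _ k_norm])
      show "(\<lambda>x. k j (\<alpha> g x)) \<in> bmeas X" by (rule bmeas_compose[OF k_meas A.act_meas[OF gG]])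
      show "(\<integral>x. (k j (\<alpha> g x))\<^sup>2 \<partial>X) = 1"
        using integral_mp[OF A.act_meas[OF gG] A.act_distr[OF gG], of "\<lambda>x. (k j x)\<^sup>2"]
          bmeas_measurable[OF bmeas_power2[OF k_meas]] k_norm by simp
    qed
    have idx\<sigma>: "(\<lambda>y. idx (\<sigma> g y)) \<in> measurable P (count_space {1..n})"
      by (rule measurable_compose[OF S.act_meas[OF gG] idx_meas])
    have I_bmeas: "(\<lambda>y. I (idx y) (idx (\<sigma> g y))) \<in> bmeas P"
    proof (rule bmeasI[where c=4])
      show "(\<lambda>y. I (idx y) (idx (\<sigma> g y))) \<in> borel_measurable P"
        by (rule measurable_compose_countable'[OF measurable_compose[OF idx\<sigma>] idx_meas]) auto
    qed (use I0 I4 in \<open>auto simp: abs_le_iff intro: order_trans[OF _ I0]\<close>)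
    \<comment> \<open>Transitions between cells that do not occur in X: the overlap there is null,
      so the copied overlap has measure below \<epsilon>. For all other pairs the kernels are
      close.\<close>
    define D where "D i j = (if 0 < measure X (\<alpha> g ` A i \<inter> A j) then {} else {y \<in> B i. \<sigma> g y \<in> B j})" for i j
    have Dm: "D i j \<in> sets P" if "i \<in> {1..n}" "j \<in> {1..n}" for i j
      using S.measure_image_Int(1)[OF gG Bm[OF that(1)] Bm[OF that(2)]] by (simp add: D_def)
    have Dp: "P.prob (D i j) \<le> \<epsilon>" if ij: "i \<in> {1..n}" "j \<in> {1..n}" for i j
    proof (cases "0 < measure X (\<alpha> g ` A i \<inter> A j)")
      case False
      then have z: "measure X (\<alpha> g ` A i \<inter> A j) = 0" by (meson measure_nonneg order_antisym not_le)
      have "\<bar>measure X (\<alpha> g ` A i \<inter> A j) - P.prob (\<sigma> g ` B i \<inter> B j)\<bar> < \<epsilon>"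
        using B(2) g ij by blast
      then have "P.prob (\<sigma> g ` B i \<inter> B j) \<le> \<epsilon>" unfolding z by linarith
      then show ?thesis using False
        unfolding S.measure_image_Int(3)[OF gG Bm[OF ij(1)] Bm[OF ij(2)]] by (simp add: D_def)
    qed (use \<epsilon> in \<open>simp add: D_def\<close>)
    define E where "E = {y \<in> space P. h0 y \<noteq> idx y}"
    define E' where "E' = {y \<in> space P. h0 (\<sigma> g y) \<noteq> idx (\<sigma> g y)}"
    define N where "N = (\<Union>i\<in>{1..n}. \<Union>j\<in>{1..n}. D i j)"
    have EN: "E \<in> sets P" "E' \<in> sets P" "N \<in> sets P"
    proof -
      show "E \<in> sets P" unfolding E_def by (rule D_meas)
      show "E' \<in> sets P" unfolding E'_def
        by (rule neq_sets[OF measurable_compose[OF S.act_meas[OF gG] h0_meas] idx\<sigma>]) simp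
      show "N \<in> sets P" unfolding N_def by (intro sets.finite_UN Dm) auto
    qed
    have "P.prob N \<le> (\<Sum>i\<in>{1..n}. P.prob (\<Union>j\<in>{1..n}. D i j))"
      unfolding N_def by (intro measure_UNION_le sets.finite_UN Dm) auto
    also have "\<dots> \<le> (\<Sum>i\<in>{1..n}. \<Sum>j\<in>{1..n}. P.prob (D i j))"
      by (intro sum_mono measure_UNION_le Dm) auto
    also have "\<dots> \<le> (\<Sum>i\<in>{1..n}. \<Sum>j\<in>{1..n}. \<epsilon>)"
      by (intro sum_mono Dp)
    also have "\<dots> = real n * real n * \<epsilon>" by simp
    finally have pN: "P.prob N \<le> real n * real n * \<epsilon>" .
    have pE: "P.prob E < \<epsilon>" unfolding E_def by (rule idx_h0)
    have pE': "P.prob E' < \<epsilon>"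
      unfolding E'_def using measure_mp[OF S.act_meas[OF gG] S.act_distr[OF gG] D_meas] idx_h0 by simp
    have "P.prob (E \<union> E' \<union> N) \<le> P.prob E + P.prob E' + P.prob N"
      using measure_Un_le[OF sets.Un[OF EN(1,2)] EN(3)] measure_Un_le[OF EN(1,2)] by linarith
    then have bad: "P.prob (E \<union> E' \<union> N) \<le> (2 + real n * real n) * \<epsilon>"
      using pE pE' pN by (simp add: algebra_simps)
    have bad_meas: "E \<union> E' \<union> N \<in> sets P" using EN by simp
    have pt: "I (idx y) (idx (\<sigma> g y)) \<le> \<delta> / 2 + 4 * indicator (E \<union> E' \<union> N) y" if y: "y \<in> space P" for y
    proof (cases "y \<in> E \<union> E' \<union> N")
      case True
      then show ?thesis using I4[of "idx y" "idx (\<sigma> g y)"] \<delta> by simp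
    next
      case False
      have \<sigma>y: "\<sigma> g y \<in> space P" by (rule S.act_space[OF gG y])
      have e: "h0 y = idx y" "h0 (\<sigma> g y) = idx (\<sigma> g y)"
        using False y by (auto simp: E_def E'_def)
      note i = h0_in[OF y, unfolded e] and j = h0_in[OF \<sigma>y, unfolded e]
      have "y \<notin> D (idx y) (idx (\<sigma> g y))" using False i j unfolding N_def by blast
      then have "0 < measure X (\<alpha> g ` A (idx y) \<inter> A (idx (\<sigma> g y)))"
        using i j unfolding D_def by (auto split: if_splits)
      then have "(\<integral>x. (k0 (idx (\<sigma> g y)) (\<alpha> g x) - k0 (idx y) x)\<^sup>2 \<partial>X) \<le> \<delta> / 2"
        using k0_inv gG i j by blast
      then have "I (idx y) (idx (\<sigma> g y)) \<le> \<delta> / 2" using i j by (simp add: I_def k_def)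
      then show ?thesis using False by simp
    qed
    have "(\<integral>y. \<integral>x. (f (\<alpha> g x, \<sigma> g y) - f (x, y))\<^sup>2 \<partial>X \<partial>P) = (\<integral>y. I (idx y) (idx (\<sigma> g y)) \<partial>P)"
      by (simp add: f_eq I_def)
    also have "\<dots> \<le> (\<integral>y. \<delta> / 2 + 4 * indicator (E \<union> E' \<union> N) y \<partial>P)"
      by (intro integral_mono P.integrable_bmeas I_bmeas pt bmeas_add bmeas_const bmeas_scale bmeas_indicator bad_meas)
    also have "\<dots> = \<delta> / 2 + 4 * P.prob (E \<union> E' \<union> N)"
    proof -
      have "integrable P (\<lambda>y. 4 * indicator (E \<union> E' \<union> N) y :: real)"
        by (intro P.integrable_bmeas bmeas_scale bmeas_indicator bad_meas)
      then show ?thesis using bad_meas by (simp add: P.prob_space)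
    qed
    also have "\<dots> \<le> \<delta> / 2 + 4 * ((2 + real n * real n) * \<epsilon>)" using bad by simp
    also have "4 * ((2 + real n * real n) * \<epsilon>) \<le> 8 * (1 + real n * real n) * \<epsilon>"
      using \<epsilon> by (simp add: algebra_simps)
    finally show ?thesis using \<epsilon>_\<delta> by simp
  qed
  have flat: "(\<integral>x. (\<integral>y. f (x, y) \<partial>P)\<^sup>2 \<partial>X) \<le> \<eta>"
  proof -
    define J where "J i = {y \<in> space P. idx y = i}" for i
    define p where "p i = P.prob (J i)" for i
    define c where "c i j = (\<integral>x. k i x * k j x \<partial>X)" for i j
    have Jm: "J i \<in> sets P" if "i \<in> {1..n}" for i
    proof -
      have "idx -` {i} \<inter> space P \<in> sets P" using that by (intro measurable_sets[OF idx_meas]) auto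
      moreover have "idx -` {i} \<inter> space P = J i" by (auto simp: J_def)
      ultimately show ?thesis by simp
    qed
    have c01: "0 \<le> c i j" "c i j \<le> 1" for i j
      unfolding c_def using k_nonneg A.X.kernel_bounds(2)[OF k_meas k_meas k_norm k_norm, of i j] by auto
    have inner: "(\<integral>y. f (x, y) \<partial>P) = (\<Sum>i\<in>{1..n}. p i * k i x)" for x
    proof -
      have "f (x, y) = (\<Sum>i\<in>{1..n}. indicator (J i) y * k i x)" if "y \<in> space P" for y
      proof -
        have "(\<Sum>i\<in>{1..n}. indicator (J i) y * k i x) = (\<Sum>i\<in>{1..n}. if i = idx y then k i x else 0)"
          using that by (intro sum.cong refl) (auto simp: J_def)
        then show ?thesis using idx_in[OF that] by (simp add: f_eq)
      qed
      then have "(\<integral>y. f (x, y) \<partial>P) = (\<integral>y. (\<Sum>i\<in>{1..n}. indicator (J i) y * k i x) \<partial>P)"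
        by (intro Bochner_Integration.integral_cong refl)
      also have "\<dots> = (\<Sum>i\<in>{1..n}. \<integral>y. indicator (J i) y * k i x \<partial>P)"
        by (intro Bochner_Integration.integral_sum P.integrable_bmeas bmeas_mult bmeas_indicator bmeas_const Jm)
      also have "\<dots> = (\<Sum>i\<in>{1..n}. p i * k i x)"
        using Jm by (intro sum.cong refl) (simp add: p_def)
      finally show ?thesis .
    qed
    have "(\<integral>x. (\<integral>y. f (x, y) \<partial>P)\<^sup>2 \<partial>X) = (\<integral>x. (\<Sum>i\<in>{1..n}. \<Sum>j\<in>{1..n}. p i * p j * (k i x * k j x)) \<partial>X)"
      unfolding inner power2_eq_square sum_product by (simp add: ac_simps)
    also have "\<dots> = (\<Sum>i\<in>{1..n}. \<integral>x. (\<Sum>j\<in>{1..n}. p i * p j * (k i x * k j x)) \<partial>X)"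
      by (intro Bochner_Integration.integral_sum A.X.integrable_bmeas bmeas_sum bmeas_scale bmeas_mult k_meas)
    also have "\<dots> = (\<Sum>i\<in>{1..n}. \<Sum>j\<in>{1..n}. \<integral>x. p i * p j * (k i x * k j x) \<partial>X)"
      by (intro sum.cong refl Bochner_Integration.integral_sum A.X.integrable_bmeas bmeas_scale bmeas_mult k_meas)
    also have "\<dots> = (\<Sum>i\<in>{1..n}. \<Sum>j\<in>{1..n}. p i * p j * c i j)"
      by (simp add: c_def)
    also have "\<dots> \<le> (\<Sum>i\<in>{1..n}. \<Sum>j\<in>{1..n}. measure X (A i) * measure X (A j) * c i j + 4 * \<epsilon>)"
    proof (intro sum_mono)
      fix i j assume ij: "i \<in> {1..n}" "j \<in> {1..n}"
      \<comment> \<open>One \<epsilon> comes from the cylinder approximation and one from weak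
        containment at the identity.\<close>
      have p_le: "p i \<le> measure X (A i) + 2 * \<epsilon>" if i: "i \<in> {1..n}" for i
      proof -
        have "J i \<subseteq> B i \<union> {y \<in> space P. h0 y \<noteq> idx y}" using h0_in unfolding J_def by fastforce
        then have "p i \<le> P.prob (B i \<union> {y \<in> space P. h0 y \<noteq> idx y})"
          unfolding p_def using Bm[OF i] D_meas by (intro P.finite_measure_mono) auto
        also have "\<dots> \<le> P.prob (B i) + P.prob {y \<in> space P. h0 y \<noteq> idx y}"
          by (rule measure_Un_le[OF Bm[OF i] D_meas])
        finally have 1: "p i \<le> P.prob (B i) + \<epsilon>" using idx_h0 by linarith
        have sub: "A i \<subseteq> space X" "B i \<subseteq> space P" using sets.sets_into_space Am[OF i] Bm[OF i] by auto
        have "\<alpha> \<one>\<^bsub>G\<^esub> ` A i = A i"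
          using sub(1) A.act_one by (auto intro!: image_eqI simp: subset_iff)
        moreover have "\<sigma> \<one>\<^bsub>G\<^esub> ` B i = B i"
          using sub(2) S.act_one by (auto intro!: image_eqI simp: subset_iff)
        moreover have "\<bar>measure X (\<alpha> \<one>\<^bsub>G\<^esub> ` A i \<inter> A i) - P.prob (\<sigma> \<one>\<^bsub>G\<^esub> ` B i \<inter> B i)\<bar> < \<epsilon>"
          using B(2) i by blast
        ultimately have "\<bar>measure X (A i) - P.prob (B i)\<bar> < \<epsilon>" by (simp only: Int_absorb)
        then show ?thesis using 1 by linarith
      qed
      have p01: "0 \<le> p i" "p i \<le> 1" for i by (auto simp: p_def)
      have "p i * p j \<le> (measure X (A i) + 2 * \<epsilon>) * p j"
        using p_le[OF ij(1)] p01 by (intro mult_right_mono) auto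
      also have "\<dots> = measure X (A i) * p j + 2 * \<epsilon> * p j" by (simp add: algebra_simps)
      also have "2 * \<epsilon> * p j \<le> 2 * \<epsilon> * 1" using \<epsilon> p01 by (intro mult_left_mono) auto
      also have "measure X (A i) * p j \<le> measure X (A i) * (measure X (A j) + 2 * \<epsilon>)"
        using p_le[OF ij(2)] by (intro mult_left_mono) auto
      also have "\<dots> = measure X (A i) * measure X (A j) + measure X (A i) * (2 * \<epsilon>)" by (simp add: algebra_simps)
      also have "measure X (A i) * (2 * \<epsilon>) \<le> 1 * (2 * \<epsilon>)" using \<epsilon> by (intro mult_right_mono) auto
      finally have pp: "p i * p j \<le> measure X (A i) * measure X (A j) + 4 * \<epsilon>" by simp
      have "p i * p j * c i j \<le> (measure X (A i) * measure X (A j) + 4 * \<epsilon>) * c i j"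
        by (rule mult_right_mono[OF pp c01(1)])
      also have "\<dots> = measure X (A i) * measure X (A j) * c i j + 4 * \<epsilon> * c i j" by (simp add: algebra_simps)
      also have "4 * \<epsilon> * c i j \<le> 4 * \<epsilon> * 1" using \<epsilon> c01 by (intro mult_left_mono) auto
      finally show "p i * p j * c i j \<le> measure X (A i) * measure X (A j) * c i j + 4 * \<epsilon>" by simp
    qed
    also have "\<dots> = (\<Sum>i\<in>{1..n}. \<Sum>j\<in>{1..n}. measure X (A i) * measure X (A j) * c i j) + 4 * (real n * real n) * \<epsilon>"
      by (simp add: sum.distrib)
    also have "(\<Sum>i\<in>{1..n}. \<Sum>j\<in>{1..n}. measure X (A i) * measure X (A j) * c i j)
        = (\<Sum>i\<in>{1..n}. \<Sum>j\<in>{1..n}. measure X (A i) * measure X (A j) * (\<integral>x. k0 i x * k0 j x \<partial>X))"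
      by (intro sum.cong refl) (simp add: c_def k_def)
    also have "4 * (real n * real n) * \<epsilon> \<le> 4 * (1 + real n * real n) * \<epsilon>"
      using \<epsilon> by (simp add: algebra_simps)
    finally show ?thesis using k0_flat \<epsilon>_\<eta> by linarith
  qed
  show ?thesis
  proof (intro exI conjI)
    show "\<forall>x. \<forall>y\<in>space P. \<forall>y'\<in>space P. (\<forall>h\<in>F. y h = y' h) \<longrightarrow> f (x, y) = f (x, y')"
      unfolding f_eq using idx_loc by metis
    show "\<forall>y\<in>space P. (\<integral>x. (f (x, y))\<^sup>2 \<partial>X) = 1" by (simp add: f_eq k_norm)
    show "\<forall>z. 0 \<le> f z" by (simp add: f_def k_nonneg)
    show "\<forall>g\<in>S. (\<integral>y. \<integral>x. (f (\<alpha> g x, \<sigma> g y) - f (x, y))\<^sup>2 \<partial>X \<partial>P) \<le> \<delta>"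
      by (intro ballI invariance)
  qed (fact f_bmeas F flat)+
qed

text \<open>The facts known almost everywhere are gathered on one conull set stable under both
  actions, and a measurable cocycle is selected; this gives an instance of \<open>orbit_sub\<close>,
  for which \<open>test_functions\<close> supplies the functions that
  \<open>main_contradiction\<close> excludes.\<close>

lemma no_weakly_containing_subaction:
  fixes G :: "'g monoid" and X :: "'x measure" and \<alpha> :: "'g \<Rightarrow> 'x \<Rightarrow> 'x"
  assumes G: "group G" "countable (carrier G)" "\<not> amenable G"
    and X: "standard_prob_space X" and free: "essentially_free G X \<alpha>"
    and cpt: "compact_action TYPE('k) G X \<alpha>" and Z: "standard_prob_space Z"
    and \<sigma>: "pmp_action G P \<sigma>" and wc: "weakly_contained G X \<alpha> P \<sigma>"
    and orb: "AE y in P. \<forall>g\<in>carrier G. \<exists>l\<in>carrier H. \<sigma> g y = shift H l y"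
  shows False
proof -
  interpret A: pmp G X \<alpha> using cpt by unfold_locales (simp add: compact_action_def)
  interpret S: pmp G P \<sigma> by unfold_locales (rule \<sigma>)
  interpret G: group G by (rule G)
  interpret Z: prob_space Z by (rule prob_Z)
  have inf: "infinite (carrier G)" by (rule non_amenable_infinite[OF G(1,3)])
  obtain U where U: "separates Z U" using standard_separates[OF Z] by blast
  have Um: "U n \<in> sets Z" for n using U by (simp add: separates_def)
  obtain W where W: "separates P W" using PiM_separates[OF U] by blast
  note eq_meas = separates_eq_sets[OF W]
  have \<sigma>_AE1: "AE y in P. \<sigma> g y \<noteq> y" if g: "g \<in> carrier G" "g \<noteq> \<one>\<^bsub>G\<^esub>" for g
  proof (rule weakly_contained_free[OF A.pmp_action X \<sigma> W wc g(1)])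
    show "AE x in X. \<alpha> g x \<noteq> x"
      using free unfolding essentially_free_def
    proof eventually_elim
      case (elim x)
      show ?case
      proof
        assume "\<alpha> g x = x"
        then have "g \<in> stabilizer G \<alpha> x" using g by (simp add: stabilizer_def)
        then show False using elim g by simp
      qed
    qed
  qed
  have \<sigma>_AE: "AE y in P. stabilizer G \<sigma> y = {\<one>\<^bsub>G\<^esub>}"
  proof -
    have "AE y in P. \<forall>g\<in>carrier G - {\<one>\<^bsub>G\<^esub>}. \<sigma> g y \<noteq> y"
      using G(2) \<sigma>_AE1 by (simp add: AE_ball_countable)
    then show ?thesis
      using AE_space by eventually_elim (auto simp: stabilizer_def S.act_one)
  qed
  \<comment> \<open>Free orbits of the infinite group G are contained in orbits of the
    shift.\<close>
  have infH: "infinite (carrier H)"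
  proof
    assume fin: "finite (carrier H)"
    have "AE y in P. stabilizer G \<sigma> y = {\<one>\<^bsub>G\<^esub>} \<and> (\<forall>g\<in>carrier G. \<exists>l\<in>carrier H. \<sigma> g y = shift H l y)"
      using \<sigma>_AE orb by eventually_elim blast
    from P.AE_ex[OF this] obtain y where y: "y \<in> space P" "stabilizer G \<sigma> y = {\<one>\<^bsub>G\<^esub>}"
      "\<forall>g\<in>carrier G. \<exists>l\<in>carrier H. \<sigma> g y = shift H l y" by blast
    have "(\<lambda>g. \<sigma> g y) ` carrier G \<subseteq> (\<lambda>l. shift H l y) ` carrier H" using y(3) by blast
    then have "finite ((\<lambda>g. \<sigma> g y) ` carrier G)" by (rule finite_subset) (use fin in simp)
    moreover have "inj_on (\<lambda>g. \<sigma> g y) (carrier G)"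
      by (intro inj_onI) (rule S.free_inj[OF y(2,1)])
    ultimately show False using inf finite_imageD by blast
  qed
  \<comment> \<open>Otherwise P would be concentrated on one point, contrary to the freeness of
    \<sigma>.\<close>
  have "\<exists>n. 0 < measure Z (U n) \<and> measure Z (U n) < 1"
  proof (rule ccontr)
    assume neg: "\<not> ?thesis"
    have det: "measure Z (U n) = 0 \<or> measure Z (U n) = 1" for n
      using neg Z.prob_le_1[of "U n"] measure_nonneg[of Z "U n"] by (metis less_eq_real_def)
    obtain g where g: "g \<in> carrier G" "g \<noteq> \<one>\<^bsub>G\<^esub>"
    proof -
      have "\<not> carrier G \<subseteq> {\<one>\<^bsub>G\<^esub>}" using inf finite_subset by blast
      then show ?thesis using that by blast
    qed
    have "AE y in P. \<sigma> g y = y"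
      by (rule deterministic_base[OF U det S.act_meas[OF g(1)] S.act_distr[OF g(1)]])
    then have "AE y in P. False" using \<sigma>_AE1[OF g] by eventually_elim simp
    then show False using P.AE_ex by blast
  qed
  then obtain n where n: "0 < measure Z (U n)" "measure Z (U n) < 1" by blast
  have shift_AE: "AE y in P. \<forall>l\<in>carrier H - {\<one>}. shift H l y \<noteq> y"
  proof (subst AE_ball_countable)
    show "countable (carrier H - {\<one>})" using countable_H by (rule countable_subset[rotated]) blast
    show "\<forall>l\<in>carrier H - {\<one>}. AE y in P. shift H l y \<noteq> y"
      by (intro ballI shift_essentially_free[OF infH Um n eq_meas]) auto
  qed
  define Q where "Q y \<longleftrightarrow> stabilizer G \<sigma> y = {\<one>\<^bsub>G\<^esub>} \<and> (\<forall>g\<in>carrier G. \<exists>l\<in>carrier H. \<sigma> g y = shift H l y) \<and>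
    (\<forall>l\<in>carrier H - {\<one>}. shift H l y \<noteq> y)" for y
  have AE_Q: "AE y in P. Q y"
    using \<sigma>_AE orb shift_AE by eventually_elim (simp add: Q_def)
  \<comment> \<open>Requiring Q along the whole shift orbit makes Y stable under the shift, and
    thereby under \<sigma>, whose orbits lie in those of the shift.\<close>
  define Y where "Y = {y \<in> space P. \<forall>l\<in>carrier H. Q (shift H l y)}"
  have Y_space: "Y \<subseteq> space P" by (auto simp: Y_def)
  have AE_Y: "AE y in P. y \<in> Y"
  proof -
    have "AE y in P. \<forall>l\<in>carrier H. Q (shift H l y)"
      using countable_H AE_mp_map[OF shift_measurable1 distr_shift AE_Q] by (simp add: AE_ball_countable)
    then show ?thesis using AE_space by eventually_elim (simp add: Y_def)
  qed
  have YQ: "Q y" if "y \<in> Y" for y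
  proof -
    have "y \<in> space P" "Q (shift H \<one> y)" using that by (auto simp: Y_def)
    then show ?thesis by (simp add: shift_one)
  qed
  have Y_shift: "shift H l y \<in> Y" if l: "l \<in> carrier H" and y: "y \<in> Y" for l y
  proof -
    have "Q (shift H l' (shift H l y))" if "l' \<in> carrier H" for l'
    proof -
      have "Q (shift H (l' \<otimes> l) y)" using that l y by (simp add: Y_def)
      then show ?thesis by (simp only: shift_mult[OF that l])
    qed
    then show ?thesis using l y by (simp add: Y_def shift_in_space)
  qed
  have Y_\<sigma>: "\<sigma> g y \<in> Y" if "g \<in> carrier G" "y \<in> Y" for g y
    using YQ[OF that(2)] that Y_shift unfolding Q_def by metis
  define e where "e = from_nat_into (carrier H)"
  have e: "e n \<in> carrier H" for n unfolding e_def by (rule from_nat_into[OF I_ne])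
  \<comment> \<open>Taking the least index in an enumeration of the group makes the choice of the
    group element measurable in y.\<close>
  define w where "w g y = e (LEAST n. \<sigma> g y = shift H (e n) y)" for g y
  have w_meas: "w g \<in> measurable P (count_space (carrier H))" if g: "g \<in> carrier G" for g
  proof -
    have "(\<lambda>y. LEAST n. \<sigma> g y = shift H (e n) y) \<in> measurable P (count_space UNIV)"
      by (intro measurable_Least) (simp add: pred_def eq_meas[OF S.act_meas[OF g] shift_measurable1[OF e]])
    then show ?thesis unfolding w_def by (rule measurable_compose) (simp add: e)
  qed
  have \<sigma>_eq: "\<sigma> g y = shift H (w g y) y" if gy: "g \<in> carrier G" "y \<in> Y" for g y
  proof -
    obtain l where l: "l \<in> carrier H" "\<sigma> g y = shift H l y"
      using YQ[OF gy(2)] gy(1) unfolding Q_def by blast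
    obtain n where "e n = l" using from_nat_into_surj[OF countable_H l(1)] unfolding e_def by blast
    then have "\<sigma> g y = shift H (e n) y" using l by simp
    then show ?thesis unfolding w_def by (rule LeastI)
  qed
  have \<sigma>_mult: "\<sigma> (g \<otimes>\<^bsub>G\<^esub> g') y = \<sigma> g (\<sigma> g' y)" if "g \<in> carrier G" "g' \<in> carrier G" "y \<in> Y" for g g' y
    using S.composition_rule[of y g g'] that Y_space by blast
  have \<sigma>_one: "\<sigma> \<one>\<^bsub>G\<^esub> y = y" if "y \<in> Y" for y
    by (rule S.act_one) (use that Y_space in blast)
  have \<sigma>_free: "g = g'" if "g \<in> carrier G" "g' \<in> carrier G" "y \<in> Y" "\<sigma> g y = \<sigma> g' y" for g g' y
    using YQ[OF that(3)] that Y_space by (intro S.free_inj[of y]) (auto simp: Q_def)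
  have shift_free: "l = l'" if l: "l \<in> carrier H" "l' \<in> carrier H" and y: "y \<in> Y" and eq: "shift H l y = shift H l' y" for l l' y
  proof -
    have "shift H (inv l' \<otimes> l) y = y"
      using l y eq Y_space by (simp add: shift_mult shift_inv subset_iff)
    then have "inv l' \<otimes> l = \<one>" using YQ[OF y] l unfolding Q_def by (metis Diff_iff H.inv_closed H.m_closed singletonD)
    then show ?thesis using l by (metis H.inv_equality H.inv_inv H.inv_closed)
  qed
  have os: "orbit_sub H Z G \<sigma> w Y"
    by (rule orbit_sub.intro[OF bern_axioms orbit_sub_axioms.intro[OF G(1,2) S.act_meas S.act_distr
      Y_space AE_Y Y_\<sigma> Y_shift \<sigma>_mult \<sigma>_one \<sigma>_free shift_free w_meas \<sigma>_eq eq_meas]])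
  show False
    by (rule orbit_sub.main_contradiction[OF os G(3) A.X.prob_space_axioms A.act_meas A.act_distr
      test_functions[OF cpt free G(2) inf \<sigma> wc]])
qed

end

theorem corollary1p6:
  fixes \<Gamma> :: "'g monoid" and X :: "'x measure" and \<alpha> :: "'g \<Rightarrow> 'x \<Rightarrow> 'x"
    and \<Lambda> :: "'l monoid" and Z :: "'z measure"
  assumes "group \<Gamma>" and "countable (carrier \<Gamma>)" and "\<not> amenable \<Gamma>"
    and "standard_prob_space X" and "pmp_action \<Gamma> X \<alpha>"
    and "essentially_free \<Gamma> X \<alpha>" and "ergodic \<Gamma> X \<alpha>"
    and "compact_action TYPE('k) \<Gamma> X \<alpha>"
    and "group \<Lambda>" and "countable (carrier \<Lambda>)" and "standard_prob_space Z"
  shows "\<not> (\<exists>\<sigma>. pmp_action \<Gamma> (bernoulli_space \<Lambda> Z) \<sigma> \<and>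
              weakly_contained \<Gamma> X \<alpha> (bernoulli_space \<Lambda> Z) \<sigma> \<and>
              (AE y in bernoulli_space \<Lambda> Z.
                 orbit \<Gamma> \<sigma> y \<subseteq> orbit \<Lambda> (bernoulli_action \<Lambda> Z) y))"
proof
  interpret bern \<Lambda> Z
    using assms by (intro bern.intro bern_axioms.intro) (simp_all add: standard_prob_space_def)
  have bsp: "bernoulli_space \<Lambda> Z = P" by (simp add: bernoulli_space_def)
  assume "\<exists>\<sigma>. pmp_action \<Gamma> (bernoulli_space \<Lambda> Z) \<sigma> \<and>
    weakly_contained \<Gamma> X \<alpha> (bernoulli_space \<Lambda> Z) \<sigma> \<and>
    (AE y in bernoulli_space \<Lambda> Z. orbit \<Gamma> \<sigma> y \<subseteq> orbit \<Lambda> (bernoulli_action \<Lambda> Z) y)"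
  then obtain \<sigma> where \<sigma>: "pmp_action \<Gamma> P \<sigma>" "weakly_contained \<Gamma> X \<alpha> P \<sigma>"
    "AE y in P. orbit \<Gamma> \<sigma> y \<subseteq> orbit \<Lambda> (bernoulli_action \<Lambda> Z) y"
    unfolding bsp by (elim exE conjE) (rule that)
  have "AE y in P. \<forall>g\<in>carrier \<Gamma>. \<exists>l\<in>carrier \<Lambda>. \<sigma> g y = shift \<Lambda> l y"
    using \<sigma>(3) AE_space
  proof eventually_elim
    case (elim y)
    have "bernoulli_action \<Lambda> Z l y = shift \<Lambda> l y" for l
      using elim(2) by (simp add: bernoulli_action_def shift_def bsp)
    then show ?case using elim(1) by (auto simp: orbit_def)
  qed
  then show False
    by (rule no_weakly_containing_subaction[OF assms(1-4,6,8,11) \<sigma>(1,2)])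
qed

end
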